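(* Let $d\in\mathbb{N}$, $0<s<\infty$ and $1\le p,q\le\infty$ with $\frac1q-\frac1p<\frac sd$. Then there exist constants $C>0$ and $W_0,L_0\in\mathbb{N}$, depending only on $s,p,q,d$, such that for all integers $W\ge W_0$, $L\ge L_0$ and every $f\in\mathcal{W}^{s,q}([0,1]^d)$, \[ \inf_{g\in \mathcal{NN}_{d,1}(W,L)} \|f-g\|_{L^p([0,1]^d)} \le C\, \|f\|_{\mathcal{W}^{s,q}([0,1]^d)}\, (WL)^{-2s/d}. \]
   Context: ReLU networks: $\sigma(t)=\max\{t,0\}$ applied componentwise. For $d,k,W,L\in\mathbb{N}$, $\mathcal{NN}_{d,k}(W,L)$ (abbreviated $\mathcal{NN}(W,L)$ when $d,k$ are clear) is the set of maps $g:\mathbb{R}^d\to\mathbb{R}^k$ of the form $g_0(x)=x$, $g_{\ell+1}(x)=\sigma(A_\ell g_\ell(x)+b_\ell)$ for $\ell=0,\dots,L-1$, $g(x)=A_Lg_L(x)+b_L$, where $A_\ell\in\mathbb{R}^{N_{\ell+1}\times N_\ell}$, $b_\ell\in\mathbb{R}^{N_{\ell+1}}$, $N_0=d$, $N_{L+1}=k$, and $N_1,\dots,N_L\in\mathbb{N}$ satisfy $\max\{N_1,\dots,N_L\}\le W$ ($W$ = width, $L$ = depth = number of hidden layers). Sobolev spaces on $\Omega=[0,1]^d$: for $s\in\mathbb{N}$, $\|f\|_{\mathcal{W}^{s,q}(\Omega)}^q=\|f\|_{L^q(\Omega)}^q+\sum_{|\gamma|=s}\|\partial^\gamma f\|_{L^q(\Omega)}^q$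 (weak derivatives, usual modification for $q=\infty$). For non-integer $s>0$, $\|f\|_{\mathcal{W}^{s,q}(\Omega)}^q=\|f\|_{L^q(\Omega)}^q+|f|_{\mathcal{W}^{s,q}(\Omega)}^q$ with $|f|_{\mathcal{W}^{s,q}(\Omega)}^q=\sum_{|\gamma|=\lfloor s\rfloor}\big(\|\partial^\gamma f\|_{L^q}^q+\int_\Omega\int_\Omega\frac{|\partial^\gamma f(x)-\partial^\gamma f(y)|^q}{|x-y|^{d+(s-\lfloor s\rfloor)q}}dxdy\big)$ for $q<\infty$, and for $q=\infty$, $|f|_{\mathcal{W}^{s,\infty}}=\sum_{|\gamma|=\lfloor s\rfloor}\big(\|\partial^\gamma f\|_{L^\infty}+\operatorname{ess\,sup}_{x,y}\frac{|\partial^\gamma f(x)-\partial^\gamma f(y)|}{|x-y|^{s-\lfloor s\rfloor}}\big)$ (Sobolev–Slobodeckij spaces). $\mathcal{W}^{s,q}(\Omega)$ is the set of $f\in L^q(\Omega)$ with finite norm. *)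

theory Defs
  imports "HOL-Probability.Probability"
begin

definition unit_cube :: "(real^'n) set" where
  "unit_cube = {x. \<forall>i. 0 \<le> x$i \<and> x$i \<le> 1}"

definition open_unit_cube :: "(real^'n) set" where
  "open_unit_cube = {x. \<forall>i. 0 < x$i \<and> x$i < 1}"

definition relu :: "real \<Rightarrow> real" where
  "relu t = max t 0"

text \<open>Hidden states: hid A b N h1 k is the state g_(k+1) of the (k+1)-th hidden layer,
  given the state h1 = g_1 of the first hidden layer. Layer l has width N l, its
  weight matrix A l (row j, column i) and bias b l.\<close>
fun hid :: "(nat \<Rightarrow> nat \<Rightarrow> nat \<Rightarrow> real) \<Rightarrow> (nat \<Rightarrow> nat \<Rightarrow> real) \<Rightarrow> (nat \<Rightarrow> nat)
            \<Rightarrow> (nat \<Rightarrow> real) \<Rightarrow> nat \<Rightarrow> (nat \<Rightarrow> real)" where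
  "hid A b N h1 0 = h1"
| "hid A b N h1 (Suc k) =
     (\<lambda>j. relu ((\<Sum>i<N (Suc k). A (Suc k) j i * hid A b N h1 k i) + b (Suc k) j))"

text \<open>NN_{d,1}(W,L) with d = CARD('n): input layer A_0 (N_1 x d) with bias b_0,
  hidden-to-hidden layers A_l (l = 1..L-1), output layer (1 x N_L) with bias c.
  For L = 0 the network is affine.\<close>
definition NN :: "nat \<Rightarrow> nat \<Rightarrow> (real^'n \<Rightarrow> real) set" where
  "NN W L = {g. \<exists>(N::nat \<Rightarrow> nat) (A0::nat \<Rightarrow> 'n \<Rightarrow> real) (b0::nat \<Rightarrow> real)
                  (A::nat \<Rightarrow> nat \<Rightarrow> nat \<Rightarrow> real) (b::nat \<Rightarrow> nat \<Rightarrow> real)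
                  (a::nat \<Rightarrow> real) (a'::'n \<Rightarrow> real) (c::real).
       (\<forall>l\<in>{1..L}. 1 \<le> N l \<and> N l \<le> W) \<and>
       g = (\<lambda>x. if L = 0 then (\<Sum>i\<in>UNIV. a' i * x$i) + c
                 else (\<Sum>i<N L. a i *
                        hid A b N (\<lambda>j. relu ((\<Sum>i'\<in>UNIV. A0 j i' * x$i') + b0 j)) (L - 1) i) + c)}"

definition enn_root :: "real \<Rightarrow> ennreal \<Rightarrow> ennreal" where
  "enn_root r I = (if I = \<infinity> then \<infinity> else ennreal (enn2real I powr (1 / r)))"

definition inv_exp :: "ennreal \<Rightarrow> real" where
  "inv_exp p = (if p = \<infinity> then 0 else 1 / enn2real p)"

definition Lnorm :: "ennreal \<Rightarrow> (real^'n \<Rightarrow> real) \<Rightarrow> ennreal" where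
  "Lnorm p f = (if p = \<infinity> then esssup (lebesgue_on unit_cube) (\<lambda>x. ennreal \<bar>f x\<bar>)
                else enn_root (enn2real p)
                       (\<integral>\<^sup>+ x. ennreal (\<bar>f x\<bar> powr enn2real p) \<partial>lebesgue_on unit_cube))"

definition pd :: "'n \<Rightarrow> (real^'n \<Rightarrow> real) \<Rightarrow> (real^'n \<Rightarrow> real)" where
  "pd i \<phi> = (\<lambda>x. deriv (\<lambda>t. \<phi> (x + t *\<^sub>R axis i 1)) 0)"

fun pdl :: "'n list \<Rightarrow> (real^'n \<Rightarrow> real) \<Rightarrow> (real^'n \<Rightarrow> real)" where
  "pdl [] \<phi> = \<phi>"
| "pdl (i # is) \<phi> = pd i (pdl is \<phi>)"

definition test_fun :: "(real^'n \<Rightarrow> real) \<Rightarrow> bool" where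
  "test_fun \<phi> \<longleftrightarrow>
     (\<forall>is. continuous_on UNIV (pdl is \<phi>) \<and>
            (\<forall>i x. (\<lambda>t. pdl is \<phi> (x + t *\<^sub>R axis i 1)) differentiable (at 0))) \<and>
     compact (closure {x. \<phi> x \<noteq> 0}) \<and> closure {x. \<phi> x \<noteq> 0} \<subseteq> open_unit_cube"

definition loc_integrable :: "(real^'n \<Rightarrow> real) \<Rightarrow> bool" where
  "loc_integrable f \<longleftrightarrow>
     (\<forall>K. compact K \<and> K \<subseteq> open_unit_cube \<longrightarrow> integrable (lebesgue_on K) f)"

definition weak_deriv :: "('n \<Rightarrow> nat) \<Rightarrow> (real^'n \<Rightarrow> real) \<Rightarrow> (real^'n \<Rightarrow> real) \<Rightarrow> bool" where
  "weak_deriv \<gamma> f g \<longleftrightarrow> loc_integrable f \<and> loc_integrable g \<and>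
     (\<forall>\<phi>. test_fun \<phi> \<longrightarrow> (\<forall>is. (\<forall>i. count (mset is) i = \<gamma> i) \<longrightarrow>
        (\<integral>x. f x * pdl is \<phi> x \<partial>lebesgue_on open_unit_cube)
          = (-1) ^ (\<Sum>i\<in>UNIV. \<gamma> i) * (\<integral>x. g x * \<phi> x \<partial>lebesgue_on open_unit_cube)))"

definition sob_order :: "real \<Rightarrow> nat" where
  "sob_order s = nat \<lfloor>s\<rfloor>"

definition multi_idx :: "nat \<Rightarrow> ('n \<Rightarrow> nat) set" where
  "multi_idx k = {\<gamma>. (\<Sum>i\<in>UNIV. \<gamma> i) = k}"

definition gagliardo :: "real \<Rightarrow> real \<Rightarrow> (real^'n \<Rightarrow> real) \<Rightarrow> ennreal" where
  "gagliardo \<sigma> q h =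
     (\<integral>\<^sup>+ x. (\<integral>\<^sup>+ y. ennreal (\<bar>h x - h y\<bar> powr q / dist x y powr (real CARD('n) + \<sigma> * q))
        \<partial>lebesgue_on unit_cube) \<partial>lebesgue_on unit_cube)"

definition hoelder :: "real \<Rightarrow> (real^'n \<Rightarrow> real) \<Rightarrow> ennreal" where
  "hoelder \<sigma> h = esssup (lebesgue_on unit_cube \<Otimes>\<^sub>M lebesgue_on unit_cube)
                     (\<lambda>(x, y). ennreal (\<bar>h x - h y\<bar> / dist x y powr \<sigma>))"

text \<open>The norm of f in W^{s,q}, given a family D of weak derivatives
  (D \<gamma> = \<partial>^\<gamma> f for |\<gamma>| = floor s). For q = \<infinity> the usual modification
  (sum instead of q-th power sum) is used.\<close>
definition sob_expr :: "real \<Rightarrow> ennreal \<Rightarrow> (real^'n \<Rightarrow> real)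
                        \<Rightarrow> (('n \<Rightarrow> nat) \<Rightarrow> (real^'n \<Rightarrow> real)) \<Rightarrow> ennreal" where
  "sob_expr s q f D =
    (let k = sob_order s; \<sigma> = s - real k in
     if q = \<infinity> then
       Lnorm \<infinity> f + (\<Sum>\<gamma>\<in>multi_idx k. Lnorm \<infinity> (D \<gamma>) + (if s \<in> \<nat> then 0 else hoelder \<sigma> (D \<gamma>)))
     else enn_root (enn2real q)
       ((\<integral>\<^sup>+ x. ennreal (\<bar>f x\<bar> powr enn2real q) \<partial>lebesgue_on unit_cube) +
        (\<Sum>\<gamma>\<in>multi_idx k.
           (\<integral>\<^sup>+ x. ennreal (\<bar>D \<gamma> x\<bar> powr enn2real q) \<partial>lebesgue_on unit_cube) +
           (if s \<in> \<nat> then 0 else gagliardo \<sigma> (enn2real q) (D \<gamma>)))))"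

text \<open>Weak derivatives are unique a.e., so the infimum is attained by any choice;
  if they do not exist the norm is \<infinity>.\<close>
definition sob_norm :: "real \<Rightarrow> ennreal \<Rightarrow> (real^'n \<Rightarrow> real) \<Rightarrow> ennreal" where
  "sob_norm s q f = (INF D \<in> {D. \<forall>\<gamma>\<in>multi_idx (sob_order s). weak_deriv \<gamma> f (D \<gamma>)}.
                       sob_expr s q f D)"

definition sobolev :: "real \<Rightarrow> ennreal \<Rightarrow> (real^'n \<Rightarrow> real) set" where
  "sobolev s q = {f. f \<in> borel_measurable (lebesgue_on unit_cube) \<and> sob_norm s q f < \<infinity>}"

end

theory Submission
	imports Defs "HOL-Probability.Probability"
begin

text \<open>Local averaged Taylor polynomials on dyadic cells of side \<open>2 / 2^l\<close> decompose \<open>f\<close> into levels whose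
	coefficients \<open>c\<close> satisfy \<open>\<Sum>|c|^q <= 2^(l(d - s q))\<close>. Fix the critical level with about \<open>(W L)^2\<close> cells. Far
	coarser levels are stored exactly; nearby levels are rounded to multiples of a threshold which decays away from
	the critical level on the coarse side and follows the nonlinear balance on the fine side; on finer levels only the few
	coefficients above the threshold are kept. In Z-order the rounded coefficients of a level form a sparse stream of
	bounded entropy, which a network of width \<open>O(W)\<close> and depth \<open>O(L)\<close> decodes bit by bit. This is exact outside a small
	neighbourhood of the cell boundaries. Each point is bad for at most \<open>d\<close> of \<open>2d + 1\<close> shifted grids, so the median of the \<open>2d + 1\<close>
	networks has the required error everywhere.\<close>

section \<open>ReLU network calculus\<close>

text \<open>The doubled exponent comes from information: about \<open>W^2 * L\<close> stored reals,
  each carrying about \<open>L\<close> bits that are read off in \<open>L\<close> layers, give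
  \<open>(W*L)^2\<close> bits, so a level with that many cells is affordable. For
  \<open>q < p\<close> equal precision on all fine cells is too expensive; the threshold there is
  \<open>2^(-s*ls + ka*r)\<close> at distance \<open>r\<close> from the critical level
  \<open>ls\<close>. Its cost decays in \<open>r\<close> iff \<open>q*ka + s*q > d\<close>, its
  \<open>L^p\<close> error iff \<open>ka*(p - q) < s*q\<close>, and such a \<open>ka\<close> exists
  exactly because \<open>d/q - d/p < s\<close>. Decay on both sides keeps the total depth
  \<open>O(L)\<close> although about \<open>log L\<close> levels are decoded. The averaging windows
  are pushed into the cube, so weak derivatives are tested only with functions supported in the open
  cube and no extension operator is needed. A continuous network cannot jump at cell faces, and near
  them its values are uncontrolled; since \<open>p\<close> may be infinite, a small exceptional set
  is not good enough, and the median removes it altogether.\<close>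

abbreviation (input) lims :: "(nat => 'a::topological_space) => 'a => bool" (infixr "---->" 60) where "X ----> l == X \<longlonglongrightarrow> l"

text \<open>\<open>cmp X w n F G\<close>: \<open>n\<close> ReLU layers of width \<open>w\<close> compute the functions \<open>G\<close> from the registers \<open>F\<close>, where
	functions matter only on \<open>X\<close>.\<close>
inductive_set affs :: "'x set => ('x => real) set => ('x => real) set" for X F where
	base: "f : F ==> f : affs X F"
| const: "(%_. c) : affs X F"
| add: "f : affs X F ==> g : affs X F ==> (%x. f x + g x) : affs X F"
| scale: "f : affs X F ==> (%x. c * f x) : affs X F"
| cong: "f : affs X F ==> (!!x. x : X ==> g x = f x) ==> g : affs X F"

fun cmp :: "'x set => nat => nat => ('x => real) set => ('x => real) set => bool" where
	"cmp X w 0 F G \<longleftrightarrow> G \<subseteq> affs X F"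
| "cmp X w (Suc n) F G \<longleftrightarrow>
			(EX U. finite U & card U <= w & (ALL u:U. EX v:affs X F. ALL x:X. u x = relu (v x)) & cmp X w n U G)"

lemma affs_trans: "f : affs X G ==> G \<subseteq> affs X F ==> f : affs X F"
	by (induction rule: affs.induct) (auto intro: affs.intros)

lemma affs_mono: "f : affs X G ==> G \<subseteq> F ==> f : affs X F"
	by (rule affs_trans) (auto intro: affs.base)

lemma affs_sub [intro]: "F \<subseteq> affs X F"
	by (auto intro: affs.base)

lemma affs_diff: "f : affs X F ==> g : affs X F ==> (%x. f x - g x) : affs X F"
	using affs.add[of f X F "%x. (-1) * g x"] affs.scale[of g X F "-1"] by simp

lemma affs_uminus: "f : affs X F ==> (%x. - f x) : affs X F"
	using affs.scale[of f X F "-1"] by simp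

lemma affs_scale': "f : affs X F ==> (%x. f x * c) : affs X F"
	using affs.scale[of f X F c] by (simp add: mult.commute)

lemma affs_div: "f : affs X F ==> (%x. f x / c) : affs X F"
	using affs.scale[of f X F "inverse c"] by (simp add: divide_inverse mult.commute)

lemma affs_sum: "finite I ==> (!!i. i : I ==> f i : affs X F) ==> (%x. SUM i:I. f i x) : affs X F"
	by (induction I rule: finite_induct) (auto intro: affs.intros)

lemmas affs_intros = affs.const affs.add affs.scale affs_diff affs_uminus affs_scale' affs_div affs_sum

lemma affs_lin:
	assumes "f : affs X F" "F = h ` {..<M::nat}"
	shows "EX a c. ALL x:X. f x = (SUM i<M. a i * h i x) + c"
	using assms(1)
proof (induction rule: affs.induct)
	case (base f)
	then obtain j where j: "j < M" "f = h j" using assms(2) by auto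
	show ?case
		by (rule exI[of _ "%i. if i = j then 1 else 0"], rule exI[of _ 0])
				(use j in \<open>simp add: if_distrib[of "%a. a * _"] cong: if_cong\<close>)
next
	case (const c)
	show ?case by (rule exI[of _ "%i. 0"]) auto
next
	case (add f g)
	then obtain a c a' c' where "ALL x:X. f x = (SUM i<M. a i * h i x) + c" "ALL x:X. g x = (SUM i<M. a' i * h i x) + c'"
		by blast
	thus ?case
		by (intro exI[of _ "%i. a i + a' i"] exI[of _ "c + c'"]) (simp add: algebra_simps sum.distrib)
next
	case (scale f e)
	then obtain a c where "ALL x:X. f x = (SUM i<M. a i * h i x) + c"
		by blast
	thus ?case
		by (intro exI[of _ "%i. e * a i"] exI[of _ "e * c"]) (simp add: algebra_simps sum_distrib_left)
next
	case (cong f g)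
	thus ?case by metis
qed

lemma cmp_pre: "cmp X w n G H ==> G \<subseteq> affs X F ==> cmp X w n F H"
	by (cases n) (auto, meson affs_trans subsetD, meson affs_trans)

lemma cmp_seq: "cmp X w n F G ==> cmp X w m G H ==> cmp X w (n + m) F H"
	by (induction n arbitrary: F) (auto intro: cmp_pre)

lemma cmp_post: "cmp X w n F G ==> H \<subseteq> affs X G ==> cmp X w n F H"
	using cmp_seq[of X w n F G 0 H] by simp

lemma cmp_sub: "cmp X w n F G ==> H \<subseteq> G ==> cmp X w n F H"
	by (rule cmp_post) (auto intro: affs.base)

lemma cmp_pre_sub: "cmp X w n F G ==> F \<subseteq> F' ==> cmp X w n F' G"
	by (rule cmp_pre) (auto intro: affs.base)

lemma cmp_mono_w: "cmp X w n F G ==> w <= w' ==> cmp X w' n F G"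
proof (induction n arbitrary: F)
	case (Suc n)
	thus ?case unfolding cmp.simps by (meson order_trans)
qed simp

lemma cmp_par: "cmp X w1 n F G1 ==> cmp X w2 n F G2 ==> cmp X (w1 + w2) n F (G1 Un G2)"
proof (induction n arbitrary: F)
	case 0 thus ?case by auto
next
	case (Suc n)
	from Suc.prems obtain U1 U2 where
		U1: "finite U1" "card U1 <= w1" "ALL u:U1. EX v:affs X F. ALL x:X. u x = relu (v x)" "cmp X w1 n U1 G1" and
		U2: "finite U2" "card U2 <= w2" "ALL u:U2. EX v:affs X F. ALL x:X. u x = relu (v x)" "cmp X w2 n U2 G2"
		by auto
	have "cmp X (w1 + w2) n (U1 Un U2) (G1 Un G2)"
		by (rule Suc.IH) (use U1(4) U2(4) in "auto intro: cmp_pre_sub")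
	moreover have "card (U1 Un U2) <= w1 + w2"
		using card_Un_le[of U1 U2] U1 U2 by linarith
	ultimately show ?case using U1 U2 by (auto intro!: exI[of _ "U1 Un U2"])
qed

lemma cmp_layer:
	assumes "finite I" "card I <= w" "!!i. i : I ==> u i : affs X F"
		"G \<subseteq> affs X ((%i x. relu (u i x)) ` I)"
	shows "cmp X w 1 F G"
proof -
	have "card ((%i x. relu (u i x)) ` I) <= w"
		using card_image_le[OF assms(1)] assms(2) order_trans by blast
	thus ?thesis using assms by (auto intro!: exI[of _ "(%i x. relu (u i x)) ` I"])
qed

lemma cmp_layer1: "u : affs X F ==> cmp X 1 1 F {%x. relu (u x)}"
	by (rule cmp_layer[of "{()}" 1 "%_. u"]) (auto intro: affs.base)

lemma relu_id: "relu t - relu (- t) = t"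
	by (simp add: relu_def)

lemma cmp_id1: assumes "finite F" shows "cmp X (2 * card F) 1 F F"
proof (rule cmp_layer[of "F \<times> (UNIV :: bool set)" _ "%(f, b) x. if b then f x else - f x"])
	show "finite (F \<times> (UNIV :: bool set))" using assms by simp
	show "card (F \<times> (UNIV :: bool set)) <= 2 * card F"
		by (simp add: card_cartesian_product)
	show "(%(f, b) x. if b then f x else - f x) i : affs X F" if "i : F \<times> (UNIV :: bool set)" for i
		using that by (cases i; cases "snd i") (auto intro: affs_uminus affs.base)
	show "F \<subseteq> affs X ((%i x. relu ((%(f, b) x. if b then f x else - f x) i x)) ` (F \<times> (UNIV :: bool set)))" (is "_ \<subseteq> affs X ?U")
	proof
		fix f assume f: "f : F"
		have 1: "(%x. relu (f x)) : affs X ?U" 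
			by (rule affs.base, rule image_eqI[of _ _ "(f, True)"]) (use f in auto)
		have 2: "(%x. relu (- f x)) : affs X ?U"
			by (rule affs.base, rule image_eqI[of _ _ "(f, False)"]) (use f in auto)
		show "f : affs X ?U" using affs_diff[OF 1 2] by (simp add: relu_id)
	qed
qed

lemma cmp_id: assumes "finite F" shows "cmp X (2 * card F) n F F"
proof (induction n)
	case 0 show ?case by (simp add: affs_sub)
next
	case (Suc n) show ?case using cmp_seq[OF cmp_id1[OF assms] Suc] by simp
qed

text \<open>The depth of an element of \<open>NN W L\<close> is exact, so shorter computations are
  lengthened by identity layers; these cost two units per output because
  \<open>relu t - relu (- t) = t\<close>.\<close>

lemma cmp_pad: "cmp X w n F G ==> finite G ==> 2 * card G <= w ==> n <= m ==> cmp X w m F G"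
	using cmp_seq[of X w n F G "m - n" G] cmp_mono_w[OF cmp_id[of G X "m - n"], of w] by simp

lemma cmp_keep: "cmp X w n F G ==> finite H ==> H \<subseteq> F ==> cmp X (w + 2 * card H) n F (G Un H)"
	by (rule cmp_par) (auto intro: cmp_pre_sub cmp_id)

lemma cmp_seq_keep:
	assumes "cmp X w n F G" "cmp X w' m (G Un H) K" "finite H" "H \<subseteq> F" "w + 2 * card H <= w''" "w' <= w''"
	shows "cmp X w'' (n + m) F K"
	by (rule cmp_seq[OF cmp_mono_w[OF cmp_keep[OF assms(1,3,4)] assms(5)] cmp_mono_w[OF assms(2,6)]])

text \<open>Depth is spent instead of width: the summands are computed one after another while the
  inputs \<open>F\<close> and the partial sum are carried along, so the width does not depend on the
  number of summands.\<close>

lemma cmp_sum_seq: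
	assumes "finite I" "finite F" "!!i. i : I ==> cmp X w (n i) F {y i}"
	shows "cmp X (w + 2 * card F + 2) (SUM i:I. n i) F (insert (%x. SUM i:I. y i x) F)"
	using assms(1,3)
proof (induction I rule: finite_induct)
	case empty
	show ?case by (auto intro: affs_intros affs.base)
next
	case (insert i I)
	let ?S = "%x. SUM i:I. y i x"
	let ?F = "insert ?S F"
	have c: "card ?F <= card F + 1" by (simp add: assms(2) card_insert_if)
	have "cmp X (w + 2 * card ?F) (n i) ?F ({y i} Un ?F)"
		by (rule cmp_keep, rule cmp_pre_sub[OF insert.prems]) (use assms(2) in auto)
	hence "cmp X (w + 2 * card F + 2) (n i) ?F (insert (%x. SUM i:insert i I. y i x) F)"
	proof (rule cmp_post[OF cmp_mono_w])
		show "insert (%x. SUM i:insert i I. y i x) F \<subseteq> affs X ({y i} Un ?F)"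
		proof -
			have "(%x. y i x + ?S x) : affs X ({y i} Un ?F)"
				by (intro affs.add affs.base) auto
			moreover have "F \<subseteq> affs X ({y i} Un ?F)" by (auto intro: affs.base)
			ultimately show ?thesis using insert.hyps by simp
		qed
	qed (use c in auto)
	from cmp_seq[OF insert.IH[OF insert.prems] this] insert.hyps
	show ?case by (simp add: add.commute)
qed

lemma cmp_sum:
	assumes "finite I" "finite F" "!!i. i : I ==> cmp X w (n i) F {y i}"
	shows "cmp X (w + 2 * card F + 2) (SUM i:I. n i) F {%x. SUM i:I. y i x}"
	using cmp_sub[OF cmp_sum_seq[OF assms]] by auto

lemma cmp_Union:
	assumes "finite I" "!!i. i : I ==> cmp X w n F (G i)"
	shows "cmp X (card I * w) n F (\<Union>i\<in>I. G i)"
	using assms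
proof (induction I rule: finite_induct)
	case empty
	have "cmp X 0 n F {}"
		by (induction n arbitrary: F) auto
	thus ?case by simp
next
	case (insert i I)
	have "cmp X (w + card I * w) n F (G i Un (\<Union>i\<in>I. G i))"
		by (rule cmp_par) (use insert in auto)
	thus ?case using insert by simp
qed

section \<open>From register computations to elements of \<open>NN\<close>\<close>

lemma affs_realize: "g : affs X F ==> EX g':affs UNIV F. ALL x:X. g' x = g x"
proof (induction rule: affs.induct)
	case (add f g)
	then obtain f' g' where "f' : affs UNIV F" "ALL x:X. f' x = f x" "g' : affs UNIV F" "ALL x:X. g' x = g x" by auto
	thus ?case by (intro bexI[of _ "%x. f' x + g' x"]) (auto intro: affs.add)
next
	case (scale f c)
	then obtain f' where "f' : affs UNIV F" "ALL x:X. f' x = f x" by auto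
	thus ?case by (intro bexI[of _ "%x. c * f' x"]) (auto intro: affs.scale)
qed (auto intro: affs.base affs.const)

text \<open>Rule \<open>cong\<close> allows a register to be any function with the right values on
  \<open>X\<close>, which no network need compute elsewhere. Replacing each register by the unit it
  stands for yields a genuine network with the same values on \<open>X\<close>.\<close>

lemma cmp_realize: "cmp X w n F {g} ==> EX g'. cmp UNIV w n F {g'} & (ALL x:X. g' x = g x)"
proof (induction n arbitrary: F)
	case 0
	thus ?case using affs_realize[of g X F] by auto
next
	case (Suc n)
	then obtain U where U: "finite U" "card U <= w" "ALL u:U. EX v:affs X F. ALL x:X. u x = relu (v x)" "cmp X w n U {g}"
		by auto
	have "ALL u:U. EX v:affs UNIV F. ALL x:X. u x = relu (v x)"
		using U(3) affs_realize by metis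
	then obtain v where v: "!!u. u : U ==> v u : affs UNIV F" "!!u x. u : U ==> x : X ==> u x = relu (v u x)"
		by metis
	define U' where "U' = (%u x. relu (v u x)) ` U"
	have "U \<subseteq> affs X U'"
	proof
		fix u assume u: "u : U"
		have "(%x. relu (v u x)) : affs X U'" using u by (auto simp: U'_def intro: affs.base)
		thus "u : affs X U'" by (rule affs.cong) (use v u in auto)
	qed
	hence "cmp X w n U' {g}" using U(4) cmp_pre by blast
	from Suc.IH[OF this] obtain g' where g': "cmp UNIV w n U' {g'}" "ALL x:X. g' x = g x" by blast
	have "card U' <= w" using card_image_le[OF U(1)] U(2) unfolding U'_def using order_trans by blast
	hence "cmp UNIV w (Suc n) F {g'}"
		unfolding cmp.simps
	proof (intro exI[of _ U'] conjI ballI)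
		fix u assume "u : U'"
		then obtain u0 where "u0 : U" "u = (%x. relu (v u0 x))" by (auto simp: U'_def)
		thus "EX v:affs UNIV F. ALL x:UNIV. u x = relu (v x)" using v(1)[of u0] by auto
	qed (use g'(1) U(1) in "auto simp: U'_def")
	thus ?case using g'(2) by blast
qed

lemma hid_shift:
	assumes "!!l. N (Suc (Suc l)) = N' (Suc l)" "!!l. A (Suc (Suc l)) = A' (Suc l)" "!!l. b (Suc (Suc l)) = b' (Suc l)"
		"!!j. h' j = relu ((SUM i<N (Suc 0). A (Suc 0) j i * h i) + b (Suc 0) j)"
	shows "hid A b N h (Suc k) = hid A' b' N' h' k"
proof (induction k)
	case 0
	thus ?case using assms(4) by auto
next
	case (Suc k)
	have "hid A b N h (Suc (Suc k)) = (%j. relu ((SUM i<N (Suc (Suc k)). A (Suc (Suc k)) j i * hid A b N h (Suc k) i) + b (Suc (Suc k)) j))"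
		by (rule hid.simps(2))
	also have "... = hid A' b' N' h' (Suc k)" unfolding Suc.IH assms by simp
	finally show ?case .
qed

text \<open>Peels off one layer at a time: the registers after the first layer are enumerated and
  become the new \<open>h\<close>, and the weights of the remaining network are shifted by one index
  (\<open>hid_shift\<close>).\<close>

lemma cmp_hid:
	assumes "cmp UNIV w n (h ` {..<M}) {g}" "1 <= M" "M <= w"
	shows "EX N A b a c. N 1 = M & (ALL l:{1..Suc n}. 1 <= N l & N l <= w) &
		(ALL x. g x = (SUM i<N (Suc n). a i * hid A b N (%j. h j x) n i) + c)"
	using assms
proof (induction n arbitrary: h M)
	case 0
	then obtain a c where "ALL x:UNIV. g x = (SUM i<M. a i * h i x) + c" using affs_lin[of g UNIV "h ` {..<M}" h M] by auto
	hence "ALL x. g x = (SUM i<(%_. M) (Suc 0). a i * hid (%_ _ _. 0) (%_ _. 0) (%_. M) (%j. h j x) 0 i) + c" by simp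
	moreover have "(ALL l:{1..Suc 0}. 1 <= (%_. M) l & (%_. M) l <= w)" using 0 by auto
	ultimately show ?case
		by (intro exI[of _ "%_. M"] exI[of _ "%_ _ _. 0"] exI[of _ "%_ _. 0"] exI[of _ a] exI[of _ c]) simp
next
	case (Suc n)
	then obtain U where U: "finite U" "card U <= w" "ALL u:U. EX v:affs UNIV (h ` {..<M}). ALL x. u x = relu (v x)" "cmp UNIV w n U {g}"
		by auto
	\<comment> \<open>Hidden layers must have at least one unit, so an empty layer gets a constant zero
	  unit.\<close>
	define U' where "U' = (if U = {} then {%_. 0} else U)"
	have "cmp UNIV w n U' {g}" using cmp_pre_sub[OF U(4), of U'] by (auto simp: U'_def)
	have U': "finite U'" "1 <= card U'" "card U' <= w"
		using U Suc.prems by (auto simp: U'_def Suc_le_eq card_gt_0_iff)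
	have v0: "EX v:affs UNIV (h ` {..<M}). ALL x. u x = relu (v x)" if "u : U'" for u
		using that U(3) by (auto simp: U'_def relu_def split: if_splits intro!: bexI[of _ "%_. 0"] affs.const)
	obtain h' where h': "U' = h' ` {..<card U'}"
		using ex_bij_betw_nat_finite[OF U'(1)] by (auto simp: bij_betw_def atLeast0LessThan)
	have "ALL j. EX a b. j < card U' --> (ALL x. h' j x = relu ((SUM i<M. a i * h i x) + b))"
	proof
		fix j
		show "EX a b. j < card U' --> (ALL x. h' j x = relu ((SUM i<M. a i * h i x) + b))"
		proof (cases "j < card U'")
			case True
			then obtain v where v: "v : affs UNIV (h ` {..<M})" "ALL x. h' j x = relu (v x)" using v0 h' by blast
			obtain a c where "ALL x. v x = (SUM i<M. a i * h i x) + c" using affs_lin[OF v(1) refl] by auto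
			thus ?thesis using v(2) by (intro exI[of _ a] exI[of _ c]) simp
		qed auto
	qed
	then obtain a0 b0 where ab: "!!j x. j < card U' ==> h' j x = relu ((SUM i<M. a0 j i * h i x) + b0 j)" by metis
	define h'' where "h'' j x = relu ((SUM i<M. a0 j i * h i x) + b0 j)" for j x
	have "h' ` {..<card U'} = h'' ` {..<card U'}"
		by (rule image_cong) (use ab in "auto simp: h''_def fun_eq_iff")
	hence "U' = h'' ` {..<card U'}" using h' by simp
	with \<open>cmp UNIV w n U' {g}\<close> have "cmp UNIV w n (h'' ` {..<card U'}) {g}" by metis
	from Suc.IH[OF this U'(2,3)] obtain N A b a c where
		N: "N 1 = card U'" "ALL l:{1..Suc n}. 1 <= N l & N l <= w"
		"ALL x. g x = (SUM i<N (Suc n). a i * hid A b N (%j. h'' j x) n i) + c" by metis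
	define N2 where "N2 l = (if l <= 1 then M else N (l - 1))" for l
	define A2 where "A2 l = (if l <= 1 then a0 else A (l - 1))" for l
	define b2 where "b2 l = (if l <= 1 then b0 else b (l - 1))" for l
	have "hid A2 b2 N2 (%j. h j x) (Suc n) = hid A b N (%j. h'' j x) n" for x
		by (rule hid_shift) (auto simp: N2_def A2_def b2_def h''_def)
	hence "ALL x. g x = (SUM i<N2 (Suc (Suc n)). a i * hid A2 b2 N2 (%j. h j x) (Suc n) i) + c"
		using N(3) by (auto simp: N2_def)
	moreover have "ALL l:{1..Suc (Suc n)}. 1 <= N2 l & N2 l <= w"
	proof
		fix l assume "l : {1..Suc (Suc n)}"
		thus "1 <= N2 l & N2 l <= w" using N(2) Suc.prems by (cases l) (auto simp: N2_def)
	qed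
	moreover have "N2 1 = M" by (simp add: N2_def)
	ultimately show ?case by blast
qed

lemma affs_coord:
	fixes v :: "real^'n => real"
	assumes "v : affs UNIV (range (%i x. x $ i))"
	shows "EX a c. ALL x. v x = (SUM i:UNIV. a i * x $ i) + c"
	using assms
proof (induction rule: affs.induct)
	case (base f)
	then obtain j where j: "f = (%x. x $ j)" by auto
	show ?case
		by (rule exI[of _ "%i. if i = j then 1 else 0"], rule exI[of _ 0])
				(use j in \<open>simp add: if_distrib[of "%a. a * _"] cong: if_cong\<close>)
next
	case (const c)
	show ?case by (rule exI[of _ "%i. 0"]) auto
next
	case (add f g)
	then obtain a c a' c' where "ALL x. f x = (SUM i:UNIV. a i * x $ i) + c" "ALL x. g x = (SUM i:UNIV. a' i * x $ i) + c'"
		by blast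
	thus ?case
		by (intro exI[of _ "%i. a i + a' i"] exI[of _ "c + c'"]) (simp add: algebra_simps sum.distrib)
next
	case (scale f e)
	then obtain a c where "ALL x. f x = (SUM i:UNIV. a i * x $ i) + c"
		by blast
	thus ?case
		by (intro exI[of _ "%i. e * a i"] exI[of _ "e * c"]) (simp add: algebra_simps sum_distrib_left)
next
	case (cong f g)
	thus ?case by simp
qed

text \<open>The first hidden layer is separated because it reads the coordinates of a vector,
  whereas all later ones read registers numbered by \<open>nat\<close>; hence the depth
  \<open>Suc n\<close>.\<close>

lemma cmp_NN:
	fixes g :: "real^'n => real"
	assumes "cmp UNIV w (Suc n) (range (%i x. x $ i)) {g}" "1 <= w"
	shows "g : NN w (Suc n)"
proof -
	from assms obtain U where U: "finite U" "card U <= w" "ALL u:U. EX v:affs UNIV (range (%i x. x $ i)). ALL x. u x = relu (v (x::real^'n))" "cmp UNIV w n U {g}"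
		by auto
	define U' where "U' = (if U = {} then {%_. 0} else U)"
	have c: "cmp UNIV w n U' {g}" using cmp_pre_sub[OF U(4), of U'] by (auto simp: U'_def)
	have U': "finite U'" "1 <= card U'" "card U' <= w"
		using U assms by (auto simp: U'_def Suc_le_eq card_gt_0_iff)
	have v0: "EX v:affs UNIV (range (%i x. x $ i)). ALL x. u x = relu (v x)" if "u : U'" for u
		using that U(3) by (auto simp: U'_def relu_def split: if_splits intro!: bexI[of _ "%_. 0"] affs.const)
	obtain h where h: "U' = h ` {..<card U'}"
		using ex_bij_betw_nat_finite[OF U'(1)] by (auto simp: bij_betw_def atLeast0LessThan)
	have "ALL j. EX a b. j < card U' --> (ALL x. h j x = relu ((SUM i:UNIV. a i * x $ i) + b))"
	proof
		fix j
		show "EX a b. j < card U' --> (ALL x. h j x = relu ((SUM i:UNIV. a i * x $ i) + b))"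
		proof (cases "j < card U'")
			case True
			then obtain v where v: "v : affs UNIV (range (%i x. x $ i))" "ALL x. h j x = relu (v x)" using v0 h by blast
			obtain a c where "ALL x. v x = (SUM i:UNIV. a i * x $ i) + c" using affs_coord[OF v(1)] by auto
			thus ?thesis using v(2) by (intro exI[of _ a] exI[of _ c]) simp
		qed auto
	qed
	then obtain a0 b0 where ab: "!!j x. j < card U' ==> h j x = relu ((SUM i:UNIV. a0 j i * x $ i) + b0 j)" by metis
	define h' where "h' j x = relu ((SUM i:UNIV. a0 j i * x $ i) + b0 j)" for j x
	have "h ` {..<card U'} = h' ` {..<card U'}"
		by (rule image_cong) (use ab in "auto simp: h'_def fun_eq_iff")
	hence "U' = h' ` {..<card U'}" using h by simp
	with c have "cmp UNIV w n (h' ` {..<card U'}) {g}" by metis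
	from cmp_hid[OF this U'(2,3)] obtain N A b a c where
		N: "N 1 = card U'" "ALL l:{1..Suc n}. 1 <= N l & N l <= w"
		"ALL x. g x = (SUM i<N (Suc n). a i * hid A b N (%j. h' j x) n i) + c" by metis
	show ?thesis unfolding NN_def mem_Collect_eq
		by (rule exI[of _ N], rule exI[of _ a0], rule exI[of _ b0], rule exI[of _ A], rule exI[of _ b], rule exI[of _ a],
				rule exI[of _ "%_. 0"], rule exI[of _ c]) (use N in "auto simp: h'_def fun_eq_iff")
qed

section \<open>Dyadic digits and Morton keys\<close>

text \<open>The ramp of slope \<open>1 / ga\<close> lies to the left of \<open>c\<close>, so the
  jump is reproduced exactly for all \<open>v\<close> outside the open interval from
  \<open>c - ga\<close> to \<open>c\<close>.\<close>

lemma ind_relu: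
	assumes "0 < ga" "c <= v \<or> v <= c - ga"
	shows "(relu (v - c + ga) - relu (v - c)) / ga = of_bool (c <= v)"
	using assms by (auto simp: relu_def max_def field_simps)

lemma cmp_steps:
	fixes c :: "'i => real"
	assumes "finite I" "v : affs X F" "0 < ga" "!!x i. x : X ==> i : I ==> c i <= v x \<or> v x <= c i - ga"
	shows "cmp X (2 * card I) 1 F ((%i x. of_bool (c i <= v x)) ` I)"
proof (rule cmp_layer[of "I \<times> (UNIV :: bool set)" _ "%(i, b) x. if b then v x - c i + ga else v x - c i"])
	show "(%(i, b) x. if b then v x - c i + ga else v x - c i) j : affs X F" if "j : I \<times> (UNIV :: bool set)" for j
		using that assms(2) by (cases j; cases "snd j") (auto intro!: affs_intros)
	show "(%i x. of_bool (c i <= v x)) ` I \<subseteq>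
		affs X ((%i x. relu ((%(i, b) x. if b then v x - c i + ga else v x - c i) i x)) ` (I \<times> (UNIV :: bool set)))" (is "_ \<subseteq> affs X ?U")
	proof
		fix f assume "f : (%i x. of_bool (c i <= v x) :: real) ` I"
		then obtain i where i: "i : I" "f = (%x. of_bool (c i <= v x))" by auto
		have 1: "(%x. relu (v x - c i + ga)) : affs X ?U"
			by (rule affs.base, rule image_eqI[of _ _ "(i, True)"]) (use i in auto)
		have 2: "(%x. relu (v x - c i)) : affs X ?U"
			by (rule affs.base, rule image_eqI[of _ _ "(i, False)"]) (use i in auto)
		have "(%x. (relu (v x - c i + ga) - relu (v x - c i)) / ga) : affs X ?U"
			by (intro affs_intros 1 2)
		thus "f : affs X ?U" 
			by (rule affs.cong) (use ind_relu[OF assms(3)] assms(4) i in auto)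
	qed
qed (use assms in "auto simp: card_cartesian_product")

text \<open>Abel summation: every function of the integer part is an affine combination of the same
  step functions. Once the steps are registers, arbitrarily many tables \<open>S\<close> are
  available without further units.\<close>

lemma floor_telescope:
	fixes S :: "nat => real"
	assumes "0 <= v" "v < real b"
	shows "S (nat (floor (v))) = S 0 + (SUM i:{1..<b}. (S i - S (i - 1)) * of_bool (real i <= v))"
proof -
	define D where "D = nat (floor (v))"
	have D: "D < b" using assms unfolding D_def by linarith
	have "real i <= v \<longleftrightarrow> i <= D" for i using assms unfolding D_def by linarith
	hence "(SUM i:{1..<b}. (S i - S (i - 1)) * of_bool (real i <= v)) = (SUM i:{1..<b}. if i <= D then S i - S (i - 1) else 0)"
		by (intro sum.cong) auto
	also have "... = (SUM i:{1..D}. S i - S (i - 1))"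
		using D by (intro sum.mono_neutral_cong_right) auto
	also have "... = S D - S 0" by (induction D) auto
	finally show ?thesis by (simp add: D_def)
qed

lemma affs_floor:
	fixes S :: "nat => real"
	assumes "!!x. x : X ==> 0 <= v x & v x < real b" "(%i x. of_bool (real i <= v x)) ` {1..<b} \<subseteq> affs X F"
	shows "(%x. S (nat (floor (v x)))) : affs X F"
proof -
	have "(%x. S 0 + (SUM i:{1..<b}. (S i - S (i - 1)) * of_bool (real i <= v x))) : affs X F"
		by (intro affs_intros) (use assms(2) in "auto simp: image_subset_iff")
	thus ?thesis by (rule affs.cong) (use floor_telescope assms(1) in blast)
qed

text \<open>Bit \<open>j\<close> of \<open>m\<close> moves to position \<open>d*j\<close>, leaving
  room for the bits of the other \<open>d - 1\<close> coordinates.\<close>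

function spr :: "nat => nat => nat" where
	"spr d m = (if m = 0 then 0 else m mod 2 + 2 ^ d * spr d (m div 2))"
	by auto
termination by (relation "Wellfounded.measure snd") auto
declare spr.simps[simp del]

lemma spr_0 [simp]: "spr d 0 = 0" by (simp add: spr.simps)

lemma spr_rec: "spr d m = m mod 2 + 2 ^ d * spr d (m div 2)"
	by (cases "m = 0") (auto simp: spr.simps[of d m])

lemma spr_add: "r < 2 ^ e ==> spr d (m * 2 ^ e + r) = 2 ^ (d * e) * spr d m + spr d r"
proof (induction e arbitrary: r)
	case (Suc e)
	have e: "m * 2 ^ Suc e + r = 2 * (m * 2 ^ e) + r" by simp
	have 1: "(m * 2 ^ Suc e + r) mod 2 = r mod 2" unfolding e by presburger
	have 2: "(m * 2 ^ Suc e + r) div 2 = m * 2 ^ e + r div 2" unfolding e by presburger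
	have "r div 2 < 2 ^ e" using Suc.prems by auto
	from Suc.IH[OF this] show ?case
		unfolding spr_rec[of d "m * 2 ^ Suc e + r"] spr_rec[of d r] 1 2
		by (simp add: algebra_simps power_add)
qed simp

definition idx :: "'n::finite => nat" where
	"idx = (SOME f. bij_betw f UNIV {..<CARD('n)})"

lemma idx_bij: "bij_betw (idx :: 'n::finite => nat) UNIV {..<CARD('n)}"
proof -
	have "EX f. bij_betw f (UNIV :: 'n set) {..<CARD('n)}"
		using ex_bij_betw_finite_nat[of "UNIV :: 'n set"] by (simp add: atLeast0LessThan)
	thus ?thesis unfolding idx_def by (rule someI_ex)
qed

text \<open>The Morton (Z-order) code: the cells of a coarser dyadic level are intervals of the code of a
	finer one, cf. \<open>key_div\<close>.\<close>
definition key :: "('n::finite => nat) => nat" where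
	"key m = (SUM i:UNIV. 2 ^ idx i * spr CARD('n) (m i))"

lemma bits_sum_less: "(!!j. b j <= 1) ==> (SUM j<d. 2 ^ j * b j) < (2::nat) ^ d"
proof (induction d)
	case (Suc d)
	have "2 ^ d * b d <= 2 ^ d * 1" by (rule mult_le_mono2[OF Suc.prems])
	hence "2 ^ d * b d <= 2 ^ d" by (simp only: mult_1_right)
	moreover have "(SUM j<d. 2 ^ j * b j) < (2::nat) ^ d" using Suc by blast
	ultimately have "(SUM j<d. 2 ^ j * b j) + 2 ^ d * b d < 2 * 2 ^ d" by linarith
	thus ?case by simp
qed simp

lemma bits_sum_inj: "(!!j. b j <= 1) ==> (!!j. b' j <= 1) ==> (SUM j<d. 2 ^ j * b j) = (SUM j<d. (2::nat) ^ j * b' j) ==> j < d ==> b j = b' j"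
proof (induction d)
	case (Suc d)
	have l: "(SUM j<d. 2 ^ j * b j) < (2::nat) ^ d" "(SUM j<d. 2 ^ j * b' j) < (2::nat) ^ d"
		using Suc.prems by (auto intro!: bits_sum_less)
	have e: "(SUM j<d. 2 ^ j * b j) + 2 ^ d * b d = (SUM j<d. 2 ^ j * b' j) + (2::nat) ^ d * b' d" using Suc.prems(3) by simp
	from arg_cong[OF e, of "%x. x div 2 ^ d"] l have "b d = b' d" by simp
	moreover from this e have "(SUM j<d. 2 ^ j * b j) = (SUM j<d. (2::nat) ^ j * b' j)" by simp
	ultimately show ?case using Suc by (cases "j = d") auto
qed simp

lemma sum_idx: "(SUM i:(UNIV::'n::finite set). 2 ^ idx i * b i) = (SUM j<CARD('n). (2::nat) ^ j * b (inv_into UNIV idx j))"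
proof -
	have "(SUM i:(UNIV::'n set). 2 ^ idx i * b i) = (SUM i:(UNIV::'n set). 2 ^ idx i * b (inv_into UNIV idx (idx i)))"
		using idx_bij[where 'n='n] by (simp add: bij_betw_def)
	also have "... = (SUM j<CARD('n). (2::nat) ^ j * b (inv_into UNIV idx j))"
		by (rule sum.reindex_bij_betw[OF idx_bij])
	finally show ?thesis .
qed

lemma key_rec: "key (m::'n::finite => nat) = (SUM i:UNIV. 2 ^ idx i * (m i mod 2)) + 2 ^ CARD('n) * key (%i. m i div 2)"
	unfolding key_def sum_distrib_left sum.distrib[symmetric]
	by (intro sum.cong refl) (subst spr_rec, simp add: algebra_simps)

lemma key_low: "(SUM i:(UNIV::'n::finite set). 2 ^ idx i * (m i mod 2)) < (2::nat) ^ CARD('n)"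
	unfolding sum_idx by (rule bits_sum_less) simp

lemma key_div1: "key (m::'n::finite => nat) div 2 ^ CARD('n) = key (%i. m i div 2)"
	unfolding key_rec[of m] using key_low[of m] by simp

lemma key_div: "key (m::'n::finite => nat) div 2 ^ (CARD('n) * e) = key (%i. m i div 2 ^ e)"
proof (induction e arbitrary: m)
	case (Suc e)
	have "key m div 2 ^ (CARD('n) * Suc e) = (key m div 2 ^ CARD('n)) div 2 ^ (CARD('n) * e)"
		by (simp add: power_add div_mult2_eq)
	thus ?case by (simp add: key_div1 Suc div_mult2_eq)
qed simp

lemma key_inj_aux:
	fixes m m' :: "'n::finite => nat"
	shows "(!!i. m i < 2 ^ N) ==> (!!i. m' i < 2 ^ N) ==> key m = key m' ==> m i = m' i"
proof (induction N arbitrary: m m' i)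
	case (Suc N)
	have 1: "key (%i. m i div 2) = key (%i. m' i div 2)" using Suc.prems(3) key_div1 by metis
	have "m i div 2 = m' i div 2" for i
		by (rule Suc.IH[OF _ _ 1]) (use Suc.prems in "auto simp: less_mult_imp_div_less mult.commute")
	moreover have "m i mod 2 = m' i mod 2" for i
	proof -
		have "(SUM i:(UNIV::'n set). 2 ^ idx i * (m i mod 2)) = (SUM i:(UNIV::'n set). 2 ^ idx i * (m' i mod 2))"
			using Suc.prems(3) 1 unfolding key_rec[of m] key_rec[of m'] by simp
		hence "m (inv_into UNIV idx (idx i)) mod 2 = m' (inv_into UNIV idx (idx i)) mod 2"
			unfolding sum_idx by (intro bits_sum_inj[where b = "%j. m (inv_into UNIV idx j) mod 2" and b' = "%j. m' (inv_into UNIV idx j) mod 2" and d = "CARD('n)"])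
				(use idx_bij[where 'n='n] in "auto simp: bij_betw_def")
		thus ?thesis using idx_bij[where 'n='n] by (simp add: bij_betw_def)
	qed
	ultimately show ?case by (metis mult_div_mod_eq)
qed simp

lemma key_inj: assumes "key m = key m'" shows "m = (m' :: 'n::finite => nat)"
proof
	fix i
	define N where "N = (SUM i:UNIV. m i + m' i)"
	have "m i + m' i <= N" for i unfolding N_def by (rule member_le_sum[of _ _ "%i. m i + m' i"]) auto
	hence "m i < 2 ^ N" "m' i < 2 ^ N" for i
		using less_exp[of N] le_less_trans[of "m i" N] le_less_trans[of "m' i" N] by (meson add_leE)+
	thus "m i = m' i" using key_inj_aux assms by blast
qed

lemma key_0 [simp]: "key (%_. 0) = 0" by (simp add: key_def)

lemma key_less: fixes m :: "'n::finite => nat" assumes "!!i. m i < 2 ^ l" shows "key m < 2 ^ (CARD('n) * l)"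
	using key_div[of m l] assms by (simp add: div_eq_0_iff)

section \<open>Cells, remainders and the extraction of dyadic digits\<close>

definition cel :: "nat => real => nat" where "cel l y = nat (floor (2 ^ l * y))"
definition fr :: "nat => real => real" where "fr l y = frac (2 ^ l * y)"
text \<open>The margin is one-sided because the ramp of \<open>ind_relu\<close> lies to the left of
  its jump. Only the finest level \<open>N\<close> is mentioned, since coarser grid points are finer
  ones as well. For \<open>ep = 1\<close> the condition forces \<open>y\<close> to be a multiple of
  \<open>2^(-N)\<close>, see \<open>good_1D\<close>.\<close>

definition good :: "nat => real => real => bool" where
	"good N ep y \<longleftrightarrow> 0 <= y & y < 1 & frac (2 ^ N * y) <= 1 - ep"

lemma fr_bounds: "0 <= fr l y" "fr l y < 1" by (auto simp: fr_def frac_lt_1)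

lemma cel_fr: "0 <= y ==> 2 ^ l * y = real (cel l y) + fr l y"
	by (simp add: cel_def fr_def frac_def)

lemma pow_cel_fr: "0 <= y ==> 2 ^ (l + e) * y = 2 ^ e * real (cel l y) + 2 ^ e * fr l y"
	unfolding distrib_left[symmetric] cel_fr[symmetric] power_add by simp

lemma cel_less: "0 <= y ==> y < 1 ==> cel l y < 2 ^ l"
	unfolding cel_def by (simp add: nat_less_iff floor_less_iff)

lemma fr_add: "fr (l + e) y = frac (2 ^ e * fr l y)"
proof -
	have *: "2 ^ e * fr l y = 2 ^ (l + e) * y - of_int (2 ^ e * floor (2 ^ l * y))"
		by (simp add: fr_def frac_def algebra_simps power_add)
	show ?thesis unfolding fr_def[of "l + e"] * frac_def floor_diff_of_int of_int_diff by simp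
qed

lemma cel_add: assumes "0 <= y" shows "cel (l + e) y = cel l y * 2 ^ e + nat (floor (2 ^ e * fr l y))"
proof -
	have "2 ^ (l + e) * y = of_int (int (cel l y * 2 ^ e)) + 2 ^ e * fr l y"
		using pow_cel_fr[OF assms, of l e] by simp
	hence "floor (2 ^ (l + e) * y) = int (cel l y * 2 ^ e) + floor (2 ^ e * fr l y)" by (simp only: int_add_floor)
	moreover have "0 <= floor (2 ^ e * fr l y)" using fr_bounds by simp
	ultimately show ?thesis unfolding cel_def[of "l + e"] by (simp add: nat_add_distrib nat_mult_distrib nat_power_eq)
qed

lemma cel_div: assumes "0 <= y" shows "cel (l + e) y div 2 ^ e = cel l y"
proof -
	have "2 ^ e * fr l y < 2 ^ e" using fr_bounds[of l y] by simp
	hence "nat (floor (2 ^ e * fr l y)) < 2 ^ e" using fr_bounds[of l y] by (simp add: nat_less_iff floor_less_iff)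
	thus ?thesis unfolding cel_add[OF assms] by simp
qed

text \<open>Scaling by \<open>2^(N - l)\<close> turns an integer at level \<open>l\<close> into one
  at level \<open>N\<close>, where a point closely below it would have fractional part above
  \<open>1 - ep\<close>. The value \<open>ep / 2^N\<close> is not optimal but serves all levels at
  once.\<close>

lemma good_gap:
	fixes i :: int
	assumes "good N ep y" "l <= N" "0 < ep"
	shows "of_int i <= 2 ^ l * y \<or> 2 ^ l * y <= of_int i - ep / 2 ^ N"
proof (rule disjCI)
	assume "~ 2 ^ l * y <= of_int i - ep / 2 ^ N"
	hence 1: "2 ^ l * y > of_int i - ep / 2 ^ N" by simp
	have N: "(2::real) ^ N = 2 ^ (N - l) * 2 ^ l" using assms(2) by (simp flip: power_add)
	have "2 ^ (N - l) * (2 ^ l * y) > 2 ^ (N - l) * (of_int i - ep / 2 ^ N)" using 1 by simp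
	moreover have "2 ^ (N - l) * (ep / 2 ^ N) <= ep"
		using assms(3) unfolding N by (simp add: divide_simps) 
	ultimately have "2 ^ N * y > of_int (2 ^ (N - l) * i) - ep"
		unfolding N by (simp add: algebra_simps)
	moreover have "frac (2 ^ N * y) <= 1 - ep" using assms(1) by (simp add: good_def)
	ultimately have "floor (2 ^ N * y) > 2 ^ (N - l) * i - 1"
		unfolding frac_def by linarith
	hence "of_int (2 ^ (N - l) * i) <= 2 ^ N * y" by linarith
	hence "2 ^ (N - l) * of_int i <= 2 ^ (N - l) * (2 ^ l * y)" unfolding N by (simp add: algebra_simps)
	thus "of_int i <= 2 ^ l * y" by simp
qed

lemma good_gap_fr:
	assumes "good N ep y" "l + e <= N" "0 < ep"
	shows "real i <= 2 ^ e * fr l y \<or> 2 ^ e * fr l y <= real i - ep / 2 ^ N"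
proof -
	have "0 <= y" using assms(1) by (simp add: good_def)
	hence "2 ^ e * fr l y = 2 ^ (l + e) * y - of_int (2 ^ e * int (cel l y))"
		using pow_cel_fr[of y l e] by simp
	moreover have "of_int (int i + 2 ^ e * int (cel l y)) <= 2 ^ (l + e) * y \<or> 2 ^ (l + e) * y <= of_int (int i + 2 ^ e * int (cel l y)) - ep / 2 ^ N"
		by (rule good_gap) (use assms in auto)
	ultimately show ?thesis by auto
qed

text \<open>Reads \<open>e\<close> binary digits in one layer with about \<open>2^e\<close> steps.
  The new remainder and the new spread digits differ from linear expressions in the old registers
  only by functions of the integer part of \<open>2^e * fr l y\<close>, so both are affine in the
  same steps.\<close>

lemma cmp_chunk:
	assumes g: "!!x. x : X ==> good N ep (y x)" "0 < ep" "l + e <= N"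
	shows "cmp X (2 * 2 ^ e + 4) 1 {%x. fr l (y x), %x. real (spr d (cel l (y x)))}
			{%x. fr (l + e) (y x), %x. real (spr d (cel (l + e) (y x)))}" (is "cmp X _ 1 ?F ?G")
proof -
	define v where "v x = 2 ^ e * fr l (y x)" for x
	let ?I = "(%i x. of_bool (real i <= v x)) ` {1..<2 ^ e}"
	have c: "cmp X (2 * card {1..<(2::nat) ^ e}) 1 ?F ?I"
		by (rule cmp_steps[of _ _ _ _ "ep / 2 ^ N"])
				(use g good_gap_fr[OF g(1,3,2)] in "auto simp: v_def intro: affs_intros affs.base")
	have "cmp X (2 * card {1..<(2::nat) ^ e} + 2 * card ?F) 1 ?F (?I Un ?F)"
		by (rule cmp_par[OF c cmp_id]) simp
	moreover have "card ?F <= 2" by (simp add: card_insert_if)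
	ultimately have c2: "cmp X (2 * 2 ^ e + 4) 1 ?F (?I Un ?F)"
		by (elim cmp_mono_w) simp
	have v: "0 <= v x & v x < real (2 ^ e)" for x using fr_bounds[of l "y x"] by (simp add: v_def)
	have fl: "(%x. S (nat (floor (v x)))) : affs X (?I Un ?F)" for S :: "nat => real"
		by (rule affs_floor[where b = "2 ^ e"]) (use v in "auto intro: affs.base")
	show ?thesis
	proof (rule cmp_post[OF c2])
		have "(%x. 2 ^ e * fr l (y x) - real (nat (floor (v x)))) : affs X (?I Un ?F)"
			by (rule affs_diff[OF _ fl]) (auto intro: affs_intros affs.base)
		hence 1: "(%x. fr (l + e) (y x)) : affs X (?I Un ?F)"
			by (rule affs.cong) (use v in "simp add: fr_add frac_def v_def")
		have "(%x. 2 ^ (d * e) * real (spr d (cel l (y x))) + real (spr d (nat (floor (v x))))) : affs X (?I Un ?F)"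
			by (rule affs.add[OF _ fl]) (auto intro: affs_intros affs.base)
		hence 2: "(%x. real (spr d (cel (l + e) (y x)))) : affs X (?I Un ?F)"
		proof (rule affs.cong)
			fix x assume "x : X"
			hence y: "0 <= y x" using g(1) by (auto simp: good_def)
			have "nat (floor (v x)) < 2 ^ e" using v[of x] by (simp add: nat_less_iff floor_less_iff)
			thus "real (spr d (cel (l + e) (y x))) = 2 ^ (d * e) * real (spr d (cel l (y x))) + real (spr d (nat (floor (v x))))"
				unfolding cel_add[OF y] v_def[symmetric] by (simp add: spr_add)
		qed
		show "?G \<subseteq> affs X (?I Un ?F)" using 1 2 by simp
	qed
qed

text \<open>Chunks of \<open>u\<close> digits balance the resources: width of order
  \<open>2^u\<close> and about \<open>l / u\<close> layers. The additional layer reads the last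
  \<open>l mod u\<close> digits.\<close>

lemma cmp_level1:
	assumes g: "!!x. x : X ==> good N ep (y x)" "0 < ep" "l <= N" "0 < u"
	shows "cmp X (2 * 2 ^ u + 4) (l div u + 1) {y} {%x. fr l (y x), %x. real (spr d (cel l (y x)))}"
proof -
	let ?S = "%l. {%x. fr l (y x), %x. real (spr d (cel l (y x)))}"
	have *: "cmp X (2 * 2 ^ u + 4) a {y} (?S (a * u))" if "a * u <= N" for a
		using that
	proof (induction a)
		case 0
		have "fr 0 (y x) = y x & cel 0 (y x) = 0" if "x : X" for x
			using g(1)[OF that] by (auto simp: good_def fr_def frac_eq cel_def floor_eq_iff)
		hence "(%x. fr 0 (y x)) : affs X {y}" "(%x. real (spr d (cel 0 (y x)))) : affs X {y}"
			by (auto intro: affs.cong[of y] affs.cong[of "%_. 0"] affs.base affs.const)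
		thus ?case by simp
	next
		case (Suc a)
		hence IH: "cmp X (2 * 2 ^ u + 4) a {y} (?S (a * u))" by simp
		have "cmp X (2 * 2 ^ u + 4) 1 (?S (a * u)) (?S (a * u + u))"
			by (rule cmp_chunk[OF g(1,2)]) (use Suc.prems in auto)
		from cmp_seq[OF IH this] show ?case by (simp add: add.commute)
	qed
	have m: "(2::nat) ^ (l mod u) <= 2 ^ u"
		using g(4) by (auto intro!: power_increasing less_imp_le)
	have "cmp X (2 * 2 ^ u + 4) 1 (?S (l div u * u)) (?S (l div u * u + l mod u))"
		by (rule cmp_mono_w[OF cmp_chunk[OF g(1,2)]]) (use m g(3) in auto)
	hence 2: "cmp X (2 * 2 ^ u + 4) 1 (?S (l div u * u)) (?S l)" by simp
	have "l div u * u <= N" using g(3) by (meson div_times_less_eq_dividend order_trans)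
	from cmp_seq[OF *[OF this] 2] show ?thesis .
qed

section \<open>Digit multiplication and step functions\<close>

lemma cmp_levels:
	fixes y :: "'n::finite => 'x => real"
	assumes g: "!!x i. x : X ==> good N ep (y i x)" "0 < ep" "l <= N" "0 < u"
	shows "cmp X (CARD('n) * (2 * 2 ^ u + 4)) (l div u + 1) (range y)
		(insert (%x. real (key (%i. cel l (y i x)))) (range (%i x. fr l (y i x))))"
proof -
	let ?G = "%i. {%x. fr l (y i x), %x. real (spr CARD('n) (cel l (y i x)))}"
	have "cmp X (CARD('n) * (2 * 2 ^ u + 4)) (l div u + 1) (range y) (\<Union>i\<in>UNIV. ?G i)"
	proof (rule cmp_Union)
		show "cmp X (2 * 2 ^ u + 4) (l div u + 1) (range y) (?G i)" for i
			by (rule cmp_pre_sub[OF cmp_level1[OF g(1-4)]]) auto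
	qed simp
	moreover have "(%x. real (key (%i. cel l (y i x)))) : affs X (\<Union>i\<in>UNIV. ?G i)"
		unfolding key_def of_nat_sum of_nat_mult by (intro affs_intros) (auto intro: affs.base)
	moreover have "range (%i x. fr l (y i x)) \<subseteq> affs X (\<Union>i\<in>UNIV. ?G i)" by (auto intro: affs.base)
	ultimately show ?thesis by (auto intro: cmp_post)
qed

text \<open>\<open>relu (w - M*e)\<close> is \<open>w\<close> where the penalty \<open>e\<close>
  vanishes and 0 where \<open>e >= 1\<close>, because \<open>0 <= w <= M\<close>. This is how
  products with indicators are formed without multiplication.\<close>

lemma cmp_gate:
	assumes "finite I" "card I <= n" "!!i. i : I ==> w i : affs X F" "!!i. i : I ==> e i : affs X F"
		"!!x i. x : X ==> i : I ==> 0 <= w i x & w i x <= M"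
		"!!x i. x : X ==> i : I ==> (if P i x then e i x = 0 else 1 <= e i x)"
	shows "cmp X n 1 F ((%i x. w i x * of_bool (P i x)) ` I)"
proof (rule cmp_layer[OF assms(1,2), of "%i x. w i x - M * e i x"])
	let ?U = "(%i x. relu (w i x - M * e i x)) ` I"
	show "(%i x. w i x * of_bool (P i x)) ` I \<subseteq> affs X ?U"
	proof
		fix f assume "f : (%i x. w i x * of_bool (P i x)) ` I"
		then obtain i where i: "i : I" "f = (%x. w i x * of_bool (P i x))" by auto
		have "(%x. relu (w i x - M * e i x)) : affs X ?U" using i by (auto intro: affs.base)
		thus "f : affs X ?U"
		proof (rule affs.cong)
			fix x assume x: "x : X"
			show "f x = relu (w i x - M * e i x)"
			proof (cases "P i x")
				case True
				thus ?thesis using assms(5,6)[OF x i(1)] i(2) by (simp add: relu_def)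
			next
				case False
				hence "1 <= e i x" "0 <= w i x" "w i x <= M" using assms(5,6)[OF x i(1)] by auto
				moreover from this have "M * 1 <= M * e i x" by (intro mult_left_mono) auto
				ultimately show ?thesis using False i(2) by (simp add: relu_def)
			qed
		qed
	qed
qed (intro affs_intros assms)

lemma mul_step_eq: "(w::real) * (real (c * 2 ^ u + n) / 2 ^ (l + u)) = w * (real c / 2 ^ l) + w * real n / 2 ^ (l + u)"
	by (simp add: add_divide_distrib distrib_left power_add)

text \<open>A product with a dyadic number can be exact: if \<open>n\<close> is the integer formed
  by the next \<open>u\<close> digits, then \<open>w * n\<close> is the sum of \<open>w\<close> over
  the steps \<open>1 <= i <= n\<close>, and each of these terms is a gate. The first layer finds the
  steps, the second one gates.\<close>

lemma cmp_mul_step: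
	assumes xii: "!!x. x : X ==> good N 1 (xii x)" and w: "!!x. x : X ==> 0 <= w x & w x <= M" and l: "l + u <= N"
	shows "cmp X (2 * 2 ^ u + 6) 2 {w, %x. fr l (xii x), %x. w x * (real (cel l (xii x)) / 2 ^ l)}
			{w, %x. fr (l + u) (xii x), %x. w x * (real (cel (l + u) (xii x)) / 2 ^ (l + u))}" (is "cmp X _ 2 {w, ?f, ?a} {w, ?f', ?a'}")
proof -
	define v where "v x = 2 ^ u * fr l (xii x)" for x
	let ?I = "{1..<(2::nat) ^ u}"
	let ?ind = "%i x. of_bool (real i <= v x) :: real"
	have v: "0 <= v x & v x < real (2 ^ u)" for x using fr_bounds[of l "xii x"] by (simp add: v_def)
	have c3: "card {w, f, g} <= 3" for w f g :: "'a => real" by (simp add: card_insert_if)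
	have c: "cmp X (2 * card ?I) 1 {w, ?f, ?a} (?ind ` ?I)"
		by (rule cmp_steps[of _ _ _ _ "1 / 2 ^ N"])
				(use xii good_gap_fr[OF xii l] in "auto simp: v_def intro: affs_intros affs.base")
	have c1: "cmp X (2 * 2 ^ u + 6) 1 {w, ?f, ?a} (?ind ` ?I Un {w, ?f, ?a})"
		by (rule cmp_mono_w[OF cmp_par[OF c cmp_id]]) (use c3[of w ?f ?a] in auto)
	have fl: "(%x. S (nat (floor (v x)))) : affs X (?ind ` ?I Un {w, ?f, ?a})" for S :: "nat => real"
		by (rule affs_floor[where b = "2 ^ u"]) (use v in "auto intro: affs.base")
	have "(%x. 2 ^ u * fr l (xii x) - real (nat (floor (v x)))) : affs X (?ind ` ?I Un {w, ?f, ?a})"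
		by (rule affs_diff[OF _ fl]) (auto intro: affs_intros affs.base)
	hence "?f' : affs X (?ind ` ?I Un {w, ?f, ?a})"
		by (rule affs.cong) (use v in "simp add: fr_add frac_def v_def")
	hence c2: "cmp X (2 * 2 ^ u + 6) 1 {w, ?f, ?a} (?ind ` ?I Un {w, ?f', ?a})"
		by (intro cmp_post[OF c1]) (auto intro: affs.base)
	have c4: "cmp X (2 ^ u) 1 (?ind ` ?I Un {w, ?f', ?a}) ((%i x. w x * of_bool (real i <= v x)) ` ?I)"
	proof (rule cmp_gate[where M = M and e = "%i x. 1 - ?ind i x"])
		show "(%x. 1 - ?ind i x) : affs X (?ind ` ?I Un {w, ?f', ?a})" if "i : ?I" for i
			using that by (intro affs_intros) (auto intro: affs.base)
	qed (use w in "auto intro: affs.base")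
	have c5: "cmp X (2 * 2 ^ u + 6) 1 (?ind ` ?I Un {w, ?f', ?a}) ((%i x. w x * of_bool (real i <= v x)) ` ?I Un {w, ?f', ?a})"
		by (rule cmp_mono_w[OF cmp_keep[OF c4]]) (use c3[of w ?f' ?a] in auto)
	have "(%x. ?a x + (SUM i:?I. w x * of_bool (real i <= v x)) / 2 ^ (l + u)) : affs X ((%i x. w x * of_bool (real i <= v x)) ` ?I Un {w, ?f', ?a})"
		by (intro affs_intros) (auto intro: affs.base)
	hence "?a' : affs X ((%i x. w x * of_bool (real i <= v x)) ` ?I Un {w, ?f', ?a})"
	proof (rule affs.cong)
		fix x assume x: "x : X"
		have "0 <= xii x" using xii[OF x] by (simp add: good_def)
		have "real (nat (floor (v x))) = (SUM i:?I. of_bool (real i <= v x))"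
			using floor_telescope[of "v x" "2 ^ u" real] v[of x] by simp
		hence S: "(SUM i:?I. w x * of_bool (real i <= v x)) = w x * real (nat (floor (v x)))"
			by (simp only: sum_distrib_left[symmetric])
		show "?a' x = ?a x + (SUM i:?I. w x * of_bool (real i <= v x)) / 2 ^ (l + u)"
			using mul_step_eq[of "w x" "cel l (xii x)" u "nat (floor (v x))" l] cel_add[OF \<open>0 <= xii x\<close>, of l u]
			unfolding S unfolding v_def by (simp only:)
	qed
	hence "cmp X (2 * 2 ^ u + 6) 1 (?ind ` ?I Un {w, ?f', ?a}) {w, ?f', ?a'}"
		by (intro cmp_post[OF c5]) (auto intro: affs.base)
	from cmp_seq[OF c2 this] show ?thesis unfolding one_add_one .
qed

text \<open>After all \<open>t * u\<close> digits the remainder of \<open>xii\<close> is 0, so no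
  approximation of the product is involved.\<close>

lemma cmp_mul:
	assumes xii: "!!x. x : X ==> good (t * u) 1 (xii x)" and w: "!!x. x : X ==> 0 <= w x & w x <= M"
	shows "cmp X (2 * 2 ^ u + 6) (2 * t) {w, xii} {%x. w x * xii x}"
proof -
	let ?S = "%l. {w, %x. fr l (xii x), %x. w x * (real (cel l (xii x)) / 2 ^ l)}"
	have *: "cmp X (2 * 2 ^ u + 6) (2 * a) {w, xii} (?S (a * u))" if "a <= t" for a
		using that
	proof (induction a)
		case 0
		have "fr 0 (xii x) = xii x & cel 0 (xii x) = 0" if "x : X" for x
			using xii[OF that] by (auto simp: good_def fr_def frac_eq cel_def floor_eq_iff)
		hence "(%x. fr 0 (xii x)) : affs X {w, xii}" "(%x. w x * (real (cel 0 (xii x)) / 2 ^ 0)) : affs X {w, xii}"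
			by (auto intro: affs.cong[of xii] affs.cong[of "%_. 0"] affs.base affs.const)
		thus ?case by (auto intro: affs.base)
	next
		case (Suc a)
		hence IH: "cmp X (2 * 2 ^ u + 6) (2 * a) {w, xii} (?S (a * u))" by simp
		have "a * u + u <= t * u" using Suc.prems by (metis add.commute mult_Suc mult_le_mono1)
		from cmp_seq[OF IH cmp_mul_step[OF xii w this]] show ?case by (simp add: add.commute)
	qed
	have "(%x. w x * xii x) : affs X (?S (t * u))"
	proof (rule affs.cong[of "%x. w x * (real (cel (t * u) (xii x)) / 2 ^ (t * u))"])
		fix x assume x: "x : X"
		have "0 <= xii x" "frac (2 ^ (t * u) * xii x) = 0"
			using xii[OF x] frac_ge_0[of "2 ^ (t * u) * xii x"] by (auto simp: good_def)
		hence "2 ^ (t * u) * xii x = real (cel (t * u) (xii x))" using cel_fr[of "xii x" "t * u"] unfolding fr_def by linarith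
		thus "w x * xii x = w x * (real (cel (t * u) (xii x)) / 2 ^ (t * u))" by (simp add: field_simps)
	qed (auto intro: affs.base)
	thus ?thesis using cmp_post[OF *[of t]] by auto
qed

lemma cmp_mul_list:
	assumes "finite Xii" "!!xii x. xii : Xii ==> x : X ==> good (t * u) 1 (xii x)"
		"!!x. x : X ==> 0 <= w x & w x <= M" "set is \<subseteq> Xii"
	shows "cmp X (2 * 2 ^ u + 6 + 2 * card Xii) (2 * t * length is) (insert w Xii) {%x. w x * (\<Prod>xii\<leftarrow>is. xii x)}"
	using assms(3,4)
proof (induction "is" arbitrary: w)
	case Nil
	thus ?case by (auto intro: affs.base)
next
	case (Cons xii "is")
	have xii: "xii : Xii" using Cons.prems by auto
	have 1: "cmp X (2 * 2 ^ u + 6) (2 * t) (insert w Xii) {%x. w x * xii x}"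
		by (rule cmp_pre_sub[OF cmp_mul[OF assms(2)]]) (use Cons.prems xii in auto)
	have "0 <= xii x & xii x <= 1" if "x : X" for x using assms(2)[OF xii that] by (simp add: good_def)
	hence "0 <= w x * xii x & w x * xii x <= M" if "x : X" for x
		using Cons.prems(1)[OF that] that mult_left_le[of "xii x" "w x"] by fastforce
	from Cons.IH[OF this] Cons.prems(2)
	have 2: "cmp X (2 * 2 ^ u + 6 + 2 * card Xii) (2 * t * length is) (insert (%x. w x * xii x) Xii) {%x. w x * xii x * (\<Prod>xii\<leftarrow>is. xii x)}" by auto
	have "cmp X (2 * 2 ^ u + 6 + 2 * card Xii) (2 * t + 2 * t * length is) (insert w Xii) {%x. w x * xii x * (\<Prod>xii\<leftarrow>is. xii x)}"
		by (rule cmp_seq_keep[OF 1, of _ _ Xii]) (use 2 assms(1) in auto)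
	thus ?case by (simp add: mult.assoc)
qed

lemma sum_shift: "(SUM i:{k..<k+n}. g i) = (SUM i<n. g (k + i :: nat))"
	using sum.shift_bounds_nat_ivl[of g 0 k n] by (simp add: atLeast0LessThan add.commute)

text \<open>One block stores \<open>W\<^sup>2\<close> values in three layers of width \<open>O(W)\<close>: the first layer finds the
	row \<open>a\<close> of the entry \<open>a W + b\<close>, which makes all data of that row available linearly; the other two
	select the column by gating.\<close>
lemma cmp_block:
	fixes J :: "'x => nat" and p :: "nat => nat" and T :: "nat => real"
	assumes p: "mono p" and T: "!!i. i < t0 + W * W ==> 0 <= T i & T i <= M" and W: "1 <= W"
	shows "cmp X (3 * W) 3 {%x. real (J x)} {%x. SUM i<W*W. T (t0 + i) * of_bool (p (t0 + i) <= J x & J x < p (Suc (t0 + i)))}"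
proof -
	define q where "q a = p (t0 + a * W)" for a
	define A where "A x = Max {a. a < W & (a = 0 \<or> q a <= J x)}" for x
	let ?J = "%x. real (J x)"
	have fin: "finite {a. a < W & (a = 0 \<or> q a <= J x)}" "{a. a < W & (a = 0 \<or> q a <= J x)} ~= {}" for x
		using W by (auto intro!: exI[of _ 0])
	have Ain: "A x < W & (A x = 0 \<or> q (A x) <= J x)" for x
		using Max_in[OF fin[of x]] unfolding A_def by blast
	have qm: "q a <= q a'" if "a <= a'" for a a'
		unfolding q_def using that p by (intro monoD[OF p]) simp
	have Ale: "a <= A x \<longleftrightarrow> q a <= J x" if "1 <= a" "a < W" for a x
	proof
		assume "a <= A x"
		thus "q a <= J x" using Ain[of x] that qm[of a "A x"] by auto
	next
		assume "q a <= J x"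
		thus "a <= A x" unfolding A_def using that fin by (intro Max_ge) auto
	qed
	let ?I = "{1..<W}"
	let ?ind = "%a x. of_bool (real (q a) <= ?J x) :: real"
	have c1: "cmp X (2 * card ?I) 1 {?J} (?ind ` ?I)"
		by (rule cmp_steps[of _ _ _ _ 1]) (auto intro: affs_intros affs.base)
	have c1: "cmp X (3 * W) 1 {?J} (?ind ` ?I Un {?J})"
		by (rule cmp_mono_w[OF cmp_par[OF c1 cmp_id]]) (use W in auto)
	have fl: "(%x. S (A x)) : affs X (?ind ` ?I Un {?J})" for S :: "nat => real"
	proof -
		have "(%x. S 0 + (SUM a:?I. (S a - S (a - 1)) * ?ind a x)) : affs X (?ind ` ?I Un {?J})"
			by (intro affs_intros) (auto intro: affs.base)
		thus ?thesis
		proof (rule affs.cong)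
			fix x
			have "S (nat (floor (real (A x)))) = S 0 + (SUM i:{1..<W}. (S i - S (i - 1)) * of_bool (real i <= real (A x)))"
				by (rule floor_telescope) (use Ain in auto)
			moreover have "(SUM i:{1..<W}. (S i - S (i - 1)) * of_bool (real i <= real (A x))) = (SUM a:?I. (S a - S (a - 1)) * ?ind a x)"
				by (intro sum.cong refl) (use Ale in auto)
			ultimately show "S (A x) = S 0 + (SUM a:?I. (S a - S (a - 1)) * ?ind a x)" by simp
		qed
	qed
	define i0 where "i0 b x = t0 + A x * W + b" for b x
	\<comment> \<open>\<open>relu (lo b x)\<close> and \<open>relu (hi b x)\<close> both vanish exactly
	  when \<open>p (i0 b x) <= J x < p (Suc (i0 b x))\<close>; otherwise one of them is at least 1,
	  all quantities being integers. Their sum is the penalty of the gate.\<close>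
	define lo where "lo b x = real (p (i0 b x)) - ?J x" for b x
	define hi where "hi b x = ?J x - (real (p (Suc (i0 b x))) - 1)" for b x
	let ?G1 = "(%b x. relu (lo b x)) ` {..<W}"
	let ?G2 = "(%b x. relu (hi b x)) ` {..<W}"
	let ?G3 = "(%b x. relu (T (i0 b x))) ` {..<W}"
	have a1: "lo b : affs X (?ind ` ?I Un {?J})" for b
		unfolding lo_def i0_def by (rule affs_diff[OF fl[of "%a. real (p (t0 + a * W + b))"]]) (auto intro: affs.base)
	have a2: "hi b : affs X (?ind ` ?I Un {?J})" for b
		unfolding hi_def i0_def by (rule affs_diff[OF _ fl[of "%a. real (p (Suc (t0 + a * W + b))) - 1"]]) (auto intro: affs.base)
	have a3: "(%x. T (i0 b x)) : affs X (?ind ` ?I Un {?J})" for b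
		unfolding i0_def by (rule fl[of "%a. T (t0 + a * W + b)"])
	have l: "cmp X W 1 (?ind ` ?I Un {?J}) ((%b x. relu (u b x)) ` {..<W})" if "!!b. u b : affs X (?ind ` ?I Un {?J})" for u
		by (rule cmp_layer[of "{..<W}" _ u]) (use that in "auto intro: affs.base")
	have c2: "cmp X (W + W + W) 1 (?ind ` ?I Un {?J}) (?G1 Un ?G2 Un ?G3)"
		by (intro cmp_par l a1 a2 a3)
	have i0: "i0 b x < t0 + W * W" if "b < W" for b x
	proof -
		have "A x + 1 <= W" using Ain[of x] by simp
		hence "(A x + 1) * W <= W * W" by (rule mult_le_mono1)
		thus ?thesis using that by (simp add: i0_def)
	qed
	have c3: "cmp X W 1 (?G1 Un ?G2 Un ?G3) ((%b x. relu (T (i0 b x)) * of_bool (p (i0 b x) <= J x & J x < p (Suc (i0 b x)))) ` {..<W})"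
	proof (rule cmp_gate[where M = M and e = "%b x. relu (lo b x) + relu (hi b x)"])
		fix x b assume "b : {..<W}"
		show "0 <= relu (T (i0 b x)) & relu (T (i0 b x)) <= M"
			using T[OF i0[of b x]] \<open>b : _\<close> by (auto simp: relu_def)
		show "if p (i0 b x) <= J x & J x < p (Suc (i0 b x)) then relu (lo b x) + relu (hi b x) = 0
					else 1 <= relu (lo b x) + relu (hi b x)"
			by (auto simp: relu_def lo_def hi_def)
		show "(%x. relu (lo b x) + relu (hi b x)) : affs X (?G1 Un ?G2 Un ?G3)"
			by (intro affs_intros) (use \<open>b : _\<close> in "auto intro: affs.base")
	qed (auto intro: affs.base)
	have "(%x. SUM b<W. relu (T (i0 b x)) * of_bool (p (i0 b x) <= J x & J x < p (Suc (i0 b x))))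
		: affs X ((%b x. relu (T (i0 b x)) * of_bool (p (i0 b x) <= J x & J x < p (Suc (i0 b x)))) ` {..<W})" (is "_ : ?A")
		by (intro affs_intros) (auto intro: affs.base)
	hence "(%x. SUM i<W*W. T (t0 + i) * of_bool (p (t0 + i) <= J x & J x < p (Suc (t0 + i)))) : ?A"
	proof (rule affs.cong)
		fix x
		let ?g = "%i. T (t0 + i) * of_bool (p (t0 + i) <= J x & J x < p (Suc (t0 + i)))"
		\<comment> \<open>Entries outside row \<open>A x\<close> are inactive, since the breakpoints
		  \<open>p\<close> are monotone and \<open>q\<close> lists the row starts.\<close>
		have z: "?g (a * W + b) = 0" if "a < W" "b < W" "a ~= A x" for a b
		proof (rule ccontr)
			assume "?g (a * W + b) ~= 0"
			hence h: "p (t0 + (a * W + b)) <= J x" "J x < p (Suc (t0 + (a * W + b)))" by auto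
			have "q a <= J x" unfolding q_def using h(1) monoD[OF p, of "t0 + a * W" "t0 + (a * W + b)"] by simp
			hence "a < A x" using Ale[of a x] that by (cases "a = 0") auto
			hence "q (A x) <= J x" "(a + 1) * W <= A x * W" using Ain[of x] by (auto simp del: mult_Suc intro: mult_le_mono1)
			moreover have "p (Suc (t0 + (a * W + b))) <= q (A x)"
				unfolding q_def using that calculation(2) by (intro monoD[OF p]) simp
			ultimately show False using h(2) by simp
		qed
		have "(SUM i<W*W. ?g i) = (SUM a<W. SUM i:{a*W..<a*W+W}. ?g i)" by (rule sum.nat_group[symmetric])
		also have "... = (SUM a<W. SUM b<W. ?g (a * W + b))"
			unfolding sum_shift ..
		also have "... = (SUM a<W. if a = A x then SUM b<W. ?g (a * W + b) else 0)"
		proof (intro sum.cong refl)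
			fix a assume "a : {..<W}"
			hence "(SUM b<W. ?g (a * W + b)) = 0" if "a ~= A x"
				using that z by (intro sum.neutral) blast
			thus "(SUM b<W. ?g (a * W + b)) = (if a = A x then SUM b<W. ?g (a * W + b) else 0)" by presburger
		qed
		also have "... = (SUM b<W. ?g (A x * W + b))" using Ain[of x] by simp
		also have "... = (SUM b<W. relu (T (i0 b x)) * of_bool (p (i0 b x) <= J x & J x < p (Suc (i0 b x))))"
			by (intro sum.cong refl) (use T[OF i0] in "auto simp: i0_def relu_def add.assoc")
		finally show "(SUM i<W*W. ?g i) = ..." .
	qed
	hence c4: "cmp X W 1 (?G1 Un ?G2 Un ?G3) {%x. SUM i<W*W. T (t0 + i) * of_bool (p (t0 + i) <= J x & J x < p (Suc (t0 + i)))}"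
		by (intro cmp_post[OF c3]) auto
	have "cmp X (3 * W) (1 + (1 + 1)) {?J} {%x. SUM i<W*W. T (t0 + i) * of_bool (p (t0 + i) <= J x & J x < p (Suc (t0 + i)))}"
		by (rule cmp_seq[OF c1 cmp_seq[OF cmp_mono_w[OF c2] cmp_mono_w[OF c4]]]) auto
	thus ?thesis by (simp add: numeral_3_eq_3)
qed

text \<open>A table of \<open>Q * W^2\<close> entries costs width \<open>O(W)\<close> and depth
  \<open>O(Q)\<close>: the \<open>Q\<close> blocks are evaluated in sequence and added. Monotonicity
  of \<open>c\<close> makes the set of indices belonging to one entry an interval, the form that
  \<open>cmp_block\<close> can handle.\<close>

lemma cmp_lookup:
	fixes J :: "'x => nat" and T :: "nat => real"
	assumes c: "mono c" and W: "1 <= W" and Q: "!!x. x : X ==> c (J x) < Q * (W * W)" and B: "!!x. x : X ==> J x < B"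
	shows "cmp X (3 * W + 4) (3 * Q) {%x. real (J x)} {%x. T (c (J x))}"
proof -
	\<comment> \<open>Gates need nonnegative values, so the table is shifted by \<open>M\<close>; since
	  exactly one entry is active, \<open>M\<close> is subtracted once at the end.\<close>
	define M where "M = (SUM i<Q*(W*W). abs (T i))"
	have M: "abs (T i) <= M" if "i < Q * (W * W)" for i
		unfolding M_def using that by (intro member_le_sum) auto
	\<comment> \<open>The generalized inverse of \<open>c\<close>, cut off at \<open>B\<close>: for
	  \<open>J < B\<close>, \<open>c J = i\<close> holds iff
	  \<open>p i <= J < p (Suc i)\<close>.\<close>
	define p where "p i = (LEAST j. i <= c j \<or> B <= j)" for i
	have p1: "i <= c (p i) \<or> B <= p i" for i unfolding p_def by (rule LeastI[of _ B]) simp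
	have p2: "p i <= j" if "i <= c j \<or> B <= j" for i j unfolding p_def using that by (rule Least_le)
	have pm: "mono p"
	proof (rule monoI)
		fix i j :: nat assume "i <= j"
		thus "p i <= p j" using p1[of j] by (intro p2) auto
	qed
	have p3: "p i <= j \<longleftrightarrow> i <= c j" if "j < B" for i j
		using that p1[of i] p2[of i j] monoD[OF c, of "p i" j] by auto
	let ?y = "%t x. SUM i<W*W. (T (t*(W*W) + i) + M) * of_bool (p (t*(W*W) + i) <= J x & J x < p (Suc (t*(W*W) + i)))"
	have "cmp X (3 * W) 3 {%x. real (J x)} {?y t}" if "t : {..<Q}" for t
	proof (rule cmp_block[OF pm _ W, of _ "%i. T i + M" "2 * M"])
		fix i assume i: "i < t * (W * W) + W * W"
		have "(t + 1) * (W * W) <= Q * (W * W)" using that by (intro mult_le_mono1) auto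
		hence "i < Q * (W * W)" using i by (simp add: algebra_simps)
		thus "0 <= T i + M & T i + M <= 2 * M" using M[of i] by linarith
	qed
	hence "cmp X (3 * W + 2 * card {%x. real (J x)} + 2) (SUM t<Q. 3) {%x. real (J x)} {%x. SUM t<Q. ?y t x}"
		by (rule cmp_sum[rotated 2]) auto
	hence *: "cmp X (3 * W + 4) (3 * Q) {%x. real (J x)} {%x. SUM t<Q. ?y t x}"
	proof -
		have "3 * W + 2 * card {%x. real (J x)} + 2 = 3 * W + 4" "(SUM t<Q. 3) = 3 * Q" by simp_all
		thus ?thesis using \<open>cmp X (3 * W + 2 * _ + 2) _ _ _\<close> by (simp only:)
	qed
	show ?thesis
	proof (rule cmp_post[OF *])
		have "(%x. (SUM t<Q. ?y t x) - M) : affs X {%x. SUM t<Q. ?y t x}" by (intro affs_diff affs.const affs.base) simp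
		hence "(%x. T (c (J x))) : affs X {%x. SUM t<Q. ?y t x}"
		proof (rule affs.cong)
			fix x assume x: "x : X"
			let ?g = "%i. (T i + M) * of_bool (p i <= J x & J x < p (Suc i))"
			have g: "?g i = (if i = c (J x) then T i + M else 0)" for i
				using p3[OF B[OF x], of i] p3[OF B[OF x], of "Suc i"] by (auto simp: not_le)
			have "(SUM t<Q. ?y t x) = (SUM t<Q. SUM i:{t*(W*W)..<t*(W*W)+W*W}. ?g i)"
				unfolding sum_shift ..
			also have "... = (SUM i<Q*(W*W). ?g i)" by (rule sum.nat_group)
			also have "... = T (c (J x)) + M" unfolding g using Q[OF x] by simp
			finally show "T (c (J x)) = (SUM t<Q. ?y t x) - M" by simp
		qed
		thus "{%x. T (c (J x))} \<subseteq> affs X {%x. SUM t<Q. ?y t x}" by simp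
	qed
qed

definition jumps :: "(nat => real) => nat set" where "jumps Ph = {j. Ph (Suc j) ~= Ph j}"

text \<open>Number the intervals of constancy: \<open>c j\<close> counts the jumps before
  \<open>j\<close>, is monotone, and determines \<open>Ph j\<close>.\<close>

lemma cmp_step_function:
	fixes J :: "'x => nat"
	assumes j: "finite (jumps Ph)" "card (jumps Ph) < Q * (W * W)" and W: "1 <= W" and B: "!!x. x : X ==> J x < B"
	shows "cmp X (3 * W + 4) (3 * Q) {%x. real (J x)} {%x. Ph (J x)}"
proof -
	define c where "c j = card (jumps Ph Int {..<j})" for j
	have cm: "mono c" unfolding c_def by (intro monoI card_mono) auto
	have eq: "Ph i = Ph (i + e)" if "c i = c (i + e)" for i e
		using that
	proof (induction e)
		case (Suc e)
		have "c i <= c (i + e)" "c (i + e) <= c (i + Suc e)" using cm by (auto intro: monoD)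
		hence 1: "c i = c (i + e)" "c (i + e) = c (Suc (i + e))" using Suc.prems by auto
		have "i + e ~: jumps Ph"
		proof
			assume a: "i + e : jumps Ph"
			have "jumps Ph Int {..<Suc (i + e)} = insert (i + e) (jumps Ph Int {..<i + e})" using a by (auto simp: less_Suc_eq)
			hence "c (Suc (i + e)) = Suc (c (i + e))" unfolding c_def by simp
			thus False using 1 by simp
		qed
		thus ?case using Suc.IH[OF 1(1)] by (simp add: jumps_def)
	qed simp
	define T where "T n = Ph (LEAST j. c j = n)" for n
	have T: "T (c j) = Ph j" for j
	proof -
		have "c (LEAST i. c i = c j) = c j" "(LEAST i. c i = c j) <= j" by (auto intro: LeastI Least_le)
		thus ?thesis unfolding T_def using eq[of "LEAST i. c i = c j" "j - (LEAST i. c i = c j)"] by simp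
	qed
	have "cmp X (3 * W + 4) (3 * Q) {%x. real (J x)} {%x. T (c (J x))}"
	proof (rule cmp_lookup[OF cm W _ B])
		fix x
		have "c (J x) <= card (jumps Ph)" unfolding c_def using j(1) by (intro card_mono) auto
		thus "c (J x) < Q * (W * W)" using j(2) by simp
	qed
	thus ?thesis unfolding T .
qed

section \<open>Sparse streams\<close>

function bin :: "nat => nat list" where
	"bin n = (if n = 0 then [] else bin (n div 2) @ [n mod 2])"
	by auto
termination by (relation "Wellfounded.measure id") auto
declare bin.simps[simp del]

lemma bin_0 [simp]: "bin 0 = []" by (simp add: bin.simps)

lemma length_bin0: "length (bin n) <= n"
proof (induction n rule: less_induct)
	case (less n)
	show ?case
	proof (cases "n = 0")
		case False
		hence "length (bin (n div 2)) <= n div 2" by (intro less) auto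
		thus ?thesis using False by (subst bin.simps) auto
	qed simp
qed

text \<open>A deliberately linear bound: beyond the \<open>a\<close> free digits each further digit
  is paid for by the carry \<open>n div 2^a\<close>. Sums of lengths are then controlled by sums of
  carries, without logarithms.\<close>

lemma length_bin: "length (bin n) <= a + n div 2 ^ a"
proof (induction a arbitrary: n)
	case 0
	thus ?case using length_bin0 by simp
next
	case (Suc a)
	show ?case
	proof (cases "n = 0")
		case False
		have "n div 2 ^ Suc a = n div 2 div 2 ^ a" by (simp add: div_mult2_eq)
		thus ?thesis using False Suc[of "n div 2"] by (subst bin.simps) auto
	qed simp
qed

lemma set_bin: "set (bin n) \<subseteq> {0..1}"
proof (induction n rule: less_induct)
	case (less n)
	thus ?case by (cases "n = 0"; subst bin.simps) auto
qed

text \<open>A stream machine with position \<open>p\<close>, accumulator \<open>a\<close> and output \<open>o\<close>: the tokens 0 and 1 shift a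
	binary digit into \<open>a\<close>, token 2 moves the position by \<open>a\<close>, and token 3 outputs \<open>a\<close> if the position is \<open>J\<close>.\<close>
fun tstep :: "nat => nat => nat \<times> nat \<times> nat => nat \<times> nat \<times> nat" where
	"tstep J sh (p, a, out) =
		(if sh <= 1 then (p, 2 * a + sh, out) else if sh = 2 then (p + a, 0, out) else (p, 0, out + (if p = J then a else 0)))"

lemma run_bin: "fold (tstep J) (bin n) (p, 0, out) = (p, n, out)"
proof (induction n rule: less_induct)
	case (less n)
	thus ?case by (cases "n = 0"; subst bin.simps) auto
qed

text \<open>Positions are transmitted as gaps from the preceding one, so entries that are not listed
  cost no tokens.\<close>

fun toks :: "(nat => nat) => nat => nat list => nat list" where
	"toks z p [] = []"
| "toks z p (i # is) = bin (i - p) @ 2 # bin (z i) @ 3 # toks z i is"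

fun gapok :: "nat => nat => nat list => bool" where
	"gapok g p [] = True"
| "gapok g p (i # is) = (i - p <= g & gapok g i is)"

lemma run_toks: "sorted (p # is) ==> distinct is ==>
	EX p'. fold (tstep J) (toks z p is) (p, 0, out) = (p', 0, out + (if J : set is then z J else 0))"
proof (induction "is" arbitrary: p out)
	case (Cons i "is")
	have "fold (tstep J) (toks z p (i # is)) (p, 0, out) = fold (tstep J) (toks z i is) (i, 0, out + (if i = J then z i else 0))"
		using Cons.prems by (simp add: run_bin)
	moreover have "EX p'. fold (tstep J) (toks z i is) (i, 0, out + (if i = J then z i else 0)) =
			(p', 0, out + (if i = J then z i else 0) + (if J : set is then z J else 0))"
		by (rule Cons.IH) (use Cons.prems in auto)
	ultimately show ?case using Cons.prems by auto
qed simp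

text \<open>With an empty accumulator token 0 is neutral, so it serves as padding to a common
  length.\<close>

lemma run_zeros: "(tstep J 0 ^^ m) (p, 0, out) = (p, 0, out)"
	by (induction m) auto

lemma set_toks: "set (toks z p is) \<subseteq> {0..3}"
proof (induction "is" arbitrary: p)
	case (Cons i "is")
	thus ?case using set_bin[of "i - p"] set_bin[of "z i"] by fastforce
qed simp

lemma length_toks: "gapok (2 ^ a) p is ==> length (toks z p is) <= (\<Sum>i\<leftarrow>is. (2 * a + 3) * (1 + z i div 2 ^ a))"
proof (induction "is" arbitrary: p)
	case (Cons i "is")
	have "(i - p) div 2 ^ a <= 1" using Cons.prems div_le_mono[of "i - p" "2 ^ a" "2 ^ a"] by simp
	hence "length (bin (i - p)) <= a + 1" using length_bin[of "i - p" a] by linarith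
	hence "length (toks z p (i # is)) <= (a + 1) + 1 + (a + z i div 2 ^ a) + 1 + length (toks z i is)"
		using length_bin[of "z i" a] by simp
	also have "length (toks z i is) <= (\<Sum>i\<leftarrow>is. (2 * a + 3) * (1 + z i div 2 ^ a))"
		using Cons by simp
	also have "(a + 1) + 1 + (a + z i div 2 ^ a) + 1 <= (2 * a + 3) * (1 + z i div 2 ^ a)"
		by (simp add: algebra_simps)
	finally show ?case by simp
qed simp

lemma gapok_sorted:
	assumes "sorted (p # is)" "distinct (p # is)"
		"!!i j. i : set (p # is) ==> j : set (p # is) ==> i < j ==> ALL k:set (p # is). ~ (i < k & k < j) ==> j - i <= g"
	shows "gapok g p is"
	using assms
proof (induction "is" arbitrary: p)
	case (Cons i "is")
	have pi: "p < i" "ALL k:set is. i < k" using Cons.prems(1,2) by (auto simp: le_less)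
	have "i - p <= g" by (rule Cons.prems(3)) (use pi in auto)
	moreover have "gapok g i is"
	proof (rule Cons.IH)
		fix k j assume "k : set (i # is)" "j : set (i # is)" "k < j" "ALL l:set (i # is). ~ (k < l & l < j)"
		thus "j - k <= g" using pi by (intro Cons.prems(3)) auto
	qed (use Cons.prems in auto)
	ultimately show ?case by simp
qed simp

text \<open>The tokens are base 4 digits after the point, so the next token is the integer part of 4
  times the code. By \<open>enc_bounds\<close> the tail stays below 1 by a fixed margin, the gap
  that makes digit extraction exact.\<close>

fun enc :: "nat list => real" where
	"enc [] = 0"
| "enc (sh # ts) = (real sh + enc ts) / 4"

lemma enc_bounds: "set ts \<subseteq> {0..3} ==> 0 <= enc ts & enc ts <= 1 - 1 / 4 ^ length ts"
proof (induction ts)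
	case (Cons sh ts)
	hence "0 <= enc ts" "enc ts <= 1 - 1 / 4 ^ length ts" "real sh <= 3" by auto
	hence "real sh + enc ts <= 4 - 1 / 4 ^ length ts" by linarith
	hence "(real sh + enc ts) / 4 <= 1 - 1 / 4 ^ length (sh # ts)" by simp
	thus ?case using \<open>0 <= enc ts\<close> by simp
qed simp

lemma cmp_abs: assumes "u : affs X F" shows "cmp X 2 1 F {%x. abs (u x)}"
proof (rule cmp_layer[of "UNIV :: bool set" _ "%b x. if b then u x else - u x"])
	show "(%x. if i then u x else - u x) : affs X F" for i
		using assms by (cases i) (auto intro: affs_uminus)
	let ?U = "range (%b x. relu (if b then u x else - u x))"
	have "(%x. relu (u x)) : ?U" by (rule image_eqI[of _ _ True]) auto
	moreover have "(%x. relu (- u x)) : ?U" by (rule image_eqI[of _ _ False]) auto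
	ultimately have "(%x. relu (u x) + relu (- u x)) : affs X ?U" by (intro affs_intros affs.base)
	hence "(%x. abs (u x)) : affs X ?U" by (rule affs.cong) (auto simp: relu_def)
	thus "{%x. abs (u x)} \<subseteq> affs X ?U" by simp
qed auto

lemma cmp_gate1:
	assumes "w : affs X F" "e : affs X F" "!!x. x : X ==> 0 <= w x & w x <= M"
		"!!x. x : X ==> (if P x then e x = 0 else 1 <= e x)"
	shows "cmp X 1 1 F {%x. w x * of_bool (P x)}"
	using cmp_gate[of "{()}" 1 "%_. w" X F "%_. e" M "%_. P"] assms by simp

lemma card_insert_le_Suc: "card (insert x A) <= Suc (card A)"
	by (cases "finite A") (auto simp: card_insert_if)

text \<open>Supplies the a priori bound on the accumulator that the gates need.\<close>

lemma acc_bound: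
	"set ts \<subseteq> {0..3} ==> a < 2 ^ k ==> fst (snd (fold (tstep J) ts (p, a, out))) < 2 ^ (k + length ts)"
proof (induction ts arbitrary: p a out k)
	case (Cons sh ts)
	obtain p' a' out' where s: "tstep J sh (p, a, out) = (p', a', out')" by (metis prod_cases3)
	have "a' < 2 ^ Suc k" using s Cons.prems(2) by (auto split: if_splits)
	have "fst (snd (fold (tstep J) ts (p', a', out'))) < 2 ^ (Suc k + length ts)"
		by (rule Cons.IH) (use Cons.prems \<open>a' < 2 ^ Suc k\<close> in auto)
	thus ?case using s by simp
qed simp

text \<open>Three layers per token: extract the leading base 4 digit, form the penalties that
  identify the token and the position, gate the updates. The width is an absolute constant, so long
  codes cost depth only.\<close>

lemma cmp_machine:
	fixes J st :: "'x => nat" and ts :: "'x => nat list"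
	assumes ts: "!!x. x : X ==> length (ts x) = n & set (ts x) \<subseteq> {0..3}"
	shows "cmp X 20 (3 * n) {%x. real (J x), %x. enc (ts x), %x. real (st x)}
		{%x. real (snd (snd (fold (tstep (J x)) (ts x) (st x, 0, 0))))}"
proof -
	define s where "s j x = fold (tstep (J x)) (take j (ts x)) (st x, 0, 0)" for j x
	define Jr where "Jr x = real (J x)" for x
	define P where "P j x = real (fst (s j x))" for j x
	define A where "A j x = real (fst (snd (s j x)))" for j x
	define O' where "O' j x = real (snd (snd (s j x)))" for j x
	define th where "th j x = enc (drop j (ts x))" for j x
	let ?S = "%j. {Jr, th j, P j, A j, O' j}"
	have step: "cmp X 20 3 (?S j) (?S (Suc j))" if j: "j < n" for j
	proof -
		define sh where "sh x = ts x ! j" for x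
		define t where "t x = real (sh x)" for x
		define v where "v x = 4 * th j x" for x
		have d: "drop j (ts x) = sh x # drop (Suc j) (ts x)" if "x : X" for x
			using ts[OF that] j by (simp add: sh_def Cons_nth_drop_Suc)
		have v: "v x = t x + th (Suc j) x" if "x : X" for x
			using d[OF that] by (simp add: v_def th_def t_def)
		have t3: "sh x <= 3" if "x : X" for x
			using ts[OF that] j nth_mem[of j "ts x"] unfolding sh_def by fastforce
		have th: "0 <= th (Suc j) x" "th (Suc j) x <= 1 - 1 / 4 ^ n" if x: "x : X" for x
		proof -
			have "set (drop (Suc j) (ts x)) \<subseteq> {0..3}" using ts[OF x] set_drop_subset by fast
			note b = enc_bounds[OF this]
			thus "0 <= th (Suc j) x" by (simp add: th_def)
			have "(4::real) ^ length (drop (Suc j) (ts x)) <= 4 ^ n" using ts[OF x] by (intro power_increasing) auto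
			hence "1 / 4 ^ n <= 1 / (4::real) ^ length (drop (Suc j) (ts x))" by (intro divide_left_mono) auto
			thus "th (Suc j) x <= 1 - 1 / 4 ^ n" using b by (simp add: th_def)
		qed
		have th1: "th (Suc j) x < 1" if "x : X" for x using th(2)[OF that] by (smt (verit) zero_less_divide_1_iff zero_less_power)
		have s: "s (Suc j) x = tstep (J x) (sh x) (s j x)" if "x : X" for x
			using ts[OF that] j by (simp add: s_def sh_def take_Suc_conv_app_nth)
		let ?I = "(%i x. of_bool (real i <= v x) :: real) ` {1..<4}"
		have va: "v : affs X (?S j)" unfolding v_def[abs_def] by (intro affs.scale affs.base) simp
		have c: "cmp X (2 * card {1..<4::nat}) 1 (?S j) ?I"
		proof (rule cmp_steps[of _ _ _ _ "1 / 4 ^ n"])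
			fix x and i :: nat assume x: "x : X"
			show "real i <= v x \<or> v x <= real i - 1 / 4 ^ n"
			proof (cases "i <= sh x")
				case True
				thus ?thesis using v[OF x] th(1)[OF x] by (simp add: t_def)
			next
				case False
				hence "real (sh x) + 1 <= real i" by simp
				thus ?thesis using v[OF x] th(2)[OF x] by (simp add: t_def)
			qed
		qed (auto intro: va)
		have "card (?S j) <= 5" by (intro card_insert_le_Suc[THEN order_trans] Suc_le_mono[THEN iffD2]) (auto intro!: card_insert_le_Suc[THEN order_trans] simp: numeral_eq_Suc)
		hence c1: "cmp X 20 1 (?S j) (?I Un ?S j)"
			by (intro cmp_mono_w[OF cmp_par[OF c cmp_id]]) auto
		have fl: "nat (floor (v x)) = sh x" if "x : X" for x
			using v[OF that] th(1)[OF that] th1[OF that] by (simp add: t_def nat_eq_iff floor_eq_iff)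
		have "(%x. real (nat (floor (v x)))) : affs X (?I Un ?S j)"
		proof (rule affs_floor[where b = 4])
			show "0 <= v x & v x < real 4" if "x : X" for x
				using v[OF that] th(1)[OF that] th1[OF that] t3[OF that] by (simp add: t_def)
		qed (auto intro: affs.base)
		hence ta: "t : affs X (?I Un ?S j)"
			by (rule affs.cong) (simp add: fl t_def)
		have "(%x. 4 * th j x - t x) : affs X (?I Un ?S j)"
			by (intro affs_diff affs.scale ta affs.base) auto
		hence tha: "th (Suc j) : affs X (?I Un ?S j)"
			by (rule affs.cong) (use v in "simp add: v_def")
		let ?R = "{t, Jr, th (Suc j), P j, A j, O' j}"
		have c1: "cmp X 20 1 (?S j) ?R"
			by (rule cmp_post[OF c1]) (use ta tha in "auto intro: affs.base")
		let ?E = "{%x. relu (t x - 1)} Un {%x. abs (t x - 2)} Un {%x. abs (t x - 3)} Un {%x. abs (P j x - Jr x)}"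
		have c2: "cmp X (1 + 2 + 2 + 2) 1 ?R ?E"
			by (intro cmp_par cmp_abs cmp_layer1 affs_intros) (auto intro: affs.base)
		have "card ?R <= 6" by (intro card_insert_le_Suc[THEN order_trans] Suc_le_mono[THEN iffD2]) (auto intro!: card_insert_le_Suc[THEN order_trans] simp: numeral_eq_Suc)
		hence c2: "cmp X 20 1 ?R (?E Un ?R)"
			by (intro cmp_mono_w[OF cmp_par[OF c2 cmp_id]]) auto
		\<comment> \<open>Bounds \<open>2 * A j x + t x\<close>, as \<open>A j x <= 2^n\<close> and
		  \<open>t x <= 3\<close>.\<close>
		define M :: real where "M = 2 * 2 ^ n + 3"
		have A: "0 <= A j x" "A j x <= 2 ^ n" if x: "x : X" for x
		proof -
			have "set (take j (ts x)) \<subseteq> {0..3}" using ts[OF x] set_take_subset by fast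
			from acc_bound[OF this, of 0 0 "J x" "st x" 0] have "fst (snd (s j x)) < 2 ^ j"
				using ts[OF x] j by (simp add: s_def)
			also have "... <= (2::nat) ^ n" using j by (intro power_increasing) auto
			finally have "real (fst (snd (s j x))) < real (2 ^ n)" by (simp only: of_nat_less_iff)
			thus "0 <= A j x" "A j x <= 2 ^ n" by (auto simp: A_def)
		qed
		have t03: "0 <= t x" "t x <= 3" if "x : X" for x using t3[OF that] by (auto simp: t_def)
		have g1: "cmp X 1 1 (?E Un ?R) {%x. (2 * A j x + t x) * of_bool (sh x <= 1)}"
		proof (rule cmp_gate1[where M = M])
			show "0 <= 2 * A j x + t x & 2 * A j x + t x <= M" if "x : X" for x
				using A[OF that] t03[OF that] by (simp add: M_def)
			show "if sh x <= 1 then (relu (t x - 1)) = 0 else 1 <= (relu (t x - 1))" for x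
				by (auto simp: t_def relu_def)
			show "(%x. 2 * A j x + t x) : affs X (?E Un ?R)"
				by (intro affs_intros) (auto intro: affs.base)
		qed (auto intro: affs.base)
		have g2: "cmp X 1 1 (?E Un ?R) {%x. A j x * of_bool (sh x = 2)}"
		proof (rule cmp_gate1[where M = M])
			show "0 <= A j x & A j x <= M" if "x : X" for x
				using A[OF that] by (simp add: M_def)
			show "if sh x = 2 then abs (t x - 2) = 0 else 1 <= abs (t x - 2)" for x
				by (auto simp: t_def)
		qed (auto intro!: affs.base)
		have g3: "cmp X 1 1 (?E Un ?R) {%x. A j x * of_bool (sh x = 3 & P j x = Jr x)}"
		proof (rule cmp_gate1[where M = M])
			show "(%x. abs (t x - 3) + abs (P j x - Jr x)) : affs X (?E Un ?R)"
				by (intro affs_intros) (auto intro!: affs.base)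
			show "0 <= A j x & A j x <= M" if "x : X" for x
				using A[OF that] by (simp add: M_def)
			show "if sh x = 3 & P j x = Jr x then abs (t x - 3) + abs (P j x - Jr x) = 0 else 1 <= abs (t x - 3) + abs (P j x - Jr x)" for x
			proof -
				have "sh x ~= 3 ==> 1 <= abs (t x - 3)" by (auto simp: t_def)
				moreover have "P j x ~= Jr x ==> 1 <= abs (P j x - Jr x)" by (auto simp: P_def Jr_def)
				ultimately show ?thesis by (auto simp: t_def add_increasing add_increasing2)
			qed
		qed (auto intro!: affs.base)
		let ?g1 = "%x. (2 * A j x + t x) * of_bool (sh x <= 1)"
		let ?g2 = "%x. A j x * of_bool (sh x = 2)"
		let ?g3 = "%x. A j x * of_bool (sh x = 3 & P j x = Jr x)"
		have "cmp X (1 + 1 + 1 + 2 * card ?R) 1 (?E Un ?R) ({?g1} Un {?g2} Un {?g3} Un ?R)"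
			by (intro cmp_par g1 g2 g3 cmp_pre_sub[OF cmp_id]) auto
		hence c3: "cmp X 20 1 (?E Un ?R) ({?g1} Un {?g2} Un {?g3} Un ?R)"
			using \<open>card ?R <= 6\<close> by (elim cmp_mono_w) auto
		have e: "fst (s (Suc j) x) = (if sh x = 2 then fst (s j x) + fst (snd (s j x)) else fst (s j x)) &
				fst (snd (s (Suc j) x)) = (if sh x <= 1 then 2 * fst (snd (s j x)) + sh x else 0) &
				snd (snd (s (Suc j) x)) = (if sh x = 3 & fst (s j x) = J x then snd (snd (s j x)) + fst (snd (s j x)) else snd (snd (s j x)))" if "x : X" for x
			unfolding s[OF that] using t3[OF that] by (cases "s j x") auto
		have "P (Suc j) : affs X ({?g1} Un {?g2} Un {?g3} Un ?R)"
			by (rule affs.cong[OF affs.add[of "P j" _ _ ?g2]]) (use e in "auto simp: P_def A_def intro!: affs.base")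
		moreover have "O' (Suc j) : affs X ({?g1} Un {?g2} Un {?g3} Un ?R)"
			by (rule affs.cong[OF affs.add[of "O' j" _ _ ?g3]]) (use e in "auto simp: P_def A_def O'_def Jr_def intro!: affs.base")
		moreover have "A (Suc j) : affs X ({?g1} Un {?g2} Un {?g3} Un ?R)"
			by (rule affs.cong[of ?g1]) (use e in "auto simp: A_def t_def intro!: affs.base")
		ultimately have c3: "cmp X 20 1 (?E Un ?R) (?S (Suc j))"
			by (intro cmp_post[OF c3]) (auto intro: affs.base)
		have "cmp X 20 (1 + (1 + 1)) (?S j) (?S (Suc j))" by (rule cmp_seq[OF c1 cmp_seq[OF c2 c3]])
		thus ?thesis by (simp add: numeral_3_eq_3)
	qed
	have *: "cmp X 20 (3 * j) {Jr, %x. enc (ts x), %x. real (st x)} (?S j)" if "j <= n" for j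
		using that
	proof (induction j)
		case 0
		have "th 0 = (%x. enc (ts x))" "P 0 = (%x. real (st x))" "A 0 = (%_. 0)" "O' 0 = (%_. 0)"
			by (auto simp: fun_eq_iff th_def P_def A_def O'_def s_def)
		thus ?case by (auto intro: affs.base affs.const)
	next
		case (Suc j)
		thus ?case using cmp_seq[OF Suc.IH step[of j]] by (simp add: add.commute)
	qed
	have "O' n : affs X (?S n)" by (rule affs.base) simp
	hence "(%x. real (snd (snd (fold (tstep (J x)) (ts x) (st x, 0, 0))))) : affs X (?S n)"
		by (rule affs.cong) (use ts in "simp add: O'_def s_def")
	thus ?thesis using cmp_post[OF *[of n]] by (simp add: Jr_def[abs_def])
qed

text \<open>The positions are grouped into blocks of nearly equal total weight. A lookup of depth
  \<open>O(Q)\<close> delivers the code and the starting position of the block containing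
  \<open>J\<close>, and the machine runs over its \<open>(2*a + 3) * (2*G)\<close> tokens. Lightness
  of all entries prevents a block from exceeding the weight \<open>2*G\<close>.\<close>

lemma cmp_stream_light:
	fixes J :: "'x => nat" and z :: "nat => nat"
	assumes U: "!!x. x : X ==> J x < U" and G: "1 <= G" and light: "!!i. z i div 2 ^ a < G" and W: "1 <= W"
		and R: "U div 2 ^ a + 1 + card {i. i < U & z i ~= 0} + (SUM i<U. z i div 2 ^ a) < Q * (W * W) * G"
	shows "cmp X (6 * W + 20) (3 * Q + 3 * ((2 * a + 3) * (2 * G))) {%x. real (J x)} {%x. real (z (J x))}"
proof -
	\<comment> \<open>Besides the nonzero entries all multiples of \<open>2^a\<close> are listed,
	  possibly with value 0. Consecutive listed positions of a block then differ by at most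
	  \<open>2^a\<close>, and a gap has at most \<open>a + 1\<close> digits.\<close>
	define K where "K = {i. i < U & (z i ~= 0 \<or> 2 ^ a dvd i)}"
	define w where "w i = (if i : K then 1 + z i div 2 ^ a else 0)" for i
	define S where "S j = (SUM i<j. w i)" for j
	\<comment> \<open>Cutting the prefix weight at multiples of \<open>G\<close> makes
	  \<open>gid\<close> monotone, as \<open>cmp_lookup\<close> requires; a block can overshoot only
	  through its last entry, whence the bound \<open>2*G\<close> below.\<close>
	define gid where "gid j = S j div G" for j
	have K: "finite K" unfolding K_def by auto
	have Sm: "S i <= S j" if "i <= j" for i j unfolding S_def using that by (intro sum_mono2) auto
	have gm: "mono gid" unfolding gid_def using Sm by (intro monoI div_le_mono) auto
	have cK: "card K <= U div 2 ^ a + 1 + card {i. i < U & z i ~= 0}"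
	proof -
		have "K \<subseteq> (%k. 2 ^ a * k) ` {..U div 2 ^ a} Un {i. i < U & z i ~= 0}"
		proof
			fix i assume i: "i : K"
			show "i : (%k. 2 ^ a * k) ` {..U div 2 ^ a} Un {i. i < U & z i ~= 0}"
			proof (cases "z i = 0")
				case True
				hence "i = 2 ^ a * (i div 2 ^ a)" "i div 2 ^ a <= U div 2 ^ a" using i by (auto simp: K_def intro!: div_le_mono)
				thus ?thesis by blast
			qed (use i in "auto simp: K_def")
		qed
		hence "card K <= card ((%k. 2 ^ a * k) ` {..U div 2 ^ a} Un {i. i < U & z i ~= 0})"
			by (intro card_mono) auto
		also have "... <= card ((%k. 2 ^ a * k) ` {..U div 2 ^ a}) + card {i. i < U & z i ~= 0}" by (rule card_Un_le)
		also have "card ((%k. 2 ^ a * k) ` {..U div 2 ^ a}) <= card {..U div 2 ^ a}" by (rule card_image_le) simp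
		finally show ?thesis by simp
	qed
	have SU: "S U < Q * (W * W) * G"
	proof -
		have "S U = (SUM i:K. 1 + z i div 2 ^ a)"
			unfolding S_def w_def by (rule sum.mono_neutral_cong_right) (auto simp: K_def)
		also have "... = card K + (SUM i:K. z i div 2 ^ a)" by (simp only: sum.distrib) simp
		also have "(SUM i:K. z i div 2 ^ a) <= (SUM i<U. z i div 2 ^ a)" by (intro sum_mono2) (auto simp: K_def)
		finally show ?thesis using cK R by linarith
	qed
	have gQ: "gid (J x) < Q * (W * W)" if "x : X" for x
	proof -
		have "S (J x) <= S U" using U[OF that] by (intro Sm) simp
		hence "S (J x) < Q * (W * W) * G" using SU by simp
		thus ?thesis unfolding gid_def by (rule less_mult_imp_div_less)
	qed
	define Kg where "Kg g = {i : K. gid i = g}" for g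
	define ks where "ks g = sorted_list_of_set (Kg g)" for g
	define st where "st g = (if Kg g = {} then 0 else Min (Kg g))" for g
	define n where "n = (2 * a + 3) * (2 * G)"
	have Kg: "finite (Kg g)" for g using K by (simp add: Kg_def)
	have ks: "set (ks g) = Kg g" "sorted (ks g)" "distinct (ks g)" for g using Kg by (auto simp: ks_def)
	have st: "st g <= i" if "i : Kg g" for i g using that Kg by (auto simp: st_def)
	have stin: "st g : Kg g" if "Kg g ~= {}" for g using that Kg by (auto simp: st_def)
	have adj: "j - i <= 2 ^ a" if ij: "i : Kg g" "j : Kg g" "i < j" "ALL k:Kg g. ~ (i < k & k < j)" for i j g
	proof (rule ccontr)
		assume n: "~ j - i <= 2 ^ a"
		define k where "k = 2 ^ a * (i div 2 ^ a + 1)"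
		have "i = 2 ^ a * (i div 2 ^ a) + i mod 2 ^ a" "i mod 2 ^ a < 2 ^ a" by simp_all
		hence k: "i < k" "k <= i + 2 ^ a" unfolding k_def distrib_left by linarith+
		hence "k < j" using n by linarith
		moreover from this have "gid k = g" using monoD[OF gm, of i k] monoD[OF gm, of k j] ij k by (auto simp: Kg_def)
		moreover have "k < U" using \<open>k < j\<close> ij(2) by (auto simp: Kg_def K_def)
		moreover have "2 ^ a dvd k" by (simp add: k_def)
		ultimately show False using ij(4) k by (auto simp: Kg_def K_def)
	qed
	have gap: "gapok (2 ^ a) (st g) (ks g)" for g
	proof (cases "ks g")
		case (Cons i l)
		hence ne: "Kg g ~= {}" using ks(1)[of g] by auto
		have "i = st g"
		proof (rule antisym)
			have "st g : set (i # l)" "sorted (i # l)" using ks[of g] Cons stin[OF ne] by simp_all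
			thus "i <= st g" by auto
			have "i : Kg g" using ks(1)[of g] Cons by auto
			thus "st g <= i" by (rule st)
		qed
		moreover have "gapok (2 ^ a) i l"
		proof (rule gapok_sorted)
			have Kgl: "Kg g = set (i # l)" using ks(1)[of g] Cons by simp
			show "j - p <= 2 ^ a" if "p : set (i # l)" "j : set (i # l)" "p < j" "ALL k:set (i # l). ~ (p < k & k < j)" for p j
				using adj[of p g j] that unfolding Kgl by blast
		qed (use ks[of g] Cons in auto)
		ultimately show ?thesis using Cons by simp
	qed simp
	have len: "length (toks z (st g) (ks g)) <= n" for g
	proof (cases "Kg g = {}")
		case True
		thus ?thesis by (simp add: ks_def)
	next
		case False
		define m where "m = Max (Kg g)"
		have m: "m : Kg g" "!!i. i : Kg g ==> i <= m" using False Kg by (auto simp: m_def)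
		have "(SUM i:Kg g. w i) <= (SUM i:{st g..<Suc m}. w i)"
			by (intro sum_mono2) (use m st[of _ g] in "auto simp: less_Suc_eq_le")
		also have "... = S (Suc m) - S (st g)"
		proof -
			have "S (Suc m) = S (st g) + (SUM i:{st g..<Suc m}. w i)" unfolding S_def atLeast0LessThan[symmetric]
				by (rule sum.atLeastLessThan_concat[symmetric]) (use st[OF m(1)] in auto)
			thus ?thesis by simp
		qed
		also have "... <= 2 * G"
		proof -
			have "S m div G = g" "S (st g) div G = g" using m(1) stin[OF False] by (auto simp: Kg_def gid_def)
			hence "S m < (g + 1) * G" "g * G <= S (st g)"
				using G dividend_less_div_times[of G "S m"] div_times_less_eq_dividend[of "S (st g)" G] by auto
			moreover have "w m <= G" using light[of m] G by (auto simp: w_def)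
			moreover have "S (Suc m) = S m + w m" by (simp add: S_def)
			ultimately show ?thesis by simp
		qed
		finally have wg: "(SUM i:Kg g. w i) <= 2 * G" .
		have "length (toks z (st g) (ks g)) <= (\<Sum>i\<leftarrow>ks g. (2 * a + 3) * (1 + z i div 2 ^ a))"
			by (rule length_toks[OF gap])
		also have "... = (SUM i:Kg g. (2 * a + 3) * (1 + z i div 2 ^ a))"
			using ks[of g] by (simp add: sum_list_distinct_conv_sum_set)
		also have "... = (2 * a + 3) * (SUM i:Kg g. w i)"
			unfolding sum_distrib_left by (intro sum.cong) (auto simp: w_def Kg_def)
		also have "... <= n" unfolding n_def by (intro mult_le_mono2 wg)
		finally show ?thesis .
	qed
	define ts where "ts g = toks z (st g) (ks g) @ replicate (n - length (toks z (st g) (ks g))) 0" for g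
	have ts: "length (ts g) = n" "set (ts g) \<subseteq> {0..3}" for g
		using len[of g] set_toks[of z "st g" "ks g"] by (auto simp: ts_def)
	have out: "snd (snd (fold (tstep (J x)) (ts (gid (J x))) (st (gid (J x)), 0, 0))) = z (J x)" if x: "x : X" for x
	proof -
		let ?g = "gid (J x)"
		have "sorted (st ?g # ks ?g)" using ks[of ?g] st[of _ ?g] by auto
		from run_toks[OF this ks(3), of "J x" z 0] obtain p' where
			"fold (tstep (J x)) (toks z (st ?g) (ks ?g)) (st ?g, 0, 0) = (p', 0, if J x : set (ks ?g) then z (J x) else 0)" by auto
		moreover have "(if J x : set (ks ?g) then z (J x) else 0) = z (J x)"
			using U[OF x] unfolding ks by (auto simp: Kg_def K_def)
		ultimately show ?thesis by (simp add: ts_def run_zeros)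
	qed
	let ?J = "%x. real (J x)"
	let ?a = "%x. enc (ts (gid (J x)))"
	let ?b = "%x. real (st (gid (J x)))"
	have 1: "cmp X (3 * W + 4) (3 * Q) {?J} {?a}"
		by (rule cmp_lookup[OF gm W gQ U, where T = "%g. enc (ts g)"])
	have 2: "cmp X (3 * W + 4) (3 * Q) {?J} {?b}"
		by (rule cmp_lookup[OF gm W gQ U, where T = "%g. real (st g)"])
	have 3: "cmp X (6 * W + 20) (3 * Q) {?J} ({?a} Un {?b} Un {?J})"
		by (rule cmp_mono_w[OF cmp_par[OF cmp_par[OF 1 2] cmp_id]]) auto
	have "cmp X 20 (3 * n) {?J, ?a, ?b} {%x. real (snd (snd (fold (tstep (J x)) (ts (gid (J x))) (st (gid (J x)), 0, 0))))}"
		by (rule cmp_machine) (use ts in auto)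
	hence "cmp X 20 (3 * n) ({?a} Un {?b} Un {?J}) {%x. real (snd (snd (fold (tstep (J x)) (ts (gid (J x))) (st (gid (J x)), 0, 0))))}"
		by (simp add: insert_commute)
	hence "cmp X 20 (3 * n) ({?a} Un {?b} Un {?J}) {%x. real (z (J x))}"
	proof (rule cmp_post)
		show "{%x. real (z (J x))} \<subseteq> affs X {%x. real (snd (snd (fold (tstep (J x)) (ts (gid (J x))) (st (gid (J x)), 0, 0))))}" (is "_ \<subseteq> affs X {?o}")
			using affs.cong[OF affs.base[of ?o "{?o}" X], of "%x. real (z (J x))"] out by simp
	qed
	from cmp_seq[OF 3 cmp_mono_w[OF this]] show ?thesis by (simp add: n_def)
qed

lemma card_jumps_support:
	assumes "finite {i. Ph i ~= 0}"
	shows "finite (jumps Ph)" "card (jumps Ph) <= 2 * card {i. Ph i ~= 0}"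
proof -
	let ?S = "{i. Ph i ~= 0}"
	have sub: "jumps Ph \<subseteq> ?S Un (%i. i - 1) ` ?S"
	proof
		fix j assume "j : jumps Ph"
		hence "Ph j ~= 0 \<or> Ph (Suc j) ~= 0" by (auto simp: jumps_def)
		thus "j : ?S Un (%i. i - 1) ` ?S"
			by (auto intro: image_eqI[of _ _ "Suc j"])
	qed
	thus "finite (jumps Ph)" using assms finite_subset by blast
	have "card (jumps Ph) <= card (?S Un (%i. i - 1) ` ?S)" by (rule card_mono[OF _ sub]) (use assms in auto)
	also have "... <= card ?S + card ((%i. i - 1) ` ?S)" by (rule card_Un_le)
	also have "card ((%i. i - 1) ` ?S) <= card ?S" by (rule card_image_le[OF assms])
	finally show "card (jumps Ph) <= 2 * card ?S" by simp
qed

text \<open>Entries with carry at least \<open>G\<close> would overfill a block, but the carry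
  budget allows fewer than \<open>Q * W^2 / 2\<close> of them. They are stored as a step function
  with at most two jumps each, and the remaining light part is streamed.\<close>

lemma cmp_stream:
	fixes J :: "'x => nat" and z :: "nat => nat"
	assumes U: "!!x. x : X ==> J x < U" and G: "1 <= G" and W: "1 <= W"
		and R: "2 * (U div 2 ^ a + 1 + card {i. i < U & z i ~= 0} + (SUM i<U. z i div 2 ^ a)) < Q * (W * W) * G"
	shows "cmp X (6 * W + 24) (6 * Q + 6 * ((2 * a + 3) * G)) {%x. real (J x)} {%x. real (z (J x))}"
proof -
	let ?J = "%x. real (J x)"
	define zl where "zl i = (if z i div 2 ^ a < G then z i else 0)" for i
	define zh where "zh i = (if z i div 2 ^ a < G \<or> U <= i then 0 else real (z i))" for i
	have "card {i. i < U & zl i ~= 0} <= card {i. i < U & z i ~= 0}" by (intro card_mono) (auto simp: zl_def)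
	moreover have "(SUM i<U. zl i div 2 ^ a) <= (SUM i<U. z i div 2 ^ a)" by (intro sum_mono) (auto simp: zl_def)
	ultimately have l: "cmp X (6 * W + 20) (3 * Q + 3 * ((2 * a + 3) * (2 * G))) {?J} {%x. real (zl (J x))}"
		by (intro cmp_stream_light[OF U G _ W]) (use G R in "auto simp: zl_def")
	let ?S = "{i. zh i ~= 0}"
	have sub: "?S \<subseteq> {i. i < U & G <= z i div 2 ^ a}" by (auto simp: zh_def split: if_splits)
	have fin: "finite ?S" by (rule finite_subset[OF sub]) auto
	have "card ?S * G = (SUM i:?S. G)" by simp
	also have "... <= (SUM i:?S. z i div 2 ^ a)" by (intro sum_mono) (use sub in auto)
	also have "... <= (SUM i<U. z i div 2 ^ a)" by (intro sum_mono2) (use sub in auto)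
	finally have c: "card ?S * G <= (SUM i<U. z i div 2 ^ a)" .
	have "2 * (A + 1 + B + C) < D ==> c <= C ==> 2 * c < D" for A B C D c :: nat
		by (rule le_less_trans[of _ "2 * (A + 1 + B + C)"]) auto
	from this[OF R c] have "2 * (card ?S * G) < Q * (W * W) * G" .
	hence "(2 * card ?S) * G < (Q * (W * W)) * G" by (metis mult.assoc)
	hence "2 * card ?S < Q * (W * W)" by (simp only: mult_less_cancel2)
	hence "card (jumps zh) < Q * (W * W)" using card_jumps_support(2)[OF fin] by linarith
	from cmp_step_function[OF card_jumps_support(1)[OF fin] this W U]
	have h: "cmp X (3 * W + 4) (3 * Q) {?J} {%x. zh (J x)}" .
	have h': "cmp X (6 * W + 20) (3 * Q) {?J} ({%x. zh (J x)} Un {?J})"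
		by (rule cmp_mono_w[OF cmp_par[OF h cmp_id]]) (use W in auto)
	have l': "cmp X (6 * W + 24) (3 * Q + 3 * ((2 * a + 3) * (2 * G))) ({%x. zh (J x)} Un {?J}) ({%x. real (zl (J x))} Un {%x. zh (J x)})"
		by (rule cmp_mono_w[OF cmp_par[OF cmp_pre_sub[OF l] cmp_pre_sub[OF cmp_id]]]) auto
	have "cmp X (6 * W + 24) (3 * Q + (3 * Q + 3 * ((2 * a + 3) * (2 * G)))) {?J} ({%x. real (zl (J x))} Un {%x. zh (J x)})"
		by (rule cmp_seq[OF cmp_mono_w[OF h'] l']) simp
	moreover have "(%x. real (z (J x))) : affs X ({%x. real (zl (J x))} Un {%x. zh (J x)})"
		by (rule affs.cong[OF affs.add[OF affs.base[of "%x. real (zl (J x))"] affs.base[of "%x. zh (J x)"]]]) (auto simp: zl_def zh_def dest: U)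
	ultimately have "cmp X (6 * W + 24) (3 * Q + (3 * Q + 3 * ((2 * a + 3) * (2 * G)))) {?J} {%x. real (z (J x))}"
		by (auto intro: cmp_post)
	thus ?thesis by (simp add: algebra_simps)
qed

section \<open>The network of one shift\<close>

lemma good_1D: assumes "good N 1 y" shows "0 <= y" "y < 1" "frac (2 ^ N * y) = 0"
	using assms frac_ge_0[of "2 ^ N * y"] by (auto simp: good_def)

lemma good_1I: "0 <= y ==> y < 1 ==> frac (2 ^ N * y) = 0 ==> good N 1 y"
	unfolding good_def by linarith

lemma wbase_arith:
	fixes d E :: nat
	assumes "1 <= E"
	shows "d * (2 * E + 4) + 2 * d <= (40 + 10 * d) * E" "6 * E + 24 + 2 * d <= (40 + 10 * d) * E"
		"2 * E + 6 + 4 * d + 2 <= (40 + 10 * d) * E" "(40 + 10 * d) * E + 4 * d + 4 <= 3 * ((40 + 10 * d) * E)"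
		"2 <= (40 + 10 * d) * E"
proof -
	define x where "x = d * E"
	have d: "d <= x" using mult_le_mono2[OF assms, of d] by (simp add: x_def)
	have w: "(40 + 10 * d) * E = 40 * E + 10 * x" "d * (2 * E + 4) = 2 * x + 4 * d" by (simp_all add: algebra_simps x_def)
	show "d * (2 * E + 4) + 2 * d <= (40 + 10 * d) * E" using d assms unfolding w by simp
	show "6 * E + 24 + 2 * d <= (40 + 10 * d) * E" using d assms unfolding w by simp
	show "2 * E + 6 + 4 * d + 2 <= (40 + 10 * d) * E" using d assms unfolding w by simp
	show "(40 + 10 * d) * E + 4 * d + 4 <= 3 * ((40 + 10 * d) * E)" using d assms unfolding w by simp
	show "2 <= (40 + 10 * d) * E" using d assms unfolding w by simp
qed

lemma good_fr: assumes "good N 1 y" "l <= N" shows "good N 1 (fr l y)"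
proof -
	have "(2::real) ^ N * (2 ^ l * y) = 2 ^ l * (2 ^ N * y)" by simp
	obtain n :: int where n: "2 ^ N * y = of_int n" using good_1D(3)[OF assms(1)] by (auto elim: Ints_cases simp: frac_eq_0_iff)
	have "2 ^ N * fr l y = of_int (2 ^ l * n - 2 ^ N * floor (2 ^ l * y))"
		unfolding fr_def frac_def by (simp add: n[symmetric] algebra_simps)
	hence "frac (2 ^ N * fr l y) = 0" by (simp only: frac_of_int)
	thus ?thesis using fr_bounds[of l y] by (intro good_1I)
qed

lemma cmp_monomial:
	fixes xii :: "'n::finite => 'x => real"
	assumes c: "cmp X w1 n F (insert w (range xii))" and g: "!!i x. x : X ==> good (t * u) 1 (xii i x)"
		and M: "!!x. x : X ==> 0 <= w x & w x <= M" and w: "w1 <= w2" "2 * 2 ^ u + 6 + 2 * CARD('n) <= w2"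
	shows "cmp X w2 (n + 2 * t * (SUM i:UNIV. be i)) F {%x. w x * (PROD i:UNIV. xii i x ^ be i)}"
proof -
	obtain us :: "'n list" where us: "set us = UNIV" "distinct us" using finite_distinct_list[of "UNIV :: 'n set"] by auto
	define ks where "ks = concat (map (%i. replicate (be i) (xii i)) us)"
	have len: "length ks = (SUM i:UNIV. be i)"
		using us by (simp add: ks_def length_concat comp_def sum_list_distinct_conv_sum_set)
	have pr: "(\<Prod>xii\<leftarrow>concat (map (%i. replicate (be i) (xii i)) vs). xii x) = (\<Prod>i\<leftarrow>vs. xii i x ^ be i)" for x vs
		by (induction vs) auto
	have "(\<Prod>xii\<leftarrow>ks. xii x) = (PROD i:UNIV. xii i x ^ be i)" for x
		unfolding ks_def pr using prod.distinct_set_conv_list[OF us(2), of "%i. xii i x ^ be i"] us(1) by simp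
	moreover have "cmp X (2 * 2 ^ u + 6 + 2 * card (range xii)) (2 * t * length ks) (insert w (range xii)) {%x. w x * (\<Prod>xii\<leftarrow>ks. xii x)}"
		by (rule cmp_mul_list) (use g M in "auto simp: ks_def")
	ultimately have *: "cmp X (2 * 2 ^ u + 6 + 2 * card (range xii)) (2 * t * (SUM i:UNIV. be i)) (insert w (range xii)) {%x. w x * (PROD i:UNIV. xii i x ^ be i)}"
		by (simp add: len)
	have "card (range xii) <= CARD('n)" by (rule card_image_le) simp
	hence "cmp X w2 (2 * t * (SUM i:UNIV. be i)) (insert w (range xii)) {%x. w x * (PROD i:UNIV. xii i x ^ be i)}"
		using w(2) by (intro cmp_mono_w[OF *]) simp
	from cmp_seq[OF cmp_mono_w[OF c w(1)] this] show ?thesis .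
qed

text \<open>A common width for all building blocks; the constants 40 and 10 are merely large enough
  for the inequalities of \<open>wbase_arith\<close>.\<close>

abbreviation wbase :: "nat => nat => nat" where "wbase d u == (40 + 10 * d) * 2 ^ u"

lemma level_bounds:
	assumes "good N 1 y" "l <= N" shows "cel l y < 2 ^ l" using cel_less good_1D[OF assms(1)] by blast

text \<open>Term of one streamed level: read the digits, decode the coefficient from the Morton
  code, multiply by the monomial in the remainders. It works for natural \<open>z\<close>; signs and
  the quantization step are restored linearly in \<open>cmp_approximant\<close>.\<close>

lemma cmp_level_term:
	fixes y :: "'n::finite => 'x => real" and z :: "nat => nat"
	assumes g: "!!i x. x : X ==> good (t * u) 1 (y i x)" and u: "0 < u" and l: "l <= t * u" and G: "1 <= G"
		and R: "2 * (2 ^ (CARD('n) * l) div 2 ^ a + 1 + card {i. i < 2 ^ (CARD('n) * l) & z i ~= 0}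
				+ (SUM i<2 ^ (CARD('n) * l). z i div 2 ^ a)) < Q * (2 ^ u * 2 ^ u) * G"
	shows "cmp X (wbase CARD('n) u) ((t + 1) + (6 * Q + 6 * ((2 * a + 3) * G)) + 2 * t * (SUM i:UNIV. be i)) (range y)
			{%x. real (z (key (%i. cel l (y i x)))) * (PROD i:UNIV. fr l (y i x) ^ be i)}"
proof -
	let ?J = "%x. key (%i. cel l (y i x))"
	let ?Xii = "range (%i x. fr l (y i x))"
	let ?w = "wbase CARD('n) u"
	have u1: "1 <= (2::nat) ^ u" by simp
	note wa = wbase_arith[OF u1, of "CARD('n)"]
	have w1: "CARD('n) * (2 * 2 ^ u + 4) <= ?w" using wa(1) by linarith
	have w2: "6 * 2 ^ u + 24 + 2 * CARD('n) <= ?w" by (rule wa(2))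
	have cxi: "card ?Xii <= CARD('n)" by (rule card_image_le) simp
	have c1: "cmp X ?w (l div u + 1) (range y) (insert (%x. real (?J x)) ?Xii)"
		by (rule cmp_mono_w[OF cmp_levels[OF g _ l u] w1]) auto
	have JU: "?J x < 2 ^ (CARD('n) * l)" if "x : X" for x
		by (rule key_less) (use level_bounds[OF g[OF that] l] in auto)
	have "cmp X (6 * 2 ^ u + 24) (6 * Q + 6 * ((2 * a + 3) * G)) {%x. real (?J x)} {%x. real (z (?J x))}"
		by (rule cmp_stream[OF JU G _ R]) auto
	hence c2: "cmp X (6 * 2 ^ u + 24 + 2 * card ?Xii) (6 * Q + 6 * ((2 * a + 3) * G)) (insert (%x. real (?J x)) ?Xii) ({%x. real (z (?J x))} Un ?Xii)"
		by (intro cmp_par[OF cmp_pre_sub] cmp_pre_sub[OF cmp_id]) auto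
	have c2: "cmp X ?w (6 * Q + 6 * ((2 * a + 3) * G)) (insert (%x. real (?J x)) ?Xii) (insert (%x. real (z (?J x))) ?Xii)"
		using cmp_mono_w[OF c2, of ?w] w2 cxi by simp
	have c12: "cmp X ?w ((l div u + 1) + (6 * Q + 6 * ((2 * a + 3) * G))) (range y) (insert (%x. real (z (?J x))) ?Xii)"
		by (rule cmp_seq[OF c1 c2])
	define M where "M = (SUM i<2 ^ (CARD('n) * l). z i)"
	have M: "0 <= real (z (?J x)) & real (z (?J x)) <= real M" if "x : X" for x
	proof -
		have "z (?J x) <= M" unfolding M_def using JU[OF that] by (intro member_le_sum) auto
		thus ?thesis by simp
	qed
	have c3: "cmp X ?w ((l div u + 1) + (6 * Q + 6 * ((2 * a + 3) * G)) + 2 * t * (SUM i:UNIV. be i)) (range y)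
			{%x. real (z (?J x)) * (PROD i:UNIV. fr l (y i x) ^ be i)}"
		by (rule cmp_monomial[OF c12 _ M]) (use good_fr[OF g l] w2 in auto)
	have lt: "l div u <= t" using l u by (metis div_le_mono nonzero_mult_div_cancel_right less_numeral_extra(3))
	have "2 <= ?w" by (rule wa(5))
	thus ?thesis by (intro cmp_pad[OF c3]) (use lt in auto)
qed

text \<open>The monomial is in the coordinates themselves instead of the remainders of one level, so
  levels with different cell sizes can share a single step function \<open>Ph\<close> (see
  \<open>PhiM\<close>).\<close>

lemma cmp_step_term:
	fixes y :: "'n::finite => 'x => real" and Ph :: "nat => real"
	assumes g: "!!i x. x : X ==> good (t * u) 1 (y i x)" and u: "0 < u" and l: "l <= t * u"
		and Ph: "finite (jumps Ph)" "card (jumps Ph) < Q * (2 ^ u * 2 ^ u)"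
	shows "cmp X (wbase CARD('n) u) ((t + 1) + 3 * Q + 4 * t * (SUM i:UNIV. be i)) (range y)
			{%x. Ph (key (%i. cel l (y i x))) * (PROD i:UNIV. y i x ^ be i)}"
proof -
	let ?J = "%x. key (%i. cel l (y i x))"
	let ?w = "wbase CARD('n) u"
	have u1: "1 <= (2::nat) ^ u" by simp
	note wa = wbase_arith[OF u1, of "CARD('n)"]
	have w1: "CARD('n) * (2 * 2 ^ u + 4) + 2 * CARD('n) <= ?w" by (rule wa(1))
	have w2: "3 * 2 ^ u + 4 + 2 * CARD('n) <= ?w" "2 * 2 ^ u + 6 + 2 * CARD('n) <= ?w"  "2 * 2 ^ u + 6 + 4 * CARD('n) + 2 <= ?w"
		using wa(2,3) by linarith+
	have cxi: "card (range y) <= CARD('n)" by (rule card_image_le) simp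
	have "cmp X (CARD('n) * (2 * 2 ^ u + 4)) (l div u + 1) (range y) {%x. real (?J x)}"
		by (rule cmp_sub[OF cmp_levels[OF g _ l u]]) auto
	hence "cmp X (CARD('n) * (2 * 2 ^ u + 4) + 2 * card (range y)) (l div u + 1) (range y) ({%x. real (?J x)} Un range y)"
		by (rule cmp_par) (rule cmp_id, simp)
	hence c1: "cmp X ?w (l div u + 1) (range y) ({%x. real (?J x)} Un range y)"
		by (rule cmp_mono_w) (use w1 cxi in linarith)
	have JU: "?J x < 2 ^ (CARD('n) * l)" if "x : X" for x
		by (rule key_less) (use level_bounds[OF g[OF that] l] in auto)
	have "cmp X (3 * 2 ^ u + 4) (3 * Q) {%x. real (?J x)} {%x. Ph (?J x)}"
		by (rule cmp_step_function[OF Ph _ JU]) auto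
	hence "cmp X (3 * 2 ^ u + 4 + 2 * card (range y)) (3 * Q) ({%x. real (?J x)} Un range y) ({%x. Ph (?J x)} Un range y)"
		by (intro cmp_par[OF cmp_pre_sub] cmp_pre_sub[OF cmp_id]) auto
	hence c2: "cmp X ?w (3 * Q) ({%x. real (?J x)} Un range y) ({%x. Ph (?J x)} Un range y)"
		by (rule cmp_mono_w) (use w2 cxi in linarith)
	define M where "M = (SUM i<2 ^ (CARD('n) * l). abs (Ph i))"
	have M: "abs (Ph (?J x)) <= M" if "x : X" for x
		unfolding M_def using JU[OF that] by (auto intro!: member_le_sum[of _ _ "%i. abs (Ph i)"])
	let ?p = "%x. PROD i:UNIV. y i x ^ be i"
	have c12: "cmp X ?w (l div u + 1 + 3 * Q) (range y) (insert (%x. Ph (?J x)) (range y))"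
		using cmp_seq[OF c1 c2] by simp
	\<comment> \<open>shift by \<open>M\<close> to make the factor nonnegative, then subtract \<open>M\<close> times the monomial\<close>
	have c3: "cmp X (2 * 2 ^ u + 6 + 2 * CARD('n)) (0 + 2 * t * (SUM i:UNIV. be i)) (insert (%x. Ph (?J x)) (range y)) {%x. (Ph (?J x) + M) * ?p x}"
		by (rule cmp_monomial[where M = "2 * M"]) (use g M in "force intro: affs_intros affs.base simp: abs_le_iff")+
	have c4: "cmp X (2 * 2 ^ u + 6 + 2 * CARD('n)) (0 + 2 * t * (SUM i:UNIV. be i)) (range y) {%x. 1 * ?p x}"
		by (rule cmp_monomial[where M = 1]) (use g in "auto intro: affs_intros affs.base")
	have c3': "cmp X ?w (2 * t * (SUM i:UNIV. be i)) (insert (%x. Ph (?J x)) (range y)) ({%x. (Ph (?J x) + M) * ?p x} Un range y)"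
		using cmp_mono_w[OF cmp_keep[OF c3, of "range y"], of ?w] w2(3) cxi by auto
	have c4': "cmp X ?w (2 * t * (SUM i:UNIV. be i)) ({%x. (Ph (?J x) + M) * ?p x} Un range y) ({%x. 1 * ?p x} Un {%x. (Ph (?J x) + M) * ?p x})"
		by (rule cmp_mono_w[OF cmp_par[OF cmp_pre_sub[OF c4[unfolded add_0]] cmp_pre_sub[OF cmp_id[of "{%x. (Ph (?J x) + M) * ?p x}"]]]]) (use w2(3) in auto)
	have "(%x. (Ph (?J x) + M) * ?p x - M * (1 * ?p x)) : affs X ({%x. 1 * ?p x} Un {%x. (Ph (?J x) + M) * ?p x})"
		by (intro affs_diff affs.scale affs.base) auto
	hence "(%x. Ph (?J x) * ?p x) : affs X ({%x. 1 * ?p x} Un {%x. (Ph (?J x) + M) * ?p x})"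
		by (rule affs.cong) (simp add: algebra_simps)
	hence c5: "cmp X ?w (l div u + 1 + 3 * Q + (2 * t * (SUM i:UNIV. be i) + 2 * t * (SUM i:UNIV. be i))) (range y) {%x. Ph (?J x) * ?p x}"
		by (intro cmp_post[OF cmp_seq[OF c12 cmp_seq[OF c3' c4']]]) auto
	have lt: "l div u <= t" using l u by (metis div_le_mono nonzero_mult_div_cancel_right less_numeral_extra(3))
	have "2 <= ?w" by (rule wa(5))
	thus ?thesis by (intro cmp_pad[OF c5]) (use lt in auto)
qed

text \<open>The first stage replaces \<open>y\<close> by its truncation \<open>yt\<close> to
  \<open>t*u\<close> digits, the only place where the margin \<open>ep\<close> enters; afterwards
  all coordinates are dyadic, so \<open>good\<close> holds with margin 1 and all products are exact.
  The Boolean argument of \<open>z\<close> separates the positive from the negative part of the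
  coefficients.\<close>

lemma cmp_approximant:
	fixes y :: "'n::finite => 'x => real" and z :: "bool => nat => ('n => nat) => nat => nat"
	assumes g: "!!i x. x : X ==> good (t * u) ep (y i x)" and ep: "0 < ep" and u: "0 < u" and "0 < t"
		and Ls: "finite Ls" "!!l. l : Ls ==> l <= t * u" "!!l. l : Ls ==> 1 <= G l" and Bs: "finite Bs" "!!be. be : Bs ==> (SUM i:UNIV. be i) <= D"
		and R: "!!b l be. l : Ls ==> be : Bs ==> 2 * (2 ^ (CARD('n) * l) div 2 ^ a l + 1 + card {i. i < 2 ^ (CARD('n) * l) & z b l be i ~= 0}
				+ (SUM i<2 ^ (CARD('n) * l). z b l be i div 2 ^ a l)) < Q l * (2 ^ u * 2 ^ u) * G l"
		and m: "m <= t * u" and Ph: "!!be. be : Bs ==> finite (jumps (Ph be))" "!!be. be : Bs ==> card (jumps (Ph be)) < Qm * (2 ^ u * 2 ^ u)"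
		and yt: "!!i x. yt i x = y i x - fr (t * u) (y i x) / 2 ^ (t * u)"
	shows "cmp X (3 * wbase CARD('n) u) ((t + 1) + (card Bs * ((t + 1) + 3 * Qm + 4 * t * D)
			+ 2 * card Bs * (SUM l:Ls. (t + 1) + (6 * Q l + 6 * ((2 * a l + 3) * G l)) + 2 * t * D))) (range y)
			{%x. (SUM be:Bs. Ph be (key (%i. cel m (yt i x))) * (PROD i:UNIV. yt i x ^ be i)) +
				(SUM l:Ls. SUM be:Bs. de l * (real (z True l be (key (%i. cel l (yt i x)))) - real (z False l be (key (%i. cel l (yt i x))))) * (PROD i:UNIV. fr l (yt i x) ^ be i))}"
proof -
	let ?w = "wbase CARD('n) u"
	have yt_nat: "yt i x = real (cel (t * u) (y i x)) / 2 ^ (t * u)" if "x : X" for i x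
		using cel_fr[of "y i x" "t * u"] g[OF that, of i] by (simp add: yt good_def field_simps)
	have gt: "good (t * u) 1 (yt i x)" if "x : X" for i x
	proof -
		have "frac (2 ^ (t * u) * yt i x) = 0" unfolding yt_nat[OF that] by simp
		moreover have "real (cel (t * u) (y i x)) < 2 ^ (t * u)"
			using cel_less[of "y i x" "t * u"] g[OF that, of i] by (simp add: good_def) 
		moreover have "0 <= yt i x" unfolding yt_nat[OF that] by simp
		ultimately show ?thesis by (intro good_1I) (simp_all add: yt_nat[OF that])
	qed
	have cy: "card (range y) <= CARD('n)" "card (range yt) <= CARD('n)" by (auto intro: card_image_le)
	have u1: "1 <= (2::nat) ^ u" by simp
	note wa = wbase_arith[OF u1, of "CARD('n)"]
	have tu: "t * u div u = t" using u by simp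
	have "cmp X (CARD('n) * (2 * 2 ^ u + 4)) (t + 1) (range y) (range (%i x. fr (t * u) (y i x)))"
		using cmp_levels[where X = X and y = y, OF g ep order_refl u] unfolding tu by (rule cmp_sub) auto
	hence "cmp X (CARD('n) * (2 * 2 ^ u + 4) + 2 * card (range y)) (t + 1) (range y) (range (%i x. fr (t * u) (y i x)) Un range y)"
		by (rule cmp_par) (rule cmp_id, simp)
	hence "cmp X (3 * ?w) (t + 1) (range y) (range (%i x. fr (t * u) (y i x)) Un range y)"
		by (rule cmp_mono_w) (use cy wa(1) in linarith)
	moreover have "range yt \<subseteq> affs X (range (%i x. fr (t * u) (y i x)) Un range y)"
	proof (clarify, rule affs.cong)
		fix i
		show "(%x. y i x - fr (t * u) (y i x) / 2 ^ (t * u)) : affs X (range (%i x. fr (t * u) (y i x)) Un range y)"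
			by (intro affs_intros) (auto intro: affs.base)
	qed (rule yt)
	ultimately have c0: "cmp X (3 * ?w) (t + 1) (range y) (range yt)" by (rule cmp_post)
	let ?M = "%be x. Ph be (key (%i. cel m (yt i x))) * (PROD i:UNIV. yt i x ^ be i)"
	let ?T = "%l be b x. real (z b l be (key (%i. cel l (yt i x)))) * (PROD i:UNIV. fr l (yt i x) ^ be i)"
	have w2: "2 <= ?w" by (rule wa(5))
	have cM: "cmp X (?w + 2 * card (range yt) + 2) (SUM be:Bs. (t + 1) + 3 * Qm + 4 * t * D) (range yt) {%x. SUM be:Bs. ?M be x}"
	proof (rule cmp_sum)
		fix be assume b: "be : Bs"
		show "cmp X ?w ((t + 1) + 3 * Qm + 4 * t * D) (range yt) {?M be}"
			by (rule cmp_pad[OF cmp_step_term[OF gt u m Ph[OF b]]]) (use w2 Bs(2)[OF b] in auto)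
	qed (use Bs in auto)
	have cS: "cmp X (?w + 2 * card (range yt) + 2) (\<Sum>(l, be, b)\<in>Ls \<times> Bs \<times> (UNIV::bool set). (t + 1) + (6 * Q l + 6 * ((2 * a l + 3) * G l)) + 2 * t * D) (range yt)
			{%x. SUM i:Ls \<times> Bs \<times> UNIV. (%(l, be, b) x. de l * ((if b then 1 else - 1) * ?T l be b x)) i x}"
	proof (rule cmp_sum)
		fix i assume i: "i : Ls \<times> Bs \<times> (UNIV :: bool set)"
		obtain l be b where ib: "i = (l, be, b)" by (metis prod_cases3)
		have "cmp X ?w ((t + 1) + (6 * Q l + 6 * ((2 * a l + 3) * G l)) + 2 * t * D) (range yt) {?T l be b}"
			by (rule cmp_pad[OF cmp_level_term[OF gt u Ls(2,3) R]]) (use w2 Bs(2) i ib in auto)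
		hence "cmp X ?w ((t + 1) + (6 * Q l + 6 * ((2 * a l + 3) * G l)) + 2 * t * D) (range yt) {%x. de l * ((if b then 1 else - 1) * ?T l be b x)}"
			by (rule cmp_post) (simp only: insert_subset empty_subsetI simp_thms, intro affs.scale affs.base, simp)
		thus "cmp X ?w (case i of (l, be, b) => (t + 1) + (6 * Q l + 6 * ((2 * a l + 3) * G l)) + 2 * t * D) (range yt) {(%(l, be, b) x. de l * ((if b then 1 else - 1) * ?T l be b x)) i}"
			by (simp add: ib)
	qed (use Bs Ls in auto)
	have sN: "(\<Sum>(l, be, b)\<in>Ls \<times> Bs \<times> (UNIV::bool set). (t + 1) + (6 * Q l + 6 * ((2 * a l + 3) * G l)) + 2 * t * D) =
			2 * card Bs * (SUM l:Ls. (t + 1) + (6 * Q l + 6 * ((2 * a l + 3) * G l)) + 2 * t * D)"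
		unfolding sum.cartesian_product[symmetric] by (simp add: sum_distrib_left algebra_simps)
	have sF: "(SUM i:Ls \<times> Bs \<times> UNIV. (%(l, be, b) x. de l * ((if b then 1 else - 1) * ?T l be b x)) i x) = 
		(SUM l:Ls. SUM be:Bs. de l * (real (z True l be (key (%i. cel l (yt i x)))) - real (z False l be (key (%i. cel l (yt i x))))) * (PROD i:UNIV. fr l (yt i x) ^ be i))" for x
		unfolding sum.cartesian_product' UNIV_bool by (intro sum.cong refl) (simp add: algebra_simps)
	have c: "cmp X (?w + 2 * card (range yt) + 2 + 2 * card (range yt) + 2) (SUM b:(UNIV::bool set). if b then card Bs * ((t + 1) + 3 * Qm + 4 * t * D)
			else 2 * card Bs * (SUM l:Ls. (t + 1) + (6 * Q l + 6 * ((2 * a l + 3) * G l)) + 2 * t * D)) (range yt)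
			{%x. SUM b:(UNIV::bool set). (if b then (%x. SUM be:Bs. ?M be x) else (%x. SUM i:Ls \<times> Bs \<times> UNIV. (%(l, be, b) x. de l * ((if b then 1 else - 1) * ?T l be b x)) i x)) x}"
	proof (rule cmp_sum)
		fix b :: bool
		show "cmp X (?w + 2 * card (range yt) + 2) (if b then card Bs * ((t + 1) + 3 * Qm + 4 * t * D)
			else 2 * card Bs * (SUM l:Ls. (t + 1) + (6 * Q l + 6 * ((2 * a l + 3) * G l)) + 2 * t * D)) (range yt)
			{if b then (%x. SUM be:Bs. ?M be x) else (%x. SUM i:Ls \<times> Bs \<times> UNIV. (%(l, be, b) x. de l * ((if b then 1 else - 1) * ?T l be b x)) i x)}"
			using cM cS unfolding sN by (cases b) simp_all
	qed auto
	have c: "cmp X (3 * ?w) (card Bs * ((t + 1) + 3 * Qm + 4 * t * D)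
			+ 2 * card Bs * (SUM l:Ls. (t + 1) + (6 * Q l + 6 * ((2 * a l + 3) * G l)) + 2 * t * D)) (range yt)
			{%x. (SUM be:Bs. ?M be x) + (SUM l:Ls. SUM be:Bs. de l * (real (z True l be (key (%i. cel l (yt i x)))) - real (z False l be (key (%i. cel l (yt i x))))) * (PROD i:UNIV. fr l (yt i x) ^ be i))}"
	proof -
		have "?w + 2 * card (range yt) + 2 + 2 * card (range yt) + 2 <= 3 * ?w"
			using cy wa(4) by linarith
		from cmp_mono_w[OF c this] show ?thesis unfolding UNIV_bool sF[symmetric] by (simp add: add.commute)
	qed
	from cmp_seq[OF c0 c] show ?thesis .
qed

section \<open>Smooth test functions\<close>

text \<open>\<open>sm P n g\<close>: the functions \<open>g b\<close>, \<open>b : P\<close>, are \<open>n\<close> times differentiable, with derivatives that are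
	locally bounded uniformly in \<open>b\<close>.\<close>
definition lbd :: "'b set => ('b => real => real) => bool" where
	"lbd P g \<longleftrightarrow> (ALL r. EX B. ALL b:P. ALL t. abs t <= r --> abs (g b t) <= B)"

fun sm :: "'b set => nat => ('b => real => real) => bool" where
	"sm P 0 g \<longleftrightarrow> lbd P g"
| "sm P (Suc n) g \<longleftrightarrow> lbd P g & (EX g'. (ALL b:P. ALL t. (g b has_real_derivative g' b t) (at t)) & sm P n g')"

lemma sm_lbd: "sm P n g ==> lbd P g" by (cases n) auto

lemma sm_Suc_D: "sm P (Suc n) g ==> sm P n g"
proof (induction n arbitrary: g)
	case (Suc n)
	thus ?case by (metis sm.simps(2))
qed auto

lemma lbd_add: assumes "lbd P f" "lbd P g" shows "lbd P (%b t. f b t + g b t)"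
	unfolding lbd_def
proof
	fix r
	from assms obtain A B where "ALL b:P. ALL t. abs t <= r --> abs (f b t) <= A" "ALL b:P. ALL t. abs t <= r --> abs (g b t) <= B"
		unfolding lbd_def by meson
	thus "EX B. ALL b:P. ALL t. abs t <= r --> abs (f b t + g b t) <= B"
		by (intro exI[of _ "A + B"]) (meson abs_triangle_ineq add_mono order_trans)
qed

lemma lbd_mult: assumes "lbd P f" "lbd P g" shows "lbd P (%b t. f b t * g b t)"
	unfolding lbd_def
proof
	fix r
	from assms obtain A B where *: "ALL b:P. ALL t. abs t <= r --> abs (f b t) <= A" "ALL b:P. ALL t. abs t <= r --> abs (g b t) <= B"
		unfolding lbd_def by meson
	show "EX B. ALL b:P. ALL t. abs t <= r --> abs (f b t * g b t) <= B"
	proof (intro exI[of _ "abs A * abs B"] ballI allI impI)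
		fix b t assume "b : P" "abs t <= r"
		hence "abs (f b t) <= abs A" "abs (g b t) <= abs B" using * by force+
		thus "abs (f b t * g b t) <= abs A * abs B" unfolding abs_mult by (intro mult_mono) auto
	qed
qed

lemma lbd_const: "(!!b. b : P ==> abs (c b) <= K) ==> lbd P (%b t. c b)"
	unfolding lbd_def by blast

lemma sm_cong: "sm P n f ==> (!!b t. b : P ==> f b t = g b t) ==> sm P n g"
proof (cases n)
	case (Suc m)
	assume a: "sm P n f" and e: "!!b t. b : P ==> f b t = g b t"
	hence "!!b. b : P ==> g b = f b" by auto
	thus ?thesis using a unfolding Suc by (auto simp: lbd_def)
qed (auto simp: lbd_def)

lemma sm_zero: "sm P n (%b t. 0)"
proof (induction n)
	case 0 thus ?case by (auto intro: lbd_const)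
next
	case (Suc n) thus ?case by (auto intro!: lbd_const exI[of _ "%b t. 0"])
qed

lemma sm_const: assumes "!!b. b : P ==> abs (c b) <= K" shows "sm P n (%b t. c b)"
proof (cases n)
	case (Suc m)
	thus ?thesis using sm_zero[of P m] assms by (auto intro!: lbd_const exI[of _ "%b t. 0"])
qed (use assms in "auto intro: lbd_const")

lemma sm_id: "sm P n (%b t. t)"
proof (cases n)
	case (Suc m)
	have "sm P m (%b t. 1)" by (rule sm_const[of P "%_. 1" 1]) simp
	thus ?thesis using Suc by (auto simp: lbd_def intro!: exI[of _ "%b t. 1"] derivative_eq_intros)
qed (auto simp: lbd_def)

lemma sm_add: "sm P n f ==> sm P n g ==> sm P n (%b t. f b t + g b t)"
proof (induction n arbitrary: f g)
	case (Suc n)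
	then obtain f' g' where "ALL b:P. ALL t. (f b has_real_derivative f' b t) (at t)" "sm P n f'"
		"ALL b:P. ALL t. (g b has_real_derivative g' b t) (at t)" "sm P n g'" by auto
	thus ?case using Suc by (auto intro!: lbd_add exI[of _ "%b t. f' b t + g' b t"] DERIV_add)
qed (auto intro: lbd_add)

lemma sm_mult: "sm P n f ==> sm P n g ==> sm P n (%b t. f b t * g b t)"
proof (induction n arbitrary: f g)
	case (Suc n)
	then obtain f' g' where *: "ALL b:P. ALL t. (f b has_real_derivative f' b t) (at t)" "sm P n f'"
		"ALL b:P. ALL t. (g b has_real_derivative g' b t) (at t)" "sm P n g'" by auto
	have "sm P n f" "sm P n g" using Suc.prems sm_Suc_D by auto
	hence "sm P n (%b t. f' b t * g b t + g' b t * f b t)" using * by (intro sm_add Suc.IH)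
	thus ?case using * Suc.prems unfolding sm.simps
		by (intro conjI lbd_mult exI[of _ "%b t. f' b t * g b t + g' b t * f b t"]) (auto intro: DERIV_mult sm_lbd)
qed (auto intro: lbd_mult)

lemma sm_cmult: "sm P n f ==> sm P n (%b t. c * f b t)"
	using sm_mult[OF sm_const[of P "%_. c" "abs c" n]] by simp

lemma sm_diff: "sm P n f ==> sm P n g ==> sm P n (%b t. f b t - g b t)"
	using sm_add[of P n f "%b t. (-1) * g b t"] sm_cmult[of P n g "-1"] by simp

lemma sm_power: "sm P n f ==> sm P n (%b t. f b t ^ k)"
	by (induction k) (auto intro!: sm_mult sm_const[of P "%_. 1" 1])

lemma sm_affine:
	assumes "sm P n g" "!!b. b : P' ==> p b : P" "!!b. b : P' ==> abs (al b) <= K & abs (ga b) <= K"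
	shows "sm P' n (%b t. g (p b) (al b * t + ga b))"
	using assms(1)
proof (induction n arbitrary: g)
	case 0
	have "lbd P' (%b t. g (p b) (al b * t + ga b))" if g: "lbd P g" for g
		unfolding lbd_def
	proof
		fix r
		obtain B where B: "ALL b:P. ALL t. abs t <= K * abs r + K --> abs (g b t) <= B" using g unfolding lbd_def by meson
		show "EX B. ALL b:P'. ALL t. abs t <= r --> abs (g (p b) (al b * t + ga b)) <= B"
		proof (intro exI[of _ B] ballI allI impI)
			fix b t assume b: "b : P'" "abs t <= r"
			have "abs (al b * t) <= K * abs r" unfolding abs_mult using assms(3)[OF b(1)] b(2) by (intro mult_mono) auto
			hence "abs (al b * t + ga b) <= K * abs r + K" using assms(3)[OF b(1)] by linarith
			thus "abs (g (p b) (al b * t + ga b)) <= B" using B assms(2)[OF b(1)] by blast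
		qed
	qed
	thus ?case using 0 by simp
next
	case (Suc n)
	then obtain g' where g': "ALL b:P. ALL t. (g b has_real_derivative g' b t) (at t)" "sm P n g'" by auto
	have "sm P' n (%b t. al b * g' (p b) (al b * t + ga b))"
		by (rule sm_mult[OF sm_const Suc.IH]) (use g' assms(3) in auto)
	moreover have "((%t. g (p b) (al b * t + ga b)) has_real_derivative al b * g' (p b) (al b * t + ga b)) (at t)" if "b : P'" for b t
	proof -
		have "((%t. al b * t + ga b) has_real_derivative al b) (at t)" by (auto intro!: derivative_eq_intros)
		from DERIV_chain2[OF _ this, of "g (p b)" "g' (p b) (al b * t + ga b)"] g'(1) assms(2)[OF that]
		show ?thesis by (simp only: mult.commute[of "al b" "g' _ _"])
	qed
	moreover have "lbd P' (%b t. g (p b) (al b * t + ga b))"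
		using sm_lbd[OF Suc.IH[OF sm_Suc_D[OF Suc.prems]]] .
	ultimately show ?case unfolding sm.simps
		by (intro conjI exI[of _ "%b t. al b * g' (p b) (al b * t + ga b)"]) auto
qed

lemma sm_inverse:
	assumes "sm P n g" "!!b t. b : P ==> g b t ~= 0" "lbd P (%b t. inverse (g b t))"
	shows "sm P n (%b t. inverse (g b t))"
	using assms(1)
proof (induction n)
	case (Suc n)
	then obtain g' where g': "ALL b:P. ALL t. (g b has_real_derivative g' b t) (at t)" "sm P n g'" by auto
	have i: "sm P n (%b t. inverse (g b t))" using Suc sm_Suc_D by blast
	have "sm P n (%b t. - (inverse (g b t) * g' b t * inverse (g b t)))"
		using sm_cmult[OF sm_mult[OF sm_mult[OF i g'(2)] i], of "-1"] by simp
	moreover have "((%t. inverse (g b t)) has_real_derivative - (inverse (g b t) * g' b t * inverse (g b t))) (at t)" if "b : P" for b t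
		by (rule DERIV_inverse') (use g' assms(2) that in auto)
	ultimately show ?case using assms(3) unfolding sm.simps
		by (intro conjI exI[of _ "%b t. - (inverse (g b t) * g' b t * inverse (g b t))"]) auto
qed (use assms in auto)

text \<open>The parameter set is there for uniformity: the kernels below depend on window offsets
  from a bounded interval, and one bound must serve for all of them.\<close>

definition smo :: "'b set => ('b => real => real) => bool" where "smo P g \<longleftrightarrow> (ALL n. sm P n g)"

lemma smo_deriv:
	assumes "smo P g"
	shows "smo P (%b. deriv (g b))" "!!b t. b : P ==> (g b has_real_derivative deriv (g b) t) (at t)"
proof -
	have "sm P n (%b. deriv (g b))" for n
	proof -
		from assms obtain g' where g': "ALL b:P. ALL t. (g b has_real_derivative g' b t) (at t)" "sm P n g'"
			unfolding smo_def by (metis sm.simps(2))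
		show ?thesis by (rule sm_cong[OF g'(2)]) (use g'(1) DERIV_imp_deriv in metis)
	qed
	thus "smo P (%b. deriv (g b))" by (simp add: smo_def)
	from assms obtain g' where g': "ALL b:P. ALL t. (g b has_real_derivative g' b t) (at t)"
		unfolding smo_def by (metis sm.simps(2))
	thus "(g b has_real_derivative deriv (g b) t) (at t)" if "b : P" for b t
		using that DERIV_imp_deriv by metis
qed

lemma smo_derivs: "smo P g ==> smo P (%b. (deriv ^^ m) (g b))"
	by (induction m) (auto intro: smo_deriv(1)[of P "%b. (deriv ^^ _) (g b)"])

lemma smo_derivs_D: "smo P g ==> b : P ==> ((deriv ^^ m) (g b) has_real_derivative (deriv ^^ Suc m) (g b) t) (at t)"
	using smo_deriv(2)[OF smo_derivs[of P g m]] by simp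

lemma smo_intros:
	"smo P f ==> smo P g ==> smo P (%b t. f b t + g b t)"
	"smo P f ==> smo P g ==> smo P (%b t. f b t - g b t)"
	"smo P f ==> smo P g ==> smo P (%b t. f b t * g b t)"
	"smo P f ==> smo P (%b t. c * f b t)"
	"smo P f ==> smo P (%b t. f b t ^ k)"
	"smo P (%b t. c)"
	"smo P (%b t. t)"
	by (auto simp: smo_def intro: sm_add sm_diff sm_mult sm_cmult sm_power sm_id sm_const[of P "%_. c" "abs c"])

lemma smo_affine: "smo P g ==> (!!b. b : P' ==> p b : P) ==> (!!b. b : P' ==> abs (al b) <= K & abs (ga b) <= K)
		==> smo P' (%b t. g (p b) (al b * t + ga b))"
	using sm_affine unfolding smo_def by blast

abbreviation smo1 :: "(real => real) => bool" where "smo1 f == smo {()} (%_. f)"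

lemma smo1_affine: "smo1 g ==> smo1 (%t. g (al * t + ga))"
	using smo_affine[of "{()}" "%_. g" "{()}" "%_. ()" "%_. al" "max (abs al) (abs ga)" "%_. ga"] by simp

lemma smo1_D: "smo1 g ==> ((deriv ^^ m) g has_real_derivative (deriv ^^ Suc m) g t) (at t)"
	using smo_derivs_D[of "{()}" "%_. g" "()"] by simp

lemma derivs_add: "smo1 f ==> smo1 g ==> (deriv ^^ m) (%t. f t + g t) = (%t. (deriv ^^ m) f t + (deriv ^^ m) g t)"
proof (induction m)
	case (Suc m)
	show ?case unfolding funpow.simps(2) o_apply Suc.IH[OF Suc.prems]
		using DERIV_imp_deriv[OF DERIV_add[OF smo1_D[of f m] smo1_D[of g m]]] Suc.prems by (intro ext) simp
qed simp

lemma derivs_cmult: "smo1 f ==> (deriv ^^ m) (%t. c * f t) = (%t. c * (deriv ^^ m) f t)"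
proof (induction m)
	case (Suc m)
	show ?case unfolding funpow.simps(2) o_apply Suc.IH[OF Suc.prems]
		using DERIV_imp_deriv[OF DERIV_cmult[OF smo1_D[of f m]]] Suc.prems by (intro ext) simp
qed simp

lemma derivs_diff: "smo1 f ==> smo1 g ==> (deriv ^^ m) (%t. f t - g t) = (%t. (deriv ^^ m) f t - (deriv ^^ m) g t)"
	using derivs_add[of f "%t. (-1) * g t" m] derivs_cmult[of g m "-1"] smo_intros(4)[of "{()}" "%_. g" "-1"] by simp

lemma derivs_sum: "finite I ==> (!!i. i : I ==> smo1 (f i)) ==>
	smo1 (%t. SUM i:I. f i t) & (deriv ^^ m) (%t. SUM i:I. f i t) = (%t. SUM i:I. (deriv ^^ m) (f i) t)"
proof (induction I rule: finite_induct)
	case empty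
	have "(deriv ^^ m) (%t. 0) = (%t. 0 :: real)" by (induction m) auto
	thus ?case by (simp add: smo_intros(6))
next
	case (insert i I)
	thus ?case by (simp add: derivs_add smo_intros(1)[of "{()}" "%_. f i" "%_ t. SUM i:I. f i t"])
qed

lemma derivs_affine: "smo1 f ==> (deriv ^^ m) (%t. f (al * t + ga)) = (%t. al ^ m * (deriv ^^ m) f (al * t + ga))"
proof (induction m)
	case (Suc m)
	have "((%t. al ^ m * (deriv ^^ m) f (al * t + ga)) has_real_derivative al ^ m * ((deriv ^^ Suc m) f (al * t + ga) * al)) (at t)" for t
		by (intro DERIV_cmult DERIV_chain2[OF smo1_D[OF Suc.prems]]) (auto intro!: derivative_eq_intros)
	from DERIV_imp_deriv[OF this] show ?case unfolding funpow.simps(2) o_apply Suc.IH[OF Suc.prems]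
		by (intro ext) simp
qed simp

lemma derivs_cong_open:
	"open S ==> (!!t. t : S ==> f t = g t) ==> t : S ==> (deriv ^^ m) f t = (deriv ^^ m) (g :: real => real) t"
proof (induction m arbitrary: t)
	case (Suc m)
	have "\<forall>\<^sub>F s in nhds t. (deriv ^^ m) f s = (deriv ^^ m) g s"
		by (rule eventually_nhds_in_open[OF Suc.prems(1,3), THEN eventually_mono]) (use Suc in auto)
	thus ?case by (simp add: deriv_cong_ev)
qed simp

lemma derivs_power:
	"(deriv ^^ m) (%t. c * (a - t) ^ i) = (%t. if m <= i then c * (-1) ^ m * (fact i / fact (i - m)) * (a - t) ^ (i - m) else (0::real))"
proof (induction m)
	case (Suc m)
	show ?case
	proof (cases "m <= i")
		case True
		show ?thesis
		proof (cases "i = m")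
			case True
			thus ?thesis using Suc by simp
		next
			case False
			then obtain j where j: "i = m + Suc j" using True by (metis add_Suc_right le_neq_implies_less less_imp_Suc_add)
			have "((%t. c * (-1) ^ m * (fact i / fact (Suc j)) * (a - t) ^ Suc j) has_real_derivative
					c * (-1) ^ m * (fact i / fact (Suc j)) * ((1 + real j) * ((- 1) * (a - t) ^ j))) (at t)" for t
				by (rule DERIV_cmult, rule DERIV_power_Suc) (auto intro!: derivative_eq_intros)
			from DERIV_imp_deriv[OF this] have "deriv (%t. c * (-1) ^ m * (fact i / fact (Suc j)) * (a - t) ^ Suc j) =
					(%t. c * (-1) ^ Suc m * (fact i / fact j) * (a - t) ^ j)"
				by (intro ext) (simp add: divide_simps)
			thus ?thesis using Suc by (simp add: j)
		qed
	qed (use Suc in simp)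
qed simp

lemma bounded_on_sym: fixes f :: "real => real" assumes "continuous_on {-r..r} f" shows "EX B. ALL t. abs t <= r --> abs (f t) <= (B::real)"
proof -
	have "compact (f ` {-r..r})" by (rule compact_continuous_image[OF assms]) auto
	then obtain B where "ALL x:f ` {-r..r}. norm x <= B" using compact_imp_bounded bounded_iff by metis
	thus ?thesis by (intro exI[of _ B]) (simp add: abs_le_iff)
qed

text \<open>A class closed under differentiation consists of smooth functions; continuity supplies
  the local bounds.\<close>

lemma smo1_class:
	assumes "!!f. f : H ==> EX f':H. ALL t. (f has_real_derivative f' t) (at t)" "f : H"
	shows "smo1 f"
proof -
	have "sm {()} n (%_. f)" if "f : H" for f n
		using that
	proof (induction n arbitrary: f)
		case 0
		obtain f' where f': "ALL t. (f has_real_derivative f' t) (at t)" using assms(1)[OF 0] by blast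
		show ?case unfolding sm.simps lbd_def
		proof
			fix r :: real
			have "continuous_on {-r..r} f" using f' by (auto intro!: DERIV_atLeastAtMost_imp_continuous_on)
			thus "EX B. ALL b:{()}. ALL t. abs t <= r --> abs (f t) <= B" using bounded_on_sym by simp
		qed
	next
		case (Suc n)
		obtain f' where f': "f' : H" "ALL t. (f has_real_derivative f' t) (at t)" using assms(1)[OF Suc.prems] by blast
		have "lbd {()} (%_. f)" using Suc.IH[OF Suc.prems] sm_lbd by blast
		thus ?case using f' Suc.IH[OF f'(1)] by auto
	qed
	thus ?thesis using assms(2) by (simp add: smo_def)
qed

text \<open>This family is closed under differentiation: by the chain rule \<open>p\<close> is
  replaced by \<open>x^2 * (p - pderiv p)\<close>, and the exponential wins at 0. Smoothness then
  follows from \<open>smo1_class\<close>.\<close>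

definition expoly :: "real poly => real => real" where
	"expoly p t = (if t > 0 then poly p (1 / t) * exp (- 1 / t) else 0)"

lemma poly_exp_tendsto: "((%x. poly p x * exp (- x)) \<longlongrightarrow> (0::real)) at_top"
proof -
	have "((%x. coeff p i * (x ^ i / exp x)) \<longlongrightarrow> coeff p i * 0) at_top" for i
		by (intro tendsto_intros tendsto_power_div_exp_0)
	hence "((%x. SUM i<=degree p. coeff p i * (x ^ i / exp x)) \<longlongrightarrow> (SUM i<=degree p. coeff p i * 0)) at_top"
		by (intro tendsto_sum)
	thus ?thesis by (simp add: poly_altdef sum_distrib_left exp_minus divide_inverse mult_ac)
qed

lemma expoly_deriv: "(expoly p has_real_derivative expoly ([:0, 0, 1:] * (p - pderiv p)) t) (at t)"
proof (cases t "0 :: real" rule: linorder_cases)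
	case less
	have "(expoly p has_real_derivative 0) (at t)"
		by (rule has_field_derivative_transform_within_open[of "%_. 0" _ _ "{..<0}"]) (use less in "auto simp: expoly_def")
	thus ?thesis using less by (simp add: expoly_def)
next
	case equal
	\<comment> \<open>The difference quotient at 0 is again a polynomial in \<open>1 / s\<close> times
	  the exponential; the extra factor \<open>1 / s\<close> turns \<open>p\<close> into
	  \<open>pCons 0 p\<close>.\<close>
	have lim: "((%s. poly (pCons 0 p) (1 / s) * exp (- (1 / s))) \<longlongrightarrow> 0) (at_right (0::real))"
		using filterlim_compose[OF poly_exp_tendsto[of "pCons 0 p"] filterlim_inverse_at_top_right]
		by (simp only: inverse_eq_divide)
	have "((%s. (expoly p s - expoly p 0) / (s - 0)) \<longlongrightarrow> 0) (at 0)"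
	proof (rule filterlim_split_at)
		show "((%s. (expoly p s - expoly p 0) / (s - 0)) \<longlongrightarrow> 0) (at_left 0)"
			by (rule tendsto_eventually) (auto simp: eventually_at_filter expoly_def)
		show "((%s. (expoly p s - expoly p 0) / (s - 0)) \<longlongrightarrow> 0) (at_right 0)"
			by (rule Lim_transform_eventually[OF lim]) (auto simp: eventually_at_filter expoly_def)
	qed
	thus ?thesis using equal by (simp add: has_field_derivative_iff expoly_def)
next
	case greater
	have "((%t. poly p (1 / t) * exp (- 1 / t)) has_real_derivative
			poly (pderiv p) (1 / t) * (- 1 / t\<^sup>2) * exp (- 1 / t) + exp (- 1 / t) * (1 / t\<^sup>2) * poly p (1 / t)) (at t)"
		using greater by (auto intro!: derivative_eq_intros DERIV_chain2[OF poly_DERIV] simp: power2_eq_square divide_simps)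
	hence "((%t. poly p (1 / t) * exp (- 1 / t)) has_real_derivative expoly ([:0, 0, 1:] * (p - pderiv p)) t) (at t)"
		using greater by (simp add: expoly_def algebra_simps power2_eq_square)
	thus ?thesis
		by (rule has_field_derivative_transform_within_open[of _ _ _ "{0<..}"]) (use greater in "auto simp: expoly_def")
qed

lemma smo1_expoly: "smo1 (expoly p)"
	by (rule smo1_class[of "range expoly"]) (use expoly_deriv in blast)+

text \<open>The step rises only between \<open>1/4\<close> and \<open>3/4\<close>. This margin keeps
  the kernels compactly inside the open cube even when their window touches the boundary.\<close>

definition sstep :: "real => real" where
	"sstep t = expoly 1 (t - 1 / 4) * inverse (expoly 1 (t - 1 / 4) + expoly 1 (3 / 4 - t))"

lemma expoly_1: "0 <= expoly 1 t" "0 < t ==> 0 < expoly 1 t" "t <= 0 ==> expoly 1 t = 0"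
	by (auto simp: expoly_def)

lemma sstep_denom_pos: "0 < expoly 1 (t - 1 / 4) + expoly 1 (3 / 4 - t)"
	using expoly_1(1)[of "t - 1/4"] expoly_1(1)[of "3/4 - t"] expoly_1(2)[of "t - 1/4"] expoly_1(2)[of "3/4 - t"]
	by (cases "t > 1/4") (auto intro: add_pos_nonneg add_nonneg_pos)

lemma smo1_sstep: "smo1 sstep"
proof -
	let ?d = "%t. expoly 1 (t - 1 / 4) + expoly 1 (3 / 4 - t)"
	have a: "smo1 (%t. expoly 1 (t - 1 / 4))" using smo1_affine[OF smo1_expoly[of 1], of 1 "-1/4"] by simp
	have b: "smo1 (%t. expoly 1 (3 / 4 - t))" using smo1_affine[OF smo1_expoly[of 1], of "-1" "3/4"] by (simp add: add.commute)
	have d: "smo1 ?d" by (rule smo_intros(1)[OF a b])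
	have "lbd {()} (%_ t. inverse (?d t))"
		unfolding lbd_def
	proof
		fix r :: real
		have "continuous_on {-r..r} (%t. inverse (?d t))"
			by (intro continuous_on_inverse DERIV_continuous_on[OF has_field_derivative_at_within[OF smo1_D[OF d, of 0, simplified]]])
					(use sstep_denom_pos in "simp add: less_imp_neq[symmetric]")
		thus "EX B. ALL b:{()}. ALL t. abs t <= r --> abs (inverse (?d t)) <= B" using bounded_on_sym by blast
	qed
	hence "smo1 (%t. inverse (?d t))"
		using d sstep_denom_pos unfolding smo_def by (intro allI sm_inverse) (auto simp: less_imp_neq[symmetric])
	from smo_intros(3)[OF a this] show ?thesis by (simp add: sstep_def[abs_def])
qed

lemma sstep_0: "t <= 1 / 4 ==> sstep t = 0" by (simp add: sstep_def expoly_1)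
lemma sstep_1: assumes "3 / 4 <= t" shows "sstep t = 1"
	using sstep_denom_pos[of t] assms by (simp add: sstep_def expoly_1(3)[of "3/4 - t"])

section \<open>Averaging kernels\<close>

text \<open>The binomial coefficient comes from expanding \<open>(xii - t)^k\<close> in powers of
  \<open>xii\<close>; the rest is the normalization of the Taylor kernel.\<close>

definition kerc :: "nat => nat => real" where "kerc k j = (-1) ^ k / fact k * real (k choose j)"

text \<open>The coefficients, as polynomials in \<open>xii\<close>, of the averaged Taylor kernel
	\<open>(-1)^k / k! (d/dt)^(k+1) [(xii - t)^k V(t)]\<close> for the smooth step \<open>V(t) = sstep ((t - b) / w)\<close>. It has compact
	support and integral 1. The difference of two such kernels is the \<open>k\<close>-th derivative of \<open>kU\<close>, a function
	with compact support and integral 0.\<close>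
definition kT :: "nat => nat => real => real => real => real" where
	"kT k j b w t = kerc k j * (deriv ^^ Suc k) (%t. (- t) ^ (k - j) * sstep ((t - b) / w)) t"

definition kU :: "nat => nat => real => real => real => real" where
	"kU k j b b' t = kerc k j * deriv (%t. (- t) ^ (k - j) * sstep ((t - b) / 1) - (- t) ^ (k - j) * sstep ((t - b') / 2)) t"

lemma smo1_pow: "smo1 (%t. (a - t) ^ i)"
	by (rule smo_intros(5)[OF smo_intros(2)[OF smo_intros(6) smo_intros(7)]])

lemma smo1_step: "smo1 (%t. sstep ((t - b) / w))"
	using smo1_affine[OF smo1_sstep, of "1 / w" "- b / w"] by (simp add: diff_divide_distrib)

lemma smo1_powstep: "smo1 (%t. (a - t) ^ i * sstep ((t - b) / w))"
	by (rule smo_intros(3)[OF smo1_pow smo1_step])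

lemma smo1_powstep0: "smo1 (%t. (- t) ^ i * sstep ((t - b) / w))"
	using smo1_powstep[of 0] by simp

lemma smo1_derivs: "smo1 f ==> smo1 ((deriv ^^ m) f)"
	using smo_derivs[of "{()}" "%_. f"] by simp

lemma smo1_deriv: "smo1 f ==> smo1 (deriv f)"
	using smo1_derivs[of f 1] by simp

lemma smo1_kT: "smo1 (kT k j b w)"
	unfolding kT_def[abs_def] by (rule smo_intros(4)[OF smo1_derivs[OF smo1_powstep0]])

lemma smo1_kU: "smo1 (kU k j b b')"
	unfolding kU_def[abs_def]
	by (rule smo_intros(4)[OF smo1_deriv[OF smo_intros(2)[OF smo1_powstep0 smo1_powstep0]]])

lemma derivs_kU: "(deriv ^^ k) (kU k j b b') = (%t. kT k j b 1 t - kT k j b' 2 t)"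
proof -
	let ?f = "%t. (- t) ^ (k - j) * sstep ((t - b) / 1)"
	let ?g = "%t. (- t) ^ (k - j) * sstep ((t - b') / 2)"
	have s: "smo1 ?f" "smo1 ?g" by (rule smo1_powstep0)+
	have d: "smo1 (deriv (%t. ?f t - ?g t))" by (rule smo1_deriv[OF smo_intros(2)[OF s]])
	have "(deriv ^^ k) (kU k j b b') = (%t. kerc k j * (deriv ^^ k) (deriv (%t. ?f t - ?g t)) t)"
		unfolding kU_def[abs_def] by (rule derivs_cmult[OF d])
	also have "(deriv ^^ k) (deriv (%t. ?f t - ?g t)) = (deriv ^^ Suc k) (%t. ?f t - ?g t)"
		by (simp only: funpow_Suc_right o_apply)
	also have "... = (%t. (deriv ^^ Suc k) ?f t - (deriv ^^ Suc k) ?g t)" by (rule derivs_diff[OF s])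
	finally show ?thesis by (simp add: kT_def right_diff_distrib fun_eq_iff del: funpow.simps)
qed

lemma powstep_low: "t < b + w / 4 ==> 0 < w ==> (deriv ^^ m) (%t. (a - t) ^ i * sstep ((t - b) / w)) t = 0"
proof -
	assume t: "t < b + w / 4" "0 < w"
	have "(deriv ^^ m) (%t. (a - t) ^ i * sstep ((t - b) / w)) t = (deriv ^^ m) (%t. 0 * (a - t) ^ i) t"
		by (rule derivs_cong_open[of "{..<b + w / 4}"]) (use t in "auto simp: sstep_0 field_simps")
	thus ?thesis unfolding derivs_power by simp
qed

lemma powstep_high: "t > b + 3 * w / 4 ==> 0 < w ==> (deriv ^^ m) (%t. (a - t) ^ i * sstep ((t - b) / w)) t =
		(if m <= i then (-1) ^ m * (fact i / fact (i - m)) * (a - t) ^ (i - m) else 0)"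
proof -
	assume t: "t > b + 3 * w / 4" "0 < w"
	have "(deriv ^^ m) (%t. (a - t) ^ i * sstep ((t - b) / w)) t = (deriv ^^ m) (%t. 1 * (a - t) ^ i) t"
		by (rule derivs_cong_open[of "{b + 3 * w / 4<..}"]) (use t in "auto simp: sstep_1 field_simps")
	thus ?thesis unfolding derivs_power by simp
qed

text \<open>Left of the step the function is 0; right of it, it is a polynomial of degree
  \<open>k - j\<close>, which \<open>k + 1\<close> derivatives annihilate.\<close>

lemma kT_support: "0 < w ==> t < b + w / 4 \<or> t > b + 3 * w / 4 ==> kT k j b w t = 0"
proof -
	assume "0 < w" "t < b + w / 4 \<or> t > b + 3 * w / 4"
	moreover have "~ Suc k <= k - j" by simp
	ultimately have "(deriv ^^ Suc k) (%t. (0 - t) ^ (k - j) * sstep ((t - b) / w)) t = 0"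
		using powstep_low[of t b w "Suc k" 0 "k - j"] powstep_high[of b w t "Suc k" 0 "k - j"] by argo
	thus ?thesis by (simp add: kT_def del: funpow.simps)
qed

text \<open>Only one derivative is taken here, so a single step would in general leave a polynomial
  on the right. It is the difference of the two steps that vanishes there.\<close>

lemma kU_support:
	assumes "(t < b + 1 / 4 & t < b' + 1 / 2) \<or> (t > b + 3 / 4 & t > b' + 3 / 2)"
	shows "kU k j b b' t = 0"
proof -
	let ?g = "%t. (- t) ^ (k - j) * sstep ((t - b) / 1) - (- t) ^ (k - j) * sstep ((t - b') / 2)"
	have "(deriv ^^ 1) ?g t = (deriv ^^ 1) (%t. 0 * (0 - t) ^ 0) t"
	proof (rule derivs_cong_open[of "{..<min (b + 1 / 4) (b' + 1 / 2)} Un {max (b + 3 / 4) (b' + 3 / 2)<..}"])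
		fix t assume "t : {..<min (b + 1 / 4) (b' + 1 / 2)} Un {max (b + 3 / 4) (b' + 3 / 2)<..}"
		thus "?g t = 0 * (0 - t) ^ 0" by (auto simp: sstep_0 sstep_1)
	qed (use assms in auto)
	thus ?thesis unfolding kU_def derivs_power by simp
qed

abbreviation brange :: "real set" where "brange == {-3..2}"

text \<open>Smoothness with the offsets as parameters bounds the kernels uniformly for
  \<open>abs t <= 10\<close>, and outside they vanish. The range \<open>brange\<close> is the one
  needed by \<open>bch_range\<close> and \<open>bpa_range\<close>.\<close>

lemma kT_kU_bound:
	"EX B>=1. ALL j<=k. ALL b:brange. ALL b':brange. ALL w:{1, 2}. ALL t. abs (kT k j b w t) <= B & abs (kU k j b b' t) <= B"
proof -
	let ?P = "brange \<times> brange \<times> {1, 2 :: real}"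
	have st: "smo ?P (%(b, b', w) t. sstep ((t - b) / w))"
	proof -
		have "smo ?P (%p t. sstep ((1 / snd (snd p)) * t + (- fst p / snd (snd p))))"
			by (rule smo_affine[OF smo1_sstep, where p = "%_. ()" and K = 3]) auto
		thus ?thesis by (simp add: case_prod_unfold diff_divide_distrib)
	qed
	have st2: "smo ?P (%(b, b', w) t. sstep ((t - b') / 2))" 
	proof -
		have "smo ?P (%p t. sstep ((1 / 2) * t + (- fst (snd p) / 2)))"
			by (rule smo_affine[OF smo1_sstep, where p = "%_. ()" and K = 3]) auto
		thus ?thesis by (simp add: case_prod_unfold diff_divide_distrib)
	qed
	have st1: "smo ?P (%(b, b', w) t. sstep ((t - b) / 1))"
	proof -
		have "smo ?P (%p t. sstep (1 * t + (- fst p)))"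
			by (rule smo_affine[OF smo1_sstep, where p = "%_. ()" and K = 3]) auto
		thus ?thesis by (simp add: case_prod_unfold diff_divide_distrib)
	qed
	have pw: "smo ?P (%p t. (- t) ^ i)" for i
		using smo_intros(5)[OF smo_intros(2)[OF smo_intros(6)[of ?P 0] smo_intros(7)]] by simp
	have T: "smo ?P (%(b, b', w). kT k j b w)" for j
		using smo_intros(4)[OF smo_derivs[OF smo_intros(3)[OF pw[of "k - j"] st], of "Suc k"], of "kerc k j"]
		by (simp add: case_prod_unfold kT_def[abs_def])
	have U: "smo ?P (%(b, b', w). kU k j b b')" for j
		using smo_intros(4)[OF smo_derivs[OF smo_intros(2)[OF smo_intros(3)[OF pw[of "k - j"] st1] smo_intros(3)[OF pw[of "k - j"] st2]], of 1], of "kerc k j"]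
		by (simp add: case_prod_unfold kU_def[abs_def])
	have "EX B. ALL b:brange. ALL b':brange. ALL w:{1, 2}. ALL t. abs (kT k j b w t) <= B & abs (kU k j b b' t) <= B" for j
	proof -
		obtain B1 where B1: "ALL p:?P. ALL t. abs t <= 10 --> abs ((%(b, b', w). kT k j b w) p t) <= B1"
			using sm_lbd[of ?P 0, OF T[of j, unfolded smo_def, rule_format]] unfolding lbd_def by meson
		obtain B2 where B2: "ALL p:?P. ALL t. abs t <= 10 --> abs ((%(b, b', w). kU k j b b') p t) <= B2"
			using sm_lbd[of ?P 0, OF U[of j, unfolded smo_def, rule_format]] unfolding lbd_def by meson
		show ?thesis
		proof (intro exI[of _ "abs B1 + abs B2"] ballI allI)
			fix b b' w t :: real assume p: "b : brange" "b' : brange" "w : {1, 2}"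
			show "abs (kT k j b w t) <= abs B1 + abs B2 & abs (kU k j b b' t) <= abs B1 + abs B2"
			proof (cases "abs t <= 10")
				case True
				have "abs (kT k j b w t) <= B1" "abs (kU k j b b' t) <= B2" using B1 B2 p True by auto
				thus ?thesis by linarith
			next
				case False
				have "kT k j b w t = 0" by (rule kT_support) (use p False in auto)
				moreover have "kU k j b b' t = 0" by (rule kU_support) (use p False in auto)
				ultimately show ?thesis by simp
			qed
		qed
	qed
	then obtain B where B: "!!j. ALL b:brange. ALL b':brange. ALL w:{1, 2}. ALL t. abs (kT k j b w t) <= B j & abs (kU k j b b' t) <= B j" by metis
	have m: "B j <= Max (insert 1 (B ` {..k}))" if "j <= k" for j using that by (intro Max_ge) auto
	show ?thesis
	proof (intro exI[of _ "Max (insert 1 (B ` {..k}))"] conjI allI impI ballI)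
		fix j b b' w t assume "j <= k" "b : brange" "b' : brange" "w : {1, 2 :: real}"
		thus "abs (kT k j b w t) <= Max (insert 1 (B ` {..k}))" "abs (kU k j b b' t) <= Max (insert 1 (B ` {..k}))"
			using B m order_trans by blast+
	qed auto
qed

lemma kT_sum: "(SUM j<=k. xii ^ j * kT k j b w t) = (-1) ^ k / fact k * (deriv ^^ Suc k) (%t. (xii - t) ^ k * sstep ((t - b) / w)) t"
proof -
	let ?g = "%j t. (real (k choose j) * xii ^ j) * ((- t) ^ (k - j) * sstep ((t - b) / w))"
	have "(%t. (xii - t) ^ k * sstep ((t - b) / w)) = (%t. SUM j<=k. ?g j t)"
	proof
		fix t
		have "(xii - t) ^ k = (SUM j<=k. real (k choose j) * xii ^ j * (- t) ^ (k - j))"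
			using binomial_ring[of xii "- t" k] by simp
		thus "(xii - t) ^ k * sstep ((t - b) / w) = (SUM j<=k. ?g j t)"
			by (simp add: sum_distrib_right mult.assoc)
	qed
	moreover have "(deriv ^^ Suc k) (%t. SUM j<=k. ?g j t) = (%t. SUM j<=k. (deriv ^^ Suc k) (?g j) t)"
		by (rule conjunct2[OF derivs_sum]) (auto intro: smo_intros(4)[OF smo1_powstep0])
	moreover have "(deriv ^^ Suc k) (?g j) = (%t. (real (k choose j) * xii ^ j) * (deriv ^^ Suc k) (%t. (- t) ^ (k - j) * sstep ((t - b) / w)) t)" for j
		by (rule derivs_cmult[OF smo1_powstep0])
	ultimately show ?thesis
		by (simp add: kT_def kerc_def sum_distrib_left mult_ac del: funpow.simps)
qed

text \<open>Under the substitution the factor \<open>(xii - t)^k\<close> contributes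
  \<open>2^k\<close> and the \<open>k + 1\<close> derivatives contribute \<open>2^(-k-1)\<close>,
  which leaves \<open>1/2\<close>. With \<open>e\<close> the parity of a cell index, this rewrites a
  window of double width in the coordinates of the child as a window of width 1 in those of the
  parent.\<close>

lemma kT_scale: "(SUM j<=k. xii ^ j * kT k j b 2 t) = (1 / 2) * (SUM j<=k. ((xii + e) / 2) ^ j * kT k j ((b + e) / 2) 1 ((t + e) / 2))"
proof -
	let ?H = "%s. ((xii + e) / 2 - s) ^ k * sstep ((s - (b + e) / 2) / 1)"
	have "(%t. (xii - t) ^ k * sstep ((t - b) / 2)) = (%t. 2 ^ k * ?H (1 / 2 * t + e / 2))"
	proof
		fix t
		have "((xii + e) / 2 - (1 / 2 * t + e / 2)) = (xii - t) / 2" "(1 / 2 * t + e / 2 - (b + e) / 2) / 1 = (t - b) / 2"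
			by (simp_all add: field_simps)
		thus "(xii - t) ^ k * sstep ((t - b) / 2) = 2 ^ k * ?H (1 / 2 * t + e / 2)"
			by (simp only: power_divide) simp
	qed
	moreover have "(deriv ^^ Suc k) (%t. 2 ^ k * ?H (1 / 2 * t + e / 2)) = (%t. 2 ^ k * (deriv ^^ Suc k) (%t. ?H (1 / 2 * t + e / 2)) t)"
		by (rule derivs_cmult[OF smo1_affine[OF smo1_powstep]])
	moreover have "(deriv ^^ Suc k) (%t. ?H (1 / 2 * t + e / 2)) = (%t. (1 / 2) ^ Suc k * (deriv ^^ Suc k) ?H (1 / 2 * t + e / 2))"
		by (rule derivs_affine[OF smo1_powstep])
	ultimately have 1: "(deriv ^^ Suc k) (%t. (xii - t) ^ k * sstep ((t - b) / 2)) t = 2 ^ k * ((1 / 2) ^ Suc k * (deriv ^^ Suc k) ?H (1 / 2 * t + e / 2))"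
		by (simp only:)
	have "(2::real) ^ k * (1 / 2) ^ Suc k = 1 / 2" by (simp add: power_one_over)
	hence 2: "2 ^ k * ((1 / 2) ^ Suc k * D) = (1 / 2) * D" for D :: real by (simp only: mult.assoc[symmetric])
	have 3: "1 / 2 * t + e / 2 = (t + e) / 2" by simp
	show ?thesis unfolding kT_sum 1 2 3 by (simp only: mult_ac)
qed

lemma integral_FTC_compact:
	fixes F f :: "real => real"
	assumes "!!t. (F has_real_derivative f t) (at t)" "!!t. isCont f t" "!!t. t < -10 \<or> t > 10 ==> f t = 0"
	shows "has_bochner_integral lborel f (F 10 - F (-10))"
proof -
	have "has_bochner_integral lborel (%x. indicator {-10..10} x *\<^sub>R f x) (F 10 - F (-10))"
		by (rule has_bochner_integral_FTC_Icc)
				(use assms in "auto simp: has_real_derivative_iff_has_vector_derivative[symmetric] intro: has_field_derivative_at_within DERIV_subset continuous_at_imp_continuous_on")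
	moreover have "(%x. indicator {-10..10} x *\<^sub>R f x) = f"
	proof
		fix x show "indicator {-10..10} x *\<^sub>R f x = f x"
			by (cases "x < -10 \<or> x > 10") (auto simp: assms(3) indicator_def)
	qed
	ultimately show ?thesis by simp
qed

lemma smo1_cont: "smo1 f ==> isCont f t"
	using smo1_D[of f 0 t] by (auto intro: DERIV_isCont)

text \<open>The kernel is an exact derivative, so up to its factor the integral is the change of a
  \<open>k\<close>-th derivative, from 0 on the left to that of \<open>(xii - t)^k\<close> on the
  right, which is \<open>(-1)^k * fact k\<close>.\<close>

lemma integral_kT_sum:
	assumes "b : brange"
	shows "has_bochner_integral lborel (%t. SUM j<=k. xii ^ j * kT k j b 1 t) 1"
proof -
	let ?g = "%t. (xii - t) ^ k * sstep ((t - b) / 1)"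
	let ?F = "%t. (-1) ^ k / fact k * (deriv ^^ k) ?g t"
	have g: "smo1 ?g" by (rule smo1_powstep)
	have "has_bochner_integral lborel (%t. (-1) ^ k / fact k * (deriv ^^ Suc k) ?g t) (?F 10 - ?F (-10))"
	proof (rule integral_FTC_compact)
		show "((%t. ?F t) has_real_derivative (-1) ^ k / fact k * (deriv ^^ Suc k) ?g t) (at t)" for t
			by (rule DERIV_cmult[OF smo1_D[OF g]])
		show "isCont (%t. (-1) ^ k / fact k * (deriv ^^ Suc k) ?g t) t" for t
			by (rule smo1_cont[OF smo_intros(4)[OF smo1_derivs[OF g]]])
		show "(-1) ^ k / fact k * (deriv ^^ Suc k) ?g t = 0" if "t < -10 \<or> t > 10" for t
			using that assms powstep_low[of t b 1 "Suc k" xii k] powstep_high[of b 1 t "Suc k" xii k] by auto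
	qed
	moreover have "?F 10 = 1" using powstep_high[of b 1 10 k xii k] assms by (simp add: power_mult_distrib[symmetric])
	moreover have "?F (-10) = 0" using powstep_low[of "-10" b 1 k xii k] assms by simp
	ultimately show ?thesis unfolding kT_sum by (simp only: diff_0_right)
qed

text \<open>Also an exact derivative, of a function that vanishes on both sides. The vanishing mean
  is what lets \<open>cf_bound\<close> subtract constants from the weak derivatives.\<close>

lemma integral_kU:
	assumes "b : brange" "b' : brange"
	shows "has_bochner_integral lborel (kU k j b b') 0"
proof -
	let ?g = "%t. (- t) ^ (k - j) * sstep ((t - b) / 1) - (- t) ^ (k - j) * sstep ((t - b') / 2)"
	have g: "smo1 ?g" by (rule smo_intros(2)[OF smo1_powstep0 smo1_powstep0])
	have "has_bochner_integral lborel (kU k j b b') (kerc k j * ?g 10 - kerc k j * ?g (-10))"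
	proof (rule integral_FTC_compact)
		show "((%t. kerc k j * ?g t) has_real_derivative kU k j b b' t) (at t)" for t
			unfolding kU_def using smo1_D[OF g, of 0] by (intro DERIV_cmult) simp
		show "kU k j b b' t = 0" if "t < -10 \<or> t > 10" for t
			using that assms by (intro kU_support) auto
	qed (rule smo1_cont[OF smo1_kU])
	moreover have "?g 10 = 0" using assms by (simp add: sstep_1)
	moreover have "?g (-10) = 0" using assms by (simp add: sstep_0)
	ultimately show ?thesis by simp
qed

lemma kT_integrable: assumes "b : brange" "w : {1, 2}" shows "integrable lborel (kT k j b w)"
proof -
	let ?g = "%t. (- t) ^ (k - j) * sstep ((t - b) / w)"
	have g: "smo1 ?g" by (rule smo1_powstep0)
	have "has_bochner_integral lborel (kT k j b w) (kerc k j * (deriv ^^ k) ?g 10 - kerc k j * (deriv ^^ k) ?g (-10))"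
	proof (rule integral_FTC_compact)
		show "((%t. kerc k j * (deriv ^^ k) ?g t) has_real_derivative kT k j b w t) (at t)" for t
			unfolding kT_def by (rule DERIV_cmult[OF smo1_D[OF g]])
		show "kT k j b w t = 0" if "t < -10 \<or> t > 10" for t
			using that assms by (intro kT_support) auto
	qed (rule smo1_cont[OF smo1_kT])
	thus ?thesis by (rule integrable.intros)
qed

section \<open>Tensor products of kernels\<close>

definition prodf :: "('n::finite => real => real) => real^'n => real" where
	"prodf g y = (PROD i:UNIV. g i (y $ i))"

lemma prodf_line: "prodf g (y + t *\<^sub>R axis i 1) = g i (y $ i + t) * (PROD j:UNIV - {i}. g j (y $ j))"
proof -
	have "prodf g (y + t *\<^sub>R axis i 1) = g i ((y + t *\<^sub>R axis i 1) $ i) * (PROD j:UNIV - {i}. g j ((y + t *\<^sub>R axis i 1) $ j))"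
		unfolding prodf_def by (rule prod.remove) auto
	also have "(PROD j:UNIV - {i}. g j ((y + t *\<^sub>R axis i 1) $ j)) = (PROD j:UNIV - {i}. g j (y $ j))"
		by (rule prod.cong) (auto simp: axis_def)
	finally show ?thesis by (simp add: axis_def)
qed

lemma prodf_line_deriv:
	assumes "!!j. smo1 (g j)"
	shows "((%t. prodf g (y + t *\<^sub>R axis i 1)) has_real_derivative prodf (g(i := deriv (g i))) y) (at 0)"
proof -
	have "((%t. g i (y $ i + t)) has_real_derivative deriv (g i) (y $ i)) (at 0)"
		using DERIV_chain2[OF _ DERIV_add[OF DERIV_const DERIV_ident], of "g i" "deriv (g i) (y $ i)" "y $ i" 0 UNIV] smo1_D[OF assms[of i], of 0 "y $ i"]
		by simp
	hence "((%t. g i (y $ i + t) * (PROD j:UNIV - {i}. g j (y $ j))) has_real_derivative deriv (g i) (y $ i) * (PROD j:UNIV - {i}. g j (y $ j))) (at 0)"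
		by (rule DERIV_cmult_right)
	moreover have "prodf (g(i := deriv (g i))) y = deriv (g i) (y $ i) * (PROD j:UNIV - {i}. g j (y $ j))"
		unfolding prodf_def by (subst prod.remove[of _ i]) (auto intro!: prod.cong)
	ultimately show ?thesis unfolding prodf_line by simp
qed

lemma pdl_prodf:
	assumes "!!j. smo1 (g j)"
	shows "pdl is (prodf g) = prodf (%j. (deriv ^^ count (mset is) j) (g j))"
proof (induction "is")
	case (Cons i "is")
	let ?G = "%j. (deriv ^^ count (mset is) j) (g j)"
	have "pd i (prodf ?G) = prodf (?G(i := deriv (?G i)))"
		unfolding pd_def by (intro ext DERIV_imp_deriv prodf_line_deriv smo1_derivs assms)
	also have "?G(i := deriv (?G i)) = (%j. (deriv ^^ count (mset (i # is)) j) (g j))"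
		by (auto simp: fun_eq_iff)
	finally show ?case by (simp add: Cons)
qed simp

lemma continuous_prodf: fixes g :: "'n::finite => real => real" shows "(!!j. smo1 (g j)) ==> continuous_on UNIV (prodf g)"
	unfolding prodf_def[abs_def]
proof (rule continuous_on_prod)
	fix i assume g: "!!j. smo1 (g j)"
	have "continuous_on UNIV (g i)" by (intro continuous_at_imp_continuous_on ballI smo1_cont g)
	moreover have "continuous_on UNIV (%y :: real^'n. y $ i)" by (intro continuous_intros)
	ultimately show "continuous_on UNIV (%y :: real^'n. g i (y $ i))"
		by (rule continuous_on_compose2) auto
qed

lemma test_fun_prodf:
	fixes g :: "'n::finite => real => real"
	assumes g: "!!j. smo1 (g j)" and s: "!!j t. t < lo j \<or> t > hi j ==> g j t = 0" and lh: "!!j. 0 < lo j" "!!j. hi j < 1"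
	shows "test_fun (prodf g)"
proof -
	let ?K = "cbox (\<chi> j. lo j) (\<chi> j. hi j) :: (real^'n) set"
	have "y : ?K" if "prodf g y ~= 0" for y
	proof (rule ccontr)
		assume "y ~: ?K"
		then obtain j where "y $ j < lo j \<or> y $ j > hi j" by (auto simp: mem_box_cart not_le)
		hence "g j (y $ j) = 0" by (rule s)
		thus False using that by (auto simp: prodf_def)
	qed
	hence sub: "{y. prodf g y ~= 0} \<subseteq> ?K" by auto
	have cl: "closure {y. prodf g y ~= 0} \<subseteq> ?K" by (rule closure_minimal[OF sub closed_cbox])
	have K: "?K \<subseteq> open_unit_cube"
	proof
		fix y :: "real^'n" assume "y : ?K"
		hence "lo i <= y $ i & y $ i <= hi i" for i by (simp add: mem_box_cart)
		hence "0 < y $ i & y $ i < 1" for i using lh(1)[of i] lh(2)[of i] by (meson le_less_trans less_le_trans)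
		thus "y : open_unit_cube" by (simp add: open_unit_cube_def)
	qed
	have "compact (closure {y. prodf g y ~= 0})"
		using bounded_subset[OF bounded_cbox sub] by (simp add: compact_closure)
	moreover have "continuous_on UNIV (pdl is (prodf g))" for "is"
		unfolding pdl_prodf[OF g] by (intro continuous_prodf smo1_derivs g)
	moreover have "(%t. pdl is (prodf g) (x + t *\<^sub>R axis i 1)) differentiable (at 0)" for "is" i x
		unfolding pdl_prodf[OF g] real_differentiable_def
		by (rule exI, rule prodf_line_deriv, rule smo1_derivs, rule g)
	ultimately show ?thesis unfolding test_fun_def using cl K by blast
qed

text \<open>Fubini, through the representation of \<open>lborel\<close> as an image of the product
  measure over \<open>Basis\<close>; \<open>ix\<close> translates basis vectors back into
  indices.\<close>

lemma integral_prodf: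
	assumes "!!i. integrable lborel (g i)"
	shows "has_bochner_integral lborel (prodf g :: real^'n::finite => real) (PROD i:UNIV. \<integral>t. g i t \<partial>lborel)"
proof -
	define ix where "ix b = (THE i. b = axis i (1::real))" for b :: "real^'n"
	have ix: "ix (axis i 1) = i" for i unfolding ix_def by (auto simp: axis_eq_axis)
	have Bs: "(Basis :: (real^'n) set) = range (%i. axis i 1)" by (auto simp: Basis_vec_def)
	have inj: "inj (%i::'n. axis i (1::real))" by (auto simp: inj_def axis_eq_axis)
	have p: "prodf g y = (PROD b:Basis. g (ix b) (y \<bullet> b))" for y
		unfolding Bs prod.reindex[OF inj] by (simp add: prodf_def ix cart_eq_inner_axis)
	interpret product_sigma_finite "%_::real^'n. lborel :: real measure" ..
	have i: "integrable (Pi\<^sub>M Basis (%_. lborel)) (%f. PROD b:Basis. g (ix b) (f b))"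
		by (rule product_integrable_prod) (use assms in auto)
	have e: "(\<integral>f. (PROD b:Basis. g (ix b) (f b)) \<partial>Pi\<^sub>M Basis (%_. lborel)) = (PROD b:Basis. \<integral>t. g (ix b) t \<partial>lborel)"
		by (rule product_integral_prod) (use assms in auto)
	let ?T = "%f. SUM b:Basis. f b *\<^sub>R (b :: real^'n)"
	have T: "?T : measurable (Pi\<^sub>M Basis (%_. lborel)) borel" by measurable
	have m: "prodf g : borel_measurable borel"
		unfolding p by (intro borel_measurable_prod measurable_compose[OF _ borel_measurable_integrable[OF assms]]) auto
	have c: "prodf g (?T f) = (PROD b:Basis. g (ix b) (f b))" for f
		unfolding p by (intro prod.cong refl) (simp add: inner_sum_left_Basis)
	have l: "(lborel :: (real^'n) measure) = distr (Pi\<^sub>M Basis (%_. lborel)) borel ?T"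
		by (rule lborel_eq)
	have "integrable lborel (prodf g :: real^'n => real)"
		unfolding l using integrable_distr_eq[OF T m] i by (simp add: c)
	moreover have "(\<integral>y. prodf g y \<partial>(lborel :: (real^'n) measure)) = (PROD b:(Basis :: (real^'n) set). \<integral>t. g (ix b) t \<partial>lborel)"
		unfolding l using integral_distr[OF T m] e by (simp add: c)
	moreover have "(PROD b:(Basis :: (real^'n) set). \<integral>t. g (ix b) t \<partial>lborel) = (PROD i:UNIV. \<integral>t. g i t \<partial>lborel)"
		unfolding Bs prod.reindex[OF inj] by (simp add: ix)
	ultimately show ?thesis using has_bochner_integral_integrable by metis
qed

section \<open>Local coefficients\<close>

abbreviation OC :: "(real^'n::finite) measure" where "OC == lebesgue_on open_unit_cube"

abbreviation nnOC :: "(real^'n::finite => ennreal) => ennreal" (binder "NI " 10) where "nnOC f == nn_integral OC f"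

abbreviation "mOC == borel_measurable OC"

text \<open>Side of a cell. The factor 2 appears because \<open>x + sh\<close> ranges over an
  interval of length 2, which \<open>yc\<close> rescales to the unit interval.\<close>

definition hw :: "nat => real" where "hw l = 2 / 2 ^ l"
definition crn :: "real => nat => nat => real" where "crn sh l j = real j * hw l - sh"
text \<open>Pushes a window of width \<open>h\<close> into the unit interval, so that kernels near
  the boundary still average over points of the cube.\<close>

definition clp :: "real => real => real" where "clp o' h = max 0 (min o' (1 - h))"
text \<open>Offset of the window of the cell, and in \<open>bpa\<close> of the window of its parent,
  measured from the corner of the cell in units of \<open>hw l\<close>.\<close>

definition bch :: "real => nat => nat => real" where
	"bch sh l j = (clp (crn sh l j) (hw l) - crn sh l j) / hw l"
definition bpa :: "real => nat => nat => real" where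
	"bpa sh l j = (clp (crn sh (l - 1) (j div 2)) (2 * hw l) - crn sh l j) / hw l"
definition cells :: "real => nat => ('n::finite => nat) set" where
	"cells sh l = {m. ALL i. m i < 2 ^ l & - hw l < crn sh l (m i) & crn sh l (m i) < 1}"
text \<open>\<open>kch\<close> is the kernel of the cell, \<open>kpa\<close> that of its parent
  expressed in the variables of the cell, and \<open>kth\<close> a potential whose
  \<open>k\<close>-th derivative is \<open>kch - kpa\<close> (\<open>derivs_kth\<close>).\<close>

definition kch :: "nat => real => nat => nat => nat => real => real" where
	"kch k sh l j be t = kT k be (bch sh l j) 1 ((t - crn sh l j) / hw l) / hw l"
definition kpa :: "nat => real => nat => nat => nat => real => real" where
	"kpa k sh l j be t = kT k be (bpa sh l j) 2 ((t - crn sh l j) / hw l) / hw l"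
definition kth :: "nat => real => nat => nat => nat => real => real" where
	"kth k sh l j be t = hw l ^ k * (kU k be (bch sh l j) (bpa sh l j) ((t - crn sh l j) / hw l) / hw l)"
definition nbh :: "real => nat => ('n::finite => nat) => (real^'n) set" where
	"nbh sh l m = {y : open_unit_cube. ALL i. abs (y $ i - crn sh l (m i)) <= 4 * hw l}"
abbreviation "iN t l m y == indicator (nbh t l m) y"
definition tot :: "nat => real => (real^'n::finite => real) => nat => ('n => nat) => ('n => nat) => real" where
	"tot k sh f l m be = (LINT y|OC. f y * prodf (%i. kch k sh l (m i) (be i)) y)"
definition par :: "nat => real => (real^'n::finite => real) => nat => ('n => nat) => ('n => nat) => real" where
	"par k sh f l m be = (LINT y|OC. f y * prodf (%i. kpa k sh l (m i) (be i)) y)"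
text \<open>Coefficients of the difference between the averaged Taylor polynomials of a cell and of
  its parent; level 1 takes the whole polynomial. Cells off the cube get 0, so that sums over
  \<open>cells\<close> and over \<open>Mx\<close> agree.\<close>

definition cf :: "nat => real => (real^'n::finite => real) => nat => ('n => nat) => ('n => nat) => real" where
	"cf k sh f l m be = (if m ~: cells sh l then 0 else if l <= 1 then tot k sh f l m be else tot k sh f l m be - par k sh f l m be)"
text \<open>Degree at most \<open>k\<close> in each variable separately, because the kernels are
  tensor products.\<close>

definition Bk :: "nat => ('n::finite => nat) set" where "Bk k = PiE UNIV (%_. {..k})"

lemma Bk_iff: "be : Bk k \<longleftrightarrow> (ALL i. be i <= k)" by (auto simp: Bk_def PiE_iff)
lemma finite_Bk [simp]: "finite (Bk k)" unfolding Bk_def by (intro finite_PiE) auto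

lemma hw_pos: "0 < hw l" by (simp add: hw_def)
lemma hw_Suc: "hw l = 2 * hw (Suc l)" by (simp add: hw_def)
lemma hw_le_1: "1 <= l ==> hw l <= 1" using power_increasing[of 1 l "2::real"] by (simp add: hw_def)

lemma cells_finite: "finite (cells sh l :: ('n::finite => nat) set)"
	by (rule finite_subset[of _ "PiE UNIV (%_. {..<2^l})"]) (auto simp: cells_def intro: finite_PiE)

lemma bch_range:
	assumes "1 <= l" "- hw l < crn sh l j" "crn sh l j < 1"
	shows "bch sh l j : {-1..1}" "0 <= crn sh l j + bch sh l j * hw l" "crn sh l j + bch sh l j * hw l + hw l <= 1"
proof -
	have h: "0 < hw l" "hw l <= 1" using hw_pos hw_le_1 assms by auto
	have e: "crn sh l j + bch sh l j * hw l = clp (crn sh l j) (hw l)" using h by (simp add: bch_def)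
	show "0 <= crn sh l j + bch sh l j * hw l" "crn sh l j + bch sh l j * hw l + hw l <= 1"
		unfolding e using h by (auto simp: clp_def)
	have "- hw l <= clp (crn sh l j) (hw l) - crn sh l j" "clp (crn sh l j) (hw l) - crn sh l j <= hw l"
		using assms h by (auto simp: clp_def max_def min_def)
	thus "bch sh l j : {-1..1}" unfolding bch_def using h by (simp add: field_simps)
qed

lemma crn_parent: "crn sh l (j div 2) = crn sh (Suc l) j - real (j mod 2) * hw (Suc l)"
proof -
	have "real j = 2 * real (j div 2) + real (j mod 2)"
		by (metis mult_div_mod_eq of_nat_add of_nat_mult of_nat_numeral)
	thus ?thesis by (simp add: crn_def hw_Suc[of l] algebra_simps)
qed

text \<open>The parent corner is the corner of the cell or lies \<open>hw l\<close> to its left. For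
  \<open>l >= 2\<close> the parent window of width \<open>2 * hw l\<close> still fits into the unit
  interval.\<close>

lemma bpa_range:
	assumes "2 <= l" "- hw l < crn sh l j" "crn sh l j < 1"
	shows "bpa sh l j : {-3..2}" "0 <= crn sh l j + bpa sh l j * hw l" "crn sh l j + bpa sh l j * hw l + 2 * hw l <= 1"
proof -
	obtain l' where l: "l = Suc l'" "1 <= l'" using assms(1) by (cases l) auto
	have h: "0 < hw l" "2 * hw l <= 1" using hw_pos hw_le_1[OF l(2)] hw_Suc[of l'] l by auto
	have e: "crn sh l j + bpa sh l j * hw l = clp (crn sh (l - 1) (j div 2)) (2 * hw l)" using h by (simp add: bpa_def)
	show "0 <= crn sh l j + bpa sh l j * hw l" "crn sh l j + bpa sh l j * hw l + 2 * hw l <= 1"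
		unfolding e using h by (auto simp: clp_def)
	have "real (j mod 2) = 0 \<or> real (j mod 2) = 1" by auto
	hence p: "crn sh (l - 1) (j div 2) = crn sh l j \<or> crn sh (l - 1) (j div 2) = crn sh l j - hw l"
		using crn_parent[of sh l' j] l by auto
	have "- 3 * hw l <= clp (crn sh (l - 1) (j div 2)) (2 * hw l) - crn sh l j" "clp (crn sh (l - 1) (j div 2)) (2 * hw l) - crn sh l j <= 2 * hw l"
		using assms h p by (auto simp: clp_def max_def min_def)
	thus "bpa sh l j : {-3..2}" unfolding bpa_def using h by (simp add: field_simps)
qed

lemma smo1_resc: "smo1 g ==> smo1 (%t. c * (g ((t - a) / h) / h))"
proof -
	assume g: "smo1 g"
	have "smo1 (%t. g ((1 / h) * t + - a / h))" by (rule smo1_affine[OF g])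
	from smo_intros(4)[OF this, of "c / h"] show ?thesis by (simp add: diff_divide_distrib)
qed

lemma derivs_resc:
	assumes "smo1 g" "h ~= 0"
	shows "(deriv ^^ k) (%t. h ^ k * (g ((t - a) / h) / h)) = (%t. (deriv ^^ k) g ((t - a) / h) / h)"
proof -
	have 1: "(%t. h ^ k * (g ((t - a) / h) / h)) = (%t. (h ^ k / h) * g ((1 / h) * t + - a / h))"
		by (simp add: diff_divide_distrib)
	have 2: "(deriv ^^ k) (%t. (h ^ k / h) * g ((1 / h) * t + - a / h)) = (%t. (h ^ k / h) * ((1 / h) ^ k * (deriv ^^ k) g ((1 / h) * t + - a / h)))"
		unfolding derivs_cmult[OF smo1_affine[OF assms(1)]] derivs_affine[OF assms(1)] ..
	show ?thesis unfolding 1 2 using assms(2) by (simp add: power_one_over diff_divide_distrib)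
qed

lemma smo1_kch: "smo1 (kch k sh l j be)" using smo1_resc[OF smo1_kT, of 1] by (simp add: kch_def[abs_def])
lemma smo1_kpa: "smo1 (kpa k sh l j be)" using smo1_resc[OF smo1_kT, of 1] by (simp add: kpa_def[abs_def])
lemma smo1_kth: "smo1 (kth k sh l j be)" using smo1_resc[OF smo1_kU] by (simp add: kth_def[abs_def])

lemma derivs_kth: "(deriv ^^ k) (kth k sh l j be) = (%t. kch k sh l j be t - kpa k sh l j be t)"
	unfolding kth_def[abs_def] using derivs_resc[OF smo1_kU, of "hw l" k] hw_pos[of l]
	by (simp add: derivs_kU kch_def kpa_def diff_divide_distrib)

text \<open>The quarter margins of \<open>sstep\<close> put the bounds strictly inside the unit
  interval. Offsets between -3 and 2 together with windows of width at most 2 stay within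
  \<open>4 * hw l\<close> of the corner.\<close>

lemma kernel_support:
	assumes "1 <= l" "- hw l < crn sh l j" "crn sh l j < 1"
	shows "EX lo hi. 0 < lo & hi < 1 & crn sh l j - 4 * hw l <= lo & hi <= crn sh l j + 4 * hw l &
			(ALL t. t < lo \<or> t > hi --> (ALL be. kch k sh l j be t = 0 & (2 <= l --> kpa k sh l j be t = 0 & kth k sh l j be t = 0)))"
proof -
	let ?h = "hw l" let ?o = "crn sh l j" let ?b = "bch sh l j" let ?b' = "bpa sh l j"
	have h: "0 < ?h" by (rule hw_pos)
	note b = bch_range[OF assms]
	have bh: "?b * ?h <= ?h" "- ?h <= ?b * ?h" using b(1) h mult_right_mono[of ?b 1 ?h] mult_right_mono[of "-1" ?b ?h] by auto
	show ?thesis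
	proof (cases "2 <= l")
		case False
		show ?thesis
		proof (rule exI[of _ "?o + ?b * ?h + ?h / 4"], rule exI[of _ "?o + ?b * ?h + 3 * ?h / 4"], intro conjI allI impI)
			fix t be assume t: "t < ?o + ?b * ?h + ?h / 4 \<or> ?o + ?b * ?h + 3 * ?h / 4 < t"
			have "(t - ?o) / ?h < ?b + 1 / 4 \<or> (t - ?o) / ?h > ?b + 3 * 1 / 4"
				using t h by (auto simp: field_simps)
			thus "kch k sh l j be t = 0" unfolding kch_def by (subst kT_support) auto
		qed (insert b(2,3) bh h False, linarith+)
	next
		case True
		note b' = bpa_range[OF True assms(2,3)]
		have bh': "?b' * ?h <= 2 * ?h" "- 3 * ?h <= ?b' * ?h" using b'(1) h mult_right_mono[of ?b' 2 ?h] mult_right_mono[of "-3" ?b' ?h] by auto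
		let ?lo = "min (?o + ?b * ?h + ?h / 4) (?o + ?b' * ?h + ?h / 2)"
		let ?hi = "max (?o + ?b * ?h + 3 * ?h / 4) (?o + ?b' * ?h + 3 * ?h / 2)"
		show ?thesis
		proof (rule exI[of _ ?lo], rule exI[of _ ?hi], intro conjI allI impI)
			fix t be assume t: "t < ?lo \<or> t > ?hi"
			let ?u = "(t - ?o) / ?h"
			have u: "(?u < ?b + 1 / 4 & ?u < ?b' + 1 / 2) \<or> (?u > ?b + 3 / 4 & ?u > ?b' + 3 / 2)"
				using t h by (auto simp: field_simps)
			show "kch k sh l j be t = 0" unfolding kch_def using u by (subst kT_support) auto
			show "kpa k sh l j be t = 0" unfolding kpa_def using u by (subst kT_support) auto
			show "kth k sh l j be t = 0" unfolding kth_def using u by (subst kU_support) auto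
		qed (insert b(2,3) bh b'(2,3) bh' h, linarith+)
	qed
qed

lemma kernel_bounds:
	"EX B>=1. ALL sh l j be t. be <= k --> 1 <= l --> - hw l < crn sh l j --> crn sh l j < 1 -->
		abs (kch k sh l j be t) <= B / hw l & (2 <= l --> abs (kpa k sh l j be t) <= B / hw l & abs (kth k sh l j be t) <= hw l ^ k * (B / hw l))"
proof -
	obtain B where B: "1 <= B" "ALL j<=k. ALL b:brange. ALL b':brange. ALL w:{1, 2}. ALL t. abs (kT k j b w t) <= B & abs (kU k j b b' t) <= B"
		using kT_kU_bound[of k] by auto
	show ?thesis
	proof (intro exI[of _ B] conjI allI impI B(1))
		fix sh l j be and t :: real assume a: "be <= k" "1 <= l" "- hw l < crn sh l j" "crn sh l j < 1"
		have b: "bch sh l j : brange" using bch_range(1)[OF a(2-4)] by auto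
		have "abs (kT k be (bch sh l j) 1 ((t - crn sh l j) / hw l)) <= B" using B(2) a(1) b by blast
		thus "abs (kch k sh l j be t) <= B / hw l" unfolding kch_def abs_divide using hw_pos[of l] by (simp add: divide_right_mono)
		assume l: "2 <= l"
		have b': "bpa sh l j : brange" using bpa_range(1)[OF l a(3,4)] by auto
		have "abs (kT k be (bpa sh l j) 2 ((t - crn sh l j) / hw l)) <= B" using B(2) a(1) b' by blast
		thus "abs (kpa k sh l j be t) <= B / hw l" unfolding kpa_def abs_divide using hw_pos[of l] by (simp add: divide_right_mono)
		have "abs (kU k be (bch sh l j) (bpa sh l j) ((t - crn sh l j) / hw l)) <= B" using B(2) a(1) b b' by blast
		thus "abs (kth k sh l j be t) <= hw l ^ k * (B / hw l)" unfolding kth_def abs_divide abs_mult using hw_pos[of l]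
			by (simp add: divide_right_mono)
	qed
qed

lemma prodf_bound:
	fixes g :: "'n::finite => real => real"
	assumes "!!i t. abs (g i t) <= C i"
	shows "abs (prodf g y) <= (PROD i:UNIV. C i)"
	unfolding prodf_def abs_prod by (rule prod_mono) (use assms in auto)

lemma open_unit_cube_box: "open_unit_cube = box (0::real^'n) 1"
	by (auto simp: open_unit_cube_def mem_box_cart)

lemma open_unit_cube_sets [measurable, simp]: "(open_unit_cube :: (real^'n) set) : sets lebesgue" "(open_unit_cube :: (real^'n) set) : sets borel"
	unfolding open_unit_cube_box by auto

lemma emeasure_open_unit_cube: "emeasure lebesgue (open_unit_cube :: (real^'n) set) = 1"
proof -
	have "ALL b:Basis. (1::real^'n) \<bullet> b = 1" by (auto simp: Basis_vec_def inner_axis)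
	hence "emeasure lborel (box (0::real^'n) 1) = 1" by (simp add: emeasure_lborel_box_eq cong: prod.cong)
	thus ?thesis unfolding open_unit_cube_box by simp
qed

lemma finite_measure_OC: "finite_measure (OC :: (real^'n) measure)"
	by (rule finite_measureI) (simp add: emeasure_restrict_space emeasure_open_unit_cube)

lemma prob_space_OC: "prob_space (OC :: (real^'n) measure)"
	by (rule prob_spaceI) (simp add: emeasure_restrict_space emeasure_open_unit_cube)

lemma borel_OC: "f : borel_measurable borel ==> f : borel_measurable (OC :: (real^'n) measure)"
	by (rule measurable_restrict_space1, rule measurable_completion) (simp add: measurable_lborel1)

lemma prodf_measurable: "(!!j. smo1 (g j)) ==> prodf g : mOC"
	by (intro borel_OC borel_measurable_continuous_onI continuous_prodf)

lemma integrable_mult_bounded: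
	assumes "integrable M f" "g : borel_measurable M" "!!x. abs (g x) <= (B::real)"
	shows "integrable M (%x. f x * g x :: real)"
proof (rule Bochner_Integration.integrable_bound)
	show "integrable M (%x. B * f x)" using assms(1) by simp
	show "AE x in M. norm (f x * g x) <= norm (B * f x)"
	proof (intro AE_I2)
		fix x
		have "0 <= B" using assms(3)[of x] by linarith
		thus "norm (f x * g x) <= norm (B * f x)" using assms(3)[of x] mult_left_mono[of "abs (g x)" B "abs (f x)"]
			by (simp add: abs_mult mult.commute)
	qed
qed (use assms in auto)

lemma integral_OC_lborel:
	assumes "g : borel_measurable borel" "!!y. y ~: open_unit_cube ==> g y = 0"
	shows "(\<integral>y. g y \<partial>(OC :: (real^'n) measure)) = (\<integral>y. g y \<partial>lborel :: real)"
proof -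
	have "(\<integral>y. g y \<partial>(OC :: (real^'n) measure)) = (\<integral>y. indicator open_unit_cube y *\<^sub>R g y \<partial>lebesgue)"
		by (rule integral_restrict_space) simp
	also have "(%y. indicator open_unit_cube y *\<^sub>R g y) = g" using assms(2) by (auto simp: fun_eq_iff indicator_def)
	also have "(\<integral>y. g y \<partial>lebesgue) = (LINT y|lborel. g y)" by (rule integral_completion) (use assms in simp)
	finally show ?thesis .
qed

lemma prodf_upd_diff: "prodf (g(i := a)) y - prodf (g(i := b)) y = prodf (g(i := (%t. a t - b t))) y"
proof -
	have "prodf (g(i := c)) y = c (y $ i) * (PROD j:UNIV - {i}. g j (y $ j))" for c
		unfolding prodf_def by (subst prod.remove[of _ i]) (auto intro!: prod.cong)
	thus ?thesis by (simp add: left_diff_distrib)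
qed

lemma integral_kth_0:
	assumes "2 <= l" "- hw l < crn sh l j" "crn sh l j < 1"
	shows "(LINT t|lborel. kth k sh l j be t) = 0" "integrable lborel (kth k sh l j be)"
proof -
	have b: "bch sh l j : brange" "bpa sh l j : brange" using bch_range(1)[of l sh j] bpa_range(1)[OF assms] assms by auto
	let ?g = "kU k be (bch sh l j) (bpa sh l j)"
	have h: "0 < hw l" by (rule hw_pos)
	from integral_kU[OF b] have i: "integrable lborel ?g" "(LINT t|lborel. ?g t) = 0" using has_bochner_integral_iff by blast+
	have i1: "integrable lborel (%t. ?g (- crn sh l j / hw l + (1 / hw l) * t))"
		by (rule lborel_integrable_real_affine[OF i(1)]) (use h in simp)
	have i2: "(LINT t|lborel. ?g (- crn sh l j / hw l + (1 / hw l) * t)) = 0"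
		using lborel_integral_real_affine[of "1 / hw l" ?g "- crn sh l j / hw l"] i(2) h by simp
	have e: "kth k sh l j be = (%t. (hw l ^ k / hw l) * ?g (- crn sh l j / hw l + (1 / hw l) * t))"
		by (auto simp: kth_def fun_eq_iff diff_divide_distrib add.commute)
	show "(LINT t|lborel. kth k sh l j be t) = 0" unfolding e integral_mult_right_zero i2 by simp
	show "integrable lborel (kth k sh l j be)" unfolding e by (rule integrable_mult_right) (rule i1)
qed

lemma kernel_integrable:
	assumes "1 <= l" "- hw l < crn sh l j" "crn sh l j < 1"
	shows "integrable lborel (kch k sh l j be)" "2 <= l ==> integrable lborel (kpa k sh l j be)"
proof -
	have h: "0 < hw l" by (rule hw_pos)
	have *: "integrable lborel (%t. kT k be b w ((t - crn sh l j) / hw l) / hw l)" if "b : brange" "w : {1, 2}" for b w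
	proof -
		have "integrable lborel (%t. kT k be b w (- crn sh l j / hw l + (1 / hw l) * t))"
			by (rule lborel_integrable_real_affine[OF kT_integrable[OF that]]) (use h in simp)
		thus ?thesis by (simp add: diff_divide_distrib add.commute)
	qed
	show "integrable lborel (kch k sh l j be)" unfolding kch_def[abs_def]
		by (rule *) (use bch_range(1)[OF assms] in auto)
	show "integrable lborel (kpa k sh l j be)" if "2 <= l" unfolding kpa_def[abs_def]
		by (rule *) (use bpa_range(1)[OF that assms(2,3)] in auto)
qed

lemma indicator_bound_integral:
	fixes D :: "real^'n::finite => real"
	assumes "integrable OC D" "Ps : mOC" "!!y. abs (Ps y) <= B * indicator Q y" "Q : sets OC"
	shows "abs (\<integral>y. D y * Ps y \<partial>OC) <= B * (LINT y|OC. indicator Q y * abs (D y))"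
proof -
	have B: "B * indicator Q y <= abs B" for y by (auto simp: indicator_def)
	hence b: "abs (Ps y) <= abs B" for y using assms(3)[of y] order_trans by blast
	have i1: "integrable OC (%y. D y * Ps y)" by (rule integrable_mult_bounded[OF assms(1,2) b])
	have i2: "integrable OC (%y. abs (D y) * indicator Q y)"
		by (rule integrable_mult_bounded[of _ _ _ 1]) (use assms in auto)
	have "abs (\<integral>y. D y * Ps y \<partial>OC) <= (LINT y|OC. abs (D y * Ps y))" by (rule integral_abs_bound)
	also have "... <= (LINT y|OC. B * (abs (D y) * indicator Q y))"
	proof (rule integral_mono)
		show "abs (D y * Ps y) <= B * (abs (D y) * indicator Q y)" for y
			using mult_left_mono[OF assms(3)[of y], of "abs (D y)"] by (simp add: abs_mult mult_ac)
	qed (use i1 i2 in auto)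
	finally show ?thesis by (simp add: mult.commute[of "abs _"])
qed

lemma nbh_sets: "nbh sh l m : sets (OC :: (real^'n::finite) measure)"
proof -
	have "nbh sh l m = open_unit_cube Int (\<Inter>i. {y. abs (y $ i - crn sh l (m i)) <= 4 * hw l})"
		by (auto simp: nbh_def)
	moreover have "closed {y :: real^'n. abs (y $ i - crn sh l (m i)) <= 4 * hw l}" for i
		by (intro closed_Collect_le continuous_intros)
	hence "closed (\<Inter>i. {y :: real^'n. abs (y $ i - crn sh l (m i)) <= 4 * hw l})" by auto
	hence "(\<Inter>i. {y :: real^'n. abs (y $ i - crn sh l (m i)) <= 4 * hw l}) : sets lebesgue"
		by (intro sets_completionI_sets) (simp add: borel_closed)
	ultimately have "nbh sh l m : sets lebesgue" by simp
	moreover have "nbh sh l m \<subseteq> open_unit_cube" by (auto simp: nbh_def)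
	ultimately show ?thesis by (simp add: sets_restrict_space_iff)
qed

lemma tot_bound:
	"EX C>=1. ALL sh l (m :: 'n::finite => nat) (be :: 'n => nat) f. be : Bk k --> 1 <= l --> m : cells sh l --> integrable OC f -->
			abs (tot k sh f l m be) <= C / hw l ^ CARD('n) * (LINT y|OC. iN sh l m y * abs (f y))"
proof -
	obtain B where B: "1 <= B" "ALL sh l j be t. be <= k --> 1 <= l --> - hw l < crn sh l j --> crn sh l j < 1 -->
		abs (kch k sh l j be t) <= B / hw l"
		using kernel_bounds[of k] by metis
	show ?thesis
	proof (intro exI[of _ "B ^ CARD('n)"] conjI allI impI)
		fix sh l and m :: "'n => nat" and be :: "'n => nat" and f :: "real^'n => real" assume a: "be : Bk k" "1 <= l" "m : cells sh l" "integrable OC f"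
		let ?Ps = "prodf (%i. kch k sh l (m i) (be i))"
		have m: "- hw l < crn sh l (m i)" "crn sh l (m i) < 1" for i using a by (auto simp: cells_def)
		have b: "abs (?Ps y) <= (B / hw l) ^ CARD('n)" for y
			using prodf_bound[of "%i. kch k sh l (m i) (be i)" "%_. B / hw l"] B(2) a m by (auto simp: Bk_iff)
		have z: "?Ps y = 0" if "y ~: nbh sh l m" for y
		proof -
			have "EX i. kch k sh l (m i) (be i) (y $ i) = 0"
			proof (rule ccontr)
				assume n: "~ ?thesis"
				have "0 < y $ i & y $ i < 1 & abs (y $ i - crn sh l (m i)) <= 4 * hw l" for i
				proof -
					obtain lo hi where "0 < lo" "hi < 1" "crn sh l (m i) - 4 * hw l <= lo" "hi <= crn sh l (m i) + 4 * hw l"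
						"ALL t. t < lo \<or> t > hi --> (ALL be. kch k sh l (m i) be t = 0)" using kernel_support[OF a(2) m, of i k] by metis
					moreover from this have "lo <= y $ i & y $ i <= hi" using n by (meson not_le)
					ultimately show ?thesis by linarith
				qed
				thus False using that by (auto simp: nbh_def open_unit_cube_def)
			qed
			thus ?thesis by (auto simp: prodf_def)
		qed
		have "abs (?Ps y) <= (B / hw l) ^ CARD('n) * iN sh l m y" for y
			using b[of y] z[of y] by (auto simp: indicator_def)
		from indicator_bound_integral[OF a(4) prodf_measurable this nbh_sets]
		show "abs (tot k sh f l m be) <= B ^ CARD('n) / hw l ^ CARD('n) * (LINT y|OC. iN sh l m y * abs (f y))"
			by (simp add: tot_def smo1_kch power_divide)
	qed (use B in auto)
qed

text \<open>The product kernel of the parent is turned into that of the cell one coordinate at a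
  time. Changing coordinate \<open>i\<close> inserts \<open>kch - kpa\<close> there, the
  \<open>k\<close>-th derivative of \<open>kth\<close>, so the weak derivative \<open>D i\<close>
  can be used; since \<open>kth\<close> has mean 0, any constant \<open>a i\<close> may be
  subtracted from \<open>D i\<close>. Only pure derivatives occur, and the gain
  \<open>hw l ^ k\<close> is the scale of \<open>kth\<close>.\<close>

lemma cf_bound:
	"EX C>=1. ALL sh l (m :: 'n::finite => nat) (be :: 'n => nat) f (D :: 'n => real^'n => real) a. be : Bk k --> 2 <= l --> m : cells sh l --> integrable OC f -->
			(ALL i. integrable OC (D i)) -->
			(ALL ph i. test_fun ph --> (LINT x|OC. f x * pdl (replicate k i) ph x) = (-1) ^ k * (LINT x|OC. D i x * ph x)) -->
			abs (cf k sh f l m be) <= C * hw l ^ k / hw l ^ CARD('n) * (SUM i:UNIV. \<integral>y. iN sh l m y * abs (D i y - a i) \<partial>OC)"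
proof -
	obtain B where B: "1 <= B" "ALL sh l j be t. be <= k --> 1 <= l --> - hw l < crn sh l j --> crn sh l j < 1 -->
		abs (kch k sh l j be t) <= B / hw l & (2 <= l --> abs (kpa k sh l j be t) <= B / hw l & abs (kth k sh l j be t) <= hw l ^ k * (B / hw l))"
		using kernel_bounds[of k] by metis
	show ?thesis
	proof (intro exI[of _ "B ^ CARD('n)"] conjI allI impI)
		fix sh l and m :: "'n => nat" and be :: "'n => nat" and f :: "real^'n => real" and D :: "'n => real^'n => real" and a
		assume as: "be : Bk k" "2 <= l" "m : cells sh l" "integrable OC f" "ALL i. integrable OC (D i)"
			and weak: "ALL ph i. test_fun ph --> (LINT x|OC. f x * pdl (replicate k i) ph x) = (-1) ^ k * (LINT x|OC. D i x * ph x)"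
		let ?h = "hw l"
		have h: "0 < ?h" by (rule hw_pos)
		have l1: "1 <= l" using as by simp
		have m: "- hw l < crn sh l (m i)" "crn sh l (m i) < 1" for i using as by (auto simp: cells_def)
		have be: "be i <= k" for i using as(1) by (simp add: Bk_iff)
		have kb: "abs (kch k sh l (m i) (be i) t) <= B / ?h" "abs (kpa k sh l (m i) (be i) t) <= B / ?h" "abs (kth k sh l (m i) (be i) t) <= ?h ^ k * (B / ?h)" for i t
			using B(2)[THEN spec[of _ sh], THEN spec[of _ l], THEN spec[of _ "m i"], THEN spec[of _ "be i"], THEN spec[of _ t]]
				be[of i] l1 m[of i] as(2) by blast+
		obtain lo hi where lh: "!!i. 0 < lo i" "!!i. hi i < 1" "!!i. crn sh l (m i) - 4 * ?h <= lo i" "!!i. hi i <= crn sh l (m i) + 4 * ?h"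
			"!!i t. t < lo i \<or> t > hi i ==> kch k sh l (m i) (be i) t = 0"
			"!!i t. t < lo i \<or> t > hi i ==> kpa k sh l (m i) (be i) t = 0"
			"!!i t. t < lo i \<or> t > hi i ==> kth k sh l (m i) (be i) t = 0"
		proof -
			have "ALL i. EX lo hi. 0 < lo & hi < 1 & crn sh l (m i) - 4 * hw l <= lo & hi <= crn sh l (m i) + 4 * hw l &
				(ALL t. t < lo \<or> t > hi --> (ALL be. kch k sh l (m i) be t = 0 & kpa k sh l (m i) be t = 0 & kth k sh l (m i) be t = 0))"
				using kernel_support[OF l1 m, of _ k] as(2) by meson
			from choice[OF this] obtain lo where "ALL i. EX hi. 0 < lo i & hi < 1 & crn sh l (m i) - 4 * hw l <= lo i & hi <= crn sh l (m i) + 4 * hw l &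
				(ALL t. t < lo i \<or> t > hi --> (ALL be. kch k sh l (m i) be t = 0 & kpa k sh l (m i) be t = 0 & kth k sh l (m i) be t = 0))" ..
			from choice[OF this] obtain hi where "ALL i. 0 < lo i & hi i < 1 & crn sh l (m i) - 4 * hw l <= lo i & hi i <= crn sh l (m i) + 4 * hw l &
				(ALL t. t < lo i \<or> t > hi i --> (ALL be. kch k sh l (m i) be t = 0 & kpa k sh l (m i) be t = 0 & kth k sh l (m i) be t = 0))" ..
			thus ?thesis using that[of lo hi] by blast
		qed
		\<comment> \<open>Coordinates in \<open>S\<close> already carry the kernel of the cell;
		  \<open>S = {}\<close> gives \<open>par\<close> and \<open>S = UNIV\<close> gives
		  \<open>tot\<close>.\<close>
		define g where "g S i = (if i : S then kch k sh l (m i) (be i) else kpa k sh l (m i) (be i))" for S i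
		define MS where "MS S = (LINT y|OC. f y * prodf (g S) y)" for S
		have sg: "smo1 (g S i)" for S i by (simp add: g_def smo1_kch smo1_kpa)
		have gb: "abs (g S i t) <= B / ?h" for S i t using kb by (simp add: g_def)
		have gs: "g S i t = 0" if "t < lo i \<or> t > hi i" for S i t using lh(5,6)[OF that] by (simp add: g_def)
		have ig: "integrable OC (%y. f y * prodf (g S) y)" for S
			by (rule integrable_mult_bounded[OF as(4) prodf_measurable[OF sg] prodf_bound[OF gb]])
		let ?C = "B ^ CARD('n) * ?h ^ k / ?h ^ CARD('n)"
		let ?E = "%i. \<integral>y. iN sh l m y * abs (D i y - a i) \<partial>OC"
		have step: "abs (MS (insert i S) - MS S) <= ?C * ?E i" if i: "i ~: S" for i S
		proof -
			let ?g = "(g S)(i := kth k sh l (m i) (be i))"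
			let ?Ps = "prodf ?g"
			have sPs: "smo1 (?g j)" for j using sg smo1_kth by (simp)
			have zPs: "?g j t = 0" if "t < lo j \<or> t > hi j" for j t using gs[OF that] lh(7)[OF that] by auto
			have tf: "test_fun ?Ps" by (rule test_fun_prodf[OF sPs zPs lh(1,2)])
			have "g (insert i S) = (g S)(i := kch k sh l (m i) (be i))" "g S = (g S)(i := kpa k sh l (m i) (be i))"
				using i by (auto simp: g_def fun_eq_iff)
			hence "prodf (g (insert i S)) y - prodf (g S) y = prodf ((g S)(i := (%t. kch k sh l (m i) (be i) t - kpa k sh l (m i) (be i) t))) y" for y
				using prodf_upd_diff by metis
			also have "(g S)(i := (%t. kch k sh l (m i) (be i) t - kpa k sh l (m i) (be i) t)) = (%j. (deriv ^^ count (mset (replicate k i)) j) (?g j))"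
				by (auto simp: fun_eq_iff derivs_kth)
			finally have "prodf (g (insert i S)) y - prodf (g S) y = pdl (replicate k i) ?Ps y" for y
				unfolding pdl_prodf[OF sPs] .
			hence "MS (insert i S) - MS S = (LINT y|OC. f y * pdl (replicate k i) ?Ps y)"
				unfolding MS_def using ig by (subst Bochner_Integration.integral_diff[symmetric]) (auto simp: right_diff_distrib[symmetric])
			also have "... = (-1) ^ k * (LINT y|OC. D i y * ?Ps y)" using weak tf by blast
			finally have e1: "abs (MS (insert i S) - MS S) = abs (\<integral>y. D i y * ?Ps y \<partial>OC)" by (simp add: abs_mult)
			have bPs: "abs (?Ps y) <= ?C" for y
			proof -
				have "abs (?Ps y) <= (PROD j:UNIV. if j = i then ?h ^ k * (B / ?h) else B / ?h)"
					by (rule prodf_bound) (use gb kb(3) in auto)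
				also have "... = ?h ^ k * (B / ?h) * (PROD j:UNIV - {i}. B / ?h)"
					by (subst prod.remove[of _ i]) (auto intro!: prod.cong)
				also have "... = ?h ^ k * (PROD j:(UNIV :: 'n set). B / ?h)"
					by (subst (2) prod.remove[of _ i]) auto
				also have "... = ?C" by (simp add: power_divide)
				finally show ?thesis .
			qed
			have z: "?Ps y = 0" if "y ~: nbh sh l m" for y
			proof -
				have "EX j. ?g j (y $ j) = 0"
				proof (rule ccontr)
					assume n: "~ ?thesis"
					have "0 < y $ j & y $ j < 1 & abs (y $ j - crn sh l (m j)) <= 4 * ?h" for j
					proof -
						have "lo j <= y $ j & y $ j <= hi j" using n zPs by (meson not_le)
						thus ?thesis using lh(1-4)[of j] by linarith
					qed
					thus False using that by (auto simp: nbh_def open_unit_cube_def)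
				qed
				thus ?thesis unfolding prodf_def by (metis (mono_tags, lifting) UNIV_I finite prod_zero)
			qed
			have b2: "abs (?Ps y) <= ?C * iN sh l m y" for y
				using bPs[of y] z[of y] by (auto simp: indicator_def)
			have "(LINT y|OC. ?Ps y) = (LINT y|lborel. ?Ps y)"
				by (rule integral_OC_lborel) (use z in "auto intro!: borel_measurable_continuous_onI continuous_prodf sPs simp: nbh_def")
			also have "... = (PROD j:UNIV. \<integral>t. ?g j t \<partial>lborel)"
			proof (rule has_bochner_integral_integral_eq, rule integral_prodf)
				show "integrable lborel (?g j)" for j
					using kernel_integrable(1)[OF l1 m] kernel_integrable(2)[OF l1 m as(2)] integral_kth_0(2)[OF as(2) m] by (auto simp: g_def)
			qed
			also have "... = 0" using integral_kth_0(1)[OF as(2) m(1)[of i] m(2)[of i], where k = k and be = "be i"] by (intro prod_zero bexI[of _ i]) auto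
			finally have i0: "(LINT y|OC. ?Ps y) = 0" .
			interpret finite_measure "OC :: (real^'n) measure" by (rule finite_measure_OC)
			have c: "integrable (OC :: (real^'n) measure) (%y. a i)" by simp
			have "(LINT y|OC. (D i y - a i) * ?Ps y) = (LINT y|OC. D i y * ?Ps y) - (LINT y|OC. a i * ?Ps y)"
				unfolding left_diff_distrib
				by (rule Bochner_Integration.integral_diff; rule integrable_mult_bounded[OF _ prodf_measurable[OF sPs] bPs])
					(use as(5) c in auto)
			hence e2: "(LINT y|OC. D i y * ?Ps y) = (LINT y|OC. (D i y - a i) * ?Ps y)" by (simp add: i0)
			show ?thesis unfolding e1 e2
				by (rule indicator_bound_integral[OF _ prodf_measurable[OF sPs] b2 nbh_sets]) (use as(5) c in auto)
		qed
		have "abs (MS S - MS {}) <= ?C * (SUM i:S. ?E i)" for S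
		proof (induction S rule: finite_induct[OF finite])
			case (2 i S)
			hence "abs (MS (insert i S) - MS {}) <= ?C * ?E i + ?C * (SUM i:S. ?E i)" using step[of i S] by linarith
			thus ?case using 2 by (simp add: distrib_left)
		qed simp
		from this[of UNIV] show "abs (cf k sh f l m be) <= ?C * (SUM i:UNIV. ?E i)"
			using as(2,3) by (simp add: cf_def tot_def par_def MS_def g_def[abs_def])
	qed (use B in auto)
qed

section \<open>Oscillation bounds\<close>

lemma card_nat_near: "card {j::nat. abs (c - real j) <= 4} <= 9"
proof -
	have "{j::nat. abs (c - real j) <= 4} \<subseteq> nat ` {ceiling (c - 4)..floor (c + 4)}"
	proof
		fix j assume "j : {j::nat. abs (c - real j) <= 4}"
		hence "ceiling (c - 4) <= int j" "int j <= floor (c + 4)" by (auto simp: abs_le_iff; linarith)+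
		thus "j : nat ` {ceiling (c - 4)..floor (c + 4)}" by (intro image_eqI[of _ _ "int j"]) auto
	qed
	hence "card {j::nat. abs (c - real j) <= 4} <= card (nat ` {ceiling (c - 4)..floor (c + 4)})" by (intro card_mono) auto
	also have "... <= card {ceiling (c - 4)..floor (c + 4)}" by (rule card_image_le) simp
	also have "... <= 9"
	proof -
		have "floor (c) - ceiling (c) <= 0" by linarith
		thus ?thesis by (simp add: nat_le_iff)
	qed
	finally show ?thesis .
qed

lemma finite_nat_near: "finite {j::nat. abs (c - real j) <= 4}"
proof (rule finite_subset)
	show "{j::nat. abs (c - real j) <= 4} \<subseteq> {..nat (ceiling (c + 4))}" by (auto simp: abs_le_iff) linarith
qed simp

text \<open>In each coordinate at most 9 integers lie within distance 4 of a given number.\<close>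

lemma nbh_overlap: "card {m : cells sh l. (y::real^'n::finite) : nbh sh l m} <= 9 ^ CARD('n)"
proof -
	let ?A = "%i. {j::nat. abs ((y $ i + sh) / hw l - real j) <= 4}"
	have h: "0 < hw l" by (rule hw_pos)
	have "{m : cells sh l. y : nbh sh l m} \<subseteq> PiE UNIV ?A"
	proof
		fix m assume "m : {m : cells sh l. y : nbh sh l m}"
		hence *: "abs (y $ i - crn sh l (m i)) <= 4 * hw l" for i by (auto simp: nbh_def)
		have "abs ((y $ i + sh) / hw l - real (m i)) <= 4" for i
		proof -
			have "(y $ i + sh) / hw l - real (m i) = (y $ i - crn sh l (m i)) / hw l" using h by (simp add: crn_def field_simps)
			thus ?thesis using *[of i] h by (simp add: abs_divide field_simps)
		qed
		thus "m : PiE UNIV ?A" by (simp add: PiE_iff)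
	qed
	hence "card {m : cells sh l. y : nbh sh l m} <= card (PiE UNIV ?A)"
		by (intro card_mono finite_PiE) (use finite_nat_near in auto)
	also have "... = (PROD i:UNIV. card (?A i))" by (rule card_PiE) simp
	also have "... <= (PROD i:(UNIV::'n set). 9)" by (intro prod_mono) (use card_nat_near in auto)
	finally show ?thesis by simp
qed

lemma nbh_sum:
	fixes G :: "real^'n::finite => ennreal"
	assumes [measurable]: "G : mOC"
	shows "(SUM m:cells sh l. \<integral>\<^sup>+y. iN sh l m y * G y \<partial>OC) <= 9 ^ CARD('n) * (NI y. G y)"
proof -
	note [measurable] = nbh_sets
	have "(SUM m:cells sh l. \<integral>\<^sup>+y. iN sh l m y * G y \<partial>OC) = (NI y. (SUM m:cells sh l. iN sh l m y * G y))"
		by (rule nn_integral_sum[symmetric]) measurable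
	also have "... <= (NI y. 9 ^ CARD('n) * G y)"
	proof (rule nn_integral_mono)
		fix y :: "real^'n"
		have "(SUM m:cells sh l. iN sh l m y * G y) = (SUM m:{m : cells sh l. y : nbh sh l m}. G y)"
			by (rule sum.mono_neutral_cong_right) (auto simp: cells_finite indicator_def)
		also have "... = of_nat (card {m : cells sh l. y : nbh sh l m}) * G y" by simp
		also have "... <= of_nat (9 ^ CARD('n)) * G y" by (intro mult_right_mono of_nat_mono nbh_overlap) auto
		finally show "(SUM m:cells sh l. iN sh l m y * G y) <= 9 ^ CARD('n) * G y" by simp
	qed
	also have "... = 9 ^ CARD('n) * (NI y. G y)" by (rule nn_integral_cmult) measurable
	finally show ?thesis .
qed

lemma prod_Basis_vec: "(PROD b:(Basis :: (real^'n::finite) set). f (x \<bullet> b)) = (PROD i:UNIV. f (x $ i))"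
proof -
	have "inj (%i::'n. axis i (1::real))" by (auto simp: inj_def axis_eq_axis)
	moreover have Bs: "(Basis :: (real^'n) set) = range (%i. axis i 1)" by (auto simp: Basis_vec_def)
	ultimately show ?thesis unfolding Bs by (subst prod.reindex) (auto simp: cart_eq_inner_axis)
qed

lemma emeasure_OC: "A : sets borel ==> A \<subseteq> open_unit_cube ==> emeasure (OC :: (real^'n::finite) measure) A = emeasure lborel A"
	by (subst emeasure_restrict_space) auto

lemma nbh_borel: "nbh sh l m : sets (borel :: (real^'n::finite) measure)"
proof -
	have "nbh sh l m = open_unit_cube Int (\<Inter>i. {y. abs (y $ i - crn sh l (m i)) <= 4 * hw l})"
		by (auto simp: nbh_def)
	moreover have "closed {y :: real^'n. abs (y $ i - crn sh l (m i)) <= 4 * hw l}" for i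
		by (intro closed_Collect_le continuous_intros)
	hence "closed (\<Inter>i. {y :: real^'n. abs (y $ i - crn sh l (m i)) <= 4 * hw l})" by auto
	ultimately show ?thesis by (auto intro: borel_closed)
qed

text \<open>For the lower bound: the averaging window, a cube of side \<open>hw l\<close> inside the
  unit cube, lies in the neighbourhood (up to its boundary) even for cells that barely meet the
  cube.\<close>

lemma nbh_measure:
	fixes m :: "'n::finite => nat"
	shows "emeasure OC (nbh sh l m) <= ennreal ((8 * hw l) ^ CARD('n))"
		"1 <= l ==> m : cells sh l ==> ennreal (hw l ^ CARD('n)) <= emeasure OC (nbh sh l m)"
proof -
	have h: "0 < hw l" by (rule hw_pos)
	let ?a = "(\<chi> i. crn sh l (m i) - 4 * hw l) :: real^'n" let ?b = "(\<chi> i. crn sh l (m i) + 4 * hw l) :: real^'n"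
	have nb: "emeasure OC (nbh sh l m) = emeasure lborel (nbh sh l m)" by (rule emeasure_OC[OF nbh_borel]) (auto simp: nbh_def)
	have "emeasure lborel (nbh sh l m) <= emeasure lborel (cbox ?a ?b)"
		by (rule emeasure_mono) (auto simp: nbh_def mem_box_cart abs_le_iff algebra_simps)
	also have "... = (PROD b:Basis. (?b - ?a) \<bullet> b)"
		by (rule emeasure_lborel_cbox) (use h in "auto simp: Basis_vec_def inner_axis")
	also have "(PROD b:Basis. (?b - ?a) \<bullet> b) = (8 * hw l) ^ CARD('n)" using prod_Basis_vec[of "%t. t" "?b - ?a"] by simp
	finally show "emeasure OC (nbh sh l m) <= ennreal ((8 * hw l) ^ CARD('n))" using nb by simp
	assume m: "1 <= l" "m : cells sh l"
	let ?c = "%i. crn sh l (m i) + bch sh l (m i) * hw l"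
	let ?a = "(\<chi> i. ?c i) :: real^'n" let ?b = "(\<chi> i. ?c i + hw l) :: real^'n"
	have b: "bch sh l (m i) : {-1..1}" "0 <= ?c i" "?c i + hw l <= 1" for i
		using bch_range[of l sh "m i"] m by (auto simp: cells_def)
	have bh: "bch sh l (m i) * hw l <= hw l" "- hw l <= bch sh l (m i) * hw l" for i
		using b(1)[of i] h mult_right_mono[of "bch sh l (m i)" 1 "hw l"] mult_right_mono[of "-1" "bch sh l (m i)" "hw l"] by auto
	have "box ?a ?b \<subseteq> nbh sh l m"
	proof
		fix y assume "y : box ?a ?b"
		hence y: "?c i < y $ i" "y $ i < ?c i + hw l" for i by (auto simp: mem_box_cart)
		have "0 < y $ i & y $ i < 1 & abs (y $ i - crn sh l (m i)) <= 4 * hw l" for i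
			using y[of i] b(2,3)[of i] bh[of i] h by linarith
		thus "y : nbh sh l m" by (simp add: nbh_def open_unit_cube_def)
	qed
	hence "emeasure lborel (box ?a ?b) <= emeasure lborel (nbh sh l m)" by (rule emeasure_mono) (simp add: nbh_borel)
	moreover have "emeasure lborel (box ?a ?b) = (PROD b:Basis. (?b - ?a) \<bullet> b)"
		by (rule emeasure_lborel_box) (use h in "auto simp: Basis_vec_def inner_axis")
	moreover have "(PROD b:Basis. (?b - ?a) \<bullet> b) = hw l ^ CARD('n)" using prod_Basis_vec[of "%t. t" "?b - ?a"] by simp
	ultimately show "ennreal (hw l ^ CARD('n)) <= emeasure OC (nbh sh l m)" using nb by simp
qed

lemma young_le:
	assumes "0 < (c::real)" "0 <= g" "1 <= q"
	shows "g <= c + c powr (1 - q) * g powr q"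
proof (cases "g <= c")
	case True
	thus ?thesis using assms by (simp add: add_increasing2)
next
	case False
	have "c powr (q - 1) <= g powr (q - 1)" using assms False by (intro powr_mono2) auto
	hence "1 <= c powr (1 - q) * g powr (q - 1)"
		using assms mult_left_mono[of "c powr (q - 1)" "g powr (q - 1)" "c powr (1 - q)"] by (simp add: powr_add[symmetric])
	hence "g * 1 <= g * (c powr (1 - q) * g powr (q - 1))" using assms by (intro mult_left_mono) auto
	also have "g * (c powr (1 - q) * g powr (q - 1)) = c powr (1 - q) * g powr q"
		using assms False powr_mult_base[of g "q - 1"] by (simp add: mult_ac)
	finally show ?thesis using assms by linarith
qed

text \<open>Hoelder's inequality up to the factor \<open>2 powr q\<close>: integrate
  \<open>young_le\<close> and choose \<open>c\<close> so that both terms balance. The elementary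
  form yields integrability as well.\<close>

lemma power_mean:
	fixes g :: "'a => real"
	assumes q: "1 <= q" and Q: "Q : sets M" "emeasure M Q <= ennreal V" "0 < V" and g: "g : borel_measurable M" "!!y. 0 <= g y"
		and I: "(\<integral>\<^sup>+y. ennreal (indicator Q y * g y powr q) \<partial>M) <= ennreal I" "0 <= I"
	shows "integrable M (%y. indicator Q y * g y)" "(LINT y|M. indicator Q y * g y) powr q <= 2 powr q * V powr (q - 1) * I"
proof -
	note [measurable] = Q(1) g(1)
	have mQ: "emeasure M Q < \<infinity>" using Q(2) by (simp add: le_less_trans)
	have i1: "integrable M (indicator Q :: _ => real)" using Q(1) mQ by simp
	have i2: "integrable M (%y. indicator Q y * g y powr q)"
		by (rule integrableI_nonneg) (use I in "auto simp: le_less_trans")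
	have I2: "(LINT y|M. indicator Q y * g y powr q) <= I"
		using I by (intro integral_real_bounded) auto
	have yl: "indicator Q y * g y <= c * indicator Q y + c powr (1 - q) * (indicator Q y * g y powr q)" if "0 < c" for c y
		using young_le[OF that g(2) q, of y] by (auto simp: indicator_def)
	show ig: "integrable M (%y. indicator Q y * g y)"
	proof (rule Bochner_Integration.integrable_bound)
		show "integrable M (%y. 1 * indicator Q y + 1 powr (1 - q) * (indicator Q y * g y powr q))" using i1 i2 by auto
		show "AE y in M. norm (indicator Q y * g y) <= norm (1 * indicator Q y + 1 powr (1 - q) * (indicator Q y * g y powr q))"
			using yl[of 1] g(2) by (intro AE_I2) (auto simp: indicator_def)
	qed measurable
	let ?x = "\<integral>y. indicator Q y * g y \<partial>M"
	have x0: "0 <= ?x" using g(2) by (intro Bochner_Integration.integral_nonneg) (auto simp: indicator_def)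
	have mV: "measure M Q <= V" using Q(2,3) by (simp add: measure_def enn2real_leI)
	have xl: "?x <= c * V + c powr (1 - q) * I" if c: "0 < c" for c
	proof -
		have "?x <= (LINT y|M. c * indicator Q y + c powr (1 - q) * (indicator Q y * g y powr q))"
			using ig i1 i2 yl[OF c] by (intro integral_mono) auto
		also have "... = c * measure M Q + c powr (1 - q) * (LINT y|M. indicator Q y * g y powr q)"
			using i1 i2 Q(1) by (subst Bochner_Integration.integral_add) auto
		also have "... <= c * V + c powr (1 - q) * I" using c mV I2 by (intro add_mono mult_left_mono) auto
		finally show ?thesis .
	qed
	show "?x powr q <= 2 powr q * V powr (q - 1) * I"
	proof (cases "I = 0")
		case True
		have "?x <= 0"
		proof (rule field_le_epsilon)
			fix e :: real assume "0 < e"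
			thus "?x <= 0 + e" using xl[of "e / V"] True Q(3) by simp
		qed
		thus ?thesis using x0 True by simp
	next
		case False
		hence I0: "0 < I" using I(2) by simp
		\<comment> \<open>The balance point, where \<open>c * V = c powr (1 - q) * I\<close>.\<close>
		define c where "c = (I / V) powr (1 / q)"
		have c: "0 < c" using I0 Q(3) by (simp add: c_def)
		have "c powr (1 - q) * I = c * V"
		proof -
			have "c powr q = I / V" using q I0 Q(3) by (simp add: c_def powr_powr)
			hence "c powr (1 - q) = c * V / I" using c q I0 Q(3) by (simp add: powr_diff field_simps)
			thus ?thesis using I0 by simp
		qed
		hence "?x <= 2 * (c * V)" using xl[OF c] by linarith
		hence "?x powr q <= (2 * (c * V)) powr q" using x0 q by (intro powr_mono2) auto
		also have "... = 2 powr q * (c powr q * V powr q)" using c Q(3) by (simp add: powr_mult)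
		also have "c powr q = I / V" using q I0 Q(3) by (simp add: c_def powr_powr)
		also have "I / V * V powr q = V powr (q - 1) * I" using Q(3) by (simp add: powr_diff field_simps)
		finally show ?thesis by (simp add: mult.assoc)
	qed
qed

text \<open>The exponent is that of \<open>hw l powr (- d)\<close> cells, on each of which
  \<open>D\<close> deviates from a constant by about \<open>hw l powr si\<close> over a volume
  \<open>hw l ^ d\<close>. This form is common to the integer, the Slobodeckij and the Hoelder
  case.\<close>

definition osc :: "real => real => real => (real^'n::finite => real) => real => bool" where
	"osc K si q D N \<longleftrightarrow> (ALL l sh. 1 <= l --> (EX a. (SUM m:cells sh l. (LINT y|OC. iN sh l m y * abs (D y - a m)) powr q)
			<= (K * N) powr q * hw l powr (real CARD('n) * q + si * q - real CARD('n))))"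

lemma sum_ennreal_le:
	assumes "finite A" "!!i. i : A ==> 0 <= f i" "(SUM i:A. ennreal (f i)) <= ennreal B" "0 <= B"
	shows "(SUM i:A. f i) <= B"
proof -
	have "ennreal (SUM i:A. f i) <= ennreal B" using assms(2,3) by (simp add: sum_ennreal)
	thus ?thesis using assms(4) by (simp add: ennreal_le_iff)
qed

text \<open>For integer order there is no further smoothness to exploit, so the constants are 0 and
  the bounded overlap of the neighbourhoods suffices.\<close>

lemma osc_integer:
	assumes q: "1 <= q"
	shows "EX K>0. ALL (D :: real^'n::finite => real) N. D : mOC --> 0 <= N -->
		(NI y. ennreal (abs (D y) powr q)) <= ennreal (N powr q) --> osc K 0 q D N"
proof -
	define d where "d = real CARD('n)"
	define K0 where "K0 = 2 powr q * (8 ^ CARD('n)) powr (q - 1) * 9 ^ CARD('n)"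
	define K where "K = K0 powr (1 / q)"
	have K0: "0 < K0" by (simp add: K0_def)
	have Kq: "K powr q = K0" using q K0 by (simp add: K_def powr_powr)
	show ?thesis unfolding osc_def
	proof (rule exI[of _ K], intro conjI allI impI)
		show "0 < K" using K0 by (simp add: K_def)
		fix D :: "real^'n => real" and N :: real and l :: nat and sh :: real
		assume D: "D : mOC" "0 <= N" "(NI y. ennreal (abs (D y) powr q)) <= ennreal (N powr q)" and l: "1 <= l"
		note [measurable] = D(1) nbh_sets
		have h: "0 < hw l" by (rule hw_pos)
		define I where "I m = (NI y. ennreal (iN sh l m y * abs (D y) powr q))" for m :: "'n => nat"
		have Ie: "I m = (NI y. iN sh l m y * ennreal (abs (D y) powr q))" for m
			unfolding I_def by (intro nn_integral_cong) (auto simp: indicator_def)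
		have If: "I m <= ennreal (N powr q)" for m
			unfolding I_def by (rule order_trans[OF nn_integral_mono D(3)]) (auto simp: indicator_def)
		have I: "I m = ennreal (enn2real (I m))" for m using If[of m] by (simp add: le_less_trans top.not_eq_extremum)
		have "(SUM m:cells sh l. ennreal (enn2real (I m))) <= 9 ^ CARD('n) * ennreal (N powr q)"
		proof -
			have "(SUM m:cells sh l. ennreal (enn2real (I m))) = (SUM m:cells sh l. \<integral>\<^sup>+y. iN sh l m y * ennreal (abs (D y) powr q) \<partial>OC)"
				by (intro sum.cong refl trans[OF I[symmetric] Ie])
			also have "... <= 9 ^ CARD('n) * (NI y. ennreal (abs (D y) powr q))"
				by (rule nbh_sum) measurable
			also have "... <= 9 ^ CARD('n) * ennreal (N powr q)" by (intro mult_left_mono D(3)) auto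
			finally show ?thesis .
		qed
		also have "... = ennreal (9 ^ CARD('n) * N powr q)" by (simp add: ennreal_mult ennreal_power[symmetric])
		finally have sI: "(SUM m:cells sh l. enn2real (I m)) <= 9 ^ CARD('n) * N powr q"
			by (intro sum_ennreal_le cells_finite) auto
		have b: "(LINT y|OC. iN sh l m y * abs (D y - 0)) powr q <= 2 powr q * ((8 * hw l) ^ CARD('n)) powr (q - 1) * enn2real (I m)" for m :: "'n => nat"
		proof -
			have "(LINT y|OC. iN sh l m y * abs (D y)) powr q <= 2 powr q * ((8 * hw l) ^ CARD('n)) powr (q - 1) * enn2real (I m)"
			proof (rule power_mean(2)[OF q nbh_sets nbh_measure(1)])
				show "(NI y. ennreal (iN sh l m y * abs (D y) powr q)) <= ennreal (enn2real (I m))"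
					using eq_refl[OF I[of m]] unfolding I_def .
			qed (use h in auto)
			thus ?thesis by simp
		qed
		have "(SUM m:cells sh l. (LINT y|OC. iN sh l m y * abs (D y - 0)) powr q)
			<= (SUM m:cells sh l. 2 powr q * ((8 * hw l) ^ CARD('n)) powr (q - 1) * enn2real (I m))"
			by (intro sum_mono b)
		also have "... <= 2 powr q * ((8 * hw l) ^ CARD('n)) powr (q - 1) * (9 ^ CARD('n) * N powr q)"
			unfolding sum_distrib_left[symmetric] by (intro mult_left_mono sI) auto
		also have "((8 * hw l) ^ CARD('n)) powr (q - 1) = (8 ^ CARD('n)) powr (q - 1) * hw l powr (d * q + 0 * q - d)"
		proof -
			have "(hw l ^ CARD('n)) powr (q - 1) = hw l powr (d * q + 0 * q - d)"
				using h by (simp add: powr_realpow[symmetric] powr_powr d_def algebra_simps)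
			thus ?thesis using h by (simp add: power_mult_distrib powr_mult)
		qed
		also have "2 powr q * ((8 ^ CARD('n)) powr (q - 1) * hw l powr (d * q + 0 * q - d)) * (9 ^ CARD('n) * N powr q) = (K * N) powr q * hw l powr (d * q + 0 * q - d)"
		proof -
			have "(K * N) powr q = K0 * N powr q"
				using D(2) K0 powr_ge_zero[of K0 "1 / q", folded K_def] by (subst powr_mult) (simp_all add: Kq)
			thus ?thesis by (simp add: K0_def)
		qed
		finally have "(SUM m:cells sh l. (LINT y|OC. iN sh l m y * abs (D y - 0)) powr q) <= (K * N) powr q * hw l powr (d * q + 0 * q - d)" .
		thus "EX a. (SUM m:cells sh l. (LINT y|OC. iN sh l m y * abs (D y - a m)) powr q) <= (K * N) powr q * hw l powr (real CARD('n) * q + 0 * q - real CARD('n))"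
			unfolding d_def by (intro exI[of _ "%_. 0"])
	qed
qed

lemma nbh_dist:
	fixes y z :: "real^'n::finite"
	assumes "y : nbh sh l m" "z : nbh sh l m" shows "dist y z <= 8 * real CARD('n) * hw l"
proof -
	have "dist y z <= (SUM i:UNIV. abs ((y - z) $ i))" unfolding dist_norm by (rule norm_le_l1_cart)
	also have "... <= (SUM i:(UNIV::'n set). 8 * hw l)"
	proof (rule sum_mono)
		fix i
		have "abs (y $ i - crn sh l (m i)) <= 4 * hw l" "abs (z $ i - crn sh l (m i)) <= 4 * hw l" using assms by (auto simp: nbh_def)
		thus "abs ((y - z) $ i) <= 8 * hw l" by simp
	qed
	finally show ?thesis by simp
qed

text \<open>Serves \<open>q = \<infinity>\<close> with fractional order, where the sums use an
  arbitrary finite exponent; counting the cells converts the pointwise bound into a bound for the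
  sum.\<close>

lemma osc_bounded_pointwise:
	assumes q: "1 <= q" and si: "0 <= si"
	shows "EX K>0. ALL (D :: real^'n::finite => real) N. D : mOC --> 0 <= N -->
		(ALL l sh. ALL m:cells sh l. 1 <= l --> (EX a. AE y in OC. y : nbh sh l m --> abs (D y - a) <= N * (8 * real CARD('n) * hw l) powr si)) --> osc K si q D N"
proof -
	define d where "d = real CARD('n)"
	define K0 where "K0 = (8 * d) powr si * 8 ^ CARD('n)"
	define K where "K = (2 ^ CARD('n)) powr (1 / q) * K0"
	have d: "1 <= d" unfolding d_def using zero_less_card_finite[where 'a='n] by linarith
	have K0: "0 < K0" using d by (simp add: K0_def)
	show ?thesis unfolding osc_def
	proof (rule exI[of _ K], intro conjI allI impI)
		show "0 < K" using K0 by (simp add: K_def)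
		fix D :: "real^'n => real" and N :: real and l :: nat and sh :: real
		assume D: "D : mOC" "0 <= N" and l: "1 <= l"
			and A: "ALL l sh. ALL m:cells sh l. 1 <= l --> (EX a. AE y in OC. y : nbh sh l m --> abs (D y - a) <= N * (8 * real CARD('n) * hw l) powr si)"
		note [measurable] = D(1) nbh_sets
		interpret finite_measure "OC :: (real^'n) measure" by (rule finite_measure_OC)
		have h: "0 < hw l" by (rule hw_pos)
		have "ALL m:cells sh l. EX a. AE y in OC. y : nbh sh l m --> abs (D y - a) <= N * (8 * d * hw l) powr si"
			using A[THEN spec[of _ l], THEN spec[of _ sh]] l unfolding d_def by blast
		from bchoice[OF this] obtain a where a: "!!m. m : cells sh l ==> AE y in OC. y : nbh sh l m --> abs (D y - a m) <= N * (8 * d * hw l) powr si" by blast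
		let ?B = "N * K0 * hw l powr (si + d)"
		have b: "(LINT y|OC. iN sh l m y * abs (D y - a m)) <= ?B" if m: "m : cells sh l" for m
		proof -
			have "(LINT y|OC. iN sh l m y * abs (D y - a m)) <= (LINT y|OC. (N * (8 * d * hw l) powr si) * iN sh l m y)"
			proof (rule integral_mono_AE')
				show "integrable OC (%y. (N * (8 * d * hw l) powr si) * indicat_real (nbh sh l m) y)"
					by (intro integrable_mult_right integrable_real_indicator nbh_sets) (simp add: less_top[symmetric])
				show "AE y in OC. indicat_real (nbh sh l m) y * abs (D y - a m) <= N * (8 * d * hw l) powr si * indicat_real (nbh sh l m) y"
					using a[OF m] by eventually_elim (auto simp: indicator_def)
			qed (use D(2) in "auto simp: indicator_def")
			also have "... = N * (8 * d * hw l) powr si * measure OC (nbh sh l m)"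
			proof -
				have "nbh sh l m Int open_unit_cube = nbh sh l m" by (auto simp: nbh_def)
				thus ?thesis using nbh_sets by simp
			qed
			also have "... <= N * (8 * d * hw l) powr si * (8 * hw l) ^ CARD('n)"
				using nbh_measure(1)[of sh l m] D(2) h by (intro mult_left_mono) (auto simp: emeasure_eq_measure)
			also have "... = ?B" using h d by (simp add: K0_def powr_mult powr_add power_mult_distrib powr_realpow[symmetric] d_def[symmetric])
			finally show ?thesis .
		qed
		have cc: "real (card (cells sh l :: ('n => nat) set)) <= 2 ^ CARD('n) * hw l powr (- d)"
		proof -
			have "card (cells sh l :: ('n => nat) set) <= card (PiE (UNIV :: 'n set) (%_. {..<(2::nat)^l}))"
				by (rule card_mono) (auto simp: cells_def intro: finite_PiE)
			also have "... = (2 ^ l) ^ CARD('n)" by (simp add: card_PiE)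
			finally have "real (card (cells sh l :: ('n => nat) set)) <= (2 ^ l) ^ CARD('n)"
				by (metis of_nat_le_iff of_nat_numeral of_nat_power)
			also have "(2 ^ l) ^ CARD('n) = (2 / hw l) ^ CARD('n)" by (simp add: hw_def)
			also have "... = 2 ^ CARD('n) * hw l powr (- d)" using h by (simp add: power_divide powr_minus d_def powr_realpow divide_inverse power_inverse)
			finally show ?thesis .
		qed
		have i0: "0 <= (LINT y|OC. iN sh l m y * abs (D y - a m))" for m
			by (intro Bochner_Integration.integral_nonneg) (auto simp: indicator_def)
		have "(SUM m:cells sh l. (LINT y|OC. iN sh l m y * abs (D y - a m)) powr q) <= (SUM m:(cells sh l :: ('n => nat) set). ?B powr q)"
			by (intro sum_mono powr_mono2 b i0) (use q in auto)
		also have "... = real (card (cells sh l :: ('n => nat) set)) * ?B powr q" by simp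
		also have "... <= 2 ^ CARD('n) * hw l powr (- d) * ?B powr q" by (intro mult_right_mono cc) auto
		also have "?B powr q = (N * K0) powr q * hw l powr ((si + d) * q)" using D(2) K0 by (simp add: powr_mult powr_powr)
		also have "2 ^ CARD('n) * hw l powr (- d) * ((N * K0) powr q * hw l powr ((si + d) * q)) = (K * N) powr q * hw l powr (d * q + si * q - d)"
		proof -
			have 1: "hw l powr (- d) * hw l powr ((si + d) * q) = hw l powr (d * q + si * q - d)"
				unfolding powr_add[symmetric] by (simp add: algebra_simps)
			have 2: "2 ^ CARD('n) * (N * K0) powr q = (K * N) powr q"
				using q D(2) K0 by (simp add: K_def powr_mult powr_powr mult_ac)
			have 3: "x * y * (A * B) = (x * A) * (y * B)" for x y A B :: real by (simp only: mult_ac)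
			show ?thesis by (rule trans[OF 3]) (simp only: 1 2)
		qed
		finally show "EX a. (SUM m:cells sh l. (LINT y|OC. iN sh l m y * abs (D y - a m)) powr q) <= (K * N) powr q * hw l powr (real CARD('n) * q + si * q - real CARD('n))"
			unfolding d_def by blast
	qed
qed

lemma nbh_AE_ex:
	assumes "AE z in OC. P z" "1 <= l" "m : cells sh l"
	shows "EX z:nbh sh l (m :: 'n::finite => nat). P z"
proof (rule ccontr)
	assume n: "~ ?thesis"
	have "AE z in OC. z ~: nbh sh l m" by (rule AE_mp[OF assms(1)]) (use n in "auto intro!: AE_I2")
	moreover have "nbh sh l m \<subseteq> space OC" by (auto simp: nbh_def)
	ultimately have "emeasure OC (nbh sh l m) = 0"
		using AE_iff_measurable[OF nbh_sets[of sh l m], of "%z. z ~: nbh sh l m"] by auto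
	thus False using nbh_measure(2)[OF assms(2,3)] hw_pos[of l] by simp
qed

text \<open>The constant of a cell is the value of \<open>D\<close> at a point \<open>z\<close> of
  its neighbourhood where the inner integral over \<open>y\<close> is at most of average size.
  Within a neighbourhood distances are \<open>O(hw l)\<close>, so the weight of the seminorm is
  bounded below.\<close>

lemma osc_gagliardo:
	assumes q: "1 <= q" and si: "0 <= si"
	shows "EX K>0. ALL (D :: real^'n::finite => real) N. D : mOC --> 0 <= N -->
		(\<integral>\<^sup>+z. \<integral>\<^sup>+y. ennreal (abs (D z - D y) powr q / dist z y powr (real CARD('n) + si * q)) \<partial>OC \<partial>OC) <= ennreal (N powr q) -->
		osc K si q D N"
proof -
	define d where "d = real CARD('n)"
	have d: "1 <= d" unfolding d_def using zero_less_card_finite[where 'a='n] by linarith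
	define e where "e = d + si * q"
	have e0: "0 <= e" using d q si by (simp add: e_def)
	define K0 where "K0 = 2 powr q * 8 powr (d * (q - 1)) * (8 * d) powr e * 9 ^ CARD('n)"
	define K where "K = K0 powr (1 / q)"
	have K0: "0 < K0" using d by (simp add: K0_def)
	have Kq: "K powr q = K0" using q K0 by (simp add: K_def powr_powr)
	show ?thesis unfolding osc_def
	proof (rule exI[of _ K], intro conjI allI impI)
		show "0 < K" using K0 by (simp add: K_def)
		fix D :: "real^'n => real" and N :: real and l :: nat and sh :: real
		assume D: "D : mOC" "0 <= N" and l: "1 <= l" and
			gg: "(\<integral>\<^sup>+z. \<integral>\<^sup>+y. ennreal (abs (D z - D y) powr q / dist z y powr (real CARD('n) + si * q)) \<partial>OC \<partial>OC) <= ennreal (N powr q)"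
		interpret finite_measure "OC :: (real^'n) measure" by (rule finite_measure_OC)
		note [measurable] = D(1) nbh_sets
		have [measurable]: "(%x. x) : measurable (OC :: (real^'n) measure) borel"
			using borel_OC[of "%x. x :: real^'n"] measurable_ident by (auto intro: measurable_restrict_space1 measurable_completion)
		have h: "0 < hw l" by (rule hw_pos)
		define G where "G z y = ennreal (abs (D z - D y) powr q / dist z y powr e)" for z y
		define Hf where "Hf z y = ennreal (abs (D y - D z) powr q)" for z y
		have Gm [measurable]: "(%(z, y). G z y) : borel_measurable (OC \<Otimes>\<^sub>M OC)" unfolding G_def by measurable
		have Hm [measurable]: "(%(z, y). Hf z y) : borel_measurable (OC \<Otimes>\<^sub>M OC)" unfolding Hf_def by measurable
		define c where "c = (8 * d * hw l) powr e"
		have HG: "Hf z y <= ennreal c * G z y" if "y : nbh sh l m" "z : nbh sh l m" for y z and m :: "'n => nat"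
		proof (cases "y = z")
			case False
			hence "0 < dist z y" by simp
			moreover have "dist z y powr e <= c" unfolding c_def
				using nbh_dist[OF that(2,1)] e0 by (intro powr_mono2) (auto simp: d_def)
			ultimately have "abs (D y - D z) powr q <= c * (abs (D z - D y) powr q / dist z y powr e)"
				by (simp add: divide_simps abs_minus_commute mult.commute mult_right_mono)
			thus ?thesis unfolding Hf_def G_def by (subst ennreal_mult[symmetric]) (auto simp: c_def intro: ennreal_leI)
		qed (simp add: Hf_def)
		define F where "F m z = (NI y. iN sh l m y * Hf z y)" for m :: "'n => nat" and z
		define I where "I m = (NI z. indicator (nbh sh l m) z * F m z)" for m :: "'n => nat"
		have Fm [measurable]: "F m : mOC" for m unfolding F_def by measurable
		have sI: "(SUM m:cells sh l. I m) <= ennreal (9 ^ CARD('n) * c * N powr q)"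
		proof -
			have "I m <= (\<integral>\<^sup>+z. indicator (nbh sh l m) z * (ennreal c * (NI y. G z y)) \<partial>OC)" for m
				unfolding I_def
			proof (rule nn_integral_mono)
				fix z
				show "indicator (nbh sh l m) z * F m z <= indicator (nbh sh l m) z * (ennreal c * (NI y. G z y))"
				proof (cases "z : nbh sh l m")
					case True
					hence "F m z <= (NI y. ennreal c * G z y)"
						unfolding F_def by (intro nn_integral_mono) (auto simp: indicator_def HG)
					also have "... = ennreal c * (NI y. G z y)" 
					proof (rule nn_integral_cmult)
						have "z : space OC" using True by (auto simp: nbh_def)
						thus "G z : mOC" using measurable_compose_Pair1[OF _ Gm] by simp
					qed
					finally show ?thesis by (rule mult_left_mono) simp
				qed simp
			qed
			hence "(SUM m:cells sh l. I m) <= (SUM m:cells sh l. \<integral>\<^sup>+z. indicator (nbh sh l m) z * (ennreal c * (NI y. G z y)) \<partial>OC)"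
				by (rule sum_mono)
			also have "... <= 9 ^ CARD('n) * (\<integral>\<^sup>+z. ennreal c * (NI y. G z y) \<partial>OC)" by (rule nbh_sum) measurable
			also have "(\<integral>\<^sup>+z. ennreal c * (NI y. G z y) \<partial>OC) = ennreal c * (\<integral>\<^sup>+z. \<integral>\<^sup>+y. G z y \<partial>OC \<partial>OC)"
				by (rule nn_integral_cmult) measurable
			also have "9 ^ CARD('n) * (ennreal c * (\<integral>\<^sup>+z. \<integral>\<^sup>+y. G z y \<partial>OC \<partial>OC)) <= 9 ^ CARD('n) * (ennreal c * ennreal (N powr q))"
				using gg by (intro mult_left_mono) (auto simp: G_def e_def d_def)
			also have "... = ennreal (9 ^ CARD('n) * c * N powr q)"
				by (simp add: ennreal_mult ennreal_power[symmetric] c_def mult.assoc)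
			finally show ?thesis .
		qed
		have Ifin: "I m < \<infinity>" if "m : cells sh l" for m
		proof -
			have "I m <= (SUM m:cells sh l. I m)" using that cells_finite by (intro member_le_sum) auto
			also have "... < \<infinity>" using sI by (simp add: le_less_trans)
			finally show ?thesis .
		qed
		\<comment> \<open>Otherwise \<open>F m\<close> would exceed \<open>I m / hw l ^ d\<close> on the
		  whole neighbourhood, whose measure is at least \<open>hw l ^ d\<close>, and its integral would
		  exceed \<open>I m\<close>.\<close>
		have ex: "EX z:nbh sh l m. F m z <= I m / ennreal (hw l ^ CARD('n))" if m: "m : cells sh l" for m
		proof (rule ccontr)
			assume n: "~ ?thesis"
			let ?c = "I m / ennreal (hw l ^ CARD('n))"
			have cf: "?c < \<infinity>" using Ifin[OF m] h by (simp add: ennreal_divide_eq_top_iff less_top[symmetric])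
			have "(NI z. ?c * indicator (nbh sh l m) z) < (NI z. indicator (nbh sh l m) z * F m z)"
			proof (rule nn_integral_less)
				show "(NI z. ?c * indicator (nbh sh l m) z) ~= \<infinity>"
					using cf emeasure_finite[of "nbh sh l m"] nbh_sets by (simp add: nn_integral_cmult_indicator ennreal_mult_eq_top_iff)
				show "AE z in OC. ?c * indicator (nbh sh l m) z <= indicator (nbh sh l m) z * F m z"
					using n by (intro AE_I2) (auto simp: indicator_def not_le less_imp_le)
				show "~ (AE z in OC. indicator (nbh sh l m) z * F m z <= ?c * indicator (nbh sh l m) z)"
				proof
					assume "AE z in OC. indicator (nbh sh l m) z * F m z <= ?c * indicator (nbh sh l m) z"
					from nbh_AE_ex[OF this l m] show False using n by auto
				qed
			qed measurable
			moreover have "(NI z. ?c * indicator (nbh sh l m) z) = ?c * emeasure OC (nbh sh l m)"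
				by (rule nn_integral_cmult_indicator) (rule nbh_sets)
			moreover have "?c * ennreal (hw l ^ CARD('n)) <= ?c * emeasure OC (nbh sh l m)"
				by (intro mult_left_mono nbh_measure(2) l m) auto
			moreover have "?c * ennreal (hw l ^ CARD('n)) = I m"
				using h by (subst mult.commute, subst ennreal_times_divide, subst mult.commute, intro ennreal_mult_divide_eq) auto
			ultimately show False unfolding I_def by simp
		qed
		have "ALL m:cells sh l. EX z. z : nbh sh l m & F m z <= I m / ennreal (hw l ^ CARD('n))" using ex by blast
		from bchoice[OF this] obtain zz where zz: "!!m. m : cells sh l ==> zz m : nbh sh l m & F m (zz m) <= I m / ennreal (hw l ^ CARD('n))" by blast
		have b: "(LINT y|OC. iN sh l m y * abs (D y - D (zz m))) powr q <= 2 powr q * ((8 * hw l) ^ CARD('n)) powr (q - 1) * (enn2real (I m) / hw l ^ CARD('n))"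
			if m: "m : cells sh l" for m
		proof (rule power_mean(2)[OF q nbh_sets nbh_measure(1)])
			have "(NI y. ennreal (iN sh l m y * abs (D y - D (zz m)) powr q)) = F m (zz m)"
				unfolding F_def Hf_def by (intro nn_integral_cong) (auto simp: indicator_def)
			also have "... <= I m / ennreal (hw l ^ CARD('n))" using zz[OF m] by simp
			also have "... = ennreal (enn2real (I m) / hw l ^ CARD('n))"
				using Ifin[OF m] h by (subst divide_ennreal[symmetric]) (auto simp: less_top)
			finally show "(NI y. ennreal (iN sh l m y * abs (D y - D (zz m)) powr q)) <= ennreal (enn2real (I m) / hw l ^ CARD('n))" .
		qed (use h in auto)
		have sIr: "(SUM m:cells sh l. enn2real (I m)) <= 9 ^ CARD('n) * c * N powr q"
		proof (rule sum_ennreal_le[OF cells_finite])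
			have "(SUM m:cells sh l. ennreal (enn2real (I m))) = (SUM m:cells sh l. I m)"
				by (intro sum.cong refl) (use Ifin in "auto simp: less_top")
			thus "(SUM m:cells sh l. ennreal (enn2real (I m))) <= ennreal (9 ^ CARD('n) * c * N powr q)" using sI by simp
		qed (auto simp: c_def)
		have "(SUM m:cells sh l. (LINT y|OC. iN sh l m y * abs (D y - D (zz m))) powr q)
			<= (SUM m:cells sh l. 2 powr q * ((8 * hw l) ^ CARD('n)) powr (q - 1) * (enn2real (I m) / hw l ^ CARD('n)))"
			by (intro sum_mono b)
		also have "... = (2 powr q * ((8 * hw l) ^ CARD('n)) powr (q - 1) / hw l ^ CARD('n)) * (SUM m:cells sh l. enn2real (I m))"
			by (simp add: sum_distrib_left)
		also have "... <= (2 powr q * ((8 * hw l) ^ CARD('n)) powr (q - 1) / hw l ^ CARD('n)) * (9 ^ CARD('n) * c * N powr q)"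
			by (intro mult_left_mono sIr) (use h in auto)
		also have "... = (K * N) powr q * hw l powr (d * q + si * q - d)"
		proof -
			have 1: "((8 * hw l) ^ CARD('n)) powr (q - 1) = 8 powr (d * (q - 1)) * hw l powr (d * (q - 1))"
				using h by (simp add: powr_realpow[symmetric] powr_powr powr_mult d_def)
			have 2: "c = (8 * d) powr e * hw l powr e" using h d by (simp add: c_def powr_mult)
			have 3: "hw l powr (d * (q - 1)) / hw l ^ CARD('n) * hw l powr e = hw l powr (d * q + si * q - d)"
				using h unfolding e_def by (simp add: powr_realpow[symmetric] powr_diff[symmetric] powr_add[symmetric] d_def[symmetric] algebra_simps)
			have 4: "(K * N) powr q = K0 * N powr q"
				using D(2) K0 powr_ge_zero[of K0 "1 / q", folded K_def] by (subst powr_mult) (simp_all add: Kq)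
			show ?thesis unfolding 1 2 3[symmetric] 4 K0_def by simp
		qed
		finally show "EX a. (SUM m:cells sh l. (LINT y|OC. iN sh l m y * abs (D y - a m)) powr q) <= (K * N) powr q * hw l powr (real CARD('n) * q + si * q - real CARD('n))"
			unfolding d_def by (intro exI[of _ "%m. D (zz m)"])
	qed
qed

lemma hoelder_pointwise:
	fixes D :: "real^'n::finite => real"
	assumes "AE z in OC. AE y in OC. abs (D z - D y) <= N * dist z y powr si" "0 <= N" "0 <= si" "1 <= l" "m : cells sh l"
	shows "EX a. AE y in OC. y : nbh sh l m --> abs (D y - a) <= N * (8 * real CARD('n) * hw l) powr si"
proof -
	obtain z where z: "z : nbh sh l m" "AE y in OC. abs (D z - D y) <= N * dist z y powr si"
		using nbh_AE_ex[OF assms(1,4,5)] by blast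
	have "AE y in OC. y : nbh sh l m --> abs (D y - D z) <= N * (8 * real CARD('n) * hw l) powr si"
		using z(2)
	proof eventually_elim
		case (elim y)
		show ?case
		proof
			assume y: "y : nbh sh l m"
			have "dist z y powr si <= (8 * real CARD('n) * hw l) powr si"
				using nbh_dist[OF z(1) y] assms(3) by (intro powr_mono2) auto
			thus "abs (D y - D z) <= N * (8 * real CARD('n) * hw l) powr si"
				using elim assms(2) mult_left_mono[of "dist z y powr si" _ N] by (simp add: abs_minus_commute) (meson order_trans)
		qed
	qed
	thus ?thesis by blast
qed

section \<open>Convergence of the local expansions\<close>

definition yc :: "real => real^'n::finite => 'n => real" where "yc sh x i = (x $ i + sh) / 2"
definition cl :: "real => nat => real^'n::finite => 'n => nat" where "cl sh l x i = cel l (yc sh x i)"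
definition mnm :: "nat => ('n::finite => nat) => ('n => real) => real" where "mnm l be y = (PROD i:UNIV. fr l (y i) ^ be i)"
text \<open>The quasi-interpolant of level \<open>l\<close>: on each cell the averaged Taylor
  polynomial, in the local variables of the cell.\<close>

definition opA :: "nat => real => nat => (real^'n::finite => real) => real^'n => real" where
	"opA k sh l f x = (SUM be:Bk k. tot k sh f l (cl sh l x) be * mnm l be (yc sh x))"

lemma yc_range:
	assumes "x : open_unit_cube" "0 <= sh" "sh < 1" shows "0 <= yc sh x i" "yc sh x i < 1"
proof -
	have "0 < x $ i" "x $ i < 1" using assms(1) by (auto simp: open_unit_cube_def)
	thus "0 <= yc sh x i" "yc sh x i < 1" using assms by (auto simp: yc_def)
qed

lemma cl_crn:
	assumes "x : open_unit_cube" "0 <= sh" "sh < 1"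
	shows "x $ i = crn sh l (cl sh l x i) + fr l (yc sh x i) * hw l"
proof -
	have "2 ^ l * yc sh x i = real (cl sh l x i) + fr l (yc sh x i)"
		unfolding cl_def by (rule cel_fr[OF yc_range(1)[OF assms]])
	hence "hw l * (2 ^ l * yc sh x i) = hw l * (real (cl sh l x i) + fr l (yc sh x i))" by simp
	moreover have "hw l * (2 ^ l * yc sh x i) = x $ i + sh" by (simp add: hw_def yc_def)
	ultimately show ?thesis by (simp add: crn_def algebra_simps)
qed

lemma cl_cells:
	assumes "x : open_unit_cube" "0 <= sh" "sh < 1"
	shows "cl sh l x : cells sh l" "x : nbh sh l (cl sh l x)"
proof -
	have h: "0 < hw l" by (rule hw_pos)
	have x: "0 < x $ i" "x $ i < 1" for i using assms(1) by (auto simp: open_unit_cube_def)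
	have f: "0 <= fr l (yc sh x i) * hw l" "fr l (yc sh x i) * hw l < hw l" for i
		using fr_bounds[of l "yc sh x i"] h by auto
	note e = cl_crn[OF assms, of _ l]
	have "cl sh l x i < 2 ^ l" for i unfolding cl_def using cel_less yc_range[OF assms] by blast
	moreover have "- hw l < crn sh l (cl sh l x i)" "crn sh l (cl sh l x i) < 1" for i using e[of i] x[of i] f[of i] by linarith+
	ultimately show "cl sh l x : cells sh l" by (simp add: cells_def)
	have "abs (x $ i - crn sh l (cl sh l x i)) <= 4 * hw l" for i using e[of i] f[of i] h by linarith
	thus "x : nbh sh l (cl sh l x)" using assms(1) by (simp add: nbh_def)
qed

lemma fr_cel_parent:
	assumes "0 <= y" shows "cel l y = cel (Suc l) y div 2" "fr l y = (fr (Suc l) y + real (cel (Suc l) y mod 2)) / 2"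
proof -
	show 1: "cel l y = cel (Suc l) y div 2" using cel_div[OF assms, of l 1] by simp
	have "2 * (real (cel l y) + fr l y) = real (cel (Suc l) y) + fr (Suc l) y"
		using cel_fr[OF assms, of l] cel_fr[OF assms, of "Suc l"] by simp
	moreover have "real (cel (Suc l) y) = 2 * real (cel l y) + real (cel (Suc l) y mod 2)"
		unfolding 1 by (metis mult_div_mod_eq of_nat_add of_nat_mult of_nat_numeral)
	ultimately show "fr l y = (fr (Suc l) y + real (cel (Suc l) y mod 2)) / 2" by simp
qed

text \<open>The polynomial of the parent is the same function in either set of local variables: by
  \<open>kT_scale\<close> with \<open>e\<close> the parity of \<open>j\<close>, the variable
  \<open>xii\<close> of the child becomes \<open>(xii + e) / 2\<close> in the parent.\<close>

lemma kpa_kch: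
	assumes l: "1 <= l"
	shows "(SUM be<=k. xii ^ be * kpa k sh (Suc l) j be t) = (SUM be<=k. ((xii + real (j mod 2)) / 2) ^ be * kch k sh l (j div 2) be t)"
proof -
	let ?e = "real (j mod 2)" let ?h = "hw (Suc l)"
	have h: "0 < ?h" by (rule hw_pos)
	let ?u = "(t - crn sh (Suc l) j) / ?h"
	have 1: "(bpa sh (Suc l) j + ?e) / 2 = bch sh l (j div 2)"
		using h by (simp add: bpa_def bch_def crn_parent[of sh l j] hw_Suc[of l] field_simps)
	have 2: "(?u + ?e) / 2 = (t - crn sh l (j div 2)) / hw l"
		using h by (simp add: crn_parent[of sh l j] hw_Suc[of l] field_simps)
	have "(SUM be<=k. xii ^ be * kpa k sh (Suc l) j be t) = (SUM be<=k. xii ^ be * kT k be (bpa sh (Suc l) j) 2 ?u) / ?h"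
		by (simp add: kpa_def sum_divide_distrib)
	also have "... = (1 / 2) * (SUM be<=k. ((xii + ?e) / 2) ^ be * kT k be (bch sh l (j div 2)) 1 ((t - crn sh l (j div 2)) / hw l)) / ?h"
		unfolding kT_scale[where xii=xii and e="?e"] 1 2 ..
	also have "... = (SUM be<=k. ((xii + ?e) / 2) ^ be * kch k sh l (j div 2) be t)"
		by (simp add: kch_def hw_Suc[of l] sum_divide_distrib[symmetric])
	finally show ?thesis .
qed

lemma sum_mono_prodf:
	"(SUM be:Bk k. prodf (%i. g i (be i)) y * (PROD i:UNIV. xii i ^ be i)) = prodf (%i t. SUM be<=k. xii i ^ be * g i be t) y"
	unfolding prodf_def Bk_def by (subst prod_sum_PiE) (auto simp: prod.distrib[symmetric] mult.commute)

lemma integrable_prodf: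
	assumes "integrable OC f" "!!i. smo1 (g i)" "!!i t. abs (g i t) <= B"
	shows "integrable OC (%y. f y * prodf g y)"
	by (rule integrable_mult_bounded[OF assms(1) prodf_measurable[OF assms(2)] prodf_bound[OF assms(3)]])

lemma kch_integrable:
	assumes "integrable OC (f :: real^'n::finite => real)" "be : Bk k" "1 <= l" "m : cells sh l"
	shows "integrable OC (%y. f y * prodf (%i. kch k sh l (m i) (be i)) y)"
		"2 <= l ==> integrable OC (%y. f y * prodf (%i. kpa k sh l (m i) (be i)) y)"
proof -
	obtain B where B: "!!sh l j be t. be <= k ==> 1 <= l ==> - hw l < crn sh l j ==> crn sh l j < 1 ==> abs (kch k sh l j be t) <= B / hw l"
		"!!sh l j be t. be <= k ==> 1 <= l ==> - hw l < crn sh l j ==> crn sh l j < 1 ==> 2 <= l ==> abs (kpa k sh l j be t) <= B / hw l"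
		using kernel_bounds[of k] by blast
	have m: "- hw l < crn sh l (m i)" "crn sh l (m i) < 1" for i using assms(4) by (auto simp: cells_def)
	have b: "be i <= k" for i using assms(2) by (simp add: Bk_iff)
	show "integrable OC (%y. f y * prodf (%i. kch k sh l (m i) (be i)) y)"
		by (rule integrable_prodf[OF assms(1) smo1_kch B(1)[OF b assms(3) m]])
	show "integrable OC (%y. f y * prodf (%i. kpa k sh l (m i) (be i)) y)" if "2 <= l"
		by (rule integrable_prodf[OF assms(1) smo1_kpa B(2)[OF b assms(3) m that]])
qed

lemma opA_kernel:
	assumes f: "integrable OC (f :: real^'n::finite => real)" and l: "1 <= l" and x: "x : open_unit_cube" "0 <= sh" "sh < 1"
	shows "opA k sh l f x = (LINT y|OC. f y * prodf (%i t. SUM be<=k. fr l (yc sh x i) ^ be * kch k sh l (cl sh l x i) be t) y)"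
proof -
	have "opA k sh l f x = (SUM be:Bk k. \<integral>y. f y * prodf (%i. kch k sh l (cl sh l x i) (be i)) y * mnm l be (yc sh x) \<partial>OC)"
		unfolding opA_def tot_def by simp
	also have "... = (LINT y|OC. (SUM be:Bk k. f y * prodf (%i. kch k sh l (cl sh l x i) (be i)) y * mnm l be (yc sh x)))"
		by (rule Bochner_Integration.integral_sum[symmetric]) (use kch_integrable(1)[OF f _ l cl_cells(1)[OF x]] in auto)
	also have "... = (LINT y|OC. f y * prodf (%i t. SUM be<=k. fr l (yc sh x i) ^ be * kch k sh l (cl sh l x i) be t) y)"
		unfolding sum_mono_prodf[symmetric] mnm_def by (simp add: sum_distrib_left mult.assoc)
	finally show ?thesis .
qed

lemma par_opA:
	assumes f: "integrable OC (f :: real^'n::finite => real)" and l: "1 <= l" and x: "x : open_unit_cube" "0 <= sh" "sh < 1"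
	shows "(SUM be:Bk k. par k sh f (Suc l) (cl sh (Suc l) x) be * mnm (Suc l) be (yc sh x)) = opA k sh l f x"
proof -
	let ?m = "cl sh (Suc l) x"
	have "(SUM be:Bk k. par k sh f (Suc l) ?m be * mnm (Suc l) be (yc sh x)) = (SUM be:Bk k. \<integral>y. f y * prodf (%i. kpa k sh (Suc l) (?m i) (be i)) y * mnm (Suc l) be (yc sh x) \<partial>OC)"
		unfolding par_def by simp
	also have "... = (LINT y|OC. (SUM be:Bk k. f y * prodf (%i. kpa k sh (Suc l) (?m i) (be i)) y * mnm (Suc l) be (yc sh x)))"
		by (rule Bochner_Integration.integral_sum[symmetric]) (intro integrable_mult_left kch_integrable(2)[OF f _ _ cl_cells(1)[OF x]]; use l in simp)
	also have "... = (LINT y|OC. f y * prodf (%i t. SUM be<=k. fr (Suc l) (yc sh x i) ^ be * kpa k sh (Suc l) (?m i) be t) y)"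
		unfolding sum_mono_prodf[symmetric] mnm_def by (simp add: sum_distrib_left mult.assoc)
	also have "... = opA k sh l f x"
	proof -
		have "?m i div 2 = cl sh l x i" "(fr (Suc l) (yc sh x i) + real (?m i mod 2)) / 2 = fr l (yc sh x i)" for i
			using fr_cel_parent[OF yc_range(1)[OF x, of i], of l] by (simp_all add: cl_def)
		thus ?thesis unfolding opA_kernel[OF f l x] kpa_kch[OF l] by simp
	qed
	finally show ?thesis .
qed

text \<open>By \<open>par_opA\<close> the parent parts of level \<open>L + 1\<close> reassemble
  \<open>opA\<close> of level \<open>L\<close>, so the partial sums telescope.\<close>

lemma cf_telescope:
	assumes f: "integrable OC (f :: real^'n::finite => real)" and x: "x : open_unit_cube" "0 <= sh" "sh < 1"
	shows "1 <= L ==> (SUM l:{1..L}. SUM be:Bk k. cf k sh f l (cl sh l x) be * mnm l be (yc sh x)) = opA k sh L f x"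
proof (induction L rule: nat_induct_at_least)
	case base
	show ?case using cl_cells(1)[OF x, of 1] by (simp add: cf_def opA_def)
next
	case (Suc L)
	have "(SUM be:Bk k. cf k sh f (Suc L) (cl sh (Suc L) x) be * mnm (Suc L) be (yc sh x)) = opA k sh (Suc L) f x - opA k sh L f x"
		using cl_cells(1)[OF x, of "Suc L"] Suc.hyps unfolding par_opA[OF f Suc.hyps x, symmetric]
		by (simp add: cf_def opA_def left_diff_distrib sum_subtractf)
	thus ?case using Suc by simp
qed

lemma opA_bound:
	"EX C>=1. ALL sh l (x :: real^'n::finite) f. integrable OC f --> 1 <= l --> x : open_unit_cube --> 0 <= sh --> sh < 1 -->
			abs (opA k sh l f x) <= C / hw l ^ CARD('n) * (LINT y|OC. indicator (nbh sh l (cl sh l x)) y * abs (f y))"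
proof -
	obtain C where C: "1 <= C" "!!sh l (m :: 'n => nat) (be :: 'n => nat) f. be : Bk k ==> 1 <= l ==> m : cells sh l ==> integrable OC f ==>
			abs (tot k sh f l m be) <= C / hw l ^ CARD('n) * (LINT y|OC. iN sh l m y * abs (f y))"
		using tot_bound[of k, where 'n='n] by blast
	have nb: "1 <= card (Bk k :: ('n => nat) set)"
	proof -
		have "(%_. 0) : (Bk k :: ('n => nat) set)" by (simp add: Bk_iff)
		hence "Bk k ~= ({} :: ('n => nat) set)" by blast
		thus ?thesis using finite_Bk by (simp add: Suc_le_eq card_gt_0_iff)
	qed
	show ?thesis
	proof (intro exI[of _ "card (Bk k :: ('n => nat) set) * C"] conjI allI impI)
		show "1 <= real (card (Bk k :: ('n => nat) set)) * C" using nb C(1) mult_mono[of 1 "real (card (Bk k :: ('n => nat) set))" 1 C] by simp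
		fix sh :: real and l :: nat and x :: "real^'n" and f :: "real^'n => real" assume a: "integrable OC f" "1 <= l" "x : open_unit_cube" "0 <= sh" "sh < 1"
		let ?I = "\<integral>y. indicator (nbh sh l (cl sh l x)) y * abs (f y) \<partial>OC"
		have "abs (opA k sh l f x) <= (SUM be:Bk k. abs (tot k sh f l (cl sh l x) be * mnm l be (yc sh x)))"
			unfolding opA_def by (rule sum_abs)
		also have "... <= (SUM be:(Bk k :: ('n => nat) set). C / hw l ^ CARD('n) * ?I)"
		proof (rule sum_mono)
			fix be :: "'n => nat" assume b: "be : Bk k"
			have "abs (mnm l be (yc sh x)) <= (PROD i:(UNIV :: 'n set). 1)"
				unfolding mnm_def abs_prod by (intro prod_mono) (use fr_bounds in "auto simp: power_abs intro!: power_le_one less_imp_le[OF fr_bounds(2)]")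
			hence "abs (mnm l be (yc sh x)) <= 1" by simp
			hence "abs (tot k sh f l (cl sh l x) be * mnm l be (yc sh x)) <= abs (tot k sh f l (cl sh l x) be)"
				unfolding abs_mult by (intro mult_left_le) auto
			also have "... <= C / hw l ^ CARD('n) * ?I" by (rule C(2)[OF b a(2) cl_cells(1)[OF a(3-5)] a(1)])
			finally show "abs (tot k sh f l (cl sh l x) be * mnm l be (yc sh x)) <= C / hw l ^ CARD('n) * ?I" .
		qed
		finally show "abs (opA k sh l f x) <= real (card (Bk k :: ('n => nat) set)) * C / hw l ^ CARD('n) * ?I" by simp
	qed
qed

text \<open>Each one-dimensional kernel has integral 1 by \<open>integral_kT_sum\<close>.
  Reproduction of constants is all that convergence needs; the order of approximation comes from
  \<open>cf_bound\<close>.\<close>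

lemma opA_const:
	fixes x :: "real^'n::finite"
	assumes l: "1 <= l" and x: "x : open_unit_cube" "0 <= sh" "sh < 1"
	shows "opA k sh l (%_. c) x = (c :: real)"
proof -
	let ?m = "cl sh l x"
	have m: "- hw l < crn sh l (?m i)" "crn sh l (?m i) < 1" for i using cl_cells(1)[OF x, of l] by (auto simp: cells_def)
	let ?g = "%i t. SUM be<=k. fr l (yc sh x i) ^ be * kch k sh l (?m i) be t"
	have h: "0 < hw l" by (rule hw_pos)
	interpret finite_measure "OC :: (real^'n) measure" by (rule finite_measure_OC)
	have sg: "smo1 (?g i)" for i
		by (rule conjunct1[OF derivs_sum]) (auto intro: smo_intros(4) smo1_kch)
	have gi: "has_bochner_integral lborel (?g i) 1" for i
	proof -
		let ?b = "bch sh l (?m i)" let ?G = "%t. SUM be<=k. fr l (yc sh x i) ^ be * kT k be ?b 1 t"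
		have b: "?b : brange" using bch_range(1)[OF l m, of i] by auto
		from integral_kT_sum[OF b, where k=k and xii="fr l (yc sh x i)"] have i: "integrable lborel ?G" "(LINT t|lborel. ?G t) = 1"
			using has_bochner_integral_iff by blast+
		have i1: "integrable lborel (%t. ?G (- crn sh l (?m i) / hw l + (1 / hw l) * t))"
			by (rule lborel_integrable_real_affine[OF i(1)]) (use h in simp)
		have i2: "(LINT t|lborel. ?G (- crn sh l (?m i) / hw l + (1 / hw l) * t)) = hw l"
			using lborel_integral_real_affine[of "1 / hw l" ?G "- crn sh l (?m i) / hw l"] i(2) h by (simp add: field_simps)
		have e: "?g i = (%t. ?G (- crn sh l (?m i) / hw l + (1 / hw l) * t) / hw l)"
			by (auto simp: kch_def fun_eq_iff diff_divide_distrib add.commute sum_divide_distrib)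
		show ?thesis unfolding has_bochner_integral_iff e using i1 i2 h by simp
	qed
	have ip: "has_bochner_integral lborel (prodf ?g :: real^'n => real) (PROD i:UNIV. \<integral>t. ?g i t \<partial>lborel)"
		by (rule integral_prodf) (use gi has_bochner_integral_iff in blast)
	have "(PROD i:UNIV. \<integral>t. ?g i t \<partial>lborel) = 1" using gi by (simp add: has_bochner_integral_iff)
	with ip have i1: "(LINT y|lborel. prodf ?g y) = 1" by (simp add: has_bochner_integral_iff)
	have z: "prodf ?g y = 0" if "y ~: open_unit_cube" for y
	proof -
		have "EX i. ~ (0 < y $ i & y $ i < 1)" using that by (auto simp: open_unit_cube_def)
		then obtain i where i: "~ (0 < y $ i & y $ i < 1)" by blast
		obtain lo hi where lh: "0 < lo" "hi < 1" "ALL t. t < lo \<or> t > hi --> (ALL be. kch k sh l (?m i) be t = 0)"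
			using kernel_support[OF l m, of i k] by metis
		have "y $ i < lo \<or> y $ i > hi" using i lh by linarith
		hence "ALL be. kch k sh l (?m i) be (y $ i) = 0" using lh(3) by blast
		hence "?g i (y $ i) = 0" by simp
		thus ?thesis unfolding prodf_def by (intro prod_zero bexI[of _ i]) auto
	qed
	have "opA k sh l (%_. c) x = (LINT y|OC. c * prodf ?g y)" by (rule opA_kernel[OF _ l x]) simp
	also have "... = c * (LINT y|OC. prodf ?g y)" by simp
	also have "(LINT y|OC. prodf ?g y) = (LINT y|lborel. prodf ?g y)"
		by (rule integral_OC_lborel[OF _ z]) (intro borel_measurable_continuous_onI continuous_prodf sg)
	finally show ?thesis using i1 by simp
qed

lemma tot_diff:
	assumes "integrable OC (f :: real^'n::finite => real)" "integrable OC g" "be : Bk k" "1 <= l" "m : cells sh l"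
	shows "tot k sh (%y. f y - g y) l m be = tot k sh f l m be - tot k sh g l m be"
	unfolding tot_def left_diff_distrib
	by (rule Bochner_Integration.integral_diff[OF kch_integrable(1)[OF assms(1,3-5)] kch_integrable(1)[OF assms(2-5)]])

lemma opA_diff:
	assumes "integrable OC (f :: real^'n::finite => real)" "integrable OC g" "1 <= l" "x : open_unit_cube" "0 <= sh" "sh < 1"
	shows "opA k sh l (%y. f y - g y) x = opA k sh l f x - opA k sh l g x"
	unfolding opA_def sum_subtractf[symmetric] left_diff_distrib[symmetric]
	by (intro sum.cong refl) (simp add: tot_diff[OF assms(1,2) _ assms(3) cl_cells(1)[OF assms(4-6)]])

lemma cl_level_set:
	"{x : open_unit_cube. cl sh l x = m} : sets (borel :: (real^'n::finite) measure)"
proof -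
	have "{x : open_unit_cube. cl sh l x = m} = open_unit_cube Int {x. ALL i. cl sh l x i = m i}" by (auto simp: fun_eq_iff)
	moreover have "{x : space borel. ALL i:(UNIV :: 'n set). cl sh l x i = m i} : sets (borel :: (real^'n) measure)"
	proof (rule sets.sets_Collect_finite_All)
		fix i
		have "(%x :: real^'n. floor (2 ^ l * ((x $ i + sh) / 2))) : measurable borel (count_space UNIV)" by measurable
		hence "(%x :: real^'n. nat (floor (2 ^ l * ((x $ i + sh) / 2)))) : measurable borel (count_space UNIV)" by measurable
		from measurable_sets[OF this, of "{m i}"] show "{x : space borel. cl sh l x i = m i} : sets (borel :: (real^'n) measure)"
			by (simp add: cl_def cel_def yc_def vimage_def Int_def conj_commute)
	qed simp
	ultimately show ?thesis by auto
qed

lemma cl_level_measure: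
	fixes m :: "'n::finite => nat"
	assumes sh: "0 <= sh" "sh < 1"
	shows "emeasure OC {x : open_unit_cube. cl sh l x = m} <= ennreal (hw l ^ CARD('n))"
proof -
	let ?S = "{x : open_unit_cube. cl sh l x = m} :: (real^'n) set"
	let ?a = "(\<chi> i. crn sh l (m i)) :: real^'n" let ?b = "(\<chi> i. crn sh l (m i) + hw l) :: real^'n"
	have h: "0 < hw l" by (rule hw_pos)
	have sub: "?S \<subseteq> cbox ?a ?b"
	proof
		fix x assume "x : ?S"
		hence x: "x : open_unit_cube" "cl sh l x = m" by auto
		have "crn sh l (m i) <= x $ i & x $ i <= crn sh l (m i) + hw l" for i
			using cl_crn[OF x(1) sh, of i l] fr_bounds[of l "yc sh x i"] h unfolding x(2)
			by (auto intro: mult_left_le_one_le)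
		thus "x : cbox ?a ?b" by (simp add: mem_box_cart)
	qed
	have "emeasure OC ?S = emeasure lborel ?S" by (rule emeasure_OC[OF cl_level_set]) auto
	also have "... <= emeasure lborel (cbox ?a ?b)" by (rule emeasure_mono) (use sub in auto)
	also have "... = (PROD b:Basis. (?b - ?a) \<bullet> b)"
		by (rule emeasure_lborel_cbox) (use h in "auto simp: Basis_vec_def inner_axis")
	also have "(PROD b:Basis. (?b - ?a) \<bullet> b) = hw l ^ CARD('n)" using prod_Basis_vec[of "%t. t" "?b - ?a"] by simp
	finally show ?thesis .
qed

lemma opA_measurable: "(opA k sh l f :: real^'n::finite => real) : mOC" if sh: "0 <= sh" "sh < 1"
proof -
	let ?S = "%m. {x : open_unit_cube. cl sh l x = m} :: (real^'n) set"
	let ?h = "%x. SUM m:cells sh l. indicator (?S m) x * (SUM be:Bk k. tot k sh f l m be * (PROD i:UNIV. (2 ^ l * ((x $ i + sh) / 2) - real (m i)) ^ be i))"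
	have S: "?S m : sets borel" for m by (rule cl_level_set)
	have "?h : borel_measurable borel" using S by measurable
	hence "?h : mOC" by (rule borel_OC)
	moreover have "opA k sh l f x = ?h x" if x: "x : space OC" for x
	proof -
		have x': "x : open_unit_cube" using x by simp
		have "?h x = (SUM m:cells sh l. if m = cl sh l x then (SUM be:Bk k. tot k sh f l m be * (PROD i:UNIV. (2 ^ l * ((x $ i + sh) / 2) - real (m i)) ^ be i)) else 0)"
			using x' by (intro sum.cong refl) (auto simp: indicator_def)
		also have "... = (SUM be:Bk k. tot k sh f l (cl sh l x) be * (PROD i:UNIV. (2 ^ l * ((x $ i + sh) / 2) - real (cl sh l x i)) ^ be i))"
			by (subst sum.delta'[OF cells_finite] sum.delta[OF cells_finite]) (simp only: cl_cells(1)[OF x' sh] if_True)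
		also have "... = opA k sh l f x"
		proof -
			have "2 ^ l * ((x $ i + sh) / 2) - real (cl sh l x i) = fr l (yc sh x i)" for i
				using cel_fr[OF yc_range(1)[OF x' sh], of l i] unfolding cl_def yc_def by linarith
			thus ?thesis unfolding opA_def mnm_def by simp
		qed
		finally show ?thesis by simp
	qed
	ultimately show ?thesis by (subst measurable_cong) auto
qed

text \<open>On a cell \<open>opA\<close> is controlled by the integral of \<open>abs f\<close> over
  the neighbourhood divided by \<open>hw l ^ d\<close>. Cells have at most this measure and the
  neighbourhoods overlap boundedly, so the constant is independent of \<open>l\<close>.\<close>

lemma opA_L1:
	"EX C>=1. ALL sh l (f :: real^'n::finite => real). integrable OC f --> 1 <= l --> 0 <= sh --> sh < 1 -->
			integrable OC (opA k sh l f) & (LINT x|OC. abs (opA k sh l f x)) <= C * (LINT x|OC. abs (f x))"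
proof -
	obtain C where C: "1 <= C" "!!(sh :: real) (l :: nat) (x :: real^'n) f. integrable OC f ==> 1 <= l ==> x : open_unit_cube ==> 0 <= sh ==> sh < 1 ==>
			abs (opA k sh l f x) <= C / hw l ^ CARD('n) * (LINT y|OC. indicator (nbh sh l (cl sh l x)) y * abs (f y))"
		using opA_bound[of k, where 'n='n] by blast
	show ?thesis
	proof (intro exI[of _ "C * 9 ^ CARD('n)"] conjI allI impI)
		show "1 <= C * 9 ^ CARD('n)" using C(1) mult_mono[of 1 C 1 "9 ^ CARD('n)"] by simp
		fix sh :: real and l :: nat and f :: "real^'n => real" assume f: "integrable OC f" and l: "1 <= l" and sh: "0 <= sh" "sh < 1"
		have h: "0 < hw l" by (rule hw_pos)
		let ?S = "%m. {x : open_unit_cube. cl sh l x = m} :: (real^'n) set"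
		define I where "I m = (LINT y|OC. iN sh l m y * abs (f y))" for m
		have I0: "0 <= I m" for m unfolding I_def by (intro Bochner_Integration.integral_nonneg) (auto simp: indicator_def)
		have Ie: "ennreal (I m) = (NI y. iN sh l m y * ennreal (abs (f y)))" for m
		proof -
			have "integrable OC (%y. abs (f y) * iN sh l m y)"
				by (rule integrable_mult_bounded[of _ _ _ 1]) (use f nbh_sets in "auto intro: borel_measurable_indicator")
			hence "ennreal (I m) = (NI y. ennreal (iN sh l m y * abs (f y)))"
				unfolding I_def by (subst nn_integral_eq_integral) (auto simp: mult.commute indicator_def)
			also have "... = (NI y. iN sh l m y * ennreal (abs (f y)))"
				by (intro nn_integral_cong) (auto simp: indicator_def)
			finally show ?thesis .
		qed
		have Sm: "emeasure OC (?S m) <= ennreal (hw l ^ CARD('n))" for m by (rule cl_level_measure[OF sh])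
		let ?c = "C / hw l ^ CARD('n)"
		have c0: "0 <= ?c" using C(1) h by simp
		have "(NI x. ennreal (abs (opA k sh l f x))) <= (NI x. (SUM m:cells sh l. ennreal (?c * I m) * indicator (?S m) x))"
		proof (rule nn_integral_mono)
			fix x :: "real^'n" assume "x : space OC"
			hence x: "x : open_unit_cube" by simp
			have "ennreal (abs (opA k sh l f x)) <= ennreal (?c * I (cl sh l x)) * indicator (?S (cl sh l x)) x"
				using C(2)[OF f l x sh] x unfolding I_def by (simp add: ennreal_leI)
			also have "... <= (SUM m:cells sh l. ennreal (?c * I m) * indicator (?S m) x)"
				by (rule member_le_sum[of "cl sh l x" _ "%m. ennreal (?c * I m) * indicator (?S m) x"]) (use cl_cells(1)[OF x sh] cells_finite in auto)
			finally show "ennreal (abs (opA k sh l f x)) <= (SUM m:cells sh l. ennreal (?c * I m) * indicator (?S m) x)" .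
		qed
		also have "... = (SUM m:cells sh l. \<integral>\<^sup>+x. ennreal (?c * I m) * indicator (?S m) x \<partial>OC)"
			by (rule nn_integral_sum) (intro borel_measurable_times_ennreal borel_measurable_const borel_OC borel_measurable_indicator cl_level_set)
		also have "... = (SUM m:cells sh l. ennreal (?c * I m) * emeasure OC (?S m))"
		proof (intro sum.cong refl nn_integral_cmult_indicator)
			fix m
			have "?S m : sets lebesgue" using cl_level_set[of sh l m] by (intro sets_completionI_sets) simp
			thus "?S m : sets OC" by (auto simp: sets_restrict_space_iff)
		qed
		also have "... <= (SUM m:cells sh l. ennreal (?c * I m) * ennreal (hw l ^ CARD('n)))"
			by (intro sum_mono mult_left_mono Sm) auto
		also have "... = (SUM m:cells sh l. ennreal C * ennreal (I m))"
		proof (intro sum.cong refl)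
			fix m
			have "ennreal (?c * I m) * ennreal (hw l ^ CARD('n)) = ennreal (?c * I m * hw l ^ CARD('n))"
				using h by (intro ennreal_mult[symmetric] mult_nonneg_nonneg c0 I0) auto
			also have "?c * I m * hw l ^ CARD('n) = C * I m" using h by simp
			finally show "ennreal (?c * I m) * ennreal (hw l ^ CARD('n)) = ennreal C * ennreal (I m)"
				using C(1) I0 by (simp add: ennreal_mult)
		qed
		also have "... = ennreal C * (SUM m:cells sh l. \<integral>\<^sup>+y. iN sh l m y * ennreal (abs (f y)) \<partial>OC)"
			by (simp add: sum_distrib_left Ie)
		also have "... <= ennreal C * (9 ^ CARD('n) * (NI y. ennreal (abs (f y))))"
			by (intro mult_left_mono nbh_sum) (use f in auto)
		also have "(NI y. ennreal (abs (f y))) = ennreal (LINT y|OC. abs (f y))" using f by (intro nn_integral_eq_integral) auto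
		also have "ennreal C * (9 ^ CARD('n) * ennreal (LINT y|OC. abs (f y))) = ennreal (C * 9 ^ CARD('n) * (LINT y|OC. abs (f y)))"
			using C(1) by (simp add: ennreal_mult ennreal_power[symmetric] mult.assoc)
		finally have *: "(NI x. ennreal (abs (opA k sh l f x))) <= ennreal (C * 9 ^ CARD('n) * (LINT y|OC. abs (f y)))" .
		show i: "integrable OC (opA k sh l f)"
			by (rule integrableI_bounded[OF opA_measurable[OF sh]]) (use * in "simp add: le_less_trans")
		show "(LINT x|OC. abs (opA k sh l f x)) <= C * 9 ^ CARD('n) * (LINT x|OC. abs (f x))"
			by (rule integral_real_bounded) (use * C(1) in auto)
	qed
qed


lemma continuous_integrable_OC:
	assumes u: "continuous_on UNIV (u :: real^'n::finite => real)" shows "integrable OC u"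
proof -
	interpret finite_measure "OC :: (real^'n) measure" by (rule finite_measure_OC)
	have "compact (u ` cbox 0 1)" by (rule compact_continuous_image) (auto intro: continuous_on_subset[OF u])
	hence "bounded (u ` cbox 0 1)" by (rule compact_imp_bounded)
	then obtain B where "ALL z:u ` cbox 0 1. norm z <= B" unfolding bounded_iff by blast
	hence B: "norm (u x) <= B" if "x : cbox 0 1" for x using that by blast
	have "norm (u x) <= B" if "x : space OC" for x using that by (intro B) (auto simp: open_unit_cube_def mem_box_cart less_imp_le)
	thus ?thesis by (intro integrable_const_bound[of _ B] AE_I2 borel_OC borel_measurable_continuous_onI u) 
qed

lemma opA_uniform:
	assumes u: "continuous_on UNIV (u :: real^'n::finite => real)" and sh: "0 <= sh" "sh < 1" and e: "0 < e"
	shows "EX l0>=1. ALL l>=l0. ALL x:open_unit_cube. abs (opA k sh l u x - u x) <= e"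
proof -
	interpret finite_measure "OC :: (real^'n) measure" by (rule finite_measure_OC)
	obtain C where C: "1 <= C" "!!(sh :: real) (l :: nat) (x :: real^'n) f. integrable OC f ==> 1 <= l ==> x : open_unit_cube ==> 0 <= sh ==> sh < 1 ==>
			abs (opA k sh l f x) <= C / hw l ^ CARD('n) * (LINT y|OC. indicator (nbh sh l (cl sh l x)) y * abs (f y))"
		using opA_bound[of k, where 'n='n] by blast
	let ?et = "e / (C * 8 ^ CARD('n))"
	have et: "0 < ?et" using e C(1) by simp
	have "uniformly_continuous_on (cbox 0 1) u" by (intro compact_uniformly_continuous continuous_on_subset[OF u]) auto
	then obtain d where d: "0 < d" "!!x y. x : cbox 0 1 ==> y : cbox 0 1 ==> dist y x < d ==> dist (u y) (u x) < ?et"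
		using et unfolding uniformly_continuous_on_def by metis
	have "(%l. 8 * real CARD('n) * (2 * (1 / 2) ^ l)) ----> 8 * real CARD('n) * (2 * 0)"
		by (intro tendsto_intros LIMSEQ_power_zero) auto
	hence "eventually (%l. 8 * real CARD('n) * (2 * (1 / 2) ^ l) < d) sequentially"
		by (rule order_tendstoD) (use d in simp)
	then obtain l0 where l0: "!!l. l0 <= l ==> 8 * real CARD('n) * (2 * (1 / 2) ^ l) < d" by (auto simp: eventually_sequentially)
	show ?thesis
	proof (intro exI[of _ "max 1 l0"] conjI allI impI ballI)
		fix l and x :: "real^'n" assume l: "max 1 l0 <= l" and x: "x : open_unit_cube"
		hence l1: "1 <= l" by simp
		have h: "0 < hw l" by (rule hw_pos)
		have hd: "8 * real CARD('n) * hw l < d" using l0[of l] l by (simp add: hw_def power_one_over)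
		let ?N = "nbh sh l (cl sh l x)"
		have sub: "x : ?N" by (rule cl_cells(2)[OF x sh])
		have c: "z : cbox 0 1" if "z : open_unit_cube" for z :: "real^'n" using that by (auto simp: open_unit_cube_def mem_box_cart less_imp_le)
		have near: "abs (u y - u x) <= ?et" if y: "y : ?N" for y
		proof -
			have "dist y x < d" using nbh_dist[OF y sub] hd by linarith
			thus ?thesis using d(2)[OF c[OF x] c] y by (auto simp: nbh_def dist_real_def intro: less_imp_le)
		qed
		have i: "integrable OC u" by (rule continuous_integrable_OC[OF u])
		have "(LINT y|OC. indicator ?N y * abs (u y - u x)) <= ?et * (8 * hw l) ^ CARD('n)"
		proof (rule integral_real_bounded)
			show "0 <= ?et * (8 * hw l) ^ CARD('n)" using less_imp_le[OF et] h by (intro mult_nonneg_nonneg) auto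
			have "(NI y. ennreal (indicator ?N y * abs (u y - u x))) <= (NI y. ennreal ?et * indicator ?N y)"
				by (intro nn_integral_mono) (use near in "auto simp: indicator_def intro!: ennreal_leI")
			also have "... = ennreal ?et * emeasure OC ?N" by (rule nn_integral_cmult_indicator[OF nbh_sets])
			also have "... <= ennreal ?et * ennreal ((8 * hw l) ^ CARD('n))" by (intro mult_left_mono nbh_measure(1)) simp
			also have "... = ennreal (?et * (8 * hw l) ^ CARD('n))" using et h by (intro ennreal_mult[symmetric]) auto
			finally show "(NI y. ennreal (indicator ?N y * abs (u y - u x))) <= ennreal (?et * (8 * hw l) ^ CARD('n))" .
		qed
		hence "C / hw l ^ CARD('n) * (LINT y|OC. indicator ?N y * abs (u y - u x)) <= C / hw l ^ CARD('n) * (?et * (8 * hw l) ^ CARD('n))"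
			using C(1) h by (intro mult_left_mono) auto
		also have "... = e" using C(1) h by (simp add: power_mult_distrib)
		finally have "abs (opA k sh l (%y. u y - u x) x) <= e"
			using C(2)[OF _ l1 x sh, of "%y. u y - u x"] Bochner_Integration.integrable_diff[OF i integrable_const[of "u x"]] by linarith
		thus "abs (opA k sh l u x - u x) <= e"
			using opA_diff[OF i _ l1 x sh, of "%_. u x" k] opA_const[OF l1 x sh, of k "u x"] by simp
	qed simp
qed

section \<open>Density of continuous functions and almost everywhere convergence\<close>

definition clip :: "real => real => real" where "clip N t = max (- N) (min N t)"

text \<open>\<open>f\<close> is first clipped to a bounded function, then approximated almost
  everywhere by continuous functions clipped at the same height, so that dominated convergence
  applies both times.\<close>

lemma L1_continuous_dense:
	assumes f: "integrable OC (f :: real^'n::finite => real)" and e: "0 < e"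
	shows "EX u. continuous_on UNIV u & (LINT x|OC. abs (f x - u x)) <= e"
proof -
	interpret finite_measure "OC :: (real^'n) measure" by (rule finite_measure_OC)
	have fm[measurable]: "f : mOC" using f by simp
	have cm: "(%x. clip c (g x)) : mOC" if "g : mOC" for c and g :: "real^'n => real"
		using that unfolding clip_def by measurable
	have "(%n. \<integral>x. abs (f x - clip (real n) (f x)) \<partial>OC) ----> (\<integral>x. 0 \<partial>(OC :: (real^'n) measure))"
	proof (rule integral_dominated_convergence[where w="%x. abs (f x)"])
		show "(%x. abs (f x - clip (real n) (f x))) : mOC" for n using cm[OF fm] by measurable
		show "AE x in OC. (%n. abs (f x - clip (real n) (f x))) ----> 0"
		proof (intro AE_I2 tendsto_eventually)
			fix x
			obtain n where n: "abs (f x) <= real n" using real_arch_simple by blast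
			show "\<forall>\<^sub>F n in sequentially. abs (f x - clip (real n) (f x)) = 0"
				unfolding eventually_sequentially by (rule exI[of _ n]) (use n in "auto simp: clip_def")
		qed
	qed (use f in "auto simp: clip_def")
	hence "eventually (%n. (LINT x|OC. abs (f x - clip (real n) (f x))) < e / 2) sequentially"
		by (rule order_tendstoD) (use e in simp)
	then obtain N :: nat where N: "(LINT x|OC. abs (f x - clip (real N) (f x))) < e / 2" by (auto simp: eventually_sequentially)
	have os: "open_unit_cube : sets (lebesgue :: (real^'n) measure)" by simp
	have "f measurable_on open_unit_cube"
		using fm os by (simp add: measurable_on_iff_borel_measurable)
	then obtain Z g where Z: "negligible Z" "!!n. continuous_on UNIV (g n)"
			"!!x. x ~: Z ==> (%n. g n x) ----> (if x : open_unit_cube then f x else 0)"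
		unfolding measurable_on_def by blast
	have "AE x in OC. x ~: Z"
	proof -
		have "AE x in lebesgue. x ~: Z" using Z(1) by (simp add: negligible_iff_null_sets AE_not_in)
		thus ?thesis using os by (subst AE_restrict_space_iff) auto
	qed
	hence ae: "AE x in OC. (%n. g n x) ----> f x"
		using AE_space by eventually_elim (use Z(3) in force)
	have gm: "g n : mOC" for n by (intro borel_OC borel_measurable_continuous_onI Z)
	have "(%n. \<integral>x. abs (clip (real N) (f x) - clip (real N) (g n x)) \<partial>OC) ----> (\<integral>x. 0 \<partial>(OC :: (real^'n) measure))"
	proof (rule integral_dominated_convergence[where w="%x. 2 * real N"])
		show "(%x. abs (clip (real N) (f x) - clip (real N) (g n x))) : mOC" for n using cm[OF fm] cm[OF gm] by measurable
		show "AE x in OC. (%n. abs (clip (real N) (f x) - clip (real N) (g n x))) ----> 0"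
			using ae
		proof eventually_elim
			case (elim x)
			hence "(%n. abs (clip (real N) (f x) - clip (real N) (g n x))) ----> abs (clip (real N) (f x) - clip (real N) (f x))"
				unfolding clip_def by (intro tendsto_intros)
			thus ?case by simp
		qed
	qed (auto simp: clip_def)
	hence "eventually (%n. (LINT x|OC. abs (clip (real N) (f x) - clip (real N) (g n x))) < e / 2) sequentially"
		by (rule order_tendstoD) (use e in simp)
	then obtain n where n: "(LINT x|OC. abs (clip (real N) (f x) - clip (real N) (g n x))) < e / 2" by (auto simp: eventually_sequentially)
	let ?u = "%x. clip (real N) (g n x)"
	have u: "continuous_on UNIV ?u" unfolding clip_def by (intro continuous_intros Z)
	have ui: "integrable OC ?u" by (rule continuous_integrable_OC[OF u])
	have ci: "integrable OC (%x. clip (real N) (f x))"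
		by (rule Bochner_Integration.integrable_bound[OF f]) (use cm[OF fm] in "auto simp: clip_def")
	have "(LINT x|OC. abs (f x - ?u x)) <= (LINT x|OC. abs (f x - clip (real N) (f x)) + abs (clip (real N) (f x) - ?u x))"
		by (intro integral_mono) (use f ui ci in auto)
	also have "... = (LINT x|OC. abs (f x - clip (real N) (f x))) + (LINT x|OC. abs (clip (real N) (f x) - ?u x))"
		by (rule Bochner_Integration.integral_add) (use f ui ci in auto)
	finally show ?thesis using N n u by (intro exI[of _ ?u]) auto
qed

text \<open>Density argument: the operators are uniformly bounded on \<open>L^1\<close> and converge
  uniformly on continuous functions.\<close>

lemma opA_tendsto_L1:
	assumes f: "integrable OC (f :: real^'n::finite => real)" and sh: "0 <= sh" "sh < 1"
	shows "(%l. \<integral>x. norm (opA k sh (Suc l) f x - f x) \<partial>OC) ----> 0"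
proof (rule LIMSEQ_I)
	fix e :: real assume e: "0 < e"
	interpret prob_space "OC :: (real^'n) measure" by (rule prob_space_OC)
	obtain C where C: "1 <= C" "!!(sh :: real) (l :: nat) (f :: real^'n => real). integrable OC f ==> 1 <= l ==> 0 <= sh ==> sh < 1 ==>
			integrable OC (opA k sh l f) & (LINT x|OC. abs (opA k sh l f x)) <= C * (LINT x|OC. abs (f x))"
		using opA_L1[of k, where 'n='n] by blast
	have "0 < e / (4 * C)" using e C(1) by simp
	then obtain u where u: "continuous_on UNIV u" "(LINT x|OC. abs (f x - u x)) <= e / (4 * C)" using L1_continuous_dense[OF f] by blast
	have ui: "integrable OC u" by (rule continuous_integrable_OC[OF u(1)])
	obtain l0 where l0: "1 <= l0" "!!l x. l0 <= l ==> x : open_unit_cube ==> abs (opA k sh l u x - u x) <= e / 4"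
		using opA_uniform[OF u(1) sh, of "e / 4" k] e by auto
	have fi: "integrable OC (%x. f x - u x)" using f ui by simp
	have "(LINT x|OC. abs (opA k sh l f x - f x)) < e" if l: "l0 <= l" for l
	proof -
		have l1: "1 <= l" using l l0(1) by simp
		have i1: "integrable OC (opA k sh l (%x. f x - u x))" "(LINT x|OC. abs (opA k sh l (%x. f x - u x) x)) <= C * (LINT x|OC. abs (f x - u x))"
			using C(2)[OF fi l1 sh] by auto
		have i2: "integrable OC (opA k sh l f)" using C(2)[OF f l1 sh] by simp
		have "(LINT x|OC. abs (opA k sh l f x - f x)) <= (LINT x|OC. abs (opA k sh l (%x. f x - u x) x) + (e / 4 + abs (f x - u x)))"
		proof (rule integral_mono)
			fix x :: "real^'n" assume "x : space OC"
			hence x: "x : open_unit_cube" by simp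
			show "abs (opA k sh l f x - f x) <= abs (opA k sh l (%x. f x - u x) x) + (e / 4 + abs (f x - u x))"
				using l0(2)[OF l x] opA_diff[OF f ui l1 x sh, of k] by linarith
		qed (use i1(1) i2 f fi in auto)
		also have "... = (LINT x|OC. abs (opA k sh l (%x. f x - u x) x)) + (LINT x|OC. e / 4 + abs (f x - u x))"
			by (rule Bochner_Integration.integral_add) (use i1(1) fi in auto)
		also have "(LINT x|OC. e / 4 + abs (f x - u x)) = e / 4 + (LINT x|OC. abs (f x - u x))"
			by (subst Bochner_Integration.integral_add) (use fi prob_space in auto)
		finally have "(LINT x|OC. abs (opA k sh l f x - f x)) <= C * (e / (4 * C)) + (e / 4 + e / (4 * C))"
			using i1(2) u(2) mult_left_mono[OF u(2), of C] C(1) by linarith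
		moreover have "e / (4 * C) <= e / 4" using C(1) e by (intro divide_left_mono) auto
		ultimately show ?thesis using C(1) e by simp
	qed
	thus "EX no. ALL n>=no. norm ((LINT x|OC. norm (opA k sh (Suc n) f x - f x)) - 0) < e"
		by (intro exI[of _ l0]) simp
qed

text \<open>Almost everywhere convergence is obtained along a subsequence; this suffices because the
  later error bounds hold for every partial sum from level \<open>lm\<close> on.\<close>

lemma opA_subseq:
	assumes f: "integrable OC (f :: real^'n::finite => real)" and sh: "0 <= sh" "sh < 1"
	shows "EX r. strict_mono r & (AE x in OC. (%n. opA k sh (Suc (r n)) f x) ----> f x)"
proof -
	have i: "integrable OC (opA k sh (Suc l) f)" for l using opA_L1[of k, where 'n='n] f sh by (metis One_nat_def Suc_le_mono le0)
	have "EX r. strict_mono r & (AE x in OC. (%n. opA k sh (Suc (r n)) f x - f x) ----> 0)"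
		using tendsto_L1_AE_subseq[OF _ opA_tendsto_L1[OF f sh, of k]] i f by auto
	thus ?thesis by (simp add: LIM_zero_iff)
qed

section \<open>Coefficient decay of Sobolev functions\<close>

lemma nn_integral_OC_le:
	"(\<integral>\<^sup>+x. g x \<partial>(OC :: (real^'n::finite) measure)) <= (\<integral>\<^sup>+x. g x \<partial>lebesgue_on unit_cube)"
proof -
	have U: "(unit_cube :: (real^'n) set) = cbox 0 1" by (auto simp: unit_cube_def mem_box_cart)
	have "(NI x. g x) = (\<integral>\<^sup>+x. g x * indicator open_unit_cube x \<partial>lebesgue)"
		by (rule nn_integral_restrict_space) simp
	also have "... <= (\<integral>\<^sup>+x. g x * indicator unit_cube x \<partial>lebesgue)"
		by (intro nn_integral_mono mult_left_mono) (auto simp: indicator_def open_unit_cube_def unit_cube_def less_imp_le)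
	also have "... = (\<integral>\<^sup>+x. g x \<partial>lebesgue_on unit_cube)"
		by (rule nn_integral_restrict_space[symmetric]) (simp add: U)
	finally show ?thesis .
qed

lemma unit_cube_sets: "(unit_cube :: (real^'n::finite) set) : sets lebesgue"
proof -
	have U: "(unit_cube :: (real^'n) set) = cbox 0 1" by (auto simp: unit_cube_def mem_box_cart)
	show ?thesis unfolding U by simp
qed

lemma AE_OC:
	assumes "AE x in lebesgue_on unit_cube. P x" shows "AE x in (OC :: (real^'n::finite) measure). P x"
proof -
	have "AE x in lebesgue. x : unit_cube --> P x" using assms unit_cube_sets by (subst (asm) AE_restrict_space_iff) auto
	hence "AE x in lebesgue. x : (open_unit_cube :: (real^'n) set) --> P x"
		by eventually_elim (auto simp: open_unit_cube_def unit_cube_def less_imp_le)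
	thus ?thesis by (subst AE_restrict_space_iff) auto
qed

text \<open>Local integrability speaks of compact subsets only; the cubes \<open>?K n\<close>
  exhaust the open cube.\<close>

lemma loc_integrable_measurable:
	assumes "loc_integrable (D :: real^'n::finite => real)" shows "D : mOC"
proof -
	let ?K = "%n. {x. ALL i. 1 / real (n + 2) <= x $ i & x $ i <= 1 - 1 / real (n + 2)} :: (real^'n) set"
	have Kb: "?K n = cbox (\<chi> i. 1 / real (n + 2)) (\<chi> i. 1 - 1 / real (n + 2))" for n by (auto simp: mem_box_cart)
	have Ko: "?K n \<subseteq> open_unit_cube" for n
	proof
		fix x :: "real^'n" assume "x : ?K n"
		hence "1 / real (n + 2) <= x $ i & x $ i <= 1 - 1 / real (n + 2)" for i by simp
		moreover have "0 < 1 / real (n + 2)" by simp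
		ultimately have "0 < x $ i & x $ i < 1" for i by (smt (verit, best))
		thus "x : open_unit_cube" unfolding open_unit_cube_def by simp
	qed
	have m: "(%x. indicator (?K n) x * D x) : borel_measurable lebesgue" for n
	proof -
		have "compact (?K n)" unfolding Kb by simp
		hence "integrable (lebesgue_on (?K n)) D" using assms Ko unfolding loc_integrable_def by blast
		hence "D : borel_measurable (lebesgue_on (?K n))" by simp
		thus ?thesis using Kb by (subst (asm) borel_measurable_restrict_space_iff) auto
	qed
	have "(%n. indicator (?K n) x * D x) ----> indicator open_unit_cube x * D x" for x
	proof (cases "x : open_unit_cube")
		case False
		hence "x ~: ?K n" for n using Ko by blast
		thus ?thesis using False by simp
	next
		case True
		have "eventually (%n. ALL i:UNIV. 1 / real (n + 2) < min (x $ i) (1 - x $ i)) sequentially"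
		proof (rule eventually_ball_finite)
			show "ALL i:UNIV. eventually (%n. 1 / real (n + 2) < min (x $ i) (1 - x $ i)) sequentially"
			proof
				fix i
				have "(%n. 1 / real (n + 2)) ----> 0" by real_asymp
				thus "eventually (%n. 1 / real (n + 2) < min (x $ i) (1 - x $ i)) sequentially"
					by (rule order_tendstoD) (use True in "simp add: open_unit_cube_def")
			qed
		qed simp
		hence "eventually (%n. indicator (?K n) x * D x = indicator open_unit_cube x * D x) sequentially"
		proof eventually_elim
			case (elim n)
			have "1 / real (n + 2) <= x $ i & x $ i <= 1 - 1 / real (n + 2)" for i using elim[rule_format, of i] by auto
			hence "x : ?K n" by blast
			thus ?case using True by (simp add: indicator_def)
		qed
		thus ?thesis by (rule tendsto_eventually)
	qed
	hence "(%x. indicator open_unit_cube x * D x) : borel_measurable lebesgue"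
		by (rule borel_measurable_LIMSEQ_real[OF _ m])
	thus ?thesis by (subst borel_measurable_restrict_space_iff) auto
qed

lemma powr_sum_le:
	assumes "finite A" "!!i. i : A ==> 0 <= x i" "0 <= q"
	shows "(SUM i:A. x i :: real) powr q <= real (card A) powr q * (SUM i:A. x i powr q)"
proof (cases "A = {}")
	case False
	define M where "M = Max (x ` A)"
	have "M : x ` A" unfolding M_def using assms(1) False by (intro Max_in) auto
	then obtain j where j: "j : A" "x j = M" by blast
	have "x i <= M" if "i : A" for i unfolding M_def using assms(1) that by simp
	hence "(SUM i:A. x i) <= real (card A) * M" by (rule sum_bounded_above)
	hence "(SUM i:A. x i) powr q <= (real (card A) * M) powr q" using assms by (intro powr_mono2 sum_nonneg) auto
	also have "... = real (card A) powr q * M powr q" using assms(2)[OF j(1)] j(2) by (intro powr_mult)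
	also have "M powr q <= (SUM i:A. x i powr q)"
		using member_le_sum[of j A "%i. x i powr q"] j assms(1) by simp
	finally show ?thesis by (simp add: mult_left_mono)
qed (simp add: assms)

lemma ennreal_powr_bound:
	assumes "enn_root q I <= ennreal N" "0 < N" "0 < q" shows "I <= ennreal (N powr q)"
proof -
	have I: "I ~= \<infinity>" using assms(1) by (auto simp: enn_root_def top_unique)
	hence "enn2real I powr (1 / q) <= N" using assms by (simp add: enn_root_def)
	hence "(enn2real I powr (1 / q)) powr q <= N powr q" using assms by (intro powr_mono2) auto
	hence "enn2real I <= N powr q" using assms by (simp add: powr_powr)
	thus ?thesis using I by (metis ennreal_enn2real ennreal_leI infinity_ennreal_def less_top)
qed

lemma Lnorm_top_bound:
	assumes "Lnorm \<infinity> (f :: real^'n::finite => real) <= ennreal N" "0 <= N"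
	shows "AE x in OC. abs (f x) <= N"
proof -
	have "AE x in lebesgue_on unit_cube. ennreal (abs (f x)) <= Lnorm \<infinity> f" unfolding Lnorm_def by (simp add: esssup_AE)
	hence "AE x in lebesgue_on unit_cube. abs (f x) <= N"
	proof eventually_elim
		case (elim x)
		hence "ennreal (abs (f x)) <= ennreal N" using assms(1) by (rule order_trans)
		thus ?case using assms(2) by simp
	qed
	thus ?thesis by (rule AE_OC)
qed

lemma AE_bound_integral:
	assumes "AE x in (OC :: (real^'n::finite) measure). abs (f x) <= N" "0 <= q"
	shows "(NI x::real^'n. ennreal (abs (f x) powr q)) <= ennreal (N powr q)"
proof -
	interpret prob_space "OC :: (real^'n) measure" by (rule prob_space_OC)
	have "(NI x. ennreal (abs (f x) powr q)) <= (NI x::real^'n. ennreal (N powr q))"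
		
	proof (rule nn_integral_mono_AE)
		show "AE x in OC. ennreal (abs (f x) powr q) <= ennreal (N powr q)"
			using assms(1) by eventually_elim (use assms(2) in "auto intro!: ennreal_leI powr_mono2")
	qed
	also have "... = ennreal (N powr q)" using emeasure_space_1 by simp
	finally show ?thesis .
qed

definition unit_idx :: "nat => 'n => 'n::finite => nat" where "unit_idx k i = (%j. if j = i then k else 0)"

lemma unit_idx_multi: "unit_idx k i : multi_idx k" by (simp add: unit_idx_def multi_idx_def)

lemma finite_multi_idx: "finite (multi_idx k :: ('n::finite => nat) set)"
proof (rule finite_subset[of _ "PiE UNIV (%_. {..k})"])
	show "multi_idx k \<subseteq> (PiE UNIV (%_. {..k}) :: ('n => nat) set)"
	proof
		fix ga :: "'n => nat" assume "ga : multi_idx k"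
		hence "ga i <= k" for i using member_le_sum[of i UNIV ga] by (simp add: multi_idx_def)
		thus "ga : PiE UNIV (%_. {..k})" by (simp add: PiE_iff)
	qed
qed (intro finite_PiE, auto)

text \<open>For \<open>q = \<infinity>\<close> the exponent \<open>q'\<close> may be any finite
  number at least 1, since the cube has measure 1. All later sums use this finite exponent.\<close>

lemma sob_extract:
	fixes f :: "real^'n::finite => real"
	assumes s: "0 < s" and q: "1 <= q" and q': "1 <= q'" "q = \<infinity> \<or> q' = enn2real q"
		and N: "sob_expr s q f D <= ennreal N" "0 < N" and ga: "ga : multi_idx (sob_order s)"
	shows "(NI x. ennreal (abs (f x) powr q')) <= ennreal (N powr q')"
		"(NI x. ennreal (abs (D ga x) powr q')) <= ennreal (N powr q')"
		"q ~= \<infinity> ==> s ~: \<nat> ==> gagliardo (s - real (sob_order s)) q' (D ga) <= ennreal (N powr q')"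
		"q = \<infinity> ==> s ~: \<nat> ==> hoelder (s - real (sob_order s)) (D ga) <= ennreal N"
proof -
	let ?k = "sob_order s"
	have top: "Lnorm \<infinity> f <= ennreal N & Lnorm \<infinity> (D ga) <= ennreal N & (s ~: \<nat> --> hoelder (s - real ?k) (D ga) <= ennreal N)" if "q = \<infinity>"
	proof -
		let ?S = "%ga. Lnorm \<infinity> (D ga) + (if s : \<nat> then 0 else hoelder (s - real ?k) (D ga))"
		have e: "Lnorm \<infinity> f + (SUM ga:multi_idx ?k. ?S ga) <= ennreal N" using N(1) that by (simp add: sob_expr_def Let_def)
		have "?S ga <= (SUM ga:multi_idx ?k. ?S ga)" by (rule member_le_sum[OF ga]) (use finite_multi_idx in auto)
		also have "... <= Lnorm \<infinity> f + (SUM ga:multi_idx ?k. ?S ga)" by simp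
		finally have g: "?S ga <= ennreal N" using e by (rule order_trans)
		have "Lnorm \<infinity> f <= Lnorm \<infinity> f + (SUM ga:multi_idx ?k. ?S ga)" by simp
		moreover have "Lnorm \<infinity> (D ga) <= ?S ga" by simp
		moreover have "hoelder (s - real ?k) (D ga) <= ?S ga" if "s ~: \<nat>" using that by simp
		ultimately show ?thesis using e g order_trans by blast
	qed
	have fin: "(\<integral>\<^sup>+x. ennreal (abs (f x) powr q') \<partial>lebesgue_on unit_cube) <= ennreal (N powr q') & (\<integral>\<^sup>+x. ennreal (abs (D ga x) powr q') \<partial>lebesgue_on unit_cube) <= ennreal (N powr q')
		& (s ~: \<nat> --> gagliardo (s - real ?k) q' (D ga) <= ennreal (N powr q'))" if nq: "q ~= \<infinity>"
	proof -
		let ?F = "\<integral>\<^sup>+x. ennreal (abs (f x) powr q') \<partial>lebesgue_on unit_cube"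
		let ?G = "%ga. \<integral>\<^sup>+x. ennreal (abs (D ga x) powr q') \<partial>lebesgue_on unit_cube"
		let ?S = "%ga. ?G ga + (if s : \<nat> then 0 else gagliardo (s - real ?k) q' (D ga))"
		have qq: "q' = enn2real q" using q' nq by simp
		have "enn_root q' (?F + (SUM ga:multi_idx ?k. ?S ga)) <= ennreal N" using N(1) nq unfolding qq by (simp add: sob_expr_def Let_def)
		hence e: "?F + (SUM ga:multi_idx ?k. ?S ga) <= ennreal (N powr q')" by (rule ennreal_powr_bound) (use N q' in auto)
		have "?S ga <= (SUM ga:multi_idx ?k. ?S ga)" by (rule member_le_sum[OF ga]) (use finite_multi_idx in auto)
		also have "... <= ?F + (SUM ga:multi_idx ?k. ?S ga)" by simp
		finally have g: "?S ga <= ennreal (N powr q')" using e by (rule order_trans)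
		have "?F <= ?F + (SUM ga:multi_idx ?k. ?S ga)" by simp
		moreover have "?G ga <= ?S ga" by simp
		moreover have "gagliardo (s - real ?k) q' (D ga) <= ?S ga" if "s ~: \<nat>" using that by simp
		ultimately show ?thesis using e g order_trans by blast
	qed
	show "(NI x. ennreal (abs (f x) powr q')) <= ennreal (N powr q')"
	proof (cases "q = \<infinity>")
		case True
		thus ?thesis using top N q' by (intro AE_bound_integral Lnorm_top_bound) auto
	next
		case False
		thus ?thesis using fin nn_integral_OC_le order_trans by blast
	qed
	show "(NI x. ennreal (abs (D ga x) powr q')) <= ennreal (N powr q')"
	proof (cases "q = \<infinity>")
		case True
		thus ?thesis using top N q' by (intro AE_bound_integral Lnorm_top_bound) auto
	next
		case False
		thus ?thesis using fin nn_integral_OC_le order_trans by blast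
	qed
	show "q ~= \<infinity> ==> s ~: \<nat> ==> gagliardo (s - real (sob_order s)) q' (D ga) <= ennreal (N powr q')" using fin by blast
	show "q = \<infinity> ==> s ~: \<nat> ==> hoelder (s - real (sob_order s)) (D ga) <= ennreal N" using top by blast
qed

lemma hoelder_AE:
	fixes h :: "real^'n::finite => real"
	assumes "hoelder si h <= ennreal N" "0 <= N"
	shows "AE z in OC. AE y in OC. abs (h z - h y) <= N * dist z y powr si"
proof -
	let ?M = "lebesgue_on (unit_cube :: (real^'n) set)"
	have U: "(unit_cube :: (real^'n) set) = cbox 0 1" by (auto simp: unit_cube_def mem_box_cart)
	have "finite_measure ?M" unfolding U by (intro finite_measure_lebesgue_on) simp
	then interpret pair_sigma_finite ?M ?M
		by (simp add: pair_sigma_finite_def finite_measure_def)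
	have "AE w in ?M \<Otimes>\<^sub>M ?M. (%(x, y). ennreal (abs (h x - h y) / dist x y powr si)) w <= hoelder si h"
		unfolding hoelder_def by (rule esssup_AE)
	hence "AE z in ?M. AE y in ?M. (%(x, y). ennreal (abs (h x - h y) / dist x y powr si)) (z, y) <= hoelder si h"
		by (rule AE_pair)
	hence "AE z in ?M. AE y in ?M. abs (h z - h y) <= N * dist z y powr si"
	proof (eventually_elim)
		case (elim z)
		thus ?case
		proof eventually_elim
			case (elim y)
			hence "ennreal (abs (h z - h y) / dist z y powr si) <= ennreal N" using assms(1) by (simp add: order_trans)
			hence "abs (h z - h y) / dist z y powr si <= N" using assms(2) by simp
			thus ?case by (cases "z = y") (simp_all add: field_simps)
		qed
	qed
	hence "AE z in ?M. AE y in OC. abs (h z - h y) <= N * dist z y powr si" by eventually_elim (rule AE_OC)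
	thus ?thesis by (rule AE_OC)
qed

lemma sob_osc:
	assumes s: "0 < s" and q: "1 <= q" and q': "1 <= q'" "q = \<infinity> \<or> q' = enn2real q"
	shows "EX K>0. ALL (f :: real^'n::finite => real) D N. (ALL ga:multi_idx (sob_order s). D ga : mOC) -->
		sob_expr s q f D <= ennreal N --> 0 < N --> (ALL ga:multi_idx (sob_order s). osc K (s - real (sob_order s)) q' (D ga) N)"
proof -
	let ?si = "s - real (sob_order s)"
	have si: "0 <= ?si" using s by (simp add: sob_order_def)
	note ex = sob_extract[OF s q q']
	consider "s : \<nat>" | "s ~: \<nat>" "q ~= \<infinity>" | "s ~: \<nat>" "q = \<infinity>" by blast
	thus ?thesis
	proof cases
		case 1
		hence 0: "?si = 0" by (auto simp: sob_order_def Nats_def)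
		obtain K where K: "0 < K" "!!(D :: real^'n => real) N. D : mOC ==> 0 <= N ==>
			(NI y. ennreal (abs (D y) powr q')) <= ennreal (N powr q') ==> osc K 0 q' D N"
			using osc_integer[OF q'(1), where 'n='n] by blast
		show ?thesis unfolding 0 using K ex(2) by (intro exI[of _ K]) (auto intro!: K(2))
	next
		case 2
		obtain K where K: "0 < K" "!!(D :: real^'n => real) N. D : mOC ==> 0 <= N ==>
			(\<integral>\<^sup>+z. \<integral>\<^sup>+y. ennreal (abs (D z - D y) powr q' / dist z y powr (real CARD('n) + ?si * q')) \<partial>OC \<partial>OC) <= ennreal (N powr q') ==>
			osc K ?si q' D N"
			using osc_gagliardo[OF q'(1) si, where 'n='n] by blast
		have G: "(\<integral>\<^sup>+z. \<integral>\<^sup>+y. ennreal (abs (D z - D y) powr q' / dist z y powr (real CARD('n) + ?si * q')) \<partial>OC \<partial>OC) <= gagliardo ?si q' D" for D :: "real^'n => real"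
			unfolding gagliardo_def by (rule order_trans[OF nn_integral_OC_le]) (intro nn_integral_mono nn_integral_OC_le)
		show ?thesis
		proof (intro exI[of _ K] conjI K(1) allI impI ballI)
			fix f :: "real^'n => real" and D N and ga :: "'n => nat" assume a: "ALL ga:multi_idx (sob_order s). D ga : mOC" "sob_expr s q f D <= ennreal N" "0 < N" "ga : multi_idx (sob_order s)"
			show "osc K ?si q' (D ga) N"
				by (rule K(2)) (use a 2 ex(3)[OF a(2,3,4)] G[of "D ga"] in auto)
		qed
	next
		case 3
		obtain K where K: "0 < K" "!!(D :: real^'n => real) N. D : mOC ==> 0 <= N ==>
			(ALL l sh. ALL m:cells sh l. 1 <= l --> (EX a. AE y in OC. y : nbh sh l m --> abs (D y - a) <= N * (8 * real CARD('n) * hw l) powr ?si)) ==> osc K ?si q' D N"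
			using osc_bounded_pointwise[OF q'(1) si, where 'n='n] by blast
		show ?thesis
		proof (intro exI[of _ K] conjI K(1) allI impI ballI)
			fix f :: "real^'n => real" and D N and ga :: "'n => nat" assume a: "ALL ga:multi_idx (sob_order s). D ga : mOC" "sob_expr s q f D <= ennreal N" "0 < N" "ga : multi_idx (sob_order s)"
			have N: "0 <= N" using a(3) by simp
			show "osc K ?si q' (D ga) N"
			proof (rule K(2)[OF _ N], use a in blast, intro allI ballI impI)
				fix l :: nat and sh and m :: "'n => nat" assume m: "m : cells sh l" "1 <= l"
				show "EX aa. AE y in OC. y : nbh sh l m --> abs (D ga y - aa) <= N * (8 * real CARD('n) * hw l) powr ?si"
					by (rule hoelder_pointwise[OF hoelder_AE[OF ex(4)[OF a(2,3,4) 3(2,1)] N] N si m(2,1)])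
			qed
		qed
	qed
qed

lemma weak_deriv_unit:
	assumes "weak_deriv (unit_idx k i) (f :: real^'n::finite => real) g" "test_fun ph"
	shows "(LINT x|OC. f x * pdl (replicate k i) ph x) = (-1) ^ k * (LINT x|OC. g x * ph x)"
proof -
	have c: "ALL j. count (mset (replicate k i)) j = unit_idx k i j" by (simp add: unit_idx_def)
	have "ALL is. (ALL j. count (mset is) j = unit_idx k i j) --> (LINT x|OC. f x * pdl is ph x) = (-1) ^ (SUM j:UNIV. unit_idx k i j) * (LINT x|OC. g x * ph x)"
		using assms unfolding weak_deriv_def by blast
	from this[rule_format, of "replicate k i"] c show ?thesis by (simp add: unit_idx_def)
qed

lemma OC_integrable_power:
	assumes g: "(g :: real^'n::finite => real) : mOC" and q: "1 <= q"
		and I: "(NI y. ennreal (abs (g y) powr q)) <= ennreal (N powr q)" "0 <= N"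
	shows "integrable OC g" "(LINT y|OC. abs (g y)) powr q <= (2 * N) powr q"
proof -
	interpret prob_space "OC :: (real^'n) measure" by (rule prob_space_OC)
	have "(NI y. ennreal (indicator open_unit_cube y * abs (g y) powr q)) = (NI y. ennreal (abs (g y) powr q))"
		by (intro nn_integral_cong) simp
	hence i: "(NI y. ennreal (indicator open_unit_cube y * abs (g y) powr q)) <= ennreal (N powr q)" using I by simp
	have o: "open_unit_cube : sets (OC :: (real^'n) measure)" "emeasure OC (open_unit_cube :: (real^'n) set) <= ennreal 1"
		using sets.top[of "OC :: (real^'n) measure"] emeasure_space_1 by auto
	note pm = power_mean[OF q o _ _ _ i, OF zero_less_one]
	have e: "integrable OC (%y. indicator open_unit_cube y * abs (g y)) \<longleftrightarrow> integrable OC (%y. abs (g y))"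
		by (intro Bochner_Integration.integrable_cong) auto
	have e2: "(LINT y|OC. indicator open_unit_cube y * abs (g y)) = (LINT y|OC. abs (g y))"
		by (intro Bochner_Integration.integral_cong) auto
	have "integrable OC (%y. abs (g y))" using pm(1) e g I(2) by simp
	thus "integrable OC g" using g by (rule integrable_abs_cancel)
	show "(LINT y|OC. abs (g y)) powr q <= (2 * N) powr q" using pm(2) e2 g I(2) by (simp add: powr_mult)
qed

lemma card_cells_1: "card (cells sh 1 :: ('n::finite => nat) set) <= 2 ^ CARD('n)"
proof -
	have "card (cells sh 1 :: ('n => nat) set) <= card (PiE (UNIV :: 'n set) (%_. {..<2 :: nat}))"
		by (rule card_mono) (auto simp: cells_def intro: finite_PiE)
	thus ?thesis by (simp add: card_PiE)
qed

text \<open>For \<open>l >= 2\<close>, \<open>cf_bound\<close> contributes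
  \<open>hw l powr (k*q' - d*q')\<close> and \<open>osc\<close> contributes
  \<open>hw l powr (d*q' + si*q' - d)\<close>; the product is \<open>hw l powr (s*q' - d)\<close>.
  Level 1 has at most \<open>2^d\<close> cells of side 1 and is estimated by the norm of
  \<open>f\<close> itself.\<close>

theorem sobolev_coefficients:
	assumes s: "0 < s" and q: "1 <= q" and q': "1 <= q'" "q = \<infinity> \<or> q' = enn2real q"
	shows "EX C>0. ALL (f :: real^'n::finite => real) D N sh. (ALL ga:multi_idx (sob_order s). weak_deriv ga f (D ga)) -->
		sob_expr s q f D <= ennreal N --> 0 < N --> 0 <= sh --> sh < 1 -->
		(ALL l>=1. ALL be:Bk (sob_order s). (SUM m:cells sh l. abs (cf (sob_order s) sh f l m be) powr q')
				<= (C * N) powr q' * 2 powr (real l * (real CARD('n) - s * q'))) &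
		(EX r. strict_mono r & (AE x in OC. (%n. SUM l:{1..Suc (r n)}. SUM be:Bk (sob_order s).
				cf (sob_order s) sh f l (cl sh l x) be * mnm l be (yc sh x)) ----> f x))"
proof -
	let ?k = "sob_order s" let ?si = "s - real (sob_order s)" let ?d = "real CARD('n)"
	obtain K where K: "0 < K" "!!(f :: real^'n => real) D N. (ALL ga:multi_idx ?k. D ga : mOC) ==>
		sob_expr s q f D <= ennreal N ==> 0 < N ==> (ALL ga:multi_idx ?k. osc K ?si q' (D ga) N)"
		using sob_osc[OF s q q', where 'n='n] by blast
	obtain C1 where C1: "1 <= C1" "!!sh (l :: nat) (m :: 'n => nat) (be :: 'n => nat) f. be : Bk ?k ==> 1 <= l ==> m : cells sh l ==> integrable OC f ==>
			abs (tot ?k sh f l m be) <= C1 / hw l ^ CARD('n) * (LINT y|OC. iN sh l m y * abs (f y))"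
		using tot_bound[of ?k, where 'n='n] by blast
	obtain C2 where C2: "1 <= C2" "!!sh (l :: nat) (m :: 'n => nat) (be :: 'n => nat) f (D :: 'n => real^'n => real) a. be : Bk ?k ==> 2 <= l ==> m : cells sh l ==> integrable OC f ==>
			(ALL i. integrable OC (D i)) ==>
			(ALL ph i. test_fun ph --> (LINT x|OC. f x * pdl (replicate ?k i) ph x) = (-1) ^ ?k * (LINT x|OC. D i x * ph x)) ==>
			abs (cf ?k sh f l m be) <= C2 * hw l ^ ?k / hw l ^ CARD('n) * (SUM i:UNIV. \<integral>y. iN sh l m y * abs (D i y - a i) \<partial>OC)"
		using cf_bound[of ?k, where 'n='n] by blast
	define E1 where "E1 = 2 ^ CARD('n) * (C1 * 2)"
	define E2 where "E2 = C2 * ?d * ?d * K"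
	\<comment> \<open>\<open>hw l = 2 powr (1 - l)\<close> produces an additional factor
	  \<open>2 powr (s*q' - d)\<close>, which \<open>2 powr s\<close> absorbs after taking the power
	  \<open>q'\<close>.\<close>
	define C where "C = 2 powr s * (E1 + E2)"
	have E: "0 < E1" "0 < E2" using C1(1) C2(1) K(1) by (auto simp: E1_def E2_def)
	show ?thesis
	proof (intro exI[of _ C] conjI allI impI ballI)
		show "0 < C" using E by (simp add: C_def)
		fix f :: "real^'n => real" and D N sh
		assume wd: "ALL ga:multi_idx ?k. weak_deriv ga f (D ga)" and N: "sob_expr s q f D <= ennreal N" "0 < N" and sh: "0 <= sh" "sh < (1 :: real)"
		note ex = sob_extract[OF s q q' N]
		have N0: "0 <= N" using N by simp
		have Dm: "D ga : mOC" if "ga : multi_idx ?k" for ga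
			using wd that unfolding weak_deriv_def by (blast intro: loc_integrable_measurable)
		have fm: "f : mOC"
			using wd unit_idx_multi[of ?k undefined] unfolding weak_deriv_def by (blast intro: loc_integrable_measurable)
		have fi: "integrable OC f" "(LINT y|OC. abs (f y)) powr q' <= (2 * N) powr q'"
			using OC_integrable_power[OF fm q'(1) ex(1)[OF unit_idx_multi] N0] by auto
		define Di where "Di i = D (unit_idx ?k i)" for i
		have Dii: "integrable OC (Di i)" for i
			unfolding Di_def using OC_integrable_power(1)[OF Dm[OF unit_idx_multi] q'(1) ex(2)[OF unit_idx_multi] N0] .
		have Dw: "(LINT x|OC. f x * pdl (replicate ?k i) ph x) = (-1) ^ ?k * (LINT x|OC. Di i x * ph x)" if "test_fun ph" for ph i
			unfolding Di_def by (rule weak_deriv_unit[OF _ that]) (use wd unit_idx_multi in blast)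
		have os: "osc K ?si q' (Di i) N" for i
			unfolding Di_def using K(2)[OF _ N] Dm unit_idx_multi by blast
		have q0: "0 <= q'" using q' by simp
		have main: "(SUM m:cells sh l. abs (cf ?k sh f l m be) powr q') <= ((E1 + E2) * N) powr q' * hw l powr (s * q' - ?d)"
			if l: "1 <= l" and b: "be : Bk ?k" for l be
		proof (cases "l = 1")
			case True
			have h: "hw l = 1" by (simp add: True hw_def)
			have "abs (cf ?k sh f l m be) powr q' <= (C1 * 2 * N) powr q'" if m: "m : cells sh l" for m
			proof -
				have "(LINT y|OC. iN sh l m y * abs (f y)) <= (LINT y|OC. abs (f y))"
				proof (rule integral_mono)
					have "integrable OC (%y. abs (f y) * iN sh l m y)"
						by (rule integrable_mult_bounded[of _ _ _ 1]) (use fi nbh_sets in "auto intro: borel_measurable_indicator")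
					thus "integrable OC (%y. iN sh l m y * abs (f y))" by (simp add: mult.commute)
				qed (use fi in "auto simp: indicator_def")
				hence "C1 * (LINT y|OC. iN sh l m y * abs (f y)) <= C1 * (LINT y|OC. abs (f y))" using C1(1) by simp
				moreover have "abs (cf ?k sh f l m be) <= C1 * (LINT y|OC. iN sh l m y * abs (f y))"
					using C1(2)[OF b l m fi(1)] m True h by (simp add: cf_def)
				ultimately have "abs (cf ?k sh f l m be) powr q' <= (C1 * (LINT y|OC. abs (f y))) powr q'" using q0 by (intro powr_mono2) auto
				also have "... = C1 powr q' * (LINT y|OC. abs (f y)) powr q'" using C1(1) by (intro powr_mult)
				also have "... <= C1 powr q' * (2 * N) powr q'" by (intro mult_left_mono fi(2)) simp
				also have "... = (C1 * (2 * N)) powr q'" by (simp add: powr_mult)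
				finally show ?thesis by (simp add: mult.assoc)
			qed
			hence "(SUM m:cells sh l. abs (cf ?k sh f l m be) powr q') <= real (card (cells sh l :: ('n => nat) set)) * (C1 * 2 * N) powr q'"
				by (rule sum_bounded_above)
			also have "... <= 2 ^ CARD('n) * (C1 * 2 * N) powr q'"
			proof (rule mult_right_mono)
				have "real (card (cells sh l :: ('n => nat) set)) <= real (2 ^ CARD('n))" unfolding True using card_cells_1 by (rule of_nat_mono)
				thus "real (card (cells sh l :: ('n => nat) set)) <= 2 ^ CARD('n)" by simp
			qed simp
			also have "... <= (2 ^ CARD('n)) powr q' * (C1 * 2 * N) powr q'"
			proof (rule mult_right_mono)
				have "(2 ^ CARD('n)) powr 1 <= (2 ^ CARD('n) :: real) powr q'" by (rule powr_mono) (use q' in auto)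
				thus "(2 ^ CARD('n) :: real) <= (2 ^ CARD('n)) powr q'" by simp
			qed simp
			also have "... = (E1 * N) powr q'" unfolding E1_def by (simp add: powr_mult mult.assoc)
			also have "... <= ((E1 + E2) * N) powr q'" using E N q0 by (intro powr_mono2) (auto intro!: mult_right_mono)
			finally show ?thesis using h by simp
		next
			case False
			hence l2: "2 <= l" using l by simp
			have h: "0 < hw l" by (rule hw_pos)
			have "ALL i. EX a. (SUM m:cells sh l. (LINT y|OC. iN sh l m y * abs (Di i y - a m)) powr q')
			<= (K * N) powr q' * hw l powr (?d * q' + ?si * q' - ?d)" using os[unfolded osc_def, rule_format, OF l] ..
			from choice[OF this] obtain a where a: "!!i. (SUM m:cells sh l. (LINT y|OC. iN sh l m y * abs (Di i y - a i m)) powr q')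
			<= (K * N) powr q' * hw l powr (?d * q' + ?si * q' - ?d)" by blast
			define I where "I i m = (LINT y|OC. iN sh l m y * abs (Di i y - a i m))" for i m
			have I0: "0 <= I i m" for i m unfolding I_def by (intro Bochner_Integration.integral_nonneg) (auto simp: indicator_def)
			let ?c = "C2 * hw l ^ ?k / hw l ^ CARD('n)"
			have c0: "0 <= ?c" using C2(1) h by simp
			have "abs (cf ?k sh f l m be) powr q' <= ?c powr q' * (?d powr q' * (SUM i:UNIV. I i m powr q'))" if m: "m : cells sh l" for m
			proof -
				have "abs (cf ?k sh f l m be) <= ?c * (SUM i:UNIV. I i m)"
					unfolding I_def by (rule C2(2)[OF b l2 m fi(1), where a="%i. a i m"]) (use Dii Dw in blast)+
				hence "abs (cf ?k sh f l m be) powr q' <= (?c * (SUM i:UNIV. I i m)) powr q'" using q0 by (intro powr_mono2) auto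
				also have "... = ?c powr q' * (SUM i:UNIV. I i m) powr q'" by (rule powr_mult)
				also have "... <= ?c powr q' * (?d powr q' * (SUM i:UNIV. I i m powr q'))"
					by (intro mult_left_mono powr_sum_le) (use I0 q0 in auto)
				finally show ?thesis .
			qed
			hence "(SUM m:cells sh l. abs (cf ?k sh f l m be) powr q') <= (SUM m:cells sh l. ?c powr q' * (?d powr q' * (SUM i:UNIV. I i m powr q')))"
				by (rule sum_mono)
			also have "... = ?c powr q' * (?d powr q' * (SUM i:UNIV. SUM m:cells sh l. I i m powr q'))"
				unfolding sum_distrib_left[symmetric] by (subst sum.swap) simp
			also have "... <= ?c powr q' * (?d powr q' * (SUM i:(UNIV :: 'n set). (K * N) powr q' * hw l powr (?d * q' + ?si * q' - ?d)))"
				unfolding I_def by (intro mult_left_mono sum_mono a) auto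
			also have "... = ?c powr q' * (?d powr q' * (?d * ((K * N) powr q' * hw l powr (?d * q' + ?si * q' - ?d))))" by simp
			also have "... <= ?c powr q' * (?d powr q' * (?d powr q' * ((K * N) powr q' * hw l powr (?d * q' + ?si * q' - ?d))))"
			proof (intro mult_left_mono mult_right_mono)
				have "1 <= CARD('n)" by (simp add: Suc_le_eq)
				hence "?d powr 1 <= ?d powr q'" by (intro powr_mono) (use q' in auto)
				thus "?d <= ?d powr q'" by simp
			qed auto
			also have "?c powr q' = C2 powr q' * hw l powr (?k * q' - ?d * q')"
			proof -
				have "hw l ^ ?k / hw l ^ CARD('n) = hw l powr (?k - ?d)" using h by (simp add: powr_diff powr_realpow)
				hence "?c = C2 * hw l powr (?k - ?d)" by (simp only: times_divide_eq_right[symmetric])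
				thus ?thesis using C2(1) by (simp add: powr_mult powr_powr left_diff_distrib)
			qed
			also have "C2 powr q' * hw l powr (?k * q' - ?d * q') * (?d powr q' * (?d powr q' * ((K * N) powr q' * hw l powr (?d * q' + ?si * q' - ?d))))
				= (C2 powr q' * (?d powr q' * (?d powr q' * (K * N) powr q'))) * (hw l powr (?k * q' - ?d * q') * hw l powr (?d * q' + ?si * q' - ?d))" by simp
			also have "hw l powr (?k * q' - ?d * q') * hw l powr (?d * q' + ?si * q' - ?d) = hw l powr (s * q' - ?d)"
				by (simp add: powr_add[symmetric] algebra_simps)
			also have "C2 powr q' * (?d powr q' * (?d powr q' * (K * N) powr q')) = (E2 * N) powr q'"
				unfolding E2_def by (simp add: powr_mult mult.assoc)
			also have "(E2 * N) powr q' * hw l powr (s * q' - ?d) <= ((E1 + E2) * N) powr q' * hw l powr (s * q' - ?d)"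
				by (intro mult_right_mono powr_mono2) (use E N q0 in "auto intro!: mult_right_mono")
			finally show ?thesis .
		qed
		show "(SUM m:cells sh l. abs (cf ?k sh f l m be) powr q') <= (C * N) powr q' * 2 powr (real l * (?d - s * q'))"
			if l: "1 <= l" and b: "be : Bk ?k" for l be
		proof -
			have "hw l = 2 powr (1 - real l)" by (simp add: hw_def powr_diff powr_realpow)
			hence "hw l powr (s * q' - ?d) = 2 powr ((1 - real l) * (s * q' - ?d))" by (simp add: powr_powr)
			also have "... <= 2 powr (s * q' + real l * (?d - s * q'))" by (intro powr_mono) (auto simp: algebra_simps)
			also have "... = (2 powr s) powr q' * 2 powr (real l * (?d - s * q'))" by (simp add: powr_add powr_powr)
			finally have "((E1 + E2) * N) powr q' * hw l powr (s * q' - ?d) <= ((E1 + E2) * N) powr q' * ((2 powr s) powr q' * 2 powr (real l * (?d - s * q')))"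
				by (intro mult_left_mono) auto
			also have "... = (C * N) powr q' * 2 powr (real l * (?d - s * q'))"
				unfolding C_def by (simp add: powr_mult mult.assoc mult.left_commute)
			finally show ?thesis using main[OF l b] by linarith
		qed
		show "EX r. strict_mono r & (AE x in OC. (%n. SUM l:{1..Suc (r n)}. SUM be:Bk ?k.
				cf ?k sh f l (cl sh l x) be * mnm l be (yc sh x)) ----> f x)"
		proof -
			obtain r where r: "strict_mono r" "AE x in OC. (%n. opA ?k sh (Suc (r n)) f x) ----> f x"
				using opA_subseq[OF fi(1) sh] by blast
			have "AE x in OC. (%n. SUM l:{1..Suc (r n)}. SUM be:Bk ?k. cf ?k sh f l (cl sh l x) be * mnm l be (yc sh x)) ----> f x"
				using r(2) AE_space
			proof eventually_elim
				case (elim x)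
				hence "x : open_unit_cube" by simp
				thus ?case using elim(1) cf_telescope[OF fi(1) _ sh, of x "Suc _" ?k] by simp
			qed
			with r(1) show ?thesis by blast
		qed
	qed
qed

section \<open>Quantization of coefficients\<close>

definition Mx :: "nat => ('n::finite => nat) set" where "Mx l = PiE UNIV (%_. {..<2 ^ l})"

lemma Mx_iff: "m : Mx l \<longleftrightarrow> (ALL i. m i < 2 ^ l)" by (auto simp: Mx_def PiE_iff)
lemma finite_Mx [simp]: "finite (Mx l)" unfolding Mx_def by (intro finite_PiE) auto
lemma card_Mx: "card (Mx l :: ('n::finite => nat) set) = 2 ^ (CARD('n) * l)"
	unfolding Mx_def by (simp add: card_PiE power_mult[symmetric] mult.commute)

text \<open>\<open>kk l\<close> transports a function on the cells of level \<open>l\<close> to their Morton codes, with value 0 elsewhere.\<close>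
definition kk :: "nat => (('n::finite => nat) => 'b::zero) => nat => 'b" where
	"kk l g J = (if J : key ` (Mx l :: ('n => nat) set) then g (inv_into (Mx l) key J) else 0)"

lemma inj_key: "inj_on key (A :: ('n::finite => nat) set)" by (auto intro: inj_onI key_inj)

lemma kk_key: "m : Mx l ==> kk l g (key m) = g m"
	by (simp add: kk_def inv_into_f_f[OF inj_key])

lemma kk_sum:
	fixes g :: "('n::finite => nat) => 'b::zero" and F :: "'b => 'c::comm_monoid_add"
	assumes "F 0 = 0" shows "(SUM J<2 ^ (CARD('n) * l). F (kk l g J)) = (SUM m:Mx l. F (g m))"
proof -
	have "key ` (Mx l :: ('n => nat) set) \<subseteq> {..<2 ^ (CARD('n) * l)}" using key_less by (fastforce simp: Mx_iff)
	hence "(SUM J<2 ^ (CARD('n) * l). F (kk l g J)) = (SUM J:key ` (Mx l :: ('n => nat) set). F (kk l g J))"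
		by (intro sum.mono_neutral_right) (auto simp: kk_def assms)
	also have "... = (SUM m:(Mx l :: ('n => nat) set). F (kk l g (key m)))" by (simp only: sum.reindex[OF inj_key] o_def)
	also have "... = (SUM m:Mx l. F (g m))" by (intro sum.cong refl) (simp add: kk_key)
	finally show ?thesis .
qed

lemma kk_supp:
	fixes g :: "('a::finite => nat) => 'b::zero"
	shows "{J. kk l g J ~= 0} = key ` {m : Mx l. g m ~= 0}"
proof
	show "{J. kk l g J ~= 0} \<subseteq> key ` {m : Mx l. g m ~= 0}"
	proof
		fix J assume J: "J : {J. kk l g J ~= 0}"
		hence "J : key ` (Mx l :: ('a => nat) set)" by (auto simp: kk_def split: if_splits)
		then obtain m :: "'a => nat" where m: "m : Mx l" "J = key m" by blast
		hence "g m ~= 0" using J kk_key[OF m(1), of g] by simp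
		thus "J : key ` {m : Mx l. g m ~= 0}" using m by blast
	qed
	show "key ` {m : Mx l. g m ~= 0} \<subseteq> {J. kk l g J ~= 0}" by (auto simp: kk_key)
qed

lemma kk_supp_card: "finite {J. kk l g J ~= 0}" "card {J. kk l g J ~= 0} = card {m : Mx l. g m ~= 0}"
	unfolding kk_supp by (auto simp: card_image[OF inj_key])

lemma jumps_sum:
	assumes "finite M" "!!l. l : M ==> finite (jumps (g l))"
	shows "finite (jumps (%J. SUM l:M. g l J))" "card (jumps (%J. SUM l:M. g l J)) <= (SUM l:M. card (jumps (g l)))"
proof -
	have s: "jumps (%J. SUM l:M. g l J) \<subseteq> (\<Union>l\<in>M. jumps (g l))"
	proof
		fix j assume "j : jumps (%J. SUM l:M. g l J)"
		hence "(SUM l:M. g l (Suc j)) ~= (SUM l:M. g l j)" by (simp add: jumps_def)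
		then obtain l where "l : M" "g l (Suc j) ~= g l j" by (meson sum.cong)
		thus "j : (\<Union>l\<in>M. jumps (g l))" by (auto simp: jumps_def)
	qed
	have f: "finite (\<Union>l\<in>M. jumps (g l))" using assms by simp
	show "finite (jumps (%J. SUM l:M. g l J))" by (rule finite_subset[OF s f])
	show "card (jumps (%J. SUM l:M. g l J)) <= (SUM l:M. card (jumps (g l)))"
		using card_mono[OF f s] card_UN_le[OF assms(1), of "%l. jumps (g l)"] by simp
qed

text \<open>A jump of \<open>g\<close> at \<open>i\<close> moves to the last code of the
  \<open>i\<close>-th group of \<open>M\<close> codes, so no new jumps arise.\<close>

lemma jumps_div:
	assumes "finite (jumps g)"
	shows "finite (jumps (%J. g (J div M)))" "card (jumps (%J. g (J div M))) <= card (jumps g)"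
proof -
	have s: "jumps (%J. g (J div M)) \<subseteq> (%i. M * Suc i - 1) ` jumps g"
	proof
		fix j assume "j : jumps (%J. g (J div M))"
		hence j: "g (Suc j div M) ~= g (j div M)" by (simp add: jumps_def)
		hence m: "Suc j mod M = 0" "Suc j div M = Suc (j div M)" by (auto simp: div_Suc split: if_splits)
		hence "Suc j = M * Suc (j div M)" by (metis add.right_neutral mult_div_mod_eq)
		hence "j = M * Suc (j div M) - 1" by simp
		moreover have "j div M : jumps g" using j m by (simp add: jumps_def)
		ultimately show "j : (%i. M * Suc i - 1) ` jumps g" by blast
	qed
	show "finite (jumps (%J. g (J div M)))" by (rule finite_subset[OF s]) (use assms in simp)
	have "card (jumps (%J. g (J div M))) <= card ((%i. M * Suc i - 1) ` jumps g)" by (rule card_mono[OF _ s]) (use assms in simp)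
	thus "card (jumps (%J. g (J div M))) <= card (jumps g)" using card_image_le[OF assms, of "%i. M * Suc i - 1"] by linarith
qed

text \<open>Coefficient of \<open>y^be\<close> in \<open>(2^l * y - j)^b\<close>; the binomial
  coefficient makes it 0 for \<open>be > b\<close>, so all degrees can be summed up to a common
  \<open>k\<close>.\<close>

definition mc :: "nat => nat => nat => nat => real" where
	"mc l j b be = real (b choose be) * (2 ^ l) ^ be * (- real j) ^ (b - be)"

lemma mc_expand: assumes "b <= k" shows "(2 ^ l * y - real j) ^ b = (SUM be<=k. y ^ be * mc l j b be)"
proof -
	have "(2 ^ l * y - real j) ^ b = (SUM be<=b. real (b choose be) * (2 ^ l * y) ^ be * (- real j) ^ (b - be))"
		using binomial_ring[of "2 ^ l * y" "- real j" b] by simp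
	also have "... = (SUM be<=b. y ^ be * mc l j b be)" by (intro sum.cong refl) (simp add: mc_def power_mult_distrib)
	also have "... = (SUM be<=k. y ^ be * mc l j b be)" using assms by (intro sum.mono_neutral_left) (auto simp: mc_def)
	finally show ?thesis .
qed

lemma mc_prod:
	fixes m b :: "'n::finite => nat"
	assumes "b : Bk k"
	shows "(PROD i:UNIV. (2 ^ l * y i - real (m i)) ^ b i) = (SUM be:Bk k. (PROD i:UNIV. mc l (m i) (b i) (be i)) * (PROD i:UNIV. y i ^ be i))"
proof -
	have "(PROD i:UNIV. (2 ^ l * y i - real (m i)) ^ b i) = (PROD i:UNIV. SUM be<=k. y i ^ be * mc l (m i) (b i) be)"
		by (intro prod.cong refl mc_expand) (use assms in "simp add: Bk_iff")
	also have "... = (SUM be:Bk k. PROD i:UNIV. y i ^ be i * mc l (m i) (b i) (be i))"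
		unfolding Bk_def by (subst prod_sum_PiE) auto
	finally show ?thesis by (simp add: prod.distrib mult.commute)
qed

text \<open>Merges the levels in \<open>M\<close> into one function of the code at the finest level
  \<open>lm\<close>: dividing the code by a power of 2 gives the code of the coarser cell, and
  \<open>mc\<close> rewrites remainders as polynomials in the coordinates. The lookup is thus paid
  once per exponent and not once per level.\<close>

definition PhiM :: "nat => nat set => nat => (nat => ('n::finite => nat) => ('n => nat) => real) => ('n => nat) => nat => real" where
	"PhiM k M lm c be J = (SUM l:M. kk l (%m. SUM b:Bk k. c l m b * (PROD i:UNIV. mc l (m i) (b i) (be i))) (J div 2 ^ (CARD('n) * (lm - l))))"

lemma PhiM_eval:
	fixes y :: "'n::finite => real"
	assumes M: "!!l. l : M ==> l <= lm" and y: "!!i. 0 <= y i" "!!i. y i < 1"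
	shows "(SUM be:Bk k. PhiM k M lm c be (key (%i. cel lm (y i))) * (PROD i:UNIV. y i ^ be i))
		= (SUM l:M. SUM b:Bk k. c l (%i. cel l (y i)) b * (PROD i:UNIV. fr l (y i) ^ b i))"
proof -
	have e: "kk l g (key (%i. cel lm (y i)) div 2 ^ (CARD('n) * (lm - l))) = g (%i. cel l (y i))" if "l : M" for l and g :: "('n => nat) => real"
	proof -
		have "cel lm (y i) div 2 ^ (lm - l) = cel l (y i)" for i using cel_div[OF y(1)[of i], of l "lm - l"] M[OF that] by simp
		hence "key (%i. cel lm (y i)) div 2 ^ (CARD('n) * (lm - l)) = key (%i. cel l (y i))" unfolding key_div by simp
		thus ?thesis using kk_key[of "%i. cel l (y i)" l g] cel_less[OF y] by (simp add: Mx_iff)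
	qed
	have f: "fr l (y i) = 2 ^ l * y i - real (cel l (y i))" for l i using cel_fr[OF y(1), of l i] by simp
	have "(SUM be:Bk k. PhiM k M lm c be (key (%i. cel lm (y i))) * (PROD i:UNIV. y i ^ be i))
			= (SUM be:Bk k. SUM l:M. SUM b:Bk k. c l (%i. cel l (y i)) b * ((PROD i:UNIV. mc l (cel l (y i)) (b i) (be i)) * (PROD i:UNIV. y i ^ be i)))"
		unfolding PhiM_def by (intro sum.cong refl) (simp add: e sum_distrib_right mult.assoc cong: sum.cong)
	also have "... = (SUM l:M. SUM b:Bk k. SUM be:Bk k. c l (%i. cel l (y i)) b * ((PROD i:UNIV. mc l (cel l (y i)) (b i) (be i)) * (PROD i:UNIV. y i ^ be i)))"
		by (subst sum.swap) (intro sum.cong refl sum.swap)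
	also have "... = (SUM l:M. SUM b:Bk k. c l (%i. cel l (y i)) b * (PROD i:UNIV. fr l (y i) ^ b i))"
		by (intro sum.cong refl) (simp add: sum_distrib_left[symmetric] mc_prod[symmetric] f)
	finally show ?thesis .
qed

lemma PhiM_jumps:
	fixes c :: "nat => ('n::finite => nat) => ('n => nat) => real"
	assumes M: "finite M"
	shows "finite (jumps (PhiM k M lm c be))" "card (jumps (PhiM k M lm c be)) <= (SUM l:M. 2 * (SUM b:Bk k. card {m : Mx l. c l m b ~= 0}))"
proof -
	let ?g = "%l. kk l (%m. SUM b:Bk k. c l m b * (PROD i:UNIV. mc l (m i) (b i) (be i)))"
	have fg: "finite (jumps (?g l))" for l by (rule card_jumps_support(1)[OF kk_supp_card(1)])
	have cg: "card (jumps (?g l)) <= 2 * (SUM b:Bk k. card {m : Mx l. c l m b ~= 0})" for l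
	proof -
		have "card (jumps (?g l)) <= 2 * card {m : Mx l. (SUM b:Bk k. c l m b * (PROD i:UNIV. mc l (m i) (b i) (be i))) ~= 0}"
			using card_jumps_support(2)[OF kk_supp_card(1)] unfolding kk_supp_card(2) .
		also have "card {m : Mx l. (SUM b:Bk k. c l m b * (PROD i:UNIV. mc l (m i) (b i) (be i))) ~= 0} <= card (\<Union>b\<in>Bk k. {m : Mx l. c l m b ~= 0})"
		proof (rule card_mono)
			show "finite (\<Union>b\<in>Bk k. {m : Mx l. c l m b ~= 0})" by simp
			show "{m : Mx l. (SUM b:Bk k. c l m b * (PROD i:UNIV. mc l (m i) (b i) (be i))) ~= 0} \<subseteq> (\<Union>b\<in>Bk k. {m : Mx l. c l m b ~= 0})"
			proof
				fix m :: "'n => nat" assume m: "m : {m : Mx l. (SUM b:Bk k. c l m b * (PROD i:UNIV. mc l (m i) (b i) (be i))) ~= 0}"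
				then obtain b where "b : Bk k" "c l m b * (PROD i:UNIV. mc l (m i) (b i) (be i)) ~= 0" by (metis (mono_tags, lifting) mem_Collect_eq sum.neutral)
				thus "m : (\<Union>b\<in>Bk k. {m : Mx l. c l m b ~= 0})" using m by auto
			qed
		qed
		also have "... <= (SUM b:Bk k. card {m : Mx l. c l m b ~= 0})" by (rule card_UN_le) simp
		finally show ?thesis by simp
	qed
	have P: "PhiM k M lm c be = (%J. SUM l:M. ?g l (J div 2 ^ (CARD('n) * (lm - l))))" by (simp add: PhiM_def fun_eq_iff)
	show "finite (jumps (PhiM k M lm c be))" unfolding P by (intro jumps_sum M jumps_div fg)
	have "card (jumps (PhiM k M lm c be)) <= (SUM l:M. card (jumps (%J. ?g l (J div 2 ^ (CARD('n) * (lm - l))))))"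
		unfolding P by (intro jumps_sum M jumps_div fg)
	also have "... <= (SUM l:M. 2 * (SUM b:Bk k. card {m : Mx l. c l m b ~= 0}))"
		by (intro sum_mono order_trans[OF jumps_div(2)[OF fg] cg])
	finally show "card (jumps (PhiM k M lm c be)) <= (SUM l:M. 2 * (SUM b:Bk k. card {m : Mx l. c l m b ~= 0}))" .
qed

text \<open>Dropping the digits after position \<open>N\<close> changes no cell of a level up to
  \<open>N\<close>; hence no coefficient is affected, only the monomials are.\<close>

lemma trunc_props:
	assumes y: "0 <= y" "y < 1" and l: "l <= N"
	defines "y' == y - fr N y / 2 ^ N"
	shows "0 <= y'" "y' < 1" "cel l y' = cel l y" "abs (fr l y - fr l y') <= 2 ^ l / 2 ^ N"
proof -
	have e: "2 ^ N * y = real (cel N y) + fr N y" by (rule cel_fr[OF y(1)])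
	have y': "y' = real (cel N y) / 2 ^ N"
	proof -
		have "2 ^ N * y' = real (cel N y)" unfolding y'_def right_diff_distrib e by simp
		thus ?thesis by (simp add: field_simps)
	qed
	show 0: "0 <= y'" using y' by simp
	show "y' < 1" 
	proof -
		have "0 <= fr N y / 2 ^ N" using fr_bounds(1) by simp
		thus ?thesis using y(2) unfolding y'_def by linarith
	qed
	have c: "cel N y' = cel N y" unfolding cel_def y' by (simp add: cel_def)
	have N: "N = l + (N - l)" using l by simp
	show cl: "cel l y' = cel l y" using cel_div[OF 0, of l "N - l"] cel_div[OF y(1), of l "N - l"] c N by simp
	have "fr l y - fr l y' = 2 ^ l * (fr N y / 2 ^ N)"
		using cel_fr[OF y(1), of l] cel_fr[OF 0, of l] cl unfolding y'_def right_diff_distrib by simp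
	moreover have "2 ^ l * (fr N y / 2 ^ N) <= 2 ^ l / 2 ^ N" "0 <= 2 ^ l * (fr N y / 2 ^ N)"
		using fr_bounds[of N y] by (auto simp: divide_right_mono)
	ultimately show "abs (fr l y - fr l y') <= 2 ^ l / 2 ^ N" by simp
qed

lemma mnm_diff:
	fixes y y' :: "'n::finite => real"
	assumes "!!i. abs (fr l (y i) - fr l (y' i)) <= h" "b : Bk k"
	shows "abs (mnm l b y - mnm l b y') <= real (CARD('n) * k) * h"
proof -
	have h: "0 <= h" using order_trans[OF abs_ge_zero assms(1)] .
	have f: "norm (fr l t) <= 1" for t using fr_bounds[of l t] by simp
	have "norm ((PROD i:(UNIV :: 'n set). fr l (y i) ^ b i) - (PROD i:UNIV. fr l (y' i) ^ b i)) <= (SUM i:(UNIV :: 'n set). norm (fr l (y i) ^ b i - fr l (y' i) ^ b i))"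
		by (intro norm_prod_diff) (use fr_bounds in "auto simp: power_abs intro!: power_le_one less_imp_le[OF fr_bounds(2)]")
	also have "... <= (SUM i:(UNIV :: 'n set). real k * h)"
	proof (rule sum_mono)
		fix i
		have "norm (fr l (y i) ^ b i - fr l (y' i) ^ b i) <= real (b i) * norm (fr l (y i) - fr l (y' i))" by (rule norm_power_diff[OF f f])
		also have "... <= real k * h" using assms by (intro mult_mono) (auto simp: Bk_iff)
		finally show "norm (fr l (y i) ^ b i - fr l (y' i) ^ b i) <= real k * h" .
	qed
	finally show ?thesis by (simp add: mnm_def)
qed

lemma mnm_le_1: "abs (mnm l b (y :: 'n::finite => real)) <= 1"
proof -
	have "abs (mnm l b y) <= (PROD i:(UNIV :: 'n set). 1)"
		unfolding mnm_def abs_prod by (intro prod_mono) (use fr_bounds in "auto simp: power_abs intro!: power_le_one less_imp_le[OF fr_bounds(2)]")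
	thus ?thesis by simp
qed

text \<open>Only the positive part is rounded; applied to \<open>c\<close> and to \<open>- c\<close>
  it yields the two natural numbers that are streamed.\<close>

definition zz :: "real => real => nat" where "zz de c = nat (floor (max 0 (c / de)))"

lemma zz_le: "0 < de ==> real (zz de c) <= abs c / de"
proof -
	assume d: "0 < de"
	have "real (zz de c) = of_int (floor (max 0 (c / de)))" unfolding zz_def by (simp add: of_nat_nat)
	also have "... <= max 0 (c / de)" by simp
	also have "... <= abs c / de" using d by (auto simp: divide_right_mono)
	finally show ?thesis .
qed

text \<open>A nonzero value forces \<open>abs c >= de\<close>, and then the power
  \<open>q >= 1\<close> only enlarges the quotient. In this way \<open>q\<close>-summability bounds
  both the number and the total size of the nonzero entries.\<close>

lemma zz_powr: assumes "0 < de" "1 <= q" shows "real (zz de c) <= (abs c / de) powr q"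
proof (cases "zz de c = 0")
	case False
	hence 1: "1 <= abs c / de" using zz_le[OF assms(1), of c] by linarith
	have "(abs c / de) powr 1 <= (abs c / de) powr q" using 1 assms(2) by (intro powr_mono) auto
	moreover have "(abs c / de) powr 1 = abs c / de" using 1 by (intro powr_one) linarith
	ultimately show ?thesis using zz_le[OF assms(1), of c] by linarith
qed simp

text \<open>Rounding is towards zero, so the error exceeds neither the step nor
  \<open>abs c\<close>. The second bound keeps the errors \<open>q\<close>-summable on fine levels,
  where most coefficients are below the step.\<close>

lemma zz_err:
	assumes d: "0 < de"
	shows "abs (c - de * (real (zz de c) - real (zz de (- c)))) <= de" "abs (c - de * (real (zz de c) - real (zz de (- c)))) <= abs c"
		"abs (de * (real (zz de c) - real (zz de (- c)))) <= abs c"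
proof -
	have 1: "real (zz de c) <= t & t < real (zz de c) + 1 & zz de (- c) = 0" if "0 <= t" "t = c / de" for t c
		using that unfolding zz_def by (auto simp: max_def of_nat_nat)
	let ?e = "%c. c - de * (real (zz de c) - real (zz de (- c)))"
	have 2: "0 <= ?e c & ?e c <= de & ?e c <= c" if c: "0 <= c" for c
	proof -
		let ?t = "c / de"
		have t: "0 <= ?t" using c d by simp
		note 1[OF t refl]
		moreover have "de * ?t = c" using d by simp
		moreover have "de * real (zz de c) <= de * ?t" using calculation(1) d by (intro mult_left_mono) auto
		moreover have "de * ?t <= de * (real (zz de c) + 1)" using calculation(1) d by (intro mult_left_mono) auto
		ultimately show ?thesis using d by (simp add: distrib_left)
	qed
	have 3: "?e (- c) = - ?e c" by (simp add: algebra_simps)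
	show "abs (?e c) <= de" "abs (?e c) <= abs c" "abs (de * (real (zz de c) - real (zz de (- c)))) <= abs c"
		using 2[of c] 2[of "- c"] 3 by (cases "0 <= c"; linarith)+
qed

section \<open>Level budgets\<close>

lemma square_le_exp: "(real v + 1)\<^sup>2 <= 6 * 2 ^ v"
proof -
	have "(real v)\<^sup>2 + 4 * real v + 6 <= 6 * 2 ^ v"
	proof (induction v)
		case (Suc v)
		have "(real (Suc v))\<^sup>2 + 4 * real (Suc v) + 6 <= 2 * ((real v)\<^sup>2 + 4 * real v + 6)"
			by (simp add: power2_eq_square algebra_simps)
		thus ?case using Suc by simp
	qed simp
	thus ?thesis by (simp add: power2_eq_square algebra_simps)
qed

lemma succ_le_exp: "real v + 1 <= 2 ^ v"
	by (induction v) auto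

lemma summable_linear_geometric:
	assumes "0 < e" shows "summable (%r. (real r + 1) * (2 powr (- e)) ^ r)"
proof -
	have "2 powr (- e) < (2 powr 0 :: real)" using assms by (intro powr_less_mono) auto
	hence x: "norm (2 powr (- e)) < 1" by simp
	thus ?thesis using sums_summable[OF geometric_deriv_sums[of "2 powr (- e)"]] by (simp add: add.commute)
qed

lemma real_div_le: "real (z div n) <= real z / real n"
proof -
	have "real (z div n * n) <= real z" by (rule of_nat_mono) simp
	thus ?thesis by (cases "n = 0") (simp_all add: field_simps)
qed

lemma budget_arith: "x <= P ==> y <= P ==> z <= 2 * P ==> 2 * (x + 1 + y + z) <= 8 * P + (2 :: real)"
	by (simp add: algebra_simps)

locale lev =
	fixes s q ka ep :: real and d u v :: nat
	assumes s: "0 < s" and q: "1 <= q" and ep: "0 < ep" "ep <= 1" "ep <= q * ka + s * q - real d" and d: "1 <= d" and u: "1 <= u"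
begin

text \<open>With \<open>W = 2^u\<close> and \<open>L = 2^v\<close>, \<open>ls\<close> is the critical level and \<open>dl l\<close> the quantization step of level \<open>l\<close>. Levels up
	to \<open>lo\<close> are exact, those in \<open>(lo, hi]\<close> are streamed, those in \<open>(hi, lm]\<close> are hard-thresholded. A stream of level \<open>l\<close> has
	carry blocks of \<open>AA * rr l\<close> bits and \<open>Gl l\<close> tokens per block; \<open>tt\<close> is the number of base \<open>2^u\<close> digits of the input.\<close>
definition "ls = (2 * (u + v)) div d"
definition "r1 = nat (ceiling (real v / ep))"
definition "lo = ls - r1"
definition "hi = ls + r1"
definition "lm = hi + nat (ceiling (real ls * real d / ep)) + 1"
definition "rr l = (if l <= ls then ls - l else l - ls)"
definition "dl l = 2 powr (if l <= ls then - s * real ls - real (rr l) else - s * real ls + ka * real (rr l))"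
text \<open>The entropy budget: about \<open>(W*L)^2\<close> at the critical level, damped by
  \<open>2 powr (- ep)\<close> per level away from it.\<close>

definition "PP r = 2 powr (real d * real ls - ep * real r)"
definition "Gl l = nat (ceiling (2 powr (real v - ep * real (rr l) / 2)))"
definition "AA = d + 1 + nat (ceiling (s))"
definition "cT = nat (ceiling ((real d + 1) * (5 + 1 / ep + 2 * real d / ep) + 2 * s))"
definition "tt = cT * (v + 1)"

lemma ls_le: "real d * real ls <= 2 * (real u + real v)" "2 * (real u + real v) <= real d * (real ls + 1)"
proof -
	have "d * ls <= 2 * (u + v)" unfolding ls_def by simp
	hence "real (d * ls) <= real (2 * (u + v))" by (rule of_nat_mono)
	thus "real d * real ls <= 2 * (real u + real v)" by simp
	have "2 * (u + v) <= d * (ls + 1)" unfolding ls_def using d dividend_less_times_div[of d "2 * (u + v)"] by simp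
	hence "real (2 * (u + v)) <= real (d * (ls + 1))" by (rule of_nat_mono)
	thus "2 * (real u + real v) <= real d * (real ls + 1)" by (simp add: distrib_left)
qed

lemma dl_pos: "0 < dl l" by (simp add: dl_def)
lemma PP_pos: "0 < PP r" by (simp add: PP_def)
lemma AA_ge: "real d + 1 + s <= real AA" using s unfolding AA_def by (simp add: of_nat_nat)
lemma real_d: "1 <= real d" using d by simp

text \<open>At distance \<open>r1\<close> the budget \<open>PP\<close> has lost a factor
  \<open>2^v\<close>, so about \<open>W^2 * L\<close> items remain; these fit into an exact lookup
  of depth \<open>O(L)\<close>. Streaming is needed only closer to the critical level.\<close>

lemma r1_ge: "real v <= ep * real r1"
proof -
	have "real v / ep <= real r1" unfolding r1_def using ep by linarith
	thus ?thesis using ep by (simp add: field_simps)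
qed

lemma r1_le: "real r1 + 1 <= (2 + 1 / ep) * (real v + 1)"
proof -
	have "0 <= real v / ep" using ep by simp
	hence "real r1 + 1 <= real v / ep + 2" unfolding r1_def by linarith
	also have "... <= (2 + 1 / ep) * (real v + 1)" using ep by (simp add: field_simps)
	finally show ?thesis .
qed

text \<open>The exponent \<open>q*ka + s*q - d >= ep\<close> is the decay per level that remains
  after dividing the bound on the coefficients by \<open>dl l powr q\<close>.\<close>

lemma up_sum:
	assumes l: "ls < l" and c: "(SUM m:M. abs (c m) powr q) <= 2 powr (real l * (real d - s * q))"
	shows "(SUM m:M. (abs (c m) / dl l) powr q) <= PP (rr l)"
proof -
	have r: "real l = real ls + real (rr l)" using l by (simp add: rr_def)
	have D: "dl l = 2 powr (- s * real ls + ka * real (rr l))" using l by (simp add: dl_def)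
	have "(SUM m:M. (abs (c m) / dl l) powr q) = (SUM m:M. abs (c m) powr q) / dl l powr q"
		by (simp add: powr_divide dl_pos[THEN less_imp_le] sum_divide_distrib)
	also have "... <= 2 powr (real l * (real d - s * q)) / dl l powr q" by (intro divide_right_mono c) simp
	also have "... = 2 powr (real l * (real d - s * q) - (- s * real ls + ka * real (rr l)) * q)"
		unfolding D powr_powr by (rule powr_diff[symmetric])
	also have "... = 2 powr (real d * real ls - real (rr l) * (q * ka + s * q - real d))" unfolding r by (simp add: algebra_simps)
	also have "... <= PP (rr l)" unfolding PP_def
		using mult_right_mono[OF ep(3), of "real (rr l)"] by (intro powr_mono) (auto simp: mult.commute)
	finally show ?thesis .
qed

text \<open>Coarse levels have few cells but large coefficients. \<open>young_le\<close> at the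
  natural size \<open>2 powr (- s*l)\<close> bounds their sum, and the division by
  \<open>2^(AA * rr l)\<close> absorbs the growth because \<open>AA >= d + 1 + s\<close>.\<close>

lemma down_sum:
	fixes c :: "('n::finite => nat) => real"
	assumes dd: "d = CARD('n)" and l: "l <= ls" and c: "(SUM m:Mx l. abs (c m) powr q) <= 2 powr (real l * (real d - s * q))"
	shows "(SUM m:Mx l. abs (c m) / dl l) / 2 ^ (AA * rr l) <= 2 * PP (rr l)"
proof -
	have r: "real l = real ls - real (rr l)" using l by (simp add: rr_def)
	let ?L = "2 powr (- s * real l)"
	have "(SUM m:Mx l. abs (c m)) <= (SUM m:(Mx l :: ('n => nat) set). ?L + ?L powr (1 - q) * abs (c m) powr q)"
		by (intro sum_mono young_le) (use q in auto)
	also have "... = 2 ^ (d * l) * ?L + ?L powr (1 - q) * (SUM m:(Mx l :: ('n => nat) set). abs (c m) powr q)"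
		by (simp add: sum.distrib sum_distrib_left[symmetric] card_Mx dd)
	also have "... <= 2 ^ (d * l) * ?L + ?L powr (1 - q) * 2 powr (real l * (real d - s * q))"
		by (intro add_left_mono mult_left_mono c) simp
	also have "2 ^ (d * l) * ?L = 2 powr (real l * (real d - s))"
		by (simp add: powr_realpow[symmetric] powr_add[symmetric] algebra_simps)
	also have "?L powr (1 - q) * 2 powr (real l * (real d - s * q)) = 2 powr (real l * (real d - s))"
		by (simp add: powr_powr powr_add[symmetric] algebra_simps)
	finally have "(SUM m:Mx l. abs (c m)) / dl l / 2 ^ (AA * rr l) <= (2 * 2 powr (real l * (real d - s))) / dl l / 2 ^ (AA * rr l)"
		using dl_pos by (intro divide_right_mono) (auto intro: less_imp_le)
	also have "... = 2 * 2 powr (real l * (real d - s) + s * real ls + real (rr l) - real AA * real (rr l))"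
		using l unfolding dl_def by (simp add: powr_realpow[symmetric] powr_diff powr_add powr_minus field_simps)
	also have "... <= 2 * PP (rr l)"
	proof -
		have "ep + s + 1 <= real AA + real d" using AA_ge ep real_d by linarith
		hence "(ep + s + 1) * real (rr l) <= (real AA + real d) * real (rr l)" by (rule mult_right_mono) simp
		hence "real l * (real d - s) + s * real ls + real (rr l) - real AA * real (rr l) <= real d * real ls - ep * real (rr l)"
			unfolding r by (simp add: algebra_simps)
		thus ?thesis unfolding PP_def by (intro mult_left_mono powr_mono) auto
	qed
	finally show ?thesis by (simp add: sum_divide_distrib)
qed

lemma cells_frac: "2 ^ (d * l) / 2 ^ (AA * rr l) <= PP (rr l)"
proof -
	have "2 ^ (d * l) / 2 ^ (AA * rr l) = 2 powr (real d * real l - real AA * real (rr l))"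
		by (simp add: powr_realpow[symmetric] powr_diff)
	also have "... <= PP (rr l)"
	proof -
		have "(real d + ep) * real (rr l) <= real AA * real (rr l)" using AA_ge ep s by (intro mult_right_mono) auto
		moreover have "real d * real l <= real d * (real ls + real (rr l))" by (intro mult_left_mono) (auto simp: rr_def)
		ultimately have "real d * real l - real AA * real (rr l) <= real d * real ls - ep * real (rr l)" by (simp add: algebra_simps)
		thus ?thesis unfolding PP_def by (intro powr_mono) auto
	qed
	finally show ?thesis .
qed

lemma cells_down: assumes "l <= ls" shows "2 ^ (d * l) <= PP (rr l)"
proof -
	have r: "real l = real ls - real (rr l)" using assms by (simp add: rr_def)
	have "ep * real (rr l) <= real d * real (rr l)" using ep real_d by (intro mult_right_mono) auto
	hence "real (d * l) <= real d * real ls - ep * real (rr l)" unfolding of_nat_mult r right_diff_distrib by linarith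
	hence "2 powr real (d * l) <= PP (rr l)" unfolding PP_def by (intro powr_mono) auto
	moreover have "2 powr real (d * l) = (2 :: real) ^ (d * l)" by (rule powr_realpow) simp
	ultimately show ?thesis by simp
qed

lemma zz_counts:
	fixes c :: "('n::finite => nat) => real"
	assumes dd: "d = CARD('n)" and c: "(SUM m:Mx l. abs (c m) powr q) <= 2 powr (real l * (real d - s * q))"
	shows "real (card {m : Mx l. zz (dl l) (c m) ~= 0}) <= PP (rr l)" "real (SUM m:Mx l. zz (dl l) (c m) div 2 ^ (AA * rr l)) <= 2 * PP (rr l)"
proof -
	have div: "real (z div 2 ^ a) <= real z / 2 ^ a" for z a :: nat
		using real_div_le[of z "2 ^ a"] by simp
	have "real (card {m : Mx l. zz (dl l) (c m) ~= 0}) <= PP (rr l) & real (SUM m:Mx l. zz (dl l) (c m) div 2 ^ (AA * rr l)) <= 2 * PP (rr l)"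
	proof (cases "l <= ls")
		case True
		have "card {m : Mx l. zz (dl l) (c m) ~= 0} <= card (Mx l :: ('n => nat) set)" by (intro card_mono) auto
		hence "real (card {m : Mx l. zz (dl l) (c m) ~= 0}) <= real (2 ^ (d * l))" unfolding card_Mx dd by (rule of_nat_mono)
		also have "... <= PP (rr l)" using cells_down[OF True] by simp
		finally have 1: "real (card {m : Mx l. zz (dl l) (c m) ~= 0}) <= PP (rr l)" .
		have "real (SUM m:Mx l. zz (dl l) (c m) div 2 ^ (AA * rr l)) = (SUM m:Mx l. real (zz (dl l) (c m) div 2 ^ (AA * rr l)))" by simp
		also have "... <= (SUM m:(Mx l :: ('n => nat) set). abs (c m) / dl l / 2 ^ (AA * rr l))"
			by (intro sum_mono order_trans[OF div] divide_right_mono zz_le dl_pos) simp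
		also have "... <= 2 * PP (rr l)" using down_sum[OF dd True c] by (simp add: sum_divide_distrib)
		finally show ?thesis using 1 by simp
	next
		case False
		hence l: "ls < l" by simp
		have "real (SUM m:Mx l. zz (dl l) (c m)) = (SUM m:Mx l. real (zz (dl l) (c m)))" by simp
		also have "... <= (SUM m:(Mx l :: ('n => nat) set). (abs (c m) / dl l) powr q)" by (intro sum_mono zz_powr dl_pos q)
		also have "... <= PP (rr l)" by (rule up_sum[OF l c])
		finally have S: "real (SUM m:Mx l. zz (dl l) (c m)) <= PP (rr l)" .
		have "card {m : Mx l. zz (dl l) (c m) ~= 0} = (SUM m:{m : Mx l. zz (dl l) (c m) ~= 0}. 1)" by simp
		also have "... <= (SUM m:{m : Mx l. zz (dl l) (c m) ~= 0}. zz (dl l) (c m))" by (intro sum_mono) auto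
		also have "... <= (SUM m:Mx l. zz (dl l) (c m))" by (intro sum_mono2) auto
		finally have "real (card {m : Mx l. zz (dl l) (c m) ~= 0}) <= real (SUM m:Mx l. zz (dl l) (c m))" by (rule of_nat_mono)
		moreover have "real (SUM m:Mx l. zz (dl l) (c m) div 2 ^ (AA * rr l)) <= real (SUM m:Mx l. zz (dl l) (c m))"
			by (intro of_nat_mono sum_mono) simp
		ultimately show ?thesis using S PP_pos[of "rr l"] by linarith
	qed
	thus "real (card {m : Mx l. zz (dl l) (c m) ~= 0}) <= PP (rr l)" "real (SUM m:Mx l. zz (dl l) (c m) div 2 ^ (AA * rr l)) <= 2 * PP (rr l)" by auto
qed

lemma Gl_ge: "2 powr (real v - ep * real (rr l) / 2) <= real (Gl l)" "1 <= Gl l" "real (Gl l) <= 2 ^ v * (2 powr (- (ep / 2))) ^ rr l + 1"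
proof -
	let ?x = "2 powr (real v - ep * real (rr l) / 2)"
	have x: "0 < ?x" by simp
	show 1: "?x <= real (Gl l)" unfolding Gl_def by linarith
	show "1 <= Gl l" using 1 x by linarith
	have "real (Gl l) <= ?x + 1" unfolding Gl_def using x by linarith
	also have "?x = 2 ^ v * (2 powr (- (ep / 2))) ^ rr l"
		by (simp add: powr_realpow[symmetric] powr_powr powr_add[symmetric])
	finally show "real (Gl l) <= 2 ^ v * (2 powr (- (ep / 2))) ^ rr l + 1" .
qed

text \<open>\<open>Gl\<close> is chosen such that \<open>PP (rr l) <= Gl l ^ 2 * 4^u\<close>. In the
  capacity \<open>Q * W^2 * G\<close> both \<open>Q\<close> and \<open>G\<close> are then of order
  \<open>Gl l\<close>, so lookup and decoding are balanced.\<close>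

lemma stream_budget:
	fixes c :: "('n::finite => nat) => real"
	assumes dd: "d = CARD('n)" and c: "(SUM m:Mx l. abs (c m) powr q) <= 2 powr (real l * (real d - s * q))"
	defines "z == kk l (%m. zz (dl l) (c m))"
	shows "2 * (2 ^ (CARD('n) * l) div 2 ^ (AA * rr l) + 1 + card {i. i < 2 ^ (CARD('n) * l) & z i ~= 0}
				+ (SUM i<2 ^ (CARD('n) * l). z i div 2 ^ (AA * rr l))) < (8 * Gl l + 3) * (2 ^ u * 2 ^ u) * Gl l"
proof -
	let ?P = "PP (rr l)" let ?a = "AA * rr l"
	have 1: "real (2 ^ (CARD('n) * l) div 2 ^ ?a) <= ?P"
		using real_div_le[of "2 ^ (CARD('n) * l)" "2 ^ ?a"] cells_frac[of l] unfolding dd by simp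
	have "card {i. i < 2 ^ (CARD('n) * l) & z i ~= 0} <= card {i. z i ~= 0}"
		unfolding z_def by (intro card_mono kk_supp_card) auto
	also have "... = card {m : Mx l. zz (dl l) (c m) ~= 0}" unfolding z_def by (rule kk_supp_card(2))
	finally have "real (card {i. i < 2 ^ (CARD('n) * l) & z i ~= 0}) <= real (card {m : Mx l. zz (dl l) (c m) ~= 0})" by (rule of_nat_mono)
	hence 2: "real (card {i. i < 2 ^ (CARD('n) * l) & z i ~= 0}) <= ?P" using zz_counts(1)[OF dd c] by linarith
	have "(SUM i<2 ^ (CARD('n) * l). z i div 2 ^ ?a) = (SUM m:(Mx l :: ('n => nat) set). zz (dl l) (c m) div 2 ^ ?a)"
		unfolding z_def by (rule kk_sum[where F="%z. z div 2 ^ ?a"]) simp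
	hence 3: "real (SUM i<2 ^ (CARD('n) * l). z i div 2 ^ ?a) <= 2 * ?P" using zz_counts(2)[OF dd c] by simp
	let ?L = "2 * (2 ^ (CARD('n) * l) div 2 ^ ?a + 1 + card {i. i < 2 ^ (CARD('n) * l) & z i ~= 0} + (SUM i<2 ^ (CARD('n) * l). z i div 2 ^ ?a))"
	have "real ?L <= 8 * ?P + 2" using 1 2 3 
	proof -
		from budget_arith[OF 1 2 3] show ?thesis by (simp only: of_nat_mult of_nat_add of_nat_numeral of_nat_1)
	qed
	also have "... < 8 * (real (Gl l) * real (Gl l) * (2 ^ u * 2 ^ u)) + 3 * (2 ^ u * 2 ^ u) * real (Gl l)"
	proof -
		let ?x = "2 powr (real v - ep * real (rr l) / 2)"
		have "?P <= 2 powr (2 * (real u + real v) - ep * real (rr l))" unfolding PP_def using ls_le(1) by (intro powr_mono) auto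
		also have "... = ?x * ?x * 2 powr (2 * real u)" by (simp add: powr_add[symmetric] algebra_simps)
		also have "2 powr (2 * real u) = (2 ^ u * 2 ^ u :: real)" by (simp add: powr_realpow[symmetric] powr_add[symmetric])
		also have "?x * ?x * (2 ^ u * 2 ^ u) <= real (Gl l) * real (Gl l) * (2 ^ u * 2 ^ u)"
			by (intro mult_right_mono mult_mono Gl_ge) auto
		finally have "?P <= real (Gl l) * real (Gl l) * (2 ^ u * 2 ^ u)" .
		moreover have "3 * (1 * 1) * 1 <= 3 * (2 ^ u * 2 ^ u) * real (Gl l)" by (intro mult_mono) (use Gl_ge(2) in auto)
		ultimately show ?thesis by linarith
	qed
	also have "... = real ((8 * Gl l + 3) * (2 ^ u * 2 ^ u) * Gl l)" by (simp add: algebra_simps)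
	finally show ?thesis by (simp only: of_nat_less_iff)
qed

lemma level_sum:
	assumes F: "!!r. 0 <= F r"
	shows "(SUM l:{lo<..hi}. F (rr l)) <= 2 * (SUM r<=r1. F r :: real)"
proof -
	have S: "{lo<..hi} = {lo<..ls} Un {ls<..hi}" by (auto simp: lo_def hi_def)
	have "(SUM l:{lo<..ls}. F (rr l)) = (SUM r:(%l. ls - l) ` {lo<..ls}. F r)"
		by (subst sum.reindex) (auto simp: inj_on_def rr_def)
	also have "... <= (SUM r<=r1. F r)" by (intro sum_mono2) (auto simp: F lo_def)
	finally have 1: "(SUM l:{lo<..ls}. F (rr l)) <= (SUM r<=r1. F r)" .
	have "(SUM l:{ls<..hi}. F (rr l)) = (SUM r:(%l. l - ls) ` {ls<..hi}. F r)"
		by (subst sum.reindex) (auto simp: inj_on_def rr_def)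
	also have "... <= (SUM r<=r1. F r)" by (intro sum_mono2) (auto simp: F hi_def)
	finally have 2: "(SUM l:{ls<..hi}. F (rr l)) <= (SUM r<=r1. F r)" .
	have "(SUM l:{lo<..hi}. F (rr l)) = (SUM l:{lo<..ls}. F (rr l)) + (SUM l:{ls<..hi}. F (rr l))"
		unfolding S by (rule sum.union_disjoint) auto
	thus ?thesis using 1 2 by linarith
qed

definition "SS = (\<Sum>r. (real r + 1) * (2 powr (- (ep / 2))) ^ r)"
definition "BB = 66 + 12 * real AA"
definition "K1 D = 2 * (6 * ((2 + 1 / ep) * (real cT * (1 + 2 * real D) + 19) + BB * (2 + 1 / ep)\<^sup>2) + BB * SS)"

text \<open>The \<open>O(v + 1)\<close> streamed levels each need \<open>O(v + 1)\<close> layers for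
  digits and products; this quadratic total is absorbed by \<open>2^v\<close>. The costs
  \<open>Gl l\<close> of lookup and decoding decay geometrically away from the critical level, even
  with the factor \<open>rr l\<close>.\<close>

lemma depth_sum:
	"real (SUM l:{lo<..hi}. (tt + 1) + (6 * (8 * Gl l + 3) + 6 * ((2 * (AA * rr l) + 3) * Gl l)) + 2 * tt * D) <= K1 D * 2 ^ v"
proof -
	let ?c = "(real cT * (1 + 2 * real D) + 19) * (real v + 1)" let ?g = "%r. (2 powr (- (ep / 2))) ^ r"
	define F where "F r = ?c + BB * (real r + 1) * (2 ^ v * ?g r + 1)" for r :: nat
	have B: "0 <= BB" by (simp add: BB_def)
	have e: "0 <= 1 / ep" using ep by simp
	have F0: "0 <= F r" for r unfolding F_def using B by (intro add_nonneg_nonneg mult_nonneg_nonneg) auto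
	have t: "real ((tt + 1) + (6 * (8 * Gl l + 3) + 6 * ((2 * (AA * rr l) + 3) * Gl l)) + 2 * tt * D) <= F (rr l)" for l
	proof -
		have "real ((tt + 1) + (6 * (8 * Gl l + 3) + 6 * ((2 * (AA * rr l) + 3) * Gl l)) + 2 * tt * D)
				= (real cT * (1 + 2 * real D)) * (real v + 1) + 19 + (66 + 12 * real AA * real (rr l)) * real (Gl l)"
			by (simp add: tt_def algebra_simps)
		also have "... <= ?c + BB * (real (rr l) + 1) * (2 ^ v * ?g (rr l) + 1)"
		proof (intro add_mono mult_mono Gl_ge(3))
			have "66 * 0 <= 66 * real (rr l)" by simp
			thus "66 + 12 * real AA * real (rr l) <= BB * (real (rr l) + 1)" unfolding BB_def by (simp add: algebra_simps)
			show "real cT * (1 + 2 * real D) * (real v + 1) + 19 <= ?c" by (simp add: algebra_simps)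
		qed (use B in auto)
		finally show ?thesis unfolding F_def .
	qed
	have "real (SUM l:{lo<..hi}. (tt + 1) + (6 * (8 * Gl l + 3) + 6 * ((2 * (AA * rr l) + 3) * Gl l)) + 2 * tt * D) <= (SUM l:{lo<..hi}. F (rr l))"
		unfolding of_nat_sum by (intro sum_mono t)
	also have "... <= 2 * (SUM r<=r1. F r)" by (rule level_sum[OF F0])
	also have "(SUM r<=r1. F r) <= 6 * ((2 + 1 / ep) * (real cT * (1 + 2 * real D) + 19) + BB * (2 + 1 / ep)\<^sup>2) * 2 ^ v + BB * SS * 2 ^ v"
	proof -
		have "(SUM r<=r1. F r) <= (SUM r<=r1. (?c + BB * (real r1 + 1)) + BB * 2 ^ v * ((real r + 1) * ?g r))"
		proof (rule sum_mono)
			fix r assume "r : {..r1}"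
			hence "BB * (real r + 1) <= BB * (real r1 + 1)" using B by (intro mult_left_mono) auto
			thus "F r <= (?c + BB * (real r1 + 1)) + BB * 2 ^ v * ((real r + 1) * ?g r)" unfolding F_def by (simp add: algebra_simps)
		qed
		also have "... = (real r1 + 1) * (?c + BB * (real r1 + 1)) + BB * 2 ^ v * (SUM r<=r1. (real r + 1) * ?g r)"
			by (simp only: sum.distrib sum_distrib_left[symmetric] sum_constant card_atMost of_nat_Suc)  (simp add: algebra_simps)
		also have "... <= ((2 + 1 / ep) * (real v + 1)) * (?c + BB * ((2 + 1 / ep) * (real v + 1))) + BB * 2 ^ v * SS"
		proof (intro add_mono mult_mono)
			show "real r1 + 1 <= (2 + 1 / ep) * (real v + 1)" "real r1 + 1 <= (2 + 1 / ep) * (real v + 1)" by (rule r1_le)+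
			show "(SUM r<=r1. (real r + 1) * ?g r) <= SS" unfolding SS_def
				by (intro sum_le_suminf summable_linear_geometric) (use ep in auto)
		qed (use B e in "auto intro!: add_nonneg_nonneg mult_nonneg_nonneg sum_nonneg")
		also have "((2 + 1 / ep) * (real v + 1)) * (?c + BB * ((2 + 1 / ep) * (real v + 1)))
				= ((2 + 1 / ep) * (real cT * (1 + 2 * real D) + 19) + BB * (2 + 1 / ep)\<^sup>2) * (real v + 1)\<^sup>2"
			by (simp only: power2_eq_square distrib_left distrib_right ac_simps)
		also have "... <= ((2 + 1 / ep) * (real cT * (1 + 2 * real D) + 19) + BB * (2 + 1 / ep)\<^sup>2) * (6 * 2 ^ v)"
			by (intro mult_left_mono square_le_exp add_nonneg_nonneg mult_nonneg_nonneg) (use B e in auto)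
		finally show ?thesis by (simp only: ac_simps) 
	qed
	finally show ?thesis unfolding K1_def by (simp only: distrib_left distrib_right ac_simps)
qed

end

lemma sum_geometric_le:
	fixes x :: real assumes "0 <= x" "x < 1" "finite A" shows "(SUM j:A. x ^ j) <= 1 / (1 - x)"
	using sum_le_suminf[OF summable_geometric[of x] assms(3)] suminf_geometric[of x] assms by simp

lemma sum_powers_le: assumes "1 <= (a :: nat)" shows "(SUM l:{1..n}. 2 ^ (a * l)) <= 2 * (2 :: real) ^ (a * n)"
proof (induction n)
	case (Suc n)
	have "2 * (2 :: real) ^ (a * n) <= 2 ^ a * 2 ^ (a * n)"
		using power_increasing[OF assms, of "2 :: real"] by (intro mult_right_mono) auto
	moreover have "(2 :: real) ^ (a * Suc n) = 2 ^ a * 2 ^ (a * n)" by (simp add: power_add)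
	moreover have "(SUM l:{1..Suc n}. (2 :: real) ^ (a * l)) = (SUM l:{1..n}. 2 ^ (a * l)) + 2 ^ (a * Suc n)" by simp
	ultimately show ?case using Suc by linarith
qed simp

lemma depth_arith: "(a * x) * b + (y + z) * x = (a * b + y + z) * (x :: real)"
	by (simp add: algebra_simps)

context lev begin

definition "nc c l m b = (if l <= lo then c l m b
		else if l <= hi then dl l * (real (zz (dl l) (c l m b)) - real (zz (dl l) (- c l m b)))
		else if dl l < abs (c l m b) & l <= lm then c l m b else (0 :: real))"

text \<open>The leading 2 counts the jumps of each nonzero entry, the inner 2 bounds the geometric
  sum over coarse levels, and \<open>1 / (1 - 2 powr (- ep))\<close> the one over fine
  levels.\<close>

definition "qM nB = nat (ceiling (2 * real nB * (2 + 1 / (1 - 2 powr (- ep)))))"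
text \<open>The value of the network of one shift at good points: quantized coefficients, and
  monomials in the truncated coordinates because the network multiplies dyadic numbers.\<close>

definition "ideal k c y = (SUM l:{1..lm}. SUM b:Bk k. nc c l (%i. cel l (y i)) b * mnm l b (%i. y i - fr (tt * u) (y i) / 2 ^ (tt * u)))"

lemma nc_abs: "abs (nc c l m b) <= abs (c l m b)"
	unfolding nc_def using zz_err(3)[OF dl_pos] by auto

lemma nc_err: "l <= lo ==> c l m b - nc c l m b = 0" "l <= ls ==> abs (c l m b - nc c l m b) <= dl l" "abs (c l m b - nc c l m b) <= abs (c l m b)"
	unfolding nc_def using zz_err(1,2)[OF dl_pos] dl_pos[of l] by (auto simp: hi_def intro: less_imp_le)

text \<open>Past \<open>lm\<close> the budget \<open>PP\<close> is below 1, so not even one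
  coefficient can exceed the threshold; dropping them all is the same as thresholding.\<close>

lemma beyond:
	assumes l: "lm < l" and fM: "finite M" and c: "(SUM m:M. abs (c m) powr q) <= 2 powr (real l * (real d - s * q))" and m: "m : M"
	shows "abs (c m) <= dl l"
proof (rule ccontr)
	assume "~ abs (c m) <= dl l"
	hence "1 <= abs (c m) / dl l" using dl_pos[of l] by simp
	hence "1 powr q <= (abs (c m) / dl l) powr q" using q by (intro powr_mono2) auto
	also have "... <= (SUM m:M. (abs (c m) / dl l) powr q)" using member_le_sum[OF m, of "%m. (abs (c m) / dl l) powr q"] fM by simp
	also have "... <= PP (rr l)" by (rule up_sum[OF _ c]) (use l in "simp add: lm_def hi_def")
	also have "PP (rr l) < 2 powr 0"
		unfolding PP_def
	proof (rule powr_less_mono)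
		have "real ls * real d / ep < real (rr l)"
		proof -
			have "nat (ceiling (real ls * real d / ep)) < rr l" using l by (simp add: rr_def lm_def hi_def)
			thus ?thesis by linarith
		qed
		thus "real d * real ls - ep * real (rr l) < 0" using ep by (simp add: field_simps)
	qed simp
	finally show False by simp
qed

lemma nc_err_up:
	assumes l: "ls < l" and fM: "finite M" and c: "(SUM m:M. abs (c l m b) powr q) <= 2 powr (real l * (real d - s * q))" and m: "m : M"
	shows "abs (c l m b - nc c l m b) <= dl l"
proof (cases "lm < l")
	case True
	have "abs (c l m b) <= dl l" by (rule beyond[OF True fM c m])
	thus ?thesis using nc_err(3)[of c l m b] by linarith
next
	case False
	thus ?thesis unfolding nc_def using zz_err(1)[OF dl_pos] dl_pos[of l] l by (auto simp: lo_def)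
qed

text \<open>Coefficients are at most \<open>2^(d*l)\<close> and truncation changes a remainder by at
  most \<open>2^l / 2^(tt*u)\<close>; this many digits push the resulting error to the order of
  \<open>2 powr (- s*ls)\<close>.\<close>

lemma tt_ge: "(real d + 1) * real lm + s * real ls <= real (tt * u)"
proof -
	let ?w = "(real v + 1) * real u"
	have u1: "1 <= real u" using u by simp
	have w: "real u + real v <= ?w" "real v <= ?w" "1 <= ?w"
		using u1 mult_left_mono[OF u1, of "real v"] by (auto simp: distrib_right)
	have "1 * real ls <= real d * real ls" by (intro mult_right_mono real_d) simp
	hence "real ls <= 2 * (real u + real v)" using ls_le(1) by (metis mult_1 order_trans)
	also have "... <= 2 * ?w" by (intro mult_left_mono w) simp
	finally have l: "real ls <= 2 * ?w" .
	have lm: "real lm <= (5 + 1 / ep + 2 * real d / ep) * ?w"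
	proof -
		have "0 <= real v / ep" "0 <= real ls * real d / ep" using ep by auto
		hence "real lm <= real ls + (real v / ep + 1) + (real ls * real d / ep + 1) + 1"
			unfolding lm_def hi_def r1_def of_nat_add of_nat_1 by linarith
		also have "... <= 2 * ?w + (?w / ep + ?w) + (2 * ?w * real d / ep + ?w) + ?w"
			using w l ep by (intro add_mono divide_right_mono mult_right_mono) auto
		also have "... = (5 + 1 / ep + 2 * real d / ep) * ?w" by (simp add: algebra_simps add_divide_distrib)
		finally show ?thesis .
	qed
	have "(real d + 1) * real lm + s * real ls <= (real d + 1) * ((5 + 1 / ep + 2 * real d / ep) * ?w) + s * (2 * ?w)"
		using s by (intro add_mono mult_left_mono lm l) auto
	also have "... = ((real d + 1) * (5 + 1 / ep + 2 * real d / ep) + 2 * s) * ?w" by (simp add: distrib_right mult.assoc)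
	also have "... <= real cT * ?w"
	proof (rule mult_right_mono)
		show "(real d + 1) * (5 + 1 / ep + 2 * real d / ep) + 2 * s <= real cT" unfolding cT_def by linarith
	qed simp
	finally show ?thesis unfolding tt_def of_nat_mult of_nat_add of_nat_1 mult.assoc .
qed

lemma lm_le: "lm <= tt * u" "0 < tt"
proof -
	have "1 * real lm <= (real d + 1) * real lm" by (intro mult_right_mono) auto
	moreover have "0 <= s * real ls" using s by simp
	ultimately have "real lm <= real (tt * u)" using tt_ge by linarith
	thus 1: "lm <= tt * u" by (simp only: of_nat_le_iff)
	show "0 < tt" using 1 by (cases tt) (auto simp: lm_def)
qed

text \<open>Coarse levels are counted by their cells, fine levels by the coefficients above the
  threshold. Both sums are geometric and governed by the levels near distance \<open>r1\<close>,
  which have about \<open>4^u * 2^v\<close> items.\<close>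

lemma jumps_budget:
	fixes c :: "nat => ('n::finite => nat) => ('n => nat) => real"
	assumes dd: "d = CARD('n)" and c: "!!l b. 1 <= l ==> b : B ==> (SUM m:Mx l. abs (c l m b) powr q) <= 2 powr (real l * (real d - s * q))"
		and fB: "finite B"
	shows "(SUM l:{1..lo} Un {hi<..lm}. 2 * (SUM b:B. card {m : Mx l. nc c l m b ~= 0})) < (qM (card B) * 2 ^ v + 1) * (2 ^ u * 2 ^ u)"
proof -
	let ?x = "2 powr (- ep)"
	have "?x < 2 powr 0" using ep by (intro powr_less_mono) auto
	hence x: "0 <= ?x" "?x < 1" by auto
	have fm: "finite (Mx l :: ('n => nat) set)" for l by simp
	let ?U = "(2 :: real) ^ u * 2 ^ u * 2 ^ v"
	have e1: "real (card {m : Mx l. nc c l m b ~= 0}) <= 2 ^ (d * l)" for l b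
	proof -
		have "card {m : Mx l. nc c l m b ~= 0} <= card (Mx l :: ('n => nat) set)" by (intro card_mono) auto
		hence "real (card {m : Mx l. nc c l m b ~= 0}) <= real (2 ^ (d * l))" unfolding card_Mx dd by (rule of_nat_mono)
		thus ?thesis by simp
	qed
	have e2: "real (card {m : Mx l. nc c l m b ~= 0}) <= PP (rr l)" if l: "hi < l" and b: "b : B" for l b
	proof -
		have l1: "1 <= l" "ls < l" using l by (auto simp: hi_def)
		have "real (card {m : Mx l. nc c l m b ~= 0}) = (SUM m:{m : Mx l. nc c l m b ~= 0}. 1)" by simp
		also have "... <= (SUM m:{m : Mx l. nc c l m b ~= 0}. (abs (c l m b) / dl l) powr q)"
		proof (rule sum_mono)
			fix m assume "m : {m : Mx l. nc c l m b ~= 0}"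
			hence "dl l < abs (c l m b)" using l unfolding nc_def by (auto simp: hi_def lo_def split: if_splits)
			hence "1 <= abs (c l m b) / dl l" using dl_pos[of l] by simp
			hence "1 powr q <= (abs (c l m b) / dl l) powr q" using q by (intro powr_mono2) auto
			thus "1 <= (abs (c l m b) / dl l) powr q" by simp
		qed
		also have "... <= (SUM m:Mx l. (abs (c l m b) / dl l) powr q)" by (intro sum_mono2 fm) auto
		also have "... <= PP (rr l)" by (rule up_sum[OF l1(2) c[OF l1(1) b]])
		finally show ?thesis .
	qed
	have s1: "(SUM l:{1..lo}. (2 :: real) ^ (d * l)) <= 2 * ?U"
	proof (cases "lo = 0")
		case False
		hence "real lo = real ls - real r1" by (simp add: lo_def)
		moreover have "ep * real r1 <= real d * real r1" using ep real_d by (intro mult_right_mono) auto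
		ultimately have "real (d * lo) <= 2 * real u + real v" using ls_le(1) r1_ge by (simp add: right_diff_distrib)
		hence "2 powr real (d * lo) <= 2 powr (2 * real u + real v)" by (intro powr_mono) auto
		moreover have "2 powr real (d * lo) = (2 :: real) ^ (d * lo)" by (rule powr_realpow) simp
		moreover have "2 powr (2 * real u + real v) = ?U" by (simp add: powr_realpow[symmetric] powr_add[symmetric])
		ultimately show ?thesis using sum_powers_le[OF d, of lo] by linarith
	qed simp
	have s2: "(SUM l:{hi<..lm}. PP (rr l)) <= ?U * (1 / (1 - ?x))"
	proof -
		have "PP (rr l) <= ?U * ?x ^ (l - hi)" if l: "l : {hi<..lm}" for l
		proof -
			have r: "real (rr l) = real r1 + real (l - hi)" using l by (simp add: rr_def hi_def)
			have "real d * real ls - ep * real (rr l) <= 2 * real u + real v + - ep * real (l - hi)"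
				using ls_le(1) r1_ge unfolding r distrib_left by linarith
			hence "PP (rr l) <= 2 powr (2 * real u + real v + - ep * real (l - hi))" unfolding PP_def by (intro powr_mono) auto
			also have "... = ?U * ?x ^ (l - hi)" by (simp add: powr_realpow[symmetric] powr_add[symmetric] powr_powr)
			finally show ?thesis .
		qed
		hence "(SUM l:{hi<..lm}. PP (rr l)) <= (SUM l:{hi<..lm}. ?U * ?x ^ (l - hi))" by (rule sum_mono)
		also have "... = ?U * (SUM j:(%l. l - hi) ` {hi<..lm}. ?x ^ j)"
			by (subst sum.reindex) (auto simp: inj_on_def sum_distrib_left)
		also have "... <= ?U * (1 / (1 - ?x))" by (intro mult_left_mono sum_geometric_le x) auto
		finally show ?thesis .
	qed
	have "real (SUM l:{1..lo} Un {hi<..lm}. 2 * (SUM b:B. card {m : Mx l. nc c l m b ~= 0}))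
			= (SUM l:{1..lo}. 2 * (SUM b:B. real (card {m : Mx l. nc c l m b ~= 0}))) + (SUM l:{hi<..lm}. 2 * (SUM b:B. real (card {m : Mx l. nc c l m b ~= 0})))"
		by (subst sum.union_disjoint) (auto simp: lo_def hi_def)
	also have "... <= (SUM l:{1..lo}. 2 * (SUM b:B. 2 ^ (d * l))) + (SUM l:{hi<..lm}. 2 * (SUM b:B. PP (rr l)))"
		by (intro add_mono sum_mono mult_left_mono e1 e2) auto
	also have "... = 2 * real (card B) * ((SUM l:{1..lo}. 2 ^ (d * l)) + (SUM l:{hi<..lm}. PP (rr l)))"
		by (simp add: sum_distrib_left distrib_left mult.assoc)
	also have "... <= 2 * real (card B) * (2 * ?U + ?U * (1 / (1 - ?x)))" by (intro mult_left_mono add_mono s1 s2) simp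
	also have "... = 2 * real (card B) * (2 + 1 / (1 - ?x)) * ?U" by (simp add: algebra_simps)
	also have "... <= real (qM (card B)) * ?U"
	proof (rule mult_right_mono)
		show "2 * real (card B) * (2 + 1 / (1 - ?x)) <= real (qM (card B))" unfolding qM_def by linarith
	qed simp
	also have "... < real ((qM (card B) * 2 ^ v + 1) * (2 ^ u * 2 ^ u))" by (simp add: algebra_simps)
	finally show ?thesis by (simp only: of_nat_less_iff)
qed

definition "Kd nB D = nat (ceiling ((real cT + 1) * (1 + real nB * (1 + 4 * real D)) + 3 * real nB * (real (qM nB) + 1) + 2 * real nB * K1 D))"

text \<open>Instance of \<open>cmp_approximant\<close>: the levels up to \<open>lo\<close> and those
  above \<open>hi\<close> share the step function \<open>PhiM\<close>, the levels between are
  streamed with the capacities of \<open>stream_budget\<close>.\<close>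

lemma ideal_network:
	fixes c :: "nat => ('n::finite => nat) => ('n => nat) => real" and y :: "'n => 'x => real"
	assumes dd: "d = CARD('n)" and c: "!!l b. 1 <= l ==> b : Bk k ==> (SUM m:Mx l. abs (c l m b) powr q) <= 2 powr (real l * (real d - s * q))"
		and g: "!!i x. x : X ==> good (tt * u) e (y i x)" and e: "0 < e"
	shows "cmp X (3 * wbase CARD('n) u) (Kd (card (Bk k :: ('n => nat) set)) (CARD('n) * k) * 2 ^ v) (range y) {%x. ideal k c (%i. y i x)}"
proof -
	let ?B = "Bk k :: ('n => nat) set" and ?D = "CARD('n) * k" and ?M = "{1..lo} Un {hi<..lm}"
	let ?nB = "card ?B"
	define yt where "yt i x = y i x - fr (tt * u) (y i x) / 2 ^ (tt * u)" for i x
	define z where "z bo l be = kk l (%m. zz (dl l) (if bo then c l m be else - c l m be))" for bo l be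
	define Ph where "Ph = PhiM k ?M lm (nc c)"
	have hl: "hi <= lm" by (simp add: lm_def)
	have u0: "0 < u" using u by simp
	have y01: "0 <= y i x" "y i x < 1" if "x : X" for i x using g[OF that, of i] by (auto simp: good_def)
	let ?dep = "(tt + 1) + (?nB * ((tt + 1) + 3 * (qM ?nB * 2 ^ v + 1) + 4 * tt * ?D)
			+ 2 * ?nB * (SUM l:{lo<..hi}. (tt + 1) + (6 * (8 * Gl l + 3) + 6 * ((2 * (AA * rr l) + 3) * Gl l)) + 2 * tt * ?D))"
	have fM: "finite (jumps (Ph be))" "card (jumps (Ph be)) < (qM ?nB * 2 ^ v + 1) * (2 ^ u * 2 ^ u)" for be
	proof -
		have fin: "finite ?M" by simp
		show "finite (jumps (Ph be))" unfolding Ph_def by (rule PhiM_jumps(1)[OF fin])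
		show "card (jumps (Ph be)) < (qM ?nB * 2 ^ v + 1) * (2 ^ u * 2 ^ u)"
			unfolding Ph_def by (rule le_less_trans[OF PhiM_jumps(2)[OF fin] jumps_budget[OF dd c finite_Bk]])
	qed
	have Ri: "2 * (2 ^ (CARD('n) * l) div 2 ^ (AA * rr l) + 1 + card {i. i < 2 ^ (CARD('n) * l) & z bo l be i ~= 0}
				+ (SUM i<2 ^ (CARD('n) * l). z bo l be i div 2 ^ (AA * rr l))) < (8 * Gl l + 3) * (2 ^ u * 2 ^ u) * Gl l"
		if l: "l : {lo<..hi}" and b: "be : ?B" for bo l be
		unfolding z_def by (rule stream_budget[OF dd]) (use c[OF _ b, of l] l in "cases bo; simp")
	have net: "cmp X (3 * wbase CARD('n) u) ?dep (range y)
			{%x. (SUM be:?B. Ph be (key (%i. cel lm (yt i x))) * (PROD i:UNIV. yt i x ^ be i)) +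
				(SUM l:{lo<..hi}. SUM be:?B. dl l * (real (z True l be (key (%i. cel l (yt i x)))) - real (z False l be (key (%i. cel l (yt i x))))) * (PROD i:UNIV. fr l (yt i x) ^ be i))}" (is "cmp _ _ _ _ {?F}")
	proof (rule cmp_approximant[where t=tt and u=u and ep=e and D="?D" and Q="%l. 8 * Gl l + 3" and a="%l. AA * rr l" and G=Gl and Qm="qM ?nB * 2 ^ v + 1"])
		show "l <= tt * u" if "l : {lo<..hi}" for l using that hl lm_le(1) by auto
		show "(SUM i:UNIV. be i) <= ?D" if "be : ?B" for be
		proof -
			have "(SUM i:UNIV. be i) <= (SUM i:(UNIV :: 'n set). k)" using that by (intro sum_mono) (simp add: Bk_iff)
			thus ?thesis by simp
		qed
	qed (use g e u0 lm_le fM Ri Gl_ge(2) in "simp_all add: yt_def")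
	have eq: "?F x = ideal k c (%i. y i x)" if x: "x : X" for x
	proof -
		have t01: "0 <= yt i x" "yt i x < 1" for i unfolding yt_def using trunc_props(1,2)[OF y01[OF x] order_refl] by auto
		have ct: "cel l (yt i x) = cel l (y i x)" if "l <= lm" for l i
			unfolding yt_def using trunc_props(3)[OF y01[OF x] order_trans[OF that lm_le(1)]] .
		have i1: "ideal k c (%i. y i x) = (SUM l:{1..lm}. SUM b:?B. nc c l (%i. cel l (yt i x)) b * mnm l b (%i. yt i x))"
			unfolding ideal_def yt_def[symmetric] by (intro sum.cong refl) (simp add: ct)
		have S: "{1..lm} = ?M Un {lo<..hi}" using hl by (auto simp: lo_def hi_def)
		have "!!l. l : ?M ==> l <= lm" using hl by (auto simp: lo_def hi_def)
		note M1 = PhiM_eval[of ?M lm "%i. yt i x" k "nc c", OF this t01]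
		have z1: "z bo l be (key (%i. cel l (yt i x))) = zz (dl l) (if bo then c l (%i. cel l (yt i x)) be else - c l (%i. cel l (yt i x)) be)" for bo l be
			unfolding z_def by (rule kk_key) (use cel_less[OF t01] in "simp add: Mx_iff")
		have A: "(SUM be:?B. Ph be (key (%i. cel lm (yt i x))) * (PROD i:UNIV. yt i x ^ be i))
			= (SUM l:?M. SUM b:?B. nc c l (%i. cel l (yt i x)) b * mnm l b (%i. yt i x))"
			unfolding Ph_def mnm_def by (rule M1)
		have "?F x = (SUM l:?M. SUM b:?B. nc c l (%i. cel l (yt i x)) b * mnm l b (%i. yt i x))
				+ (SUM l:{lo<..hi}. SUM b:?B. nc c l (%i. cel l (yt i x)) b * mnm l b (%i. yt i x))"
			unfolding A z1 unfolding mnm_def by (intro arg_cong2[of _ _ _ _ "(+)"] sum.cong refl) (auto simp: nc_def)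
		also have "... = ideal k c (%i. y i x)" unfolding i1 S by (subst sum.union_disjoint) (auto simp: lo_def hi_def)
		finally show ?thesis .
	qed
	have dep: "?dep <= Kd ?nB ?D * 2 ^ v"
	proof -
		let ?S = "SUM l:{lo<..hi}. (tt + 1) + (6 * (8 * Gl l + 3) + 6 * ((2 * (AA * rr l) + 3) * Gl l)) + 2 * tt * ?D"
		have "(real tt + 1) <= (real cT + 1) * (real v + 1)" unfolding tt_def by (simp add: algebra_simps)
		also have "... <= (real cT + 1) * 2 ^ v" by (intro mult_left_mono succ_le_exp) simp
		finally have t: "real tt + 1 <= (real cT + 1) * 2 ^ v" .
		have "real ?dep = (real tt + 1) + (real ?nB * ((real tt + 1) + 3 * (real (qM ?nB) * 2 ^ v + 1) + 4 * real tt * real ?D) + 2 * real ?nB * real ?S)"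
			by (simp only: of_nat_add of_nat_mult of_nat_power of_nat_numeral of_nat_1)
		also have "... <= (real tt + 1) + (real ?nB * ((real tt + 1) + 3 * (real (qM ?nB) * 2 ^ v + 2 ^ v) + 4 * (real tt + 1) * real ?D) + 2 * real ?nB * (K1 ?D * 2 ^ v))"
			by (intro add_mono mult_left_mono mult_right_mono order_refl depth_sum) auto
		also have "... = (real tt + 1) * (1 + real ?nB * (1 + 4 * real ?D)) + (3 * real ?nB * (real (qM ?nB) + 1) + 2 * real ?nB * K1 ?D) * 2 ^ v"
			by (simp only: distrib_left distrib_right mult_1_left mult_1_right mult.assoc mult.left_commute mult.commute add.assoc add.left_commute add.commute)
		also have "... <= ((real cT + 1) * 2 ^ v) * (1 + real ?nB * (1 + 4 * real ?D)) + (3 * real ?nB * (real (qM ?nB) + 1) + 2 * real ?nB * K1 ?D) * 2 ^ v"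
			by (intro add_mono mult_right_mono t order_refl) auto
		also have "... = ((real cT + 1) * (1 + real ?nB * (1 + 4 * real ?D)) + 3 * real ?nB * (real (qM ?nB) + 1) + 2 * real ?nB * K1 ?D) * 2 ^ v"
			by (rule depth_arith)
		also have "... <= real (Kd ?nB ?D) * 2 ^ v"
		proof (rule mult_right_mono)
			show "(real cT + 1) * (1 + real ?nB * (1 + 4 * real ?D)) + 3 * real ?nB * (real (qM ?nB) + 1) + 2 * real ?nB * K1 ?D <= real (Kd ?nB ?D)"
				unfolding Kd_def by linarith
		qed simp
		also have "... = real (Kd ?nB ?D * 2 ^ v)" by simp
		finally show ?thesis by (simp only: of_nat_le_iff)
	qed
	have w: "2 * card {%x. ideal k c (%i. y i x)} <= 3 * wbase CARD('n) u" 
	proof -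
		have "1 * 1 <= (40 + 10 * CARD('n)) * 2 ^ u" by (intro mult_mono) auto
		moreover have "2 * card {%x. ideal k c (%i. y i x)} = 2" by simp
		moreover have "1 * 1 <= w ==> x = 2 ==> x <= 3 * w" for x w :: nat by simp
		ultimately show ?thesis by blast
	qed
	have "cmp X (3 * wbase CARD('n) u) ?dep (range y) {%x. ideal k c (%i. y i x)}"
	proof (rule cmp_post[OF net])
		have "(%x. ideal k c (%i. y i x)) : affs X {?F}"
			by (rule affs.cong[OF affs.base[of ?F]]) (use eq[symmetric] in auto)
		thus "{%x. ideal k c (%i. y i x)} \<subseteq> affs X {?F}" by blast
	qed
	thus ?thesis by (rule cmp_pad[OF _ _ w dep]) simp
qed

lemma coef_le:
	fixes c :: "('n::finite => nat) => real"
	assumes c: "(SUM m:Mx l. abs (c m) powr q) <= 2 powr (real l * (real d - s * q))" and m: "m : Mx l"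
	shows "abs (c m) <= 2 ^ (d * l)"
proof -
	have "abs (c m) powr q <= (SUM m:Mx l. abs (c m) powr q)" by (rule member_le_sum[OF m]) auto
	also note c
	also have "2 powr (real l * (real d - s * q)) <= 2 powr (real (d * l) * q)"
	proof (rule powr_mono)
		have "0 <= real l * (s * q)" using s q by simp
		moreover have "real l * real d * 1 <= real l * real d * q" by (rule mult_left_mono[OF q]) simp
		ultimately show "real l * (real d - s * q) <= real (d * l) * q" by (simp add: algebra_simps)
	qed simp
	finally have "(abs (c m) powr q) powr (1 / q) <= (2 powr (real (d * l) * q)) powr (1 / q)" using q by (intro powr_mono2) auto
	hence "abs (c m) <= 2 powr real (d * l)" unfolding powr_powr using q by simp
	moreover have "2 powr real (d * l) = (2 :: real) ^ (d * l)" by (rule powr_realpow) simp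
	ultimately show ?thesis by simp
qed

text \<open>Two sources: the monomials at truncated coordinates, weighted by quantized coefficients
  and bounded through \<open>tt_ge\<close>, and the quantization of the coefficients, left as a sum.
  Levels beyond \<open>lm\<close> enter only the second, as \<open>nc\<close> is 0 there.\<close>

lemma ideal_error:
	fixes c :: "nat => ('n::finite => nat) => ('n => nat) => real"
	assumes dd: "d = CARD('n)" and c: "!!l b. 1 <= l ==> b : Bk k ==> (SUM m:Mx l. abs (c l m b) powr q) <= 2 powr (real l * (real d - s * q))"
		and y: "!!i. 0 <= y i" "!!i. y i < 1" and L: "lm <= L"
	shows "abs ((SUM l:{1..L}. SUM b:Bk k. c l (%i. cel l (y i)) b * mnm l b y) - ideal k c y)
			<= 2 * real (card (Bk k :: ('n => nat) set)) * real (CARD('n) * k) * 2 powr (- s * real ls)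
				+ (SUM l:{1..L}. SUM b:Bk k. abs (c l (%i. cel l (y i)) b - nc c l (%i. cel l (y i)) b))"
proof -
	let ?m = "%l i. cel l (y i)" and ?yt = "%i. y i - fr (tt * u) (y i) / 2 ^ (tt * u)" and ?D = "real (CARD('n) * k)" and ?nB = "real (card (Bk k :: ('n => nat) set))"
	have mM: "?m l : Mx l" for l using cel_less[OF y] by (simp add: Mx_iff)
	have split: "{1..L} = {1..lm} Un {lm<..L}" using L by auto
	have n0: "nc c l m b = 0" if "lm < l" for l m b using that by (simp add: nc_def lm_def hi_def lo_def)
	have i: "ideal k c y = (SUM l:{1..L}. SUM b:Bk k. nc c l (?m l) b * mnm l b ?yt)"
		unfolding ideal_def split by (subst sum.union_disjoint) (auto simp: n0)
	have eq: "(SUM l:{1..L}. SUM b:Bk k. c l (?m l) b * mnm l b y) - ideal k c y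
		= (SUM l:{1..L}. SUM b:Bk k. nc c l (?m l) b * (mnm l b y - mnm l b ?yt)) + (SUM l:{1..L}. SUM b:Bk k. (c l (?m l) b - nc c l (?m l) b) * mnm l b y)"
		unfolding i sum_subtractf[symmetric] sum.distrib[symmetric] by (simp add: algebra_simps)
	have "abs ((SUM l:{1..L}. SUM b:Bk k. c l (?m l) b * mnm l b y) - ideal k c y) <= (SUM l:{1..L}. SUM b:Bk k. abs (nc c l (?m l) b * (mnm l b y - mnm l b ?yt))) + (SUM l:{1..L}. SUM b:Bk k. abs ((c l (?m l) b - nc c l (?m l) b) * mnm l b y))"
		unfolding eq by (intro order_trans[OF abs_triangle_ineq] add_mono order_trans[OF sum_abs] sum_mono sum_abs)
	also have "... <= 2 * ?nB * ?D * 2 powr (- s * real ls) + (SUM l:{1..L}. SUM b:Bk k. abs (c l (?m l) b - nc c l (?m l) b))"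
	proof (intro add_mono sum_mono)
		fix l b
		show "abs ((c l (?m l) b - nc c l (?m l) b) * mnm l b y) <= abs (c l (?m l) b - nc c l (?m l) b)"
			unfolding abs_mult by (intro mult_left_le mnm_le_1) simp
	next
		have "(SUM l:{1..L}. SUM b:Bk k. abs (nc c l (?m l) b * (mnm l b y - mnm l b ?yt))) = (SUM l:{1..lm}. SUM b:Bk k. abs (nc c l (?m l) b * (mnm l b y - mnm l b ?yt)))"
			unfolding split by (subst sum.union_disjoint) (auto simp: n0)
		also have "... <= (SUM l:{1..lm}. SUM b:(Bk k :: ('n => nat) set). ?D * (2 ^ ((d + 1) * l) / 2 ^ (tt * u)))"
		proof (intro sum_mono)
			fix l and b :: "'n => nat" assume l: "l : {1..lm}" and b: "b : Bk k"
			have "abs (nc c l (?m l) b) <= 2 ^ (d * l)" using nc_abs[of c l "?m l" b] coef_le[OF c[OF _ b] mM, of l] l by auto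
			moreover have "abs (mnm l b y - mnm l b ?yt) <= ?D * (2 ^ l / 2 ^ (tt * u))"
				by (rule mnm_diff[OF _ b]) (use l lm_le(1) y in "intro trunc_props(4); auto")
			ultimately have "abs (nc c l (?m l) b * (mnm l b y - mnm l b ?yt)) <= 2 ^ (d * l) * (?D * (2 ^ l / 2 ^ (tt * u)))"
				unfolding abs_mult by (intro mult_mono) auto
			also have "... = ?D * (2 ^ ((d + 1) * l) / 2 ^ (tt * u))" by (simp add: power_add)
			finally show "abs (nc c l (?m l) b * (mnm l b y - mnm l b ?yt)) <= ?D * (2 ^ ((d + 1) * l) / 2 ^ (tt * u))" .
		qed
		also have "... = ?nB * ?D * ((SUM l:{1..lm}. 2 ^ ((d + 1) * l)) / 2 ^ (tt * u))"
			by (simp add: sum_distrib_left sum_divide_distrib mult.assoc)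
		also have "... <= ?nB * ?D * ((2 * 2 ^ ((d + 1) * lm)) / 2 ^ (tt * u))"
			by (intro mult_left_mono divide_right_mono sum_powers_le) auto
		also have "... = 2 * ?nB * ?D * (2 ^ ((d + 1) * lm) / 2 ^ (tt * u))" by simp
		also have "... <= 2 * ?nB * ?D * 2 powr (- s * real ls)"
		proof (rule mult_left_mono)
			have "2 ^ ((d + 1) * lm) / 2 ^ (tt * u) = 2 powr (real ((d + 1) * lm) - real (tt * u))"
				unfolding powr_diff by (simp only: powr_realpow zero_less_numeral)
			also have "... <= 2 powr (- s * real ls)" using tt_ge by (intro powr_mono) (auto simp: algebra_simps)
			finally show "2 ^ ((d + 1) * lm) / 2 ^ (tt * u) <= 2 powr (- s * real ls)" .
		qed simp
		finally show "(SUM l:{1..L}. SUM b:Bk k. abs (nc c l (?m l) b * (mnm l b y - mnm l b ?yt))) <= 2 * ?nB * ?D * 2 powr (- s * real ls)" .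
	qed
	finally show ?thesis .
qed

end

section \<open>Error of one shift\<close>

lemma cells_Mx: "cells sh l \<subseteq> Mx l"
	by (auto simp: cells_def Mx_iff)

lemma cl_step_measurable:
	fixes G :: "('n::finite => nat) => real"
	assumes sh: "0 <= sh" "sh < 1" and G: "!!m. 0 <= G m"
	shows "(%x. ennreal (G (cl sh l x))) : mOC"
		"(NI x. ennreal (G (cl sh l x))) <= ennreal (hw l ^ CARD('n) * (SUM m:Mx l. G m))"
proof -
	let ?S = "%m. {x : open_unit_cube. cl sh l x = m} :: (real^'n) set"
	let ?h = "%x. SUM m:cells sh l. ennreal (G m) * indicator (?S m) x"
	have fin: "finite (cells sh l :: ('n => nat) set)" by (rule cells_finite)
	have S: "?S m : sets OC" for m
	proof -
		have "?S m : sets lebesgue" using cl_level_set[of sh l m] by (intro sets_completionI_sets) simp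
		thus ?thesis by (auto simp: sets_restrict_space_iff)
	qed
	have e: "ennreal (G (cl sh l x)) = ?h x" if "x : space OC" for x
	proof -
		have x: "x : open_unit_cube" using that by simp
		have "?h x = (SUM m:cells sh l. if m = cl sh l x then ennreal (G m) else 0)"
			using x by (intro sum.cong refl) (auto simp: indicator_def)
		also have "... = ennreal (G (cl sh l x))"
			by (subst sum.delta'[OF fin] sum.delta[OF fin]) (simp only: cl_cells(1)[OF x sh] if_True)
		finally show ?thesis by simp
	qed
	have hm: "?h : mOC"
		by (intro borel_measurable_sum borel_measurable_times_ennreal borel_measurable_const borel_OC borel_measurable_indicator cl_level_set)
	show "(%x. ennreal (G (cl sh l x))) : mOC" by (subst measurable_cong[OF e]) (use hm in auto)
	have "(NI x. ennreal (G (cl sh l x))) = (NI x. ?h x)" by (rule nn_integral_cong[OF e])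
	also have "... = (SUM m:cells sh l. \<integral>\<^sup>+x. ennreal (G m) * indicator (?S m) x \<partial>OC)"
		by (rule nn_integral_sum) (intro borel_measurable_times_ennreal borel_measurable_const borel_OC borel_measurable_indicator cl_level_set)
	also have "... = (SUM m:cells sh l. ennreal (G m) * emeasure OC (?S m))" by (intro sum.cong refl nn_integral_cmult_indicator S)
	also have "... <= (SUM m:cells sh l. ennreal (G m) * ennreal (hw l ^ CARD('n)))"
		by (intro sum_mono mult_left_mono cl_level_measure[OF sh]) auto
	also have "... = ennreal (hw l ^ CARD('n) * (SUM m:cells sh l. G m))"
		using hw_pos[of l] G by (simp add: ennreal_mult[symmetric] sum_distrib_right[symmetric] sum_nonneg mult.commute[of "hw l ^ CARD('n)"] less_imp_le)
	also have "... <= ennreal (hw l ^ CARD('n) * (SUM m:Mx l. G m))"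
		using hw_pos[of l] G by (intro ennreal_leI mult_left_mono sum_mono2 cells_Mx) (auto intro: less_imp_le)
	finally show "(NI x. ennreal (G (cl sh l x))) <= ennreal (hw l ^ CARD('n) * (SUM m:Mx l. G m))" .
qed

text \<open>A substitute for Hoelder's inequality on sums over levels: each term is at most
  \<open>om i\<close> times the largest quotient, whose power is bounded by the sum of all the
  powers.\<close>

lemma weighted_powr_sum:
	fixes a om :: "'i => real"
	assumes "finite I" "!!i. i : I ==> 0 < om i" "!!i. i : I ==> 0 <= a i" "(SUM i:I. om i) <= Om" "0 < p"
	shows "(SUM i:I. a i) powr p <= Om powr p * (SUM i:I. (a i / om i) powr p)"
proof (cases "I = {}")
	case False
	define M where "M = Max ((%i. a i / om i) ` I)"
	have "M : (%i. a i / om i) ` I" unfolding M_def using assms(1) False by (intro Max_in) auto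
	then obtain j where j: "j : I" "a j / om j = M" by blast
	have M0: "0 <= M" using assms(2,3)[OF j(1)] j(2) by (metis divide_nonneg_pos)
	have "a i <= M * om i" if "i : I" for i
	proof -
		have "a i / om i <= M" unfolding M_def using assms(1) that by simp
		thus ?thesis using assms(2)[OF that] by (simp add: field_simps)
	qed
	hence "(SUM i:I. a i) <= (SUM i:I. M * om i)" by (rule sum_mono)
	also have "... <= M * Om" unfolding sum_distrib_left[symmetric] by (intro mult_left_mono assms M0)
	finally have "(SUM i:I. a i) powr p <= (M * Om) powr p" using assms by (intro powr_mono2 sum_nonneg) auto
	also have "... = Om powr p * M powr p" by (simp add: powr_mult)
	also have "M powr p <= (SUM i:I. (a i / om i) powr p)"
		using member_le_sum[of j I "%i. (a i / om i) powr p"] j assms(1) by simp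
	finally show ?thesis by (simp add: mult_left_mono)
qed (use assms in simp)

context lev begin

lemma rr_sum:
	assumes "0 <= x" "x < (1 :: real)" shows "(SUM l:{1..L}. x ^ rr l) <= 2 / (1 - x)"
proof -
	have "(SUM l:{1..L}. x ^ rr l) <= (SUM l:{..ls} Un {ls<..L}. x ^ rr l)" using assms by (intro sum_mono2) auto
	also have "... = (SUM l:{..ls}. x ^ rr l) + (SUM l:{ls<..L}. x ^ rr l)" by (rule sum.union_disjoint) auto
	also have "(SUM l:{..ls}. x ^ rr l) = (SUM r:(%l. ls - l) ` {..ls}. x ^ r)" by (subst sum.reindex) (auto simp: inj_on_def rr_def)
	also have "(SUM l:{ls<..L}. x ^ rr l) = (SUM r:(%l. l - ls) ` {ls<..L}. x ^ r)" by (subst sum.reindex) (auto simp: inj_on_def rr_def)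
	also have "(SUM r:(%l. ls - l) ` {..ls}. x ^ r) + (SUM r:(%l. l - ls) ` {ls<..L}. x ^ r) <= 1 / (1 - x) + 1 / (1 - x)"
		by (intro add_mono sum_geometric_le assms) auto
	finally show ?thesis by simp
qed

text \<open>On coarse levels every error is at most \<open>dl l\<close>. On fine levels an error
  \<open>e\<close> satisfies \<open>e^p = e^(p-q) * e^q\<close>, with the first factor bounded by
  the threshold and the second by the coefficient; \<open>s*q - ka*(p - q) >= et*p\<close> is the
  resulting decay.\<close>

lemma level_error_sum:
	fixes c :: "nat => ('n::finite => nat) => ('n => nat) => real"
	assumes dd: "d = CARD('n)" and l: "1 <= l" and c: "(SUM m:Mx l. abs (c l m b) powr q) <= 2 powr (real l * (real d - s * q))"
		and p: "q <= p" and et: "0 < et" "et <= 1" "et * p <= s * q - ka * (p - q)"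
	shows "(SUM m:Mx l. abs (c l m b - nc c l m b) powr p) <= 2 ^ (d * l) * (2 powr (- s * real ls) * 2 powr (- et * real (rr l))) powr p"
proof (cases "l <= ls")
	case True
	have p0: "0 <= p" using p q by simp
	have "abs (c l m b - nc c l m b) powr p <= (2 powr (- s * real ls) * 2 powr (- et * real (rr l))) powr p" for m
	proof (rule powr_mono2[OF p0 abs_ge_zero])
		have "abs (c l m b - nc c l m b) <= dl l" by (rule nc_err(2)[OF True])
		also have "... = 2 powr (- s * real ls - real (rr l))" using True by (simp add: dl_def)
		also have "... <= 2 powr (- s * real ls + - et * real (rr l))"
			using mult_right_mono[OF et(2), of "real (rr l)"] by (intro powr_mono) auto
		finally show "abs (c l m b - nc c l m b) <= 2 powr (- s * real ls) * 2 powr (- et * real (rr l))" by (simp only: powr_add)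
	qed
	hence "(SUM m:Mx l. abs (c l m b - nc c l m b) powr p) <= real (card (Mx l :: ('n => nat) set)) * (2 powr (- s * real ls) * 2 powr (- et * real (rr l))) powr p"
		by (intro sum_bounded_above)
	thus ?thesis by (simp add: card_Mx dd)
next
	case False
	hence l: "ls < l" by simp
	have p0: "0 < p" using p q by simp
	have r: "real l = real ls + real (rr l)" using l by (simp add: rr_def)
	have D: "dl l = 2 powr (- s * real ls + ka * real (rr l))" using l by (simp add: dl_def)
	have "abs (c l m b - nc c l m b) powr p <= dl l powr (p - q) * abs (c l m b) powr q" if m: "m : Mx l" for m
	proof -
		let ?e = "abs (c l m b - nc c l m b)"
		have "?e powr p = ?e powr (p - q) * ?e powr q" by (simp add: powr_add[symmetric])
		also have "... <= dl l powr (p - q) * abs (c l m b) powr q"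
			using nc_err_up[where c=c and b=b and M="Mx l", OF l finite_Mx c m] p q by (intro mult_mono powr_mono2 nc_err(3)) auto
		finally show ?thesis .
	qed
	hence "(SUM m:Mx l. abs (c l m b - nc c l m b) powr p) <= (SUM m:Mx l. dl l powr (p - q) * abs (c l m b) powr q)" by (rule sum_mono)
	also have "... <= dl l powr (p - q) * 2 powr (real l * (real d - s * q))" unfolding sum_distrib_left[symmetric] by (intro mult_left_mono c) simp
	also have "... = 2 powr ((- s * real ls + ka * real (rr l)) * (p - q) + real l * (real d - s * q))" unfolding D powr_powr powr_add[symmetric] ..
	also have "... <= 2 powr (real (d * l) + (- s * real ls + - et * real (rr l)) * p)"
	proof (rule powr_mono)
		have "et * p * real (rr l) <= (s * q - ka * (p - q)) * real (rr l)" by (rule mult_right_mono[OF et(3)]) simp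
		thus "(- s * real ls + ka * real (rr l)) * (p - q) + real l * (real d - s * q) <= real (d * l) + (- s * real ls + - et * real (rr l)) * p"
			unfolding of_nat_mult r by (simp add: algebra_simps)
	qed simp
	also have "... = 2 ^ (d * l) * (2 powr (- s * real ls) * 2 powr (- et * real (rr l))) powr p"
	proof -
		have "2 powr real (d * l) = (2 :: real) ^ (d * l)" by (rule powr_realpow) simp
		moreover have "2 powr (- s * real ls) * 2 powr (- et * real (rr l)) = 2 powr (- s * real ls + - et * real (rr l))" by (rule powr_add[symmetric])
		ultimately show ?thesis by (simp only: powr_powr powr_add[of 2 "real (d * l)"])
	qed
	finally show ?thesis .
qed

definition "TT nB D = 2 * real nB * real D"
definition "Cfin nB D p et = (1 + 2 / (1 - 2 powr (- et / 2))) * (TT nB D powr p + real nB powr p * real nB * 2 ^ d * (2 / (1 - 2 powr (- et / 2))) + 1) powr (1 / p)"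

text \<open>A measurable majorant \<open>H\<close> is produced because the majorants of all shifts
  are added before integrating. The estimate is proved for partial sums from level \<open>lm\<close>
  on and passes to the limit along the subsequence.\<close>

lemma shift_error_finite:
	fixes c :: "nat => ('n::finite => nat) => ('n => nat) => real" and f :: "real^'n => real"
	assumes dd: "d = CARD('n)" and c: "!!l b. 1 <= l ==> b : Bk k ==> (SUM m:Mx l. abs (c l m b) powr q) <= 2 powr (real l * (real d - s * q))"
		and p: "q <= p" and et: "0 < et" "et <= 1" "et * p <= s * q - ka * (p - q)" and sh: "0 <= sh" "sh < 1"
		and r: "strict_mono r" "AE x in OC. (%n. SUM l:{1..Suc (r n)}. SUM b:Bk k. c l (cl sh l x) b * mnm l b (yc sh x)) ----> f x"
	shows "EX H:mOC. (AE x in OC. ennreal (abs (f x - ideal k c (yc sh x)) powr p) <= H x) &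
		(NI x. H x) <= ennreal ((Cfin (card (Bk k :: ('n => nat) set)) (CARD('n) * k) p et * 2 powr (- s * real ls)) powr p)"
proof -
	interpret prob_space "OC :: (real^'n) measure" by (rule prob_space_OC)
	let ?nB = "card (Bk k :: ('n => nat) set)" and ?D = "CARD('n) * k"
	define ro where "ro = 2 powr (- s * real ls)"
	\<comment> \<open>Half of the decay rate \<open>et\<close> goes into the weights \<open>om\<close>,
	  the other half keeps the integrals of the weighted terms summable.\<close>
	define x0 where "x0 = 2 powr (- et / 2)"
	define Z where "Z = 2 / (1 - x0)"
	define T where "T = TT ?nB ?D * ro"
	define e where "e l m b = abs (c l m b - nc c l m b)" for l m b
	define E where "E l m = (SUM b:Bk k. e l m b)" for l m
	\<comment> \<open>Index 0 is not a level: it carries the error \<open>T\<close> of the truncated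
	  monomials.\<close>
	define om where "om n = (if n = 0 then 1 else x0 ^ rr n)" for n
	define a where "a n x = (if n = 0 then T else E n (cl sh n x))" for n and x :: "real^'n"
	have p0: "0 < p" "1 <= p" using p q by auto
	have "2 powr (- et / 2) < (2 powr 0 :: real)" using et by (intro powr_less_mono) auto
	hence x0: "0 < x0" "x0 < 1" by (auto simp: x0_def)
	have Z: "0 < Z" using x0 by (simp add: Z_def)
	have ro: "0 < ro" by (simp add: ro_def)
	have T0: "0 <= T" using ro by (simp add: T_def TT_def)
	have e0: "0 <= e l m b" for l m b by (simp add: e_def)
	have E0: "0 <= E l m" for l m unfolding E_def by (intro sum_nonneg e0)
	have om0: "0 < om n" for n using x0 by (simp add: om_def)
	have a0: "0 <= a n x" for n x using T0 E0 by (simp add: a_def)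
	have oms: "(SUM n:{..L}. om n) <= 1 + Z" for L
	proof -
		have "{..L} = insert 0 {1..L}" by auto
		hence "(SUM n:{..L}. om n) = 1 + (SUM n:{1..L}. x0 ^ rr n)" by (simp add: om_def)
		thus ?thesis using rr_sum[of x0 L] x0 by (simp add: Z_def)
	qed
	define h where "h n x = ennreal ((a n x / om n) powr p)" for n x
	have hm: "h n : mOC" for n
	proof (cases "n = 0")
		case False
		hence "h n = (%x. ennreal ((%m. (E n m / om n) powr p) (cl sh n x)))" by (auto simp: h_def a_def)
		thus ?thesis using cl_step_measurable(1)[OF sh, of "%m. (E n m / om n) powr p" n] by simp
	next
		case True
		hence "h n = (%_. ennreal (T powr p))" by (auto simp: h_def a_def om_def)
		thus ?thesis by simp
	qed
	define K where "K = real ?nB powr p * real ?nB * 2 ^ d"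
	have K0: "0 <= K" by (simp add: K_def)
	have hi: "(NI x. h n x) <= ennreal (ro powr p * (if n = 0 then TT ?nB ?D powr p else K * x0 ^ rr n))" for n
	proof (cases "n = 0")
		case True
		have "(NI x::real^'n. h n x) = ennreal (T powr p)" using True emeasure_space_1 by (simp add: h_def a_def om_def)
		thus ?thesis using True by (simp add: T_def powr_mult mult.commute)
	next
		case False
		hence n: "1 <= n" by simp
		have w: "om n = x0 ^ rr n" using False by (simp add: om_def)
		have "(NI x. h n x) = (NI x::real^'n. ennreal ((%m. (E n m / om n) powr p) (cl sh n x)))"
			using False by (simp add: h_def a_def)
		also have "... <= ennreal (hw n ^ CARD('n) * (SUM m:Mx n. (E n m / om n) powr p))" by (rule cl_step_measurable(2)[OF sh]) simp
		also have "... <= ennreal (ro powr p * (K * x0 ^ rr n))"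
		proof (rule ennreal_leI)
			have "(SUM m:Mx n. (E n m / om n) powr p) = (SUM m:Mx n. E n m powr p) / om n powr p"
				by (simp add: powr_divide E0 om0[THEN less_imp_le] sum_divide_distrib)
			also have "(SUM m:Mx n. E n m powr p) <= (SUM m:Mx n. real ?nB powr p * (SUM b:Bk k. e n m b powr p))"
				unfolding E_def by (intro sum_mono powr_sum_le) (use e0 p0 in auto)
			also have "... = real ?nB powr p * (SUM b:Bk k. SUM m:Mx n. e n m b powr p)"
				unfolding sum_distrib_left[symmetric] by (subst sum.swap) simp
			also have "... <= real ?nB powr p * (SUM b:(Bk k :: ('n => nat) set). 2 ^ (d * n) * (2 powr (- s * real ls) * 2 powr (- et * real (rr n))) powr p)"
				unfolding e_def by (intro mult_left_mono sum_mono level_error_sum[where c=c and l=n and p=p and et=et, OF dd n c[OF n] p et]) auto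
			also have "... = real ?nB powr p * real ?nB * 2 ^ (d * n) * (ro powr p * (x0 ^ rr n * x0 ^ rr n) powr p)"
			proof -
				have "2 powr (- et * real (rr n)) = x0 ^ rr n * x0 ^ rr n"
					unfolding x0_def powr_realpow[symmetric, OF powr_gt_zero[THEN iffD2, OF zero_neq_numeral[symmetric]]] powr_powr powr_add[symmetric] by simp
				thus ?thesis by (simp add: ro_def powr_mult)
			qed
			finally have "(SUM m:Mx n. (E n m / om n) powr p) <= real ?nB powr p * real ?nB * 2 ^ (d * n) * (ro powr p * (x0 ^ rr n * x0 ^ rr n) powr p) / om n powr p"
				by (simp add: divide_right_mono)
			also have "... = real ?nB powr p * real ?nB * 2 ^ (d * n) * (ro powr p * (x0 ^ rr n) powr p)"
				unfolding w using x0 by (simp add: powr_mult)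
			also have "... <= real ?nB powr p * real ?nB * 2 ^ (d * n) * (ro powr p * x0 ^ rr n)"
			proof -
				have "(x0 ^ rr n) powr p <= (x0 ^ rr n) powr 1" using x0 p0 by (intro powr_mono') (auto intro: power_le_one)
				thus ?thesis using x0 by (intro mult_left_mono) auto
			qed
			finally have "hw n ^ CARD('n) * (SUM m:Mx n. (E n m / om n) powr p) <= hw n ^ CARD('n) * (real ?nB powr p * real ?nB * 2 ^ (d * n) * (ro powr p * x0 ^ rr n))"
				using hw_pos[of n] by (intro mult_left_mono) auto
			also have "... = ro powr p * (K * x0 ^ rr n)"
				by (simp add: K_def hw_def dd power_divide power_mult[symmetric] mult.commute[of n])
			finally show "hw n ^ CARD('n) * (SUM m:Mx n. (E n m / om n) powr p) <= ro powr p * (K * x0 ^ rr n)" .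
		qed
		finally show ?thesis using False by simp
	qed
	define W where "W = TT ?nB ?D powr p + K * Z + 1"
	have W0: "0 < W" using K0 Z by (simp add: W_def add_nonneg_pos)
	define H where "H x = ennreal ((1 + Z) powr p) * (\<Sum>n. h n x)" for x
	have Hm: "H : mOC" unfolding H_def using hm by measurable
	have "(NI x. H x) = ennreal ((1 + Z) powr p) * (\<Sum>n. \<integral>\<^sup>+x. h n x \<partial>OC)"
		unfolding H_def using hm by (simp add: nn_integral_cmult nn_integral_suminf)
	also have "(\<Sum>n. \<integral>\<^sup>+x. h n x \<partial>OC) <= ennreal (ro powr p * W)"
	proof (rule suminf_le_const)
		fix N
		have "(SUM n<N. \<integral>\<^sup>+x. h n x \<partial>OC) <= (SUM n:{..N}. \<integral>\<^sup>+x. h n x \<partial>OC)" by (intro sum_mono2) auto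
		also have "... <= (SUM n:{..N}. ennreal (ro powr p * (if n = 0 then TT ?nB ?D powr p else K * x0 ^ rr n)))" by (intro sum_mono hi)
		also have "... = ennreal (SUM n:{..N}. ro powr p * (if n = 0 then TT ?nB ?D powr p else K * x0 ^ rr n))"
			using K0 x0 by (intro sum_ennreal) auto
		also have "... <= ennreal (ro powr p * W)"
		proof (rule ennreal_leI)
			have "{..N} = insert 0 {1..N}" by auto
			hence "(SUM n:{..N}. ro powr p * (if n = 0 then TT ?nB ?D powr p else K * x0 ^ rr n)) = ro powr p * (TT ?nB ?D powr p + K * (SUM n:{1..N}. x0 ^ rr n))"
				by (simp add: sum_distrib_left distrib_left)
			also have "... <= ro powr p * (TT ?nB ?D powr p + K * Z)"
				unfolding Z_def using x0 K0 by (intro mult_left_mono add_left_mono rr_sum) auto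
			also have "... <= ro powr p * W" unfolding W_def by (intro mult_left_mono) auto
			finally show "(SUM n:{..N}. ro powr p * (if n = 0 then TT ?nB ?D powr p else K * x0 ^ rr n)) <= ro powr p * W" .
		qed
		finally show "(SUM n<N. \<integral>\<^sup>+x. h n x \<partial>OC) <= ennreal (ro powr p * W)" .
	qed simp
	finally have "(NI x. H x) <= ennreal ((1 + Z) powr p) * ennreal (ro powr p * W)" by (simp add: mult_left_mono)
	also have "... = ennreal ((1 + Z) powr p * (ro powr p * W))" using W0 by (intro ennreal_mult[symmetric]) auto
	also have "(1 + Z) powr p * (ro powr p * W) = (((1 + Z) * W powr (1 / p)) * ro) powr p"
		using W0 p0 by (simp add: powr_mult powr_powr)
	also have "(1 + Z) * W powr (1 / p) = Cfin ?nB ?D p et" by (simp add: Cfin_def W_def Z_def x0_def K_def)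
	finally have HI: "(NI x. H x) <= ennreal ((Cfin ?nB ?D p et * ro) powr p)" .
	have "AE x in OC. ennreal (abs (f x - ideal k c (yc sh x)) powr p) <= H x"
		using r(2) AE_space
	proof eventually_elim
		case (elim x)
		hence x: "x : open_unit_cube" by simp
		let ?S = "%L. SUM l:{1..L}. SUM b:Bk k. c l (cl sh l x) b * mnm l b (yc sh x)"
		have b: "ennreal (abs (?S L - ideal k c (yc sh x)) powr p) <= H x" if L: "lm <= L" for L
		proof -
			have I: "{..L} = insert 0 {1..L}" by auto
			have "abs (?S L - ideal k c (yc sh x)) <= T + (SUM l:{1..L}. E l (cl sh l x))"
				using ideal_error[OF dd c yc_range[OF x sh] L] unfolding T_def TT_def ro_def E_def e_def cl_def by simp
			also have "... = (SUM n:{..L}. a n x)" unfolding I by (simp add: a_def)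
			finally have "abs (?S L - ideal k c (yc sh x)) powr p <= (SUM n:{..L}. a n x) powr p" using p0 by (intro powr_mono2) auto
			also have "... <= (1 + Z) powr p * (SUM n:{..L}. (a n x / om n) powr p)"
				by (rule weighted_powr_sum) (use om0 a0 oms p0 in auto)
			finally have "ennreal (abs (?S L - ideal k c (yc sh x)) powr p) <= ennreal ((1 + Z) powr p * (SUM n:{..L}. (a n x / om n) powr p))"
				by (rule ennreal_leI)
			also have "... = ennreal ((1 + Z) powr p) * (SUM n:{..L}. h n x)" unfolding h_def by (simp add: ennreal_mult sum_nonneg)
			also have "... <= H x" unfolding H_def by (intro mult_left_mono sum_le_suminf) auto
			finally show ?thesis .
		qed
		have lim: "(%n. ennreal (abs (?S (Suc (r n)) - ideal k c (yc sh x)) powr p)) ----> ennreal (abs (f x - ideal k c (yc sh x)) powr p)"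
			using elim(1) p0 by (intro tendsto_intros tendsto_ennrealI tendsto_powr') auto
		show ?case
		proof (rule LIMSEQ_le_const2[OF lim], intro exI[of _ lm] allI impI)
			fix n assume "lm <= n"
			hence "lm <= Suc (r n)" using seq_suble[OF r(1), of n] by simp
			thus "ennreal (abs (?S (Suc (r n)) - ideal k c (yc sh x)) powr p) <= H x" by (rule b)
		qed
	qed
	thus ?thesis using Hm HI unfolding ro_def by blast
qed

definition "Ctop nB D = TT nB D + real nB * (2 / (1 - 2 powr (- min 1 (- ka))))"

text \<open>\<open>ka < 0\<close> makes the threshold decay on the fine side as well, so the
  pointwise errors are dominated by a geometric series.\<close>

lemma shift_error_top:
	fixes c :: "nat => ('n::finite => nat) => ('n => nat) => real" and f :: "real^'n => real"
	assumes dd: "d = CARD('n)" and c: "!!l b. 1 <= l ==> b : Bk k ==> (SUM m:Mx l. abs (c l m b) powr q) <= 2 powr (real l * (real d - s * q))"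
		and ka: "ka < 0" and sh: "0 <= sh" "sh < 1"
		and r: "strict_mono r" "AE x in OC. (%n. SUM l:{1..Suc (r n)}. SUM b:Bk k. c l (cl sh l x) b * mnm l b (yc sh x)) ----> f x"
	shows "AE x in OC. abs (f x - ideal k c (yc sh x)) <= Ctop (card (Bk k :: ('n => nat) set)) (CARD('n) * k) * 2 powr (- s * real ls)"
	using r(2) AE_space
proof eventually_elim
	case (elim x)
	hence x: "x : open_unit_cube" by simp
	let ?nB = "card (Bk k :: ('n => nat) set)" and ?ro = "2 powr (- s * real ls)" and ?x = "2 powr (- min 1 (- ka))"
	let ?S = "%L. SUM l:{1..L}. SUM b:Bk k. c l (cl sh l x) b * mnm l b (yc sh x)"
	have "?x < 2 powr 0" using ka by (intro powr_less_mono) auto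
	hence x0: "0 <= ?x" "?x < 1" by auto
	have e: "abs (c l (cl sh l x) b - nc c l (cl sh l x) b) <= ?ro * ?x ^ rr l" if l: "1 <= l" and b: "b : Bk k" for l b
	proof -
		have m: "cl sh l x : Mx l" using cl_cells(1)[OF x sh] cells_Mx by blast
		have "abs (c l (cl sh l x) b - nc c l (cl sh l x) b) <= dl l"
		proof (cases "l <= ls")
			case False
			thus ?thesis by (intro nc_err_up[where c=c and b=b and M="Mx l", OF _ finite_Mx c[OF l b] m]) auto
		qed (rule nc_err(2))
		also have "... <= 2 powr (- s * real ls + - min 1 (- ka) * real (rr l))"
		proof -
			have "min 1 (- ka) * real (rr l) <= 1 * real (rr l)" "min 1 (- ka) * real (rr l) <= (- ka) * real (rr l)" by (intro mult_right_mono; simp)+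
			thus ?thesis unfolding dl_def by (intro powr_mono) auto
		qed
		also have "... = ?ro * ?x ^ rr l" by (simp only: powr_add powr_powr[symmetric] powr_realpow[OF powr_gt_zero[THEN iffD2, OF zero_neq_numeral[symmetric]]])
		finally show ?thesis .
	qed
	have b: "abs (?S L - ideal k c (yc sh x)) <= Ctop ?nB (CARD('n) * k) * ?ro" if L: "lm <= L" for L
	proof -
		have "abs (?S L - ideal k c (yc sh x)) <= TT ?nB (CARD('n) * k) * ?ro + (SUM l:{1..L}. SUM b:Bk k. abs (c l (cl sh l x) b - nc c l (cl sh l x) b))"
			using ideal_error[OF dd c yc_range[OF x sh] L] unfolding TT_def cl_def by simp
		also have "... <= TT ?nB (CARD('n) * k) * ?ro + (SUM l:{1..L}. SUM b:(Bk k :: ('n => nat) set). ?ro * ?x ^ rr l)"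
			by (intro add_left_mono sum_mono e) auto
		also have "... = TT ?nB (CARD('n) * k) * ?ro + real ?nB * ?ro * (SUM l:{1..L}. ?x ^ rr l)" by (simp add: sum_distrib_left mult.assoc)
		also have "... <= TT ?nB (CARD('n) * k) * ?ro + real ?nB * ?ro * (2 / (1 - ?x))" by (intro add_left_mono mult_left_mono rr_sum x0) auto
		also have "... = Ctop ?nB (CARD('n) * k) * ?ro" unfolding Ctop_def by (simp only: distrib_right mult.assoc mult.commute[of ?ro])
		finally show ?thesis .
	qed
	have lim: "(%n. abs (?S (Suc (r n)) - ideal k c (yc sh x))) ----> abs (f x - ideal k c (yc sh x))"
		using elim(1) by (intro tendsto_intros)
	show ?case
	proof (rule LIMSEQ_le_const2[OF lim], intro exI[of _ lm] allI impI)
		fix n assume "lm <= n"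
		hence "lm <= Suc (r n)" using seq_suble[OF r(1), of n] by simp
		thus "abs (?S (Suc (r n)) - ideal k c (yc sh x)) <= Ctop ?nB (CARD('n) * k) * ?ro" by (rule b)
	qed
qed

end

section \<open>Exponents and medians of shifted networks\<close>

text \<open>On \<open>2^(d*l)\<close> cells a bound with exponent \<open>q\<close> implies one with
  a smaller exponent \<open>p\<close>: split at the natural size \<open>2 powr (- s*l)\<close>. The
  resulting factor 2 is removed by halving the coefficients.\<close>

lemma exponent_reduction:
	fixes x :: "('n::finite => nat) => real"
	assumes x: "(SUM m:Mx l. abs (x m) powr q) <= 2 powr (real l * (real CARD('n) - s * q))" and p: "1 <= p" "p <= q"
	shows "(SUM m:Mx l. abs (x m / 2) powr p) <= 2 powr (real l * (real CARD('n) - s * p))"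
proof -
	let ?L = "2 powr (- s * real l)" and ?d = "real CARD('n)"
	have t: "t powr p <= ?L powr p + ?L powr (p - q) * t powr q" if t: "0 <= t" for t :: real
	proof (cases "t <= ?L")
		case True
		hence "t powr p <= ?L powr p" using t p by (intro powr_mono2) auto
		thus ?thesis by (simp add: add_increasing2)
	next
		case False
		hence tL: "?L <= t" "0 < t" using t by (auto intro: less_le_trans[of 0 ?L])
		have "t powr p = t powr (p - q) * t powr q" using tL by (simp add: powr_add[symmetric])
		also have "... <= ?L powr (p - q) * t powr q" using tL p by (intro mult_right_mono powr_mono2') auto
		finally show ?thesis by (simp add: add_increasing)
	qed
	have c: "(2 :: real) ^ (CARD('n) * l) = 2 powr (?d * real l)" by (simp add: powr_realpow[symmetric])
	have "(SUM m:Mx l. abs (x m) powr p) <= (SUM m:(Mx l :: ('n => nat) set). ?L powr p + ?L powr (p - q) * abs (x m) powr q)" by (intro sum_mono t) simp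
	also have "... = 2 ^ (CARD('n) * l) * ?L powr p + ?L powr (p - q) * (SUM m:(Mx l :: ('n => nat) set). abs (x m) powr q)"
		by (simp add: sum.distrib sum_distrib_left[symmetric] card_Mx)
	also have "... <= 2 ^ (CARD('n) * l) * ?L powr p + ?L powr (p - q) * 2 powr (real l * (?d - s * q))"
		by (intro add_left_mono mult_left_mono x) simp
	also have "2 ^ (CARD('n) * l) * ?L powr p = 2 powr (real l * (?d - s * p))"
		unfolding c by (simp add: powr_powr powr_add[symmetric] algebra_simps)
	also have "?L powr (p - q) * 2 powr (real l * (?d - s * q)) = 2 powr (real l * (?d - s * p))"
		by (simp add: powr_powr powr_add[symmetric] algebra_simps)
	finally have S: "(SUM m:Mx l. abs (x m) powr p) <= 2 * 2 powr (real l * (?d - s * p))" by simp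
	have "(2 :: real) powr 1 <= 2 powr p" using p by (intro powr_mono) auto
	hence 2: "2 <= (2 :: real) powr p" by simp
	have "(SUM m:Mx l. abs (x m / 2) powr p) = (SUM m:(Mx l :: ('n => nat) set). abs (x m) powr p) / 2 powr p"
		by (simp add: abs_divide powr_divide sum_divide_distrib)
	also have "... <= (2 * 2 powr (real l * (?d - s * p))) / 2 powr p" by (intro divide_right_mono S) simp
	also have "... <= (2 powr p * 2 powr (real l * (?d - s * p))) / 2 powr p" by (intro divide_right_mono mult_right_mono 2) auto
	finally show ?thesis by simp
qed

text \<open>The exponent \<open>q'\<close> is \<open>p\<close> if \<open>p < q\<close> and
  \<open>q\<close> otherwise, except that for \<open>p = q = \<infinity>\<close> it is a finite
  number with \<open>d < s*q'\<close>. This leaves only the case \<open>q' <= p\<close> with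
  \<open>q'\<close> finite, and the division by \<open>C*N\<close> makes the coefficient bound free
  of constants.\<close>

lemma normalized_coefficients:
	assumes s: "0 < s" and p: "1 <= p" and q: "1 <= q" and pq: "inv_exp q - inv_exp p < s / real CARD('n::finite)"
	shows "EX q' C. 1 <= q' & 0 < C & (if p = \<infinity> then real CARD('n) < s * q' else q' <= enn2real p & real CARD('n) / q' - real CARD('n) / enn2real p < s) &
		(ALL (f :: real^'n => real) D N sh. (ALL ga:multi_idx (sob_order s). weak_deriv ga f (D ga)) -->
			sob_expr s q f D <= ennreal N --> 0 < N --> 0 <= sh --> sh < 1 -->
			(ALL l b. 1 <= l --> b : Bk (sob_order s) --> (SUM m:Mx l. abs (cf (sob_order s) sh f l m b / (C * N)) powr q') <= 2 powr (real l * (real CARD('n) - s * q'))) &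
			(EX r. strict_mono r & (AE x in OC. (%n. SUM l:{1..Suc (r n)}. SUM b:Bk (sob_order s).
					cf (sob_order s) sh f l (cl sh l x) b / (C * N) * mnm l b (yc sh x)) ----> f x / (C * N))))"
proof -
	let ?k = "sob_order s" and ?d = "real CARD('n)"
	have d: "0 < ?d" by simp
	define q0 where "q0 = (if q = \<infinity> then (if p = \<infinity> then max 1 (2 * ?d / s) else enn2real p) else enn2real q)"
	have real1: "1 <= enn2real t" if "1 <= t" "t ~= \<infinity>" for t :: ennreal
		using that by (cases t) (auto simp: ennreal_1[symmetric] simp del: ennreal_1)
	have q0: "1 <= q0" "q = \<infinity> \<or> q0 = enn2real q" using real1[OF p] real1[OF q] by (auto simp: q0_def)
	obtain C where C: "0 < C" "!!(f :: real^'n => real) D N sh. (ALL ga:multi_idx ?k. weak_deriv ga f (D ga)) ==>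
		sob_expr s q f D <= ennreal N ==> 0 < N ==> 0 <= sh ==> sh < 1 ==>
		(ALL l>=1. ALL be:Bk ?k. (SUM m:cells sh l. abs (cf ?k sh f l m be) powr q0) <= (C * N) powr q0 * 2 powr (real l * (?d - s * q0))) &
		(EX r. strict_mono r & (AE x in OC. (%n. SUM l:{1..Suc (r n)}. SUM be:Bk ?k. cf ?k sh f l (cl sh l x) be * mnm l be (yc sh x)) ----> f x))"
		using sobolev_coefficients[OF s q q0, where 'n='n] by blast
	have base: "(SUM m:Mx l. abs (cf ?k sh f l m b / (C * N)) powr q0) <= 2 powr (real l * (?d - s * q0))"
		if a: "ALL ga:multi_idx ?k. weak_deriv ga f (D ga)" "sob_expr s q f D <= ennreal N" "0 < N" "0 <= sh" "sh < 1" "1 <= l" "b : Bk ?k"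
		for f :: "real^'n => real" and D N sh l b
	proof -
		have CN: "0 < C * N" using C(1) a(3) by simp
		have "(SUM m:Mx l. abs (cf ?k sh f l m b / (C * N)) powr q0) = (SUM m:cells sh l. abs (cf ?k sh f l m b / (C * N)) powr q0)"
			by (rule sum.mono_neutral_right) (auto simp: cells_Mx cf_def)
		also have "... = (SUM m:cells sh l. abs (cf ?k sh f l m b) powr q0) / (C * N) powr q0"
			using CN by (simp add: abs_divide powr_divide sum_divide_distrib)
		also have "... <= ((C * N) powr q0 * 2 powr (real l * (?d - s * q0))) / (C * N) powr q0"
			using C(2)[OF a(1-5)] a(6,7) by (intro divide_right_mono) auto
		also have "... = 2 powr (real l * (?d - s * q0))" using C(1) a(3) by simp
		finally show ?thesis .
	qed
	have conv: "EX r. strict_mono r & (AE x in OC. (%n. SUM l:{1..Suc (r n)}. SUM b:Bk ?k. cf ?k sh f l (cl sh l x) b / A * mnm l b (yc sh x)) ----> f x / A)"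
		if a: "ALL ga:multi_idx ?k. weak_deriv ga f (D ga)" "sob_expr s q f D <= ennreal N" "0 < N" "0 <= sh" "sh < 1" and A: "0 < A"
		for f :: "real^'n => real" and D N sh A
	proof -
		obtain r where r: "strict_mono r" "AE x in OC. (%n. SUM l:{1..Suc (r n)}. SUM b:Bk ?k. cf ?k sh f l (cl sh l x) b * mnm l b (yc sh x)) ----> f x"
			using C(2)[OF a] by blast
		have "AE x in OC. (%n. SUM l:{1..Suc (r n)}. SUM b:Bk ?k. cf ?k sh f l (cl sh l x) b / A * mnm l b (yc sh x)) ----> f x / A"
			using r(2)
		proof eventually_elim
			case (elim x)
			hence "(%n. (SUM l:{1..Suc (r n)}. SUM b:Bk ?k. cf ?k sh f l (cl sh l x) b * mnm l b (yc sh x)) / A) ----> f x / A"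
				using A by (intro tendsto_intros) auto
			thus ?case by (simp only: sum_divide_distrib times_divide_eq_left)
		qed
		with r(1) show ?thesis by blast
	qed
	show ?thesis
	proof (cases "p ~= \<infinity> & enn2real p < q0")
		case True
		hence qf: "q ~= \<infinity>" "q0 = enn2real q" by (auto simp: q0_def split: if_splits)
		have p1: "1 <= enn2real p" using real1[OF p] True by simp
		have red: "(SUM m:Mx l. abs (cf ?k sh f l m b / (2 * C * N)) powr enn2real p) <= 2 powr (real l * (?d - s * enn2real p))"
			if a: "ALL ga:multi_idx ?k. weak_deriv ga f (D ga)" "sob_expr s q f D <= ennreal N" "0 < N" "0 <= sh" "sh < 1" "1 <= l" "b : Bk ?k"
			for f :: "real^'n => real" and D N sh l b
		proof -
			have "(SUM m:Mx l. abs (cf ?k sh f l m b / (C * N) / 2) powr enn2real p) <= 2 powr (real l * (?d - s * enn2real p))"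
				by (rule exponent_reduction[OF base[OF a] p1]) (use True in simp)
			thus ?thesis by (simp add: mult.assoc mult.commute[of 2])
		qed
		show ?thesis
			apply (rule exI[of _ "enn2real p"], rule exI[of _ "2 * C"])
			apply (intro conjI allI impI)
			subgoal using p1 .
			subgoal using C(1) by simp
			subgoal using True s by simp
			subgoal by (rule red)
			subgoal for f D N sh by (rule conv) (use C(1) in auto)
			done
	next
		case False
		have cond: "if p = \<infinity> then ?d < s * q0 else q0 <= enn2real p & ?d / q0 - ?d / enn2real p < s"
		proof (cases "q = \<infinity>")
			case True
			have "?d < s * q0" if "p = \<infinity>"
			proof -
				have "2 * ?d / s <= q0" using that True by (simp add: q0_def)
				hence "2 * ?d <= s * q0" using s by (simp add: field_simps)
				thus ?thesis using d by linarith
			qed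
			thus ?thesis using True s by (auto simp: q0_def)
		next
			case qf: False
			hence qe: "inv_exp q = 1 / q0" by (simp add: inv_exp_def q0_def)
			have "?d * (1 / q0 - inv_exp p) < s" using pq d unfolding qe by (simp add: field_simps)
			hence "?d / q0 - ?d * inv_exp p < s" by (simp add: right_diff_distrib)
			thus ?thesis using False q0(1) by (auto simp: inv_exp_def field_simps)
		qed
		show ?thesis
			apply (rule exI[of _ q0], rule exI[of _ C])
			apply (intro conjI allI impI)
			subgoal using q0(1) .
			subgoal using C(1) .
			subgoal using cond .
			subgoal by (rule base)
			subgoal for f D N sh by (rule conv) (use C(1) in auto)
			done
	qed
qed

text \<open>For \<open>p > q\<close> the two conditions say that \<open>ka\<close> lies between
  \<open>d/q - s\<close> and \<open>s*q / (p - q)\<close>, and this interval is nonempty exactly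
  when \<open>d/q - d/p < s\<close>. For \<open>p = q\<close> the second condition is automatic and
  \<open>ka = d\<close> works.\<close>

lemma kappa_exists:
	assumes s: "0 < s" and q: "1 <= q" "q <= p" and c: "d / q - d / p < s" and d: "0 < (d :: real)"
	shows "EX ka. 0 < q * ka + s * q - d & 0 < s * q - ka * (p - q)"
proof (cases "p = q")
	case True
	have "d <= q * d" using mult_right_mono[OF q(1), of d] d by simp
	moreover have "0 < s * q" using s q by simp
	ultimately show ?thesis using True by (intro exI[of _ d]) auto
next
	case False
	hence pq: "0 < p - q" using q by simp
	have "(d / q - s) * (p - q) < s * q"
	proof -
		have "(d / q - d / p) * p < s * p" using c q by (intro mult_strict_right_mono) auto
		hence "d / q * p - d < s * p" using q by (simp add: left_diff_distrib)
		moreover have "(d / q - s) * (p - q) = d / q * p - d - s * p + s * q" using q by (simp add: field_simps)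
		ultimately show ?thesis by linarith
	qed
	hence "d / q - s < s * q / (p - q)" using pq by (simp add: field_simps)
	then obtain ka where ka: "d / q - s < ka" "ka < s * q / (p - q)" using dense by blast
	have "q * (d / q - s) < q * ka" using ka(1) q by (intro mult_strict_left_mono) auto
	moreover have "q * (d / q - s) = d - s * q" using q by (simp add: right_diff_distrib)
	moreover have "ka * (p - q) < s * q" using ka(2) pq by (simp add: field_simps)
	ultimately show ?thesis by (intro exI[of _ ka]) auto
qed

text \<open>\<open>max M h = relu (M - h) + h\<close>; one value is merged per layer while the
  inputs are carried along.\<close>

lemma cmp_max:
	assumes I: "finite I" "I ~= {}" and F: "finite F" and h: "!!i. i : I ==> h i : affs X F"
	shows "cmp X (3 + 2 * card F * card I) (card I) F {%x. Max ((%i. h i x) ` I)}"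
	using I h
proof (induction I rule: finite_ne_induct)
	case (singleton i)
	have "cmp X (2 * card {h i} + 0) 1 F {h i}"
	proof -
		have "cmp X (2 * card {h i}) 1 {h i} {h i}" by (rule cmp_id) simp
		thus ?thesis using cmp_pre[of X _ 1 "{h i}" "{h i}" F] singleton by simp
	qed
	note st = this
	have e: "{%x. Max ((%i. h i x) ` {i})} = {h i}" and c: "card {i} = 1" by simp_all
	show ?case unfolding e c by (rule cmp_mono_w[OF st]) simp
next
	case (insert i I)
	let ?M = "%x. Max ((%i. h i x) ` I)" and ?N = "%x. Max ((%i. h i x) ` insert i I)"
	have IH: "cmp X (3 + 2 * card F * card I) (card I) F {?M}" using insert by blast
	have e: "?N x = relu (?M x - h i x) + (relu (h i x) - relu (- h i x))" for x
	proof -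
		have "?N x = max (h i x) (?M x)" using insert.hyps by simp
		thus ?thesis unfolding relu_id by (simp add: relu_def max_def)
	qed
	have hi: "h i : affs X ({?M} Un F)" by (rule affs_mono[OF insert.prems]) auto
	have M: "?M : affs X ({?M} Un F)" by (intro affs.base) simp
	let ?u = "%j::nat. if j = 0 then (%x. ?M x - h i x) else if j = 1 then h i else (%x. - h i x)"
	have st: "cmp X 3 1 ({?M} Un F) {?N}"
	proof (rule cmp_layer[where I="{..<3::nat}" and u="?u"])
		show "?u j : affs X ({?M} Un F)" if "j : {..<3}" for j
			using affs_diff[OF M hi] hi affs_uminus[OF hi] by simp
		let ?G = "(%j x. relu (?u j x)) ` {..<3::nat}"
		have b: "(%x. relu (?u j x)) : affs X ?G" if "j < 3" for j by (rule affs.base) (use that in blast)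
		have "(%x. relu (?u 0 x) + (relu (?u 1 x) - relu (?u 2 x))) : affs X ?G"
			by (rule affs.add[OF b affs_diff[OF b b]]) auto
		thus "{?N} \<subseteq> affs X ?G" unfolding e by simp
	qed auto
	have "cmp X (3 + 2 * card F * card (insert i I)) (card I + 1) F {?N}"
		by (rule cmp_seq_keep[OF IH st F order_refl]) (use insert.hyps in auto)
	thus ?case using insert.hyps by simp
qed

lemma cmp_min:
	assumes I: "finite I" "I ~= {}" and F: "finite F" and h: "!!i. i : I ==> h i : affs X F"
	shows "cmp X (3 + 2 * card F * card I) (card I) F {%x. Min ((%i. h i x) ` I)}"
proof -
	let ?M = "%x. Max ((%i. - h i x) ` I)"
	have e: "Min ((%i. h i x) ` I) = - ?M x" for x
	proof (rule Min_eqI)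
		show "finite ((%i. h i x) ` I)" using I by simp
		show "- ?M x <= y" if "y : (%i. h i x) ` I" for y
		proof -
			obtain i where i: "i : I" "y = h i x" using \<open>y : _\<close> by blast
			hence "- h i x <= ?M x" using I by (intro Max_ge) auto
			thus ?thesis using i by linarith
		qed
		have "?M x : (%i. - h i x) ` I" using I by (intro Max_in) auto
		thus "- ?M x : (%i. h i x) ` I" by auto
	qed
	have "cmp X (3 + 2 * card F * card I) (card I) F {?M}" by (rule cmp_max[OF I F]) (intro affs_uminus h)
	thus ?thesis
	proof (rule cmp_post)
		have "?M : affs X {?M}" by (intro affs.base) simp
		thus "{%x. Min ((%i. h i x) ` I)} \<subseteq> affs X {?M}" unfolding e using affs_uminus by blast
	qed
qed

section \<open>Medians from maxima and minima\<close>

definition subs :: "nat => nat set set" where "subs d = {S. S \<subseteq> {..<2 * d + 1} & card S = d + 1}"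
text \<open>For \<open>2*d + 1\<close> values this is the median: the minimum over a set of
  \<open>d + 1\<close> of them is largest for the \<open>d + 1\<close> largest values. The formula
  uses only max and min, hence is a network.\<close>

definition med :: "nat => (nat => real) => real" where "med d a = Max ((%S. Min (a ` S)) ` subs d)"
definition mw :: "nat => nat" where
	"mw d = card (subs d) * (3 + 2 * (2 * d + 1) * (d + 1)) + (3 + 2 * card (subs d) * card (subs d))"

lemma subs_props: "finite (subs d)" "subs d ~= {}" "S : subs d ==> finite S" "S : subs d ==> S ~= {}"
proof -
	show "finite (subs d)" by (rule finite_subset[of _ "Pow {..<2 * d + 1}"]) (auto simp: subs_def)
	have "{..<d + 1} : subs d" by (auto simp: subs_def)
	thus "subs d ~= {}" by blast
	show "S : subs d ==> finite S" by (auto simp: subs_def intro: finite_subset)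
	show "S : subs d ==> S ~= {}" by (auto simp: subs_def)
qed

lemma cmp_med:
	fixes g :: "nat => 'x => real"
	shows "cmp UNIV (mw d) (d + 1 + card (subs d)) (g ` {..<2 * d + 1}) {%x. med d (%j. g j x)}"
proof -
	let ?F = "g ` {..<2 * d + 1}" and ?s = "card (subs d)"
	let ?m = "%S x. Min ((%j. g j x) ` S)"
	have cF: "card ?F <= 2 * d + 1" using card_image_le[of "{..<2 * d + 1}" g] by simp
	have 1: "cmp UNIV (3 + 2 * (2 * d + 1) * (d + 1)) (d + 1) ?F {?m S}" if S: "S : subs d" for S
	proof -
		have st: "cmp UNIV (3 + 2 * card ?F * card S) (card S) ?F {?m S}"
		proof (rule cmp_min[OF subs_props(3)[OF S] subs_props(4)[OF S]])
			show "g i : affs UNIV ?F" if "i : S" for i using that S by (intro affs.base imageI) (auto simp: subs_def)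
		qed simp
		have cS: "card S = d + 1" using S by (simp add: subs_def)
		show ?thesis by (rule cmp_mono_w[OF st[unfolded cS]]) (intro add_mono mult_le_mono cF order_refl)
	qed
	have A: "cmp UNIV (?s * (3 + 2 * (2 * d + 1) * (d + 1))) (d + 1) ?F (\<Union>S\<in>subs d. {?m S})"
		by (rule cmp_Union[OF subs_props(1) 1])
	let ?G = "\<Union>S\<in>subs d. {?m S}"
	have "?G = ?m ` subs d" by blast
	hence G: "finite ?G" "card ?G <= ?s" using card_image_le[OF subs_props(1), of ?m] subs_props(1) by auto
	have "cmp UNIV (3 + 2 * card ?G * ?s) ?s ?G {%x. Max ((%S. ?m S x) ` subs d)}"

	proof (rule cmp_max[OF subs_props(1,2) G(1)])
		show "?m S : affs UNIV ?G" if "S : subs d" for S by (rule affs.base) (use that in blast)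
	qed
	hence B: "cmp UNIV (3 + 2 * ?s * ?s) ?s ?G {%x. Max ((%S. ?m S x) ` subs d)}"
		by (rule cmp_mono_w) (use G(2) in "auto intro: mult_le_mono")
	show ?thesis unfolding med_def mw_def by (rule cmp_seq[OF cmp_mono_w[OF A] cmp_mono_w[OF B]]) auto
qed

text \<open>Some set of \<open>d + 1\<close> indices consists of correct values, which bounds the
  median from below; every set of \<open>d + 1\<close> contains a correct value, which bounds it
  from above.\<close>

lemma med_error:
	assumes bad: "card {j : {..<2 * d + 1}. a j ~= b j} <= d" and M: "!!j. j < 2 * d + 1 ==> abs (t - b j) <= M"
	shows "abs (t - med d a) <= M"
proof -
	let ?J = "{..<2 * d + 1}"
	let ?B = "{j : ?J. a j ~= b j}" and ?G = "{j : ?J. a j = b j}"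
	have near: "abs (t - a j) <= M" if "j : ?G" for j using that M[of j] by simp
	have "?B Un ?G = ?J" "?B Int ?G = {}" by blast+
	hence "card ?B + card ?G = card ?J" using card_Un_disjoint[of ?B ?G] by (simp del: Un_Int_eq)
	hence "d + 1 <= card ?G" using bad by simp
	then obtain S0 where S0: "S0 \<subseteq> ?G" "card S0 = d + 1" by (rule obtain_subset_with_card_n)
	hence S0': "S0 : subs d" by (auto simp: subs_def)
	have "Min (a ` S0) : a ` S0" using subs_props(3,4)[OF S0'] by (intro Min_in) auto
	then obtain j where j: "j : S0" "Min (a ` S0) = a j" by blast
	have "Min (a ` S0) <= med d a" unfolding med_def using S0' subs_props(1) by (intro Max_ge) auto
	hence lo: "t - M <= med d a" using near[of j] S0(1) j by (auto simp: abs_le_iff)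
	have "med d a : (%S. Min (a ` S)) ` subs d" unfolding med_def using subs_props(1,2) by (intro Max_in) auto
	then obtain S where S: "S : subs d" "med d a = Min (a ` S)" by blast
	have "S Int ?G ~= {}"
	proof
		assume "S Int ?G = {}"
		hence "S \<subseteq> ?B" using S(1) by (auto simp: subs_def)
		hence "card S <= card ?B" by (rule card_mono[rotated]) simp
		thus False using bad S(1) by (simp add: subs_def)
	qed
	then obtain i where i: "i : S" "i : ?G" by blast
	have "Min (a ` S) <= a i" using subs_props(3)[OF S(1)] i(1) by (intro Min_le) auto
	hence "med d a <= t + M" using near[OF i(2)] S(2) by (auto simp: abs_le_iff)
	with lo show ?thesis by (simp add: abs_le_iff)
qed

lemma shift_arith: "0 < P ==> P * (2 * A * ((x + a / P) / 2) - 2 * A * ((x + b / P) / 2)) = A * (a - b)" for P :: real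
	by (simp add: field_simps)

lemma abs_scale_less: "0 < P ==> abs t < 1 / P ==> abs (P * t) < 1" for P :: real
	by (simp add: abs_mult field_simps)

text \<open>In each coordinate at most one shift is bad. Let \<open>P = 2*d + 1\<close>. Two bad
  shifts \<open>j\<close>, \<open>j'\<close> have fractional parts closer than \<open>1 / P\<close>,
  while \<open>P\<close> times their difference is an integer congruent to
  \<open>2^(N-1) * (j - j')\<close> modulo \<open>P\<close>. That integer is therefore 0, and
  \<open>P\<close> divides \<open>j - j'\<close> because \<open>P\<close> is odd.\<close>

lemma bad_shifts:
	fixes x :: "real^'n::finite"
	assumes x: "x : open_unit_cube" and N: "1 <= N"
	shows "card {j : {..<2 * CARD('n) + 1}. ~ (ALL i. good N (1 / real (2 * CARD('n) + 1)) (yc (real j / real (2 * CARD('n) + 1)) x i))} <= CARD('n)"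
proof -
	let ?P = "2 * CARD('n) + 1"
	let ?B = "%i. {j : {..<?P}. ~ good N (1 / real ?P) (yc (real j / real ?P) x i)}"
	have one: "card (?B i) <= 1" for i
	proof -
		have "j = j'" if j: "j : ?B i" "j' : ?B i" for j j'
		proof -
			let ?y = "%j. 2 ^ N * yc (real j / real ?P) x i"
			have fr: "1 - 1 / real ?P < frac (?y j)" if "j : ?B i" for j
			proof -
				have "real j / real ?P < 1" using that by simp
				thus ?thesis using that yc_range[OF x, of "real j / real ?P" i] by (auto simp: good_def)
			qed
			have pw: "(2 :: real) ^ N = 2 * 2 ^ (N - 1)" using N by (cases N) auto
			have yd: "real ?P * (?y j - ?y j') = 2 ^ (N - 1) * (real j - real j')"
				unfolding yc_def pw by (rule shift_arith) simp
			let ?z = "floor (?y j) - floor (?y j')"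
			have sp: "?y j - ?y j' = of_int ?z + (frac (?y j) - frac (?y j'))" by (simp add: frac_def)
			let ?D = "2 ^ (N - 1) * (int j - int j')"
			have eq: "real ?P * (frac (?y j) - frac (?y j')) = of_int (?D - int ?P * ?z)"
				using yd unfolding sp by (simp add: distrib_left)
			have "abs (frac (?y j) - frac (?y j')) < 1 / real ?P" using fr[OF j(1)] fr[OF j(2)] frac_lt_1[of "?y j"] frac_lt_1[of "?y j'"] by linarith
			hence "abs (real ?P * (frac (?y j) - frac (?y j'))) < 1" by (intro abs_scale_less) simp_all
			hence "?D - int ?P * ?z = 0" unfolding eq by (metis of_int_abs of_int_less_1_iff zabs_less_one_iff)
			hence "int ?P dvd ?D" by (metis diff_eq_diff_eq diff_self dvd_triv_left eq_iff_diff_eq_0)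
			moreover have "coprime (int ?P) (2 ^ (N - 1))" by simp
			ultimately have dv: "int ?P dvd int j - int j'" by (simp add: coprime_dvd_mult_right_iff)
			have "abs (int j - int j') < int ?P" using j by auto
			hence "int j - int j' = 0" using dv zdvd_imp_le[of "int ?P" "abs (int j - int j')"] by auto
			thus ?thesis by simp
		qed
		thus ?thesis by (intro card_le_Suc0_iff_eq[THEN iffD2, unfolded One_nat_def[symmetric]]) auto
	qed
	have "{j : {..<?P}. ~ (ALL i. good N (1 / real ?P) (yc (real j / real ?P) x i))} = (\<Union>i. ?B i)" by blast
	moreover have "card (\<Union>i. ?B i) <= (SUM i:(UNIV :: 'n set). card (?B i))" by (rule card_UN_le) simp
	moreover have "(SUM i:(UNIV :: 'n set). card (?B i)) <= (SUM i:(UNIV :: 'n set). 1)" by (intro sum_mono one)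
	ultimately show ?thesis by simp
qed

lemma affs_continuous: "g : affs UNIV F ==> (!!f. f : F ==> continuous_on UNIV f) ==> continuous_on UNIV (g :: 'x::topological_space => real)"
proof (induction rule: affs.induct)
	case (cong f g)
	hence "g = f" by (simp add: fun_eq_iff)
	thus ?case using cong by simp
qed (auto intro: continuous_intros)

text \<open>Provides the measurability of the network that the essential supremum requires.\<close>

lemma cmp_continuous: "cmp UNIV w n F G ==> (!!f. f : F ==> continuous_on UNIV f) ==> g : G ==> continuous_on UNIV (g :: 'x::topological_space => real)"
proof (induction n arbitrary: F)
	case 0
	thus ?case using affs_continuous[of g F] by auto
next
	case (Suc n)
	then obtain U where U: "ALL u:U. EX v:affs UNIV F. ALL x. u x = relu (v x)" "cmp UNIV w n U G" by auto
	have "continuous_on UNIV u" if uU: "u : U" for u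
	proof -
		obtain v where v: "v : affs UNIV F" "ALL x. u x = relu (v x)" using bspec[OF U(1) uU] by blast
		have "continuous_on UNIV v" by (rule affs_continuous[OF v(1) Suc.prems(2)])
		moreover have "u = (%x. max (v x) 0)" using v(2) by (auto simp: relu_def)
		ultimately show ?thesis by (auto intro: continuous_intros)
	qed
	thus ?case using Suc.IH[OF U(2)] Suc.prems(3) by blast
qed

section \<open>Assembly\<close>

text \<open>The analysis takes place on the open cube, while the norms are over the closed one; the
  boundary is a null set.\<close>

lemma AE_boundary: "AE x in lebesgue. x : unit_cube --> x : (open_unit_cube :: (real^'n::finite) set)"
proof -
	have U: "(unit_cube :: (real^'n) set) = cbox 0 1" by (auto simp: unit_cube_def mem_box_cart)
	have "negligible (cbox 0 1 - box 0 (1 :: real^'n))" by (rule negligible_frontier_interval)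
	hence "AE x in lebesgue. x ~: cbox 0 1 - box 0 (1 :: real^'n)" by (intro AE_not_in) (simp add: negligible_iff_null_sets)
	thus ?thesis by eventually_elim (auto simp: U open_unit_cube_box)
qed

lemma AE_unit_cube:
	assumes "AE x in (OC :: (real^'n::finite) measure). P x" shows "AE x in lebesgue_on unit_cube. P x"
proof -
	have "AE x in lebesgue. x : (open_unit_cube :: (real^'n) set) --> P x" using assms by (subst (asm) AE_restrict_space_iff) auto
	hence "AE x in lebesgue. x : (unit_cube :: (real^'n) set) --> P x" using AE_boundary by eventually_elim auto
	thus ?thesis using unit_cube_sets by (subst AE_restrict_space_iff) auto
qed

lemma nn_integral_unit_cube_le:
	assumes "AE x in (OC :: (real^'n::finite) measure). h x <= K x"
	shows "(\<integral>\<^sup>+x. h x \<partial>lebesgue_on unit_cube) <= (NI x::real^'n. K x)"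
proof -
	have a: "AE x in lebesgue. x : (open_unit_cube :: (real^'n) set) --> h x <= K x" using assms by (subst (asm) AE_restrict_space_iff) auto
	have "(\<integral>\<^sup>+x. h x \<partial>lebesgue_on (unit_cube :: (real^'n) set)) = (\<integral>\<^sup>+x. h x * indicator unit_cube x \<partial>lebesgue)"
		by (rule nn_integral_restrict_space) (simp add: unit_cube_sets)
	also have "... <= (\<integral>\<^sup>+x. K x * indicator open_unit_cube x \<partial>lebesgue)"
	proof (rule nn_integral_mono_AE)
		show "AE x in lebesgue. h x * indicator unit_cube x <= K x * indicator open_unit_cube x"
			using a AE_boundary by eventually_elim (auto simp: indicator_def)
	qed
	also have "... = (NI x::real^'n. K x)" by (rule nn_integral_restrict_space[symmetric]) simp
	finally show ?thesis .
qed

lemma dyadic_bracket: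
	assumes "0 < C" "C <= (W :: nat)" shows "EX u. C * 2 ^ u <= W & W < C * 2 ^ Suc u"
proof -
	have "W < 2 ^ W" by simp
	also have "... <= C * 2 ^ W" using assms by simp
	finally have ex: "EX k. W < C * 2 ^ k" by blast
	define k where "k = (LEAST k. W < C * 2 ^ k)"
	have k: "W < C * 2 ^ k" unfolding k_def by (rule LeastI_ex[OF ex])
	have "k ~= 0" using k assms by (intro notI) simp
	then obtain u where u: "k = Suc u" by (cases k) auto
	have "~ W < C * 2 ^ u" using not_less_Least[of u "%k. W < C * 2 ^ k"] u unfolding k_def[symmetric] by simp
	thus ?thesis using k u by (intro exI[of _ u]) auto
qed

lemma enn_root_le:
	assumes "I <= ennreal (B powr p)" "0 <= B" "0 < p" shows "enn_root p I <= ennreal B"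
proof -
	have "I < \<infinity>" using assms(1) by (simp add: le_less_trans)
	hence e: "enn_root p I = ennreal (enn2real I powr (1 / p))" by (auto simp: enn_root_def)
	have "enn2real I <= B powr p" using assms(1) by (simp add: enn2real_leI)
	hence "enn2real I powr (1 / p) <= (B powr p) powr (1 / p)" using assms by (intro powr_mono2) auto
	also have "... = B" using assms by (simp add: powr_powr)
	finally show ?thesis unfolding e by (rule ennreal_leI)
qed

text \<open>The integer division in \<open>ls\<close> loses at most one level, that is, the factor
  \<open>2 powr s\<close>.\<close>

lemma (in lev) rate_bound: "2 powr (- s * real ls) <= 2 powr s * 2 powr (- 2 * s / real d * (real u + real v))"
proof -
	have "s * (2 * (real u + real v)) / real d <= s * (real d * (real ls + 1)) / real d"
		using ls_le(2) s d by (intro divide_right_mono mult_left_mono) auto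
	hence "s * (2 * (real u + real v)) / real d <= s * (real ls + 1)" using d by simp
	hence "- s * real ls <= s + - 2 * s / real d * (real u + real v)" by (simp add: algebra_simps)
	hence "2 powr (- s * real ls) <= 2 powr (s + - 2 * s / real d * (real u + real v))" by (intro powr_mono) auto
	thus ?thesis by (simp only: powr_add)
qed

lemma (in lev) Cfin_nonneg: assumes "0 < et" shows "0 <= Cfin nB D p et"
proof -
	have "2 powr (- et / 2) < (2 powr 0 :: real)" using assms by (intro powr_less_mono) auto
	thus ?thesis unfolding Cfin_def by (intro mult_nonneg_nonneg add_nonneg_nonneg) auto
qed

text \<open>The networks of all shifts \<open>j / (2*d + 1)\<close> run in parallel, followed by the
  median. The estimate passes from the \<open>ideal\<close> values to the median at every point of
  the open cube, whatever the networks of the bad shifts do there.\<close>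

lemma (in lev) median_network:
	fixes f :: "real^'n::finite => real" and c :: "nat => nat => ('n => nat) => ('n => nat) => real"
	assumes dd: "d = CARD('n)" and c: "!!j l b. j < 2 * d + 1 ==> 1 <= l ==> b : Bk k ==> (SUM m:Mx l. abs (c j l m b) powr q) <= 2 powr (real l * (real d - s * q))"
	shows "EX m. cmp UNIV (((2 * d + 1) * (3 * (40 + 10 * d)) + mw d + 2) * 2 ^ u)
			((Kd (card (Bk k :: ('n => nat) set)) (d * k) + (d + 1 + card (subs d))) * 2 ^ v) (range (%i x. x $ i)) {m} &
		(ALL x:open_unit_cube. ALL t M. (ALL j<2 * d + 1. abs (t - ideal k (c j) (yc (real j / real (2 * d + 1)) x)) <= M) --> abs (t - m x) <= M)"
proof -
	let ?P = "2 * d + 1" and ?F = "range (%i (x :: real^'n). x $ i)" and ?n = "Kd (card (Bk k :: ('n => nat) set)) (d * k) * 2 ^ v"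
	let ?w = "3 * ((40 + 10 * d) * 2 ^ u)"
	let ?sh = "%j. real j / real ?P"
	let ?X = "%j. {x. ALL i. good (tt * u) (1 / real ?P) (yc (?sh j) x i)} :: (real^'n) set"
	have "ALL j:{..<?P}. EX g. cmp UNIV ?w ?n ?F {g} & (ALL x:?X j. g x = ideal k (c j) (yc (?sh j) x))"
	proof
		fix j assume j: "j : {..<?P}"
		hence jP: "j < ?P" by simp
		have "cmp (?X j) (3 * wbase CARD('n) u) (Kd (card (Bk k :: ('n => nat) set)) (CARD('n) * k) * 2 ^ v) (range (%i x. yc (?sh j) x i)) {%x. ideal k (c j) (%i. yc (?sh j) x i)}"
			by (rule ideal_network[OF dd c[OF jP], where e="1 / real ?P"]) auto
		hence 1: "cmp (?X j) ?w ?n (range (%i x. yc (?sh j) x i)) {%x. ideal k (c j) (yc (?sh j) x)}" unfolding dd .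
		have "range (%i (x :: real^'n). yc (?sh j) x i) \<subseteq> affs (?X j) ?F"
		proof
			fix g assume "g : range (%i (x :: real^'n). yc (?sh j) x i)"
			then obtain i where g: "g = (%x. (x $ i + ?sh j) / 2)" by (auto simp: yc_def)
			show "g : affs (?X j) ?F" unfolding g by (intro affs_div affs.add affs.const affs.base) auto
		qed
		from cmp_realize[OF cmp_pre[OF 1 this]] show "EX g. cmp UNIV ?w ?n ?F {g} & (ALL x:?X j. g x = ideal k (c j) (yc (?sh j) x))" .
	qed
	from bchoice[OF this] obtain g where g: "ALL j:{..<?P}. cmp UNIV ?w ?n ?F {g j} & (ALL x:?X j. g j x = ideal k (c j) (yc (?sh j) x))" by blast
	have gc: "cmp UNIV ?w ?n ?F {g j}" if "j : {..<?P}" for j using g that by blast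
	have ge: "g j x = ideal k (c j) (yc (?sh j) x)" if "j < ?P" "x : ?X j" for j x using bspec[OF g, of j] that by blast
	define m where "m x = med d (%j. g j x)" for x
	let ?W = "(?P * (3 * (40 + 10 * d)) + mw d + 2) * 2 ^ u"
	have "cmp UNIV (card {..<?P} * ?w) ?n ?F (\<Union>j\<in>{..<?P}. {g j})" by (rule cmp_Union[OF finite_lessThan gc])
	moreover have "(\<Union>j\<in>{..<?P}. {g j}) = g ` {..<?P}" by blast
	ultimately have A: "cmp UNIV (?P * ?w) ?n ?F (g ` {..<?P})" by simp
	have u1: "1 <= (2 :: nat) ^ u" by simp
	have w1: "?P * ?w <= ?W" by (simp add: algebra_simps)
	have w2: "mw d <= ?W"
	proof -
		have "mw d * 1 <= (?P * (3 * (40 + 10 * d)) + mw d + 2) * 2 ^ u" by (rule mult_le_mono) auto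
		thus ?thesis by simp
	qed
	have w3: "2 <= ?W"
	proof -
		have "2 * 1 <= (?P * (3 * (40 + 10 * d)) + mw d + 2) * 2 ^ u" by (rule mult_le_mono) auto
		thus ?thesis by simp
	qed
	have "cmp UNIV ?W (?n + (d + 1 + card (subs d))) ?F {%x. med d (%j. g j x)}"
		by (rule cmp_seq[OF cmp_mono_w[OF A w1] cmp_mono_w[OF cmp_med w2]])
	hence "cmp UNIV ?W (?n + (d + 1 + card (subs d))) ?F {m}" by (simp only: m_def[abs_def])
	hence net: "cmp UNIV ?W ((Kd (card (Bk k :: ('n => nat) set)) (d * k) + (d + 1 + card (subs d))) * 2 ^ v) ?F {m}"
	proof (rule cmp_pad)
		show "2 * card {m} <= ?W" using w3 by simp
		have "(d + 1 + card (subs d)) * 1 <= (d + 1 + card (subs d)) * 2 ^ v" by (rule mult_le_mono2) simp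
		thus "?n + (d + 1 + card (subs d)) <= (Kd (card (Bk k :: ('n => nat) set)) (d * k) + (d + 1 + card (subs d))) * 2 ^ v"
			unfolding add_mult_distrib[of "Kd _ _"] by (intro add_left_mono) simp
	qed simp
	have "abs (t - m x) <= M" if x: "x : open_unit_cube" and M: "ALL j<?P. abs (t - ideal k (c j) (yc (?sh j) x)) <= M" for x t M
		unfolding m_def
	proof (rule med_error)
		show "abs (t - ideal k (c j) (yc (?sh j) x)) <= M" if "j < ?P" for j using M that by blast
		have "1 * 1 <= tt * u" using lm_le(2) u by (intro mult_le_mono) auto
		hence N: "1 <= tt * u" by simp
		have "card {j : {..<?P}. g j x ~= ideal k (c j) (yc (?sh j) x)} <= card {j : {..<?P}. ~ (ALL i. good (tt * u) (1 / real ?P) (yc (?sh j) x i))}"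
		proof (rule card_mono)
			show "{j : {..<?P}. g j x ~= ideal k (c j) (yc (?sh j) x)} \<subseteq> {j : {..<?P}. ~ (ALL i. good (tt * u) (1 / real ?P) (yc (?sh j) x i))}"
				using ge by blast
		qed simp
		also have "... <= d" using bad_shifts[OF x N] unfolding dd .
		finally show "card {j : {..<?P}. g j x ~= ideal k (c j) (yc (?sh j) x)} <= d" .
	qed
	thus ?thesis using net by blast
qed

text \<open>All constants are fixed before \<open>u\<close>, \<open>v\<close> and \<open>f\<close>.
  The median is at most as wrong as the worst shift, so for finite \<open>p\<close> the majorants of
  all shifts are summed, and for \<open>p = \<infinity>\<close> finitely many null sets are
  united.\<close>

lemma network_error:
	assumes s: "0 < s" and p: "1 <= p" and q: "1 <= q" and pq: "inv_exp q - inv_exp p < s / real CARD('n::finite)"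
	shows "EX K Cw Cd. 0 < K & 2 <= Cw & 1 <= Cd & (ALL u v (f :: real^'n => real) D N. 1 <= u --> f : borel_measurable (lebesgue_on unit_cube) -->
			(ALL ga:multi_idx (sob_order s). weak_deriv ga f (D ga)) --> sob_expr s q f D <= ennreal N --> 0 < N -->
			(EX g. cmp UNIV (Cw * 2 ^ u) (Cd * 2 ^ v) (range (%i x. x $ i)) {g} &
				Lnorm p (%x. f x - g x) <= ennreal (K * N * 2 powr (- 2 * s / real CARD('n) * (real u + real v)))))"
proof -
	let ?k = "sob_order s" let ?d = "CARD('n)" let ?P = "2 * ?d + 1" let ?nB = "card (Bk ?k :: ('n => nat) set)"
	let ?p = "enn2real p"
	obtain q' C where q': "1 <= q'" and C: "0 < C"
		and cond: "if p = \<infinity> then real ?d < s * q' else q' <= ?p & real ?d / q' - real ?d / ?p < s"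
		and co: "!!(f :: real^'n => real) D N sh. (ALL ga:multi_idx ?k. weak_deriv ga f (D ga)) ==>
			sob_expr s q f D <= ennreal N ==> 0 < N ==> 0 <= sh ==> sh < 1 ==>
			(ALL l b. 1 <= l --> b : Bk ?k --> (SUM m:Mx l. abs (cf ?k sh f l m b / (C * N)) powr q') <= 2 powr (real l * (real ?d - s * q'))) &
			(EX r. strict_mono r & (AE x in OC. (%n. SUM l:{1..Suc (r n)}. SUM b:Bk ?k.
					cf ?k sh f l (cl sh l x) b / (C * N) * mnm l b (yc sh x)) ----> f x / (C * N)))"
		using normalized_coefficients[OF s p q pq] by blast
	have d: "0 < real ?d" by simp
	have "EX ka. 0 < q' * ka + s * q' - real ?d & (p = \<infinity> --> ka < 0) & (p ~= \<infinity> --> 0 < s * q' - ka * (?p - q'))"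
	proof (cases "p = \<infinity>")
		case True
		hence c: "real ?d < s * q'" using cond by simp
		\<comment> \<open>The midpoint between \<open>d / q' - s\<close> and 0: the lower end makes the
		  cost decay, the upper end the error; \<open>d < s * q'\<close> leaves room between them.\<close>
		let ?ka = "(real ?d / q' - s) / 2"
		have "q' * ?ka = (real ?d - s * q') / 2" using q' by (simp add: field_simps)
		hence e: "q' * ?ka + s * q' - real ?d = (s * q' - real ?d) / 2" by (simp add: field_simps)
		have "0 < q' * ?ka + s * q' - real ?d" unfolding e using c by simp
		moreover have "(real ?d / q' - s) / 2 < 0" using c q' by (simp add: field_simps)
		ultimately show ?thesis using True by (intro exI[of _ ?ka] conjI impI; simp only: simp_thms)
	next
		case False
		thus ?thesis using kappa_exists[OF s q' _ _ d, of ?p] cond by auto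
	qed
	then obtain ka where ka: "0 < q' * ka + s * q' - real ?d" "p = \<infinity> ==> ka < 0" "p ~= \<infinity> ==> 0 < s * q' - ka * (?p - q')" by blast
	define ep where "ep = min 1 (q' * ka + s * q' - real ?d)"
	have L: "lev s q' ka ep ?d u" if "1 <= u" for u
		by unfold_locales (use s q' ka(1) that in "auto simp: ep_def Suc_le_eq")
	define et where "et = min 1 ((s * q' - ka * (?p - q')) / ?p)"
	define Ce where "Ce = (if p = \<infinity> then abs (lev.Ctop ka ?nB (?d * ?k)) else lev.Cfin ?d ?nB (?d * ?k) ?p et)"
	define Cw where "Cw = ?P * (3 * (40 + 10 * ?d)) + mw ?d + 2"
	define Cd where "Cd = lev.Kd s ep ?d ?nB (?d * ?k) + (?d + 1 + card (subs ?d))"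
	define K where "K = C * real ?P * (Ce + 1) * 2 powr s"
	have p0: "q' <= ?p" "0 < ?p" "0 < et" "et <= 1" "et * ?p <= s * q' - ka * (?p - q')" if np: "p ~= \<infinity>"
	proof -
		show a: "q' <= ?p" using cond np by simp
		thus b: "0 < ?p" using q' by linarith
		show "0 < et" "et <= 1" using ka(3)[OF np] b by (auto simp: et_def)
		have "et * ?p <= (s * q' - ka * (?p - q')) / ?p * ?p" using b by (intro mult_right_mono) (auto simp: et_def)
		thus "et * ?p <= s * q' - ka * (?p - q')" using b by simp
	qed
	have Ce0: "0 <= Ce" unfolding Ce_def using lev.Cfin_nonneg[OF L[of 1]] p0(3) by auto
	have K0: "0 < K" using C Ce0 by (simp add: K_def add_nonneg_pos)
	have main: "EX g. cmp UNIV (Cw * 2 ^ u) (Cd * 2 ^ v) (range (%i x. x $ i)) {g} &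
				Lnorm p (%x. f x - g x) <= ennreal (K * N * 2 powr (- 2 * s / real ?d * (real u + real v)))"
		if u: "1 <= u" and fm: "f : borel_measurable (lebesgue_on unit_cube)" and wd: "ALL ga:multi_idx ?k. weak_deriv ga f (D ga)"
			and sN: "sob_expr s q f D <= ennreal N" and N: "0 < N"
		for u v and f :: "real^'n => real" and D N
	proof -
		interpret lev s q' ka ep ?d u v by (rule L[OF u])
		let ?sh = "%j. real j / real ?P"
		have sh: "0 <= ?sh j" "?sh j < 1" if "j < ?P" for j
		proof -
			have "real j < real ?P" using that by (simp only: of_nat_less_iff)
			thus "?sh j < 1" by simp
		qed simp
		define A where "A = C * N"
		have A: "0 < A" using C N by (simp add: A_def)
		define c where "c j l m b = cf ?k (?sh j) f l m b / A" for j l m b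
		have cb: "(SUM m:Mx l. abs (c j l m b) powr q') <= 2 powr (real l * (real ?d - s * q'))" if "j < ?P" "1 <= l" "b : Bk ?k" for j l b
			using co[OF wd sN N sh[OF that(1)]] that unfolding c_def A_def by blast
		have cr: "EX r. strict_mono r & (AE x in OC. (%n. SUM l:{1..Suc (r n)}. SUM b:Bk ?k. c j l (cl (?sh j) l x) b * mnm l b (yc (?sh j) x)) ----> f x / A)" if "j < ?P" for j
			using co[OF wd sN N sh[OF that]] unfolding c_def A_def by blast
		obtain m where m: "cmp UNIV (Cw * 2 ^ u) (Cd * 2 ^ v) (range (%i x. x $ i)) {m}"
			"!!x t M. x : open_unit_cube ==> ALL j<?P. abs (t - ideal ?k (c j) (yc (?sh j) x)) <= M ==> abs (t - m x) <= M"
			using median_network[where c=c and k="?k", OF refl cb] unfolding Cw_def Cd_def by blast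
		define g where "g x = A * m x" for x
		have g: "cmp UNIV (Cw * 2 ^ u) (Cd * 2 ^ v) (range (%i x. x $ i)) {g}"
		proof (rule cmp_post[OF m(1)])
			have "g : affs UNIV {m}" unfolding g_def[abs_def] by (intro affs.scale affs.base) simp
			thus "{g} \<subseteq> affs UNIV {m}" by simp
		qed
		have fg: "abs (f x - g x) = A * abs (f x / A - m x)" for x
		proof -
			have "f x - g x = A * (f x / A - m x)" using A by (simp add: g_def right_diff_distrib)
			thus ?thesis using A by (simp add: abs_mult)
		qed
		let ?ro = "2 powr (- s * real ls)"
		have "Lnorm p (%x. f x - g x) <= ennreal (A * real ?P * Ce * ?ro)"
		proof (cases "p = \<infinity>")
			case True
			have Ct: "Ce = abs (Ctop ?nB (?d * ?k))" using True by (simp add: Ce_def)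
			have "AE x in OC. ALL j:{..<?P}. abs (f x / A - ideal ?k (c j) (yc (?sh j) x)) <= Ctop ?nB (?d * ?k) * ?ro"
			proof (rule AE_finite_allI)
				fix j assume "j : {..<?P}"
				hence j: "j < ?P" by simp
				obtain r where r: "strict_mono r" "AE x in OC. (%n. SUM l:{1..Suc (r n)}. SUM b:Bk ?k. c j l (cl (?sh j) l x) b * mnm l b (yc (?sh j) x)) ----> f x / A"
					using cr[OF j] by blast
				show "AE x in OC. abs (f x / A - ideal ?k (c j) (yc (?sh j) x)) <= Ctop ?nB (?d * ?k) * ?ro"
					by (rule shift_error_top[OF refl cb[OF j] ka(2)[OF True] sh[OF j] r])
			qed simp
			hence "AE x in OC. ennreal (abs (f x - g x)) <= ennreal (A * real ?P * Ce * ?ro)"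
				using AE_space
			proof eventually_elim
				case (elim x)
				hence x: "x : open_unit_cube" by simp
				have "abs (f x / A - m x) <= Ctop ?nB (?d * ?k) * ?ro" by (rule m(2)[OF x]) (use elim(1) in blast)
				also have "... <= real ?P * Ce * ?ro"
				proof (rule mult_right_mono)
					have "1 * Ce <= real ?P * Ce" using Ce0 by (intro mult_right_mono) auto
					thus "Ctop ?nB (?d * ?k) <= real ?P * Ce" using Ct by linarith
				qed simp
				finally have "A * abs (f x / A - m x) <= A * (real ?P * Ce * ?ro)" using A by (intro mult_left_mono) auto
				thus ?case unfolding fg by (intro ennreal_leI) (simp only: mult.assoc)
			qed
			hence ae: "AE x in lebesgue_on unit_cube. ennreal (abs (f x - g x)) <= ennreal (A * real ?P * Ce * ?ro)" by (rule AE_unit_cube)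
			have "continuous_on UNIV g" by (rule cmp_continuous[OF g]) (auto intro: continuous_intros)
			hence "g : borel_measurable borel" by (rule borel_measurable_continuous_onI)
			hence "g : borel_measurable lebesgue" by (intro measurable_completion) (simp add: measurable_lborel1)
			hence gm: "g : borel_measurable (lebesgue_on unit_cube)" by (rule measurable_restrict_space1)
			have "(%x. ennreal (abs (f x - g x))) : borel_measurable (lebesgue_on unit_cube)" using fm gm by measurable
			from esssup_I[OF this ae] show ?thesis using True by (simp add: Lnorm_def)
		next
			case False
			note pp = p0[OF False]
			have Cf: "Ce = Cfin ?nB (?d * ?k) ?p et" using False by (simp add: Ce_def)
			have "ALL j:{..<?P}. EX H. H : mOC & (AE x in OC. ennreal (abs (f x / A - ideal ?k (c j) (yc (?sh j) x)) powr ?p) <= H x) &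
				(NI x. H x) <= ennreal ((Ce * ?ro) powr ?p)"
			proof
				fix j assume "j : {..<?P}"
				hence j: "j < ?P" by simp
				obtain r where r: "strict_mono r" "AE x in OC. (%n. SUM l:{1..Suc (r n)}. SUM b:Bk ?k. c j l (cl (?sh j) l x) b * mnm l b (yc (?sh j) x)) ----> f x / A"
					using cr[OF j] by blast
				show "EX H. H : mOC & (AE x in OC. ennreal (abs (f x / A - ideal ?k (c j) (yc (?sh j) x)) powr ?p) <= H x) &
					(NI x. H x) <= ennreal ((Ce * ?ro) powr ?p)"
					using shift_error_finite[OF refl cb[OF j] pp(1,3,4,5) sh[OF j] r] unfolding Cf by blast
			qed
			from bchoice[OF this] obtain H where H: "ALL j:{..<?P}. H j : mOC & (AE x in OC. ennreal (abs (f x / A - ideal ?k (c j) (yc (?sh j) x)) powr ?p) <= H j x) &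
				(NI x. H j x) <= ennreal ((Ce * ?ro) powr ?p)" by blast
			have Hall: "AE x in OC. ALL j:{..<?P}. ennreal (abs (f x / A - ideal ?k (c j) (yc (?sh j) x)) powr ?p) <= H j x"
				by (rule AE_finite_allI) (use H in blast)+
			have pt: "AE x in OC. ennreal (abs (f x - g x) powr ?p) <= ennreal (A powr ?p) * (SUM j<?P. H j x)"
				using Hall AE_space
			proof eventually_elim
				case (elim x)
				hence x: "x : open_unit_cube" by simp
				let ?e = "%j. abs (f x / A - ideal ?k (c j) (yc (?sh j) x))"
				have ne: "{..<?P} ~= {}" by (auto simp: lessThan_empty_iff)
				have "Max (?e ` {..<?P}) : ?e ` {..<?P}" using ne by (intro Max_in) auto
				then obtain j0 where j0: "j0 : {..<?P}" "Max (?e ` {..<?P}) = ?e j0" by blast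
				have "abs (f x / A - m x) <= ?e j0" by (rule m(2)[OF x]) (unfold j0(2)[symmetric], auto intro!: Max_ge)
				hence "abs (f x / A - m x) powr ?p <= ?e j0 powr ?p" using pp(2) by (intro powr_mono2) auto
				hence "ennreal (abs (f x / A - m x) powr ?p) <= ennreal (?e j0 powr ?p)" by (rule ennreal_leI)
				also have "... <= H j0 x" using elim(1) j0(1) by blast
				also have "... <= (SUM j<?P. H j x)" by (rule member_le_sum[OF j0(1)]) auto
				finally have "ennreal (A powr ?p) * ennreal (abs (f x / A - m x) powr ?p) <= ennreal (A powr ?p) * (SUM j<?P. H j x)" by (intro mult_left_mono) auto
				moreover have "ennreal (abs (f x - g x) powr ?p) = ennreal (A powr ?p) * ennreal (abs (f x / A - m x) powr ?p)"
					unfolding fg by (simp add: powr_mult ennreal_mult)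
				ultimately show ?case by simp
			qed
			have Hm: "H j : mOC" if "j : {..<?P}" for j using H that by blast
			have Hi: "(NI x. H j x) <= ennreal ((Ce * ?ro) powr ?p)" if "j : {..<?P}" for j using H that by blast
			have "(\<integral>\<^sup>+x. ennreal (abs (f x - g x) powr ?p) \<partial>lebesgue_on unit_cube) <= (NI x. ennreal (A powr ?p) * (SUM j<?P. H j x))"
				by (rule nn_integral_unit_cube_le[OF pt])
			also have "... = ennreal (A powr ?p) * (NI x. (SUM j<?P. H j x))" by (intro nn_integral_cmult borel_measurable_sum Hm)
			also have "(NI x. (SUM j<?P. H j x)) = (SUM j<?P. \<integral>\<^sup>+x. H j x \<partial>OC)" by (intro nn_integral_sum Hm)
			also have "ennreal (A powr ?p) * (SUM j<?P. \<integral>\<^sup>+x. H j x \<partial>OC) <= ennreal (A powr ?p) * (SUM j<?P. ennreal ((Ce * ?ro) powr ?p))"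
				by (intro mult_left_mono sum_mono Hi) auto
			also have "(SUM j<?P. ennreal ((Ce * ?ro) powr ?p)) = ennreal (SUM j<?P. (Ce * ?ro) powr ?p)" by (intro sum_ennreal) auto
			also have "(SUM j<?P. (Ce * ?ro) powr ?p) = real ?P * (Ce * ?ro) powr ?p" by (simp only: sum_constant card_lessThan)
			also have "ennreal (A powr ?p) * ennreal (real ?P * (Ce * ?ro) powr ?p) = ennreal (A powr ?p * (real ?P * (Ce * ?ro) powr ?p))"
				by (intro ennreal_mult[symmetric]) auto
			also have "... <= ennreal ((A * real ?P * Ce * ?ro) powr ?p)"
			proof (rule ennreal_leI)
				have "real ?P powr 1 <= real ?P powr ?p" using pp(1) q' by (intro powr_mono) auto
				moreover have "real ?P powr 1 = real ?P" by (intro powr_one) simp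
				ultimately have "A powr ?p * (real ?P * (Ce * ?ro) powr ?p) <= A powr ?p * (real ?P powr ?p * (Ce * ?ro) powr ?p)"
					by (intro mult_left_mono mult_right_mono) auto
				also have "... = (A * real ?P * Ce * ?ro) powr ?p" by (simp only: powr_mult mult.assoc)
				finally show "A powr ?p * (real ?P * (Ce * ?ro) powr ?p) <= (A * real ?P * Ce * ?ro) powr ?p" .
			qed
			finally have "enn_root ?p (\<integral>\<^sup>+x. ennreal (abs (f x - g x) powr ?p) \<partial>lebesgue_on unit_cube) <= ennreal (A * real ?P * Ce * ?ro)"
				by (rule enn_root_le) (use A Ce0 pp(2) in "auto intro!: mult_nonneg_nonneg")
			thus ?thesis using False by (simp add: Lnorm_def)
		qed
		also have "... <= ennreal (K * N * 2 powr (- 2 * s / real ?d * (real u + real v)))"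
		proof (rule ennreal_leI)
			have "A * real ?P * Ce * ?ro <= A * real ?P * (Ce + 1) * (2 powr s * 2 powr (- 2 * s / real ?d * (real u + real v)))"
				using A Ce0 by (intro mult_mono rate_bound mult_nonneg_nonneg) auto
			also have "... = K * N * 2 powr (- 2 * s / real ?d * (real u + real v))" unfolding K_def A_def by (simp only: mult.assoc mult.left_commute mult.commute)
			finally show "A * real ?P * Ce * ?ro <= K * N * 2 powr (- 2 * s / real ?d * (real u + real v))" .
		qed
		finally show ?thesis using g by blast
	qed
	have "2 <= Cw" "1 <= Cd" by (simp_all add: Cw_def Cd_def)
	thus ?thesis using K0 main by blast
qed

text \<open>\<open>W\<close> and \<open>L\<close> are rounded down to \<open>Cw * 2^u\<close> and
  \<open>Cd * 2^v\<close>. No minimizing family \<open>D\<close> is required and the norm may be 0: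
  the bound is proved for every \<open>N\<close> above the norm, and then \<open>N\<close> tends to
  it.\<close>

theorem mainTheorem1:
  fixes s :: real and p q :: ennreal
  assumes "0 < s" and "1 \<le> p" and "1 \<le> q"
    and "inv_exp q - inv_exp p < s / real CARD('n::finite)"
  shows "\<exists>C>0. \<exists>W0 L0 :: nat. \<forall>W L. W0 \<le> W \<longrightarrow> L0 \<le> L \<longrightarrow>
           (\<forall>f :: real^'n \<Rightarrow> real. f \<in> sobolev s q \<longrightarrow>
              (INF g \<in> NN W L. Lnorm p (\<lambda>x. f x - g x))
                \<le> ennreal C * sob_norm s q f * ennreal ((real W * real L) powr (- 2 * s / real CARD('n))))"
proof -
	let ?e = "- 2 * s / real CARD('n)"
	obtain K Cw Cd where K: "0 < K" and Cw: "2 <= Cw" and Cd: "1 <= Cd" and net: "!!u v (f :: real^'n => real) D N. 1 <= u ==> f : borel_measurable (lebesgue_on unit_cube) ==>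
			(ALL ga:multi_idx (sob_order s). weak_deriv ga f (D ga)) ==> sob_expr s q f D <= ennreal N ==> 0 < N ==>
			(EX g. cmp UNIV (Cw * 2 ^ u) (Cd * 2 ^ v) (range (%i x. x $ i)) {g} &
				Lnorm p (%x. f x - g x) <= ennreal (K * N * 2 powr (?e * (real u + real v))))"
		using network_error[OF assms] by blast
	\<comment> \<open>Each of the two roundings loses at most a factor 2, so
	  \<open>W * L <= Q * 2^(u + v)\<close>.\<close>
	define Q where "Q = 4 * real Cw * real Cd"
	have Q: "0 < Q" using Cw Cd by (simp add: Q_def)
	define C where "C = K * Q powr (- ?e)"
	have C: "0 < C" using K Q by (simp add: C_def)
	show ?thesis
	proof (intro exI[of _ C] conjI C, rule exI[of _ "2 * Cw"], rule exI[of _ Cd], intro allI impI)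
		fix W L and f :: "real^'n => real" assume W: "2 * Cw <= W" and L: "Cd <= L" and f: "f : sobolev s q"
		obtain u where u: "Cw * 2 ^ u <= W" "W < Cw * 2 ^ Suc u" using dyadic_bracket[of Cw W] W Cw by auto
		obtain v where v: "Cd * 2 ^ v <= L" "L < Cd * 2 ^ Suc v" using dyadic_bracket[of Cd L] L Cd by auto
		have u1: "1 <= u" using u(2) W by (cases u) auto
		let ?R = "(real W * real L) powr ?e"
		have WL: "0 < real W" "0 < real L" using W Cw L Cd by auto
		have R: "0 < ?R" using WL by simp
		have rate: "2 powr (?e * (real u + real v)) <= Q powr (- ?e) * ?R"
		proof -
			have "real W <= real (Cw * 2 ^ Suc u)" "real L <= real (Cd * 2 ^ Suc v)"
				by (rule of_nat_mono[OF less_imp_le[OF u(2)]], rule of_nat_mono[OF less_imp_le[OF v(2)]])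
			hence "real W * real L <= real (Cw * 2 ^ Suc u) * real (Cd * 2 ^ Suc v)" by (intro mult_mono) auto
			also have "... = Q * 2 powr (real u + real v)" by (simp add: Q_def powr_add powr_realpow)
			finally have "(Q * 2 powr (real u + real v)) powr ?e <= ?R" using assms(1) WL by (intro powr_mono2') auto
			hence "Q powr (- ?e) * (Q * 2 powr (real u + real v)) powr ?e <= Q powr (- ?e) * ?R" by (intro mult_left_mono) auto
			moreover have "Q powr (- ?e) * (Q * 2 powr (real u + real v)) powr ?e = 2 powr (?e * (real u + real v))"
			proof -
				have "Q powr (- ?e) * Q powr ?e = 1" using Q unfolding powr_add[symmetric] by simp
				thus ?thesis by (simp only: powr_mult powr_powr mult.assoc[symmetric] mult_1_left mult.commute[of "real u + real v"])
			qed
			ultimately show ?thesis by simp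
		qed
		have bound: "(INF g \<in> NN W L. Lnorm p (%x. f x - g x)) <= ennreal (C * N * ?R)" if N: "0 < N" "sob_norm s q f < ennreal N" for N
		proof -
			obtain D where D: "ALL ga:multi_idx (sob_order s). weak_deriv ga f (D ga)" "sob_expr s q f D < ennreal N"
				using N(2) unfolding sob_norm_def INF_less_iff by blast
			obtain g where g: "cmp UNIV (Cw * 2 ^ u) (Cd * 2 ^ v) (range (%i x. x $ i)) {g}" "Lnorm p (%x. f x - g x) <= ennreal (K * N * 2 powr (?e * (real u + real v)))"
				using net[OF u1 _ D(1) less_imp_le[OF D(2)] N(1), of v] f unfolding sobolev_def by blast
			have W1: "2 * card {g} <= W" "1 <= W" using W Cw by auto
			have "cmp UNIV W L (range (%i x. x $ i)) {g}" by (rule cmp_pad[OF cmp_mono_w[OF g(1) u(1)] _ W1(1) v(1)]) simp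
			moreover have "L = Suc (L - 1)" using L Cd by simp
			ultimately have "g : NN W L" using cmp_NN[of W "L - 1" g] W1(2) by simp
			hence "(INF g \<in> NN W L. Lnorm p (%x. f x - g x)) <= Lnorm p (%x. f x - g x)" by (rule INF_lower)
			also note g(2)
			also have "ennreal (K * N * 2 powr (?e * (real u + real v))) <= ennreal (C * N * ?R)"
			proof (rule ennreal_leI)
				have "K * N * 2 powr (?e * (real u + real v)) <= K * N * (Q powr (- ?e) * ?R)" using K N by (intro mult_left_mono rate) auto
				thus "K * N * 2 powr (?e * (real u + real v)) <= C * N * ?R" by (simp only: C_def mult.assoc mult.left_commute)
			qed
			finally show ?thesis .
		qed
		have fin: "sob_norm s q f < \<infinity>" using f by (simp add: sobolev_def)
		then obtain n0 where n0: "0 <= n0" "sob_norm s q f = ennreal n0" by (cases "sob_norm s q f") auto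
		have "(INF g \<in> NN W L. Lnorm p (%x. f x - g x)) <= ennreal (C * n0 * ?R)"
		proof (rule ennreal_le_epsilon)
			fix e :: real assume e: "0 < e"
			let ?N = "n0 + e / (C * ?R)"
			have N: "0 < ?N" "n0 < ?N" using n0(1) e C R by (auto intro!: add_nonneg_pos)
			have "(INF g \<in> NN W L. Lnorm p (%x. f x - g x)) <= ennreal (C * ?N * ?R)"
				by (rule bound[OF N(1)]) (use N n0 in "simp add: ennreal_less_iff")
			also have "C * ?N * ?R = C * n0 * ?R + e" using C R by (simp add: distrib_left distrib_right)
			also have "ennreal (C * n0 * ?R + e) = ennreal (C * n0 * ?R) + ennreal e" using C n0 e by (intro ennreal_plus) auto
			finally show "(INF g \<in> NN W L. Lnorm p (%x. f x - g x)) <= ennreal (C * n0 * ?R) + ennreal e" .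
		qed
		also have "... = ennreal C * sob_norm s q f * ennreal ?R" unfolding n0(2) using C n0(1) by (simp add: ennreal_mult)
		finally show "(INF g \<in> NN W L. Lnorm p (%x. f x - g x)) <= ennreal C * sob_norm s q f * ennreal ((real W * real L) powr (- 2 * s / real CARD('n)))" .
	qed
qed

end
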